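(* Consider the planted cycles model $\mathcal{G}(n,\lambda,\delta)$, where $\delta\in(0,1]$ and $\lambda>0$ are constants independent of $n$. If $\lambda<\frac{1}{(\sqrt{2\delta}+\sqrt{1-\delta})^2}$, then almost exact recovery of the planted $2$-factor $H^*$ from $G$ is possible; moreover, there exists a polynomial-time algorithm that achieves almost exact recovery. Conversely, if $\lambda>\frac{1}{(\sqrt{2\delta}+\sqrt{1-\delta})^2}$, then almost exact recovery is information-theoretically impossible: no estimator, regardless of its computation time, achieves almost exact recovery.
   Context: Planted cycles model $\mathcal{G}(n,\lambda,\delta)$: generate an Erdős–Rényi graph $G_0\sim\mathcal{G}(n,\lambda/n)$ on vertex set $[n]$ (each pair is an edge independently with probability $\lambda/n$); independently choose a uniformly random set $V\subseteq[n]$ of $\lfloor\delta n\rfloor$ vertices (written $\delta n$); then choose a uniformly random labeled $2$-factor $H^*$ on $V$, i.e. a vertex-disjoint union of (simple) cycles spanning all vertices of $V$. Output the simple graph $G=G_0\cup H^*$. The set $V$ and the graph $H^*$ are not observed. Graphs such as $H^*$ are identified with their edge sets. An estimator $\hat H=\hat H(G)$ is a (possibly randomized) function of $G$ that outputs a set of edges of the complete graph $K_n$. Its reconstruction error is $\ell(H^*,\hat H)=|H^*\Delta\hat H|/|H^*|$, where $\Delta$ is the symmetric difference. $\hat H$ achieves almost exact recovery if $\mathbb{E}[\ell(H^*,\hat H)]=o(1)$ as $n\to\infty$. *)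

theory Defs
  imports "HOL-Probability.Probability" "HOL-Computational_Algebra.Polynomial"
begin

section \<open>The planted cycles model\<close>

text \<open>A graph is identified with its edge set, an edge being a two-element set of vertices.
  The vertex set is \<open>{..<n}\<close>.\<close>

definition complete_graph :: "nat \<Rightarrow> nat set set" where
  "complete_graph n = {e. e \<subseteq> {..<n} \<and> card e = 2}"

text \<open>\<^const>\<open>bernoulli_pmf\<close> truncates its parameter to \<open>[0,1]\<close>; this only matters for
  the finitely many \<open>n < lam\<close>.\<close>

definition erdos_renyi :: "nat \<Rightarrow> real \<Rightarrow> nat set set pmf" where
  "erdos_renyi n p =
     map_pmf (\<lambda>f. {e \<in> complete_graph n. f e})
       (Pi_pmf (complete_graph n) False (\<lambda>_. bernoulli_pmf p))"

definition cycle_edges :: "'a list \<Rightarrow> 'a set set" where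
  "cycle_edges vs = {{vs ! i, vs ! (Suc i mod length vs)} | i. i < length vs}"

definition is_two_factor :: "'a set \<Rightarrow> 'a set set \<Rightarrow> bool" where
  "is_two_factor V H \<longleftrightarrow>
     (\<exists>C. (\<forall>c\<in>C. distinct c \<and> 3 \<le> length c) \<and>
          disjoint_family_on set C \<and>
          (\<Union>c\<in>C. set c) = V \<and>
          H = (\<Union>c\<in>C. cycle_edges c))"

text \<open>The joint law of the hidden 2-factor and the observed graph. If
  \<open>\<lfloor>\<delta> n\<rfloor> \<in> {1, 2}\<close>, there is no 2-factor and the law is unspecified; for
  \<open>\<delta> > 0\<close> this concerns only finitely many \<open>n\<close>.\<close>

definition planted_cycles :: "nat \<Rightarrow> real \<Rightarrow> real \<Rightarrow> (nat set set \<times> nat set set) pmf" where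
  "planted_cycles n lam \<delta> =
     do {
       G0 \<leftarrow> erdos_renyi n (lam / real n);
       V \<leftarrow> pmf_of_set {V. V \<subseteq> {..<n} \<and> card V = nat \<lfloor>\<delta> * real n\<rfloor>};
       H \<leftarrow> pmf_of_set {H. is_two_factor V H};
       return_pmf (H, G0 \<union> H)
     }"


section \<open>Estimators and almost exact recovery\<close>

text \<open>A randomized estimator is a probability kernel: its output is drawn from a law that
  depends on the observed graph only. The output ranges over a finite set, so probability
  mass functions lose no generality.\<close>

type_synonym estimator = "nat \<Rightarrow> nat set set \<Rightarrow> nat set set pmf"

definition is_estimator :: "estimator \<Rightarrow> bool" where
  "is_estimator est \<longleftrightarrow>
     (\<forall>n. \<forall>G \<subseteq> complete_graph n. set_pmf (est n G) \<subseteq> Pow (complete_graph n))"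

definition reconstruction_error :: "'a set \<Rightarrow> 'a set \<Rightarrow> real" where
  "reconstruction_error H H' = real (card (sym_diff H H')) / real (card H)"

definition expected_error :: "real \<Rightarrow> real \<Rightarrow> estimator \<Rightarrow> nat \<Rightarrow> real" where
  "expected_error lam \<delta> est n =
     measure_pmf.expectation
       (do {
          (H, G) \<leftarrow> planted_cycles n lam \<delta>;
          H' \<leftarrow> est n G;
          return_pmf (H, H')
        })
       (\<lambda>(H, H'). reconstruction_error H H')"

definition almost_exact_recovery :: "real \<Rightarrow> real \<Rightarrow> estimator \<Rightarrow> bool" where
  "almost_exact_recovery lam \<delta> est \<longleftrightarrow> expected_error lam \<delta> est \<longlonglongrightarrow> 0"


section \<open>Polynomial-time algorithms\<close>

text \<open>The model of computation is a unit-cost random access machine with addition and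
  truncated subtraction (and without multiplication, so that the bit length of every stored
  number is at most linear in the running time plus the length of the input numbers), which is
  polynomially equivalent to Turing machines. It is presented as a structured language. The
  store consists of arrays of natural numbers; a program uses finitely many of them, namely
  those named in it. Expressions have a fixed size for a fixed program, so
  evaluating one is charged a constant.\<close>

datatype expr =
    Const nat
  | Read nat expr
  | Add expr expr
  | Sub expr expr

datatype prog =
    Skip
  | Assign nat expr expr
  | Seq prog prog
  | Cond expr prog prog
  | While expr prog

type_synonym store = "nat \<Rightarrow> nat \<Rightarrow> nat"

primrec eval_expr :: "store \<Rightarrow> expr \<Rightarrow> nat" where
  "eval_expr s (Const k) = k"
| "eval_expr s (Read a e) = s a (eval_expr s e)"
| "eval_expr s (Add e1 e2) = eval_expr s e1 + eval_expr s e2"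
| "eval_expr s (Sub e1 e2) = eval_expr s e1 - eval_expr s e2"

text \<open>\<open>exec c s t s'\<close>: program \<open>c\<close> started in store \<open>s\<close> halts after \<open>t\<close> steps in store
  \<open>s'\<close>. Nonzero numbers count as true.\<close>

inductive exec :: "prog \<Rightarrow> store \<Rightarrow> nat \<Rightarrow> store \<Rightarrow> bool" where
  Skip: "exec Skip s 1 s"
| Assign: "exec (Assign a e1 e2) s 1 (s(a := (s a)(eval_expr s e1 := eval_expr s e2)))"
| Seq: "exec c1 s t1 s' \<Longrightarrow> exec c2 s' t2 s'' \<Longrightarrow> exec (Seq c1 c2) s (t1 + t2) s''"
| CondTrue: "eval_expr s e \<noteq> 0 \<Longrightarrow> exec c1 s t s' \<Longrightarrow> exec (Cond e c1 c2) s (Suc t) s'"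
| CondFalse: "eval_expr s e = 0 \<Longrightarrow> exec c2 s t s' \<Longrightarrow> exec (Cond e c1 c2) s (Suc t) s'"
| WhileFalse: "eval_expr s e = 0 \<Longrightarrow> exec (While e c) s 1 s"
| WhileTrue: "eval_expr s e \<noteq> 0 \<Longrightarrow> exec c s t1 s' \<Longrightarrow> exec (While e c) s' t2 s'' \<Longrightarrow>
    exec (While e c) s (Suc (t1 + t2)) s''"

inductive_cases exec_SkipE: "exec Skip s t s'"
inductive_cases exec_AssignE: "exec (Assign a e1 e2) s t s'"
inductive_cases exec_SeqE: "exec (Seq c1 c2) s t s'"
inductive_cases exec_CondE: "exec (Cond e c1 c2) s t s'"
inductive_cases exec_WhileE: "exec (While e c) s t s'"

lemma exec_deterministic:
  "exec c s t s' \<Longrightarrow> exec c s u s'' \<Longrightarrow> u = t \<and> s'' = s'"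
proof (induction arbitrary: u s'' rule: exec.induct)
  case (Seq c1 s t1 s1 c2 t2 s2)
  from Seq.prems obtain v1 v2 r where "exec c1 s v1 r" "exec c2 r v2 s''" "u = v1 + v2"
    by (rule exec_SeqE)
  with Seq.IH(1)[of v1 r] Seq.IH(2)[of v2 s''] show ?case by simp
next
  case (CondTrue s e c1 t s1 c2)
  from CondTrue.prems CondTrue.hyps obtain v where "exec c1 s v s''" "u = Suc v"
    by (auto elim: exec_CondE)
  with CondTrue.IH[of v s''] show ?case by simp
next
  case (CondFalse s e c2 t s1 c1)
  from CondFalse.prems CondFalse.hyps obtain v where "exec c2 s v s''" "u = Suc v"
    by (auto elim: exec_CondE)
  with CondFalse.IH[of v s''] show ?case by simp
next
  case (WhileFalse s e c)
  from WhileFalse.prems show ?case by (rule exec_WhileE) (simp_all add: WhileFalse.hyps)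
next
  case (WhileTrue s e c t1 s1 t2 s2)
  from WhileTrue.prems show ?case
  proof (rule exec_WhileE)
    assume "eval_expr s e = 0"
    with WhileTrue.hyps show ?thesis by simp
  next
    fix v1 r v2
    assume "u = Suc (v1 + v2)" "exec c s v1 r" "exec (While e c) r v2 s''"
    with WhileTrue.IH(1)[of v1 r] WhileTrue.IH(2)[of v2 s''] show ?thesis by simp
  qed
qed (auto elim: exec_SkipE exec_AssignE)

text \<open>Input: cell 0 of array 0 holds \<open>n\<close>, and array 1 holds the adjacency matrix of \<open>G\<close> in
  row-major order; all other cells are 0. Output: the edge set whose adjacency matrix
  (above the diagonal) is left in array 2.\<close>

definition input_store :: "nat \<Rightarrow> nat set set \<Rightarrow> store" where
  "input_store n G = (\<lambda>a i.
     if a = 0 \<and> i = 0 then n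
     else if a = 1 \<and> i < n * n \<and> {i div n, i mod n} \<in> G then 1
     else 0)"

definition output_graph :: "nat \<Rightarrow> store \<Rightarrow> nat set set" where
  "output_graph n s = {{u, v} | u v. u < v \<and> v < n \<and> s 2 (u * n + v) \<noteq> 0}"

definition polynomial_time :: "(nat \<Rightarrow> nat set set \<Rightarrow> nat set set) \<Rightarrow> bool" where
  "polynomial_time A \<longleftrightarrow>
     (\<exists>(c :: prog) (p :: nat poly). \<forall>n. \<forall>G \<subseteq> complete_graph n.
        \<exists>t s. exec c (input_store n G) t s \<and> t \<le> poly p n \<and> output_graph n s = A n G)"

end

(* Call an edge of G red if it lies in H and blue otherwise. Everything is governed by
   non-backtracking walks that use a red edge at every visit of a vertex of V. Weighting such a
   walk by x^(#red - #blue), the growth rate of the expected total weight is optimised by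
   x = sqrt (lam (1 - delta)) and is below 1 exactly if
   sqrt (2 delta lam) + sqrt (lam (1 - delta)) < 1, which is the threshold condition.

   Below the threshold, max-plus message passing for T rounds misclassifies an edge only if the
   edge is the middle of such a walk of length 2T + 1 with at least as many blue as red edges.
   The expected number of these walks decays exponentially in T up to walks that repeat a blue
   edge or meet a short red cycle; T = log log log n keeps the latter negligible.

   Above the threshold, the law of H given G is uniform on the 2-factors of G on |V| vertices,
   so it suffices to find exponentially many of them: an estimator is close to few. A
   depth-first exploration in a first part of the blue edges finds an alternating path of linear
   length on which linearly many red edges start at the same balance (#red - #blue). Sprinkling
   the remaining blue edges joins these places into a digraph with positive expansion, each
   long cycle of which closes pieces of the path to a balanced closed alternating trail;
   switching along it yields another 2-factor with the same number of vertices. *)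

theory Submission
  imports Defs "HOL-Real_Asymp.Real_Asymp"
begin

text \<open>Origin of the threshold: between two landings in \<open>V\<close> a walk takes a >= 1
  red edges in one of two directions and b >= 1 blue ones, all but the last to vertices outside
  \<open>V\<close>. Such a round has weight 2 \<delta> lam x^(a - 1) (lam (1 - \<delta>) / x)^(b -
  1). The sum over a and b is least where the two ratios agree, at x = sqrt (lam (1 - \<delta>)),
  and equals 2 \<delta> lam / (1 - x)^2 there, which is 1 at the threshold. Below it x <= 1, so a
  walk with at least as many blue as red edges has weight at least 1, and weights bound numbers.
  Above it the balance has to stay in a bounded window, so that places of equal balance recur; the
  same tilt makes the step kernel symmetric in the balance, and a wide window then costs almost no
  growth. Randomness sits in the blue edges only: both halves are proved for a fixed 2-factor, whose
  shape enters only through the number of vertices on short cycles. These are few on average, since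
  subdividing edges compares 2-factors on vertex sets of different sizes.\<close>

section \<open>2-factors as 2-regular graphs\<close>

definition nb :: "'a set set \<Rightarrow> 'a \<Rightarrow> 'a set" where
  "nb H v = {u. {v, u} \<in> H}"

text \<open>Local form of \<open>is_two_factor\<close>. Switching along a trail or subdividing an
  edge changes degrees in a controlled way, whereas the list of cycles changes globally.\<close>

definition two_regular :: "'a set \<Rightarrow> 'a set set \<Rightarrow> bool" where
  "two_regular V H \<longleftrightarrow> (\<forall>e\<in>H. e \<subseteq> V \<and> card e = 2) \<and> (\<forall>v\<in>V. card (nb H v) = 2)"

text \<open>Successor modulo \<open>l\<close> as a case distinction, so that equations between
  cyclic indices become linear arithmetic.\<close>

definition cyc_succ :: "nat \<Rightarrow> nat \<Rightarrow> nat" where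
  "cyc_succ l i = (if Suc i = l then 0 else Suc i)"

definition cyc_pred :: "nat \<Rightarrow> nat \<Rightarrow> nat" where
  "cyc_pred l i = (if i = 0 then l - 1 else i - 1)"

lemma Suc_mod_cyc_succ: "i < l \<Longrightarrow> Suc i mod l = cyc_succ l i"
  by (auto simp: cyc_succ_def)

lemma cycle_edges_cyc_succ: "cycle_edges c = {{c ! i, c ! cyc_succ (length c) i} | i. i < length c}"
  unfolding cycle_edges_def by (metis (no_types, lifting) Suc_mod_cyc_succ)

lemma nb_cycle:
  assumes "distinct c" "3 \<le> length c" "i < length c"
  shows "nb (cycle_edges c) (c ! i) = {c ! cyc_succ (length c) i, c ! cyc_pred (length c) i}"
    (is "?L = ?R")
proof -
  let ?l = "length c"
  have s: "cyc_succ ?l j < ?l" "cyc_pred ?l j < ?l" if "j < ?l" for j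
    using that by (auto simp: cyc_succ_def cyc_pred_def)
  have sp: "cyc_succ ?l j = i \<longleftrightarrow> j = cyc_pred ?l i" if "j < ?l" for j
    using that assms by (auto simp: cyc_succ_def cyc_pred_def)
  have "u \<in> ?L \<longleftrightarrow> u \<in> ?R" for u
  proof -
    have "u \<in> ?L \<longleftrightarrow> (\<exists>j<?l. {c ! i, u} = {c ! j, c ! cyc_succ ?l j})"
      by (auto simp: nb_def cycle_edges_cyc_succ)
    also have "\<dots> \<longleftrightarrow> (\<exists>j<?l. (i = j \<and> u = c ! cyc_succ ?l j) \<or> (i = cyc_succ ?l j \<and> u = c ! j))"
      using assms s by (auto simp: doubleton_eq_iff nth_eq_iff_index_eq)
    also have "\<dots> \<longleftrightarrow> u = c ! cyc_succ ?l i \<or> (\<exists>j<?l. cyc_succ ?l j = i \<and> u = c ! j)"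
      using assms(3) by metis
    also have "\<dots> \<longleftrightarrow> u \<in> ?R"
      using s(2)[OF assms(3)] sp by (metis insert_iff singletonD)
    finally show ?thesis .
  qed
  thus ?thesis by blast
qed

text \<open>Length at least 3 keeps the cyclic successor and predecessor of an index apart.\<close>

lemma card_nb_cycle:
  assumes "distinct c" "3 \<le> length c" "v \<in> set c"
  shows "card (nb (cycle_edges c) v) = 2"
proof -
  obtain i where i: "i < length c" "v = c ! i" using assms(3) by (metis in_set_conv_nth)
  have "c ! cyc_succ (length c) i \<noteq> c ! cyc_pred (length c) i"
    using assms i by (subst nth_eq_iff_index_eq) (auto simp: cyc_succ_def cyc_pred_def)
  thus ?thesis using nb_cycle[OF assms(1,2) i(1)] i by simp
qed

lemma cycle_edge_props:
  assumes "distinct c" "3 \<le> length c" "e \<in> cycle_edges c"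
  shows "e \<subseteq> set c" "card e = 2"
proof -
  obtain i where i: "i < length c" "e = {c ! i, c ! cyc_succ (length c) i}"
    using assms(3) by (auto simp: cycle_edges_cyc_succ)
  have s: "cyc_succ (length c) i < length c" "cyc_succ (length c) i \<noteq> i"
    using i assms by (auto simp: cyc_succ_def)
  show "e \<subseteq> set c" using i s by auto
  show "card e = 2" using i s assms by (auto simp: nth_eq_iff_index_eq)
qed

lemma nb_Diff: "nb (A - B) v = nb A v - nb B v"
  and nb_empty [simp]: "nb {} v = {}"
  and nb_UN: "nb (\<Union>i\<in>I. F i) v = (\<Union>i\<in>I. nb (F i) v)"
  by (auto simp: nb_def)

lemma nb_cycle_outside:
  assumes "distinct c" "3 \<le> length c" "v \<notin> set c"
  shows "nb (cycle_edges c) v = {}"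
  using cycle_edge_props(1)[OF assms(1,2)] assms(3) by (force simp: nb_def)

lemma edge_eq_nb:
  assumes "card e = 2" "v \<in> e"
  obtains u where "e = {v, u}" "u \<noteq> v"
  using assms by (metis card_2_iff insert_iff insert_commute singletonD)

lemma is_two_factor_imp_two_regular:
  assumes "is_two_factor V H"
  shows "two_regular V H"
proof -
  obtain C where C: "\<forall>c\<in>C. distinct c \<and> 3 \<le> length c" "disjoint_family_on set C"
      "(\<Union>c\<in>C. set c) = V" "H = (\<Union>c\<in>C. cycle_edges c)"
    using assms by (auto simp: is_two_factor_def)
  have 1: "e \<subseteq> V \<and> card e = 2" if "e \<in> H" for e
    using that C cycle_edge_props by blast
  have 2: "card (nb H v) = 2" if v: "v \<in> V" for v
  proof -
    obtain c where c: "c \<in> C" "v \<in> set c" using v C(3) by auto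
    have "nb (cycle_edges d) v = {}" if "d \<in> C" "d \<noteq> c" for d
    proof (rule nb_cycle_outside)
      show "distinct d" "3 \<le> length d" using C(1) that by auto
      show "v \<notin> set d" using C(2) that c by (auto simp: disjoint_family_on_def)
    qed
    hence "nb H v = nb (cycle_edges c) v" using c unfolding C(4) nb_UN by auto
    thus ?thesis using card_nb_cycle[of c v] C(1) c by simp
  qed
  show ?thesis using 1 2 by (auto simp: two_regular_def)
qed

lemma two_regular_nb_subset: "two_regular V H \<Longrightarrow> nb H v \<subseteq> V - {v}"
  unfolding two_regular_def nb_def by force

lemma two_regular_finite_nb: "two_regular V H \<Longrightarrow> v \<in> V \<Longrightarrow> finite (nb H v)"
  unfolding two_regular_def by (metis card.infinite zero_neq_numeral)

lemma two_regular_nb_le2: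
  assumes "two_regular V H" "v \<in> V" "{a, b, c} \<subseteq> nb H v" 
  shows "a = b \<or> b = c \<or> a = c"
proof (rule ccontr)
  assume "\<not> ?thesis"
  hence "card {a, b, c} = 3" by auto
  moreover have "card {a,b,c} \<le> card (nb H v)"
    using assms two_regular_finite_nb by (metis card_mono)
  ultimately show False using assms by (simp add: two_regular_def)
qed

text \<open>A vertex of the cycle already has degree 2 inside it, so no further edge of
  \<open>H\<close> touches the cycle: a cycle contained in \<open>H\<close> is a component.\<close>

lemma two_regular_remove_cycle:
  assumes H: "two_regular V H" and c: "distinct c" "3 \<le> length c" "cycle_edges c \<subseteq> H"
  shows "two_regular (V - set c) (H - cycle_edges c)" "set c \<subseteq> V"
proof -
  show sub: "set c \<subseteq> V"
  proof
    fix v assume v: "v \<in> set c"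
    hence "nb (cycle_edges c) v \<noteq> {}" using card_nb_cycle[OF c(1,2) v] by auto
    then obtain u where "{v, u} \<in> cycle_edges c" by (auto simp: nb_def)
    hence "{v, u} \<in> H" using c(3) by auto
    thus "v \<in> V" using H by (auto simp: two_regular_def)
  qed
  have nbc: "nb H v = nb (cycle_edges c) v" if v: "v \<in> set c" for v
  proof -
    have "nb (cycle_edges c) v \<subseteq> nb H v" using c(3) by (auto simp: nb_def)
    moreover have "card (nb H v) = 2" using H v sub by (auto simp: two_regular_def)
    ultimately show ?thesis using card_nb_cycle[OF c(1,2) v] two_regular_finite_nb[OF H] v sub
      by (metis card_subset_eq subsetD)
  qed
  have 1: "e \<subseteq> V - set c \<and> card e = 2" if e: "e \<in> H - cycle_edges c" for e
  proof -
    have e2: "card e = 2" "e \<subseteq> V" using e H by (auto simp: two_regular_def)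
    have "v \<notin> set c" if "v \<in> e" for v
    proof
      assume v: "v \<in> set c"
      obtain u where u: "e = {v, u}" using edge_eq_nb e2(1) \<open>v \<in> e\<close> by metis
      hence "u \<in> nb H v" using e by (simp add: nb_def)
      hence "u \<in> nb (cycle_edges c) v" using nbc[OF v] by simp
      hence "e \<in> cycle_edges c" using u by (simp add: nb_def)
      thus False using e by simp
    qed
    thus ?thesis using e2 by auto
  qed
  have 2: "card (nb (H - cycle_edges c) v) = 2" if v: "v \<in> V - set c" for v
    using v H nb_cycle_outside[OF c(1,2)] by (auto simp: nb_Diff two_regular_def)
  show "two_regular (V - set c) (H - cycle_edges c)" using 1 2 by (auto simp: two_regular_def)
qed

definition path_in :: "'a set set \<Rightarrow> 'a list \<Rightarrow> bool" where
  "path_in H xs \<longleftrightarrow> (\<forall>i. Suc i < length xs \<longrightarrow> {xs ! i, xs ! Suc i} \<in> H)"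

lemma path_in_snoc:
  assumes "path_in H xs" "xs \<noteq> []" "{last xs, y} \<in> H"
  shows "path_in H (xs @ [y])"
  unfolding path_in_def
proof (intro allI impI)
  fix i assume i: "Suc i < length (xs @ [y])"
  show "{(xs @ [y]) ! i, (xs @ [y]) ! Suc i} \<in> H"
  proof (cases "Suc i < length xs")
    case True thus ?thesis using assms(1) by (auto simp: path_in_def nth_append)
  next
    case False
    hence "i = length xs - 1" "Suc i = length xs" using i by auto
    thus ?thesis using assms by (auto simp: nth_append last_conv_nth)
  qed
qed

text \<open>The end \<open>x\<close> of a longest path has a second neighbour \<open>y\<close>,
  which lies on the path by maximality and can only be its first vertex.\<close>

lemma two_regular_has_cycle:
  assumes H: "two_regular V H" and V: "finite V" "V \<noteq> {}"
  obtains c where "distinct c" "3 \<le> length c" "cycle_edges c \<subseteq> H"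
proof -
  define P where "P xs \<longleftrightarrow> distinct xs \<and> 2 \<le> length xs \<and> set xs \<subseteq> V \<and> path_in H xs" for xs
  obtain v where v: "v \<in> V" using V by auto
  hence "nb H v \<noteq> {}" using H by (force simp: two_regular_def)
  then obtain u where u: "{v, u} \<in> H" by (auto simp: nb_def)
  hence uv: "u \<in> V" "u \<noteq> v" using H by (auto simp: two_regular_def)
  have P0: "P [v, u]" using u uv v by (auto simp: P_def path_in_def less_Suc_eq)
  have bd: "length xs < Suc (card V)" if "P xs" for xs
    using that V by (metis P_def card_mono distinct_card less_Suc_eq_le)
  obtain xs where xs: "P xs" "\<forall>ys. P ys \<longrightarrow> length ys \<le> length xs"
    using ex_has_greatest_nat[of P "[v,u]" length "Suc (card V)"] P0 bd by (metis less_imp_le)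
  define l where "l = length xs"
  have dx: "distinct xs" "2 \<le> l" "set xs \<subseteq> V" and px: "path_in H xs"
    using xs by (auto simp: P_def l_def)
  define x where "x = xs ! (l - 1)"
  have xlast: "x = last xs" using dx by (cases "xs = []") (auto simp: x_def l_def last_conv_nth)
  have "x \<in> set xs" using dx by (auto simp: x_def l_def)
  hence xV: "x \<in> V" using dx by auto
  have "Suc (l - 2) < length xs" using dx(2) by (simp add: l_def)
  hence "{xs ! (l-2), xs ! Suc (l-2)} \<in> H" using px unfolding path_in_def by blast
  moreover have "Suc (l-2) = l - 1" using dx by simp
  ultimately have prev: "xs ! (l-2) \<in> nb H x" by (simp add: nb_def x_def insert_commute)
  have "card (nb H x) = 2" using H xV by (simp add: two_regular_def)
  then obtain y where y: "y \<in> nb H x" "y \<noteq> xs ! (l-2)"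
    using prev by (metis card_2_iff' )
  have yx: "y \<in> V" "y \<noteq> x" using two_regular_nb_subset[OF H] y by auto
  have "y \<in> set xs"
  proof (rule ccontr)
    assume "y \<notin> set xs"
    moreover have "xs \<noteq> []" using dx by (auto simp: l_def)
    ultimately have "P (xs @ [y])" using dx px yx y path_in_snoc[of H xs y] xlast
      by (auto simp: P_def l_def nb_def)
    thus False using xs(2) by fastforce
  qed
  then obtain j where j: "j < l" "y = xs ! j" by (metis in_set_conv_nth l_def)
  have jl: "j < l - 2"
  proof -
    have "j \<noteq> l - 1" "j \<noteq> l - 2" using j yx y x_def by auto
    thus ?thesis using j by linarith
  qed
  \<comment> \<open>An inner vertex of the path would get \<open>x\<close> as a third
    neighbour.\<close>
  have j0: "j = 0"
  proof (rule ccontr)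
    assume "j \<noteq> 0"
    have e1: "{xs ! (j-1), xs ! Suc (j-1)} \<in> H" and e2: "{xs ! j, xs ! Suc j} \<in> H"
      using px jl unfolding path_in_def l_def by auto
    have "{xs ! (j-1), xs ! Suc j, x} \<subseteq> nb H y"
      using e1 e2 y(1) \<open>j \<noteq> 0\<close> j by (auto simp: nb_def insert_commute)
    from two_regular_nb_le2[OF H yx(1) this] show False
      using dx jl \<open>j \<noteq> 0\<close> unfolding x_def l_def
      by (auto simp: nth_eq_iff_index_eq)
  qed
  have "cycle_edges xs \<subseteq> H"
  proof
    fix e assume "e \<in> cycle_edges xs"
    then obtain i where i: "i < l" "e = {xs ! i, xs ! cyc_succ l i}"
      by (auto simp: cycle_edges_cyc_succ l_def)
    show "e \<in> H"
    proof (cases "Suc i = l")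
      case True
      hence "i = l - 1" by simp
      thus ?thesis using i y j j0 True by (auto simp: cyc_succ_def nb_def x_def)
    next
      case False
      thus ?thesis using px i by (auto simp: cyc_succ_def path_in_def l_def)
    qed
  qed
  moreover have "3 \<le> length xs" using jl by (simp add: l_def)
  ultimately show thesis using dx that by blast
qed

text \<open>Cycles are peeled off one by one; what remains is 2-regular on fewer vertices.\<close>

lemma two_regular_imp_is_two_factor:
  assumes "finite V" "two_regular V H"
  shows "is_two_factor V H"
  using assms
proof (induction "card V" arbitrary: V H rule: less_induct)
  case less
  show ?case
  proof (cases "V = {}")
    case True
    hence "H = {}" using less.prems(2) by (force simp: two_regular_def)
    thus ?thesis using True unfolding is_two_factor_def
      by (intro exI[of _ "{}"]) (auto simp: disjoint_family_on_def)
  next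
    case False
    obtain c where c: "distinct c" "3 \<le> length c" "cycle_edges c \<subseteq> H"
      using two_regular_has_cycle[OF less.prems(2,1) False] .
    note r = two_regular_remove_cycle[OF less.prems(2) c]
    have "card (V - set c) < card V"
    proof (rule psubset_card_mono)
      show "V - set c \<subset> V" using r(2) c(2) by (cases c) auto
    qed (use less.prems in auto)
    from less.hyps[OF this _ r(1)] have "is_two_factor (V - set c) (H - cycle_edges c)"
      using less.prems by auto
    then obtain C where C: "\<forall>c\<in>C. distinct c \<and> 3 \<le> length c" "disjoint_family_on set C"
      "(\<Union>c\<in>C. set c) = V - set c" "H - cycle_edges c = (\<Union>c\<in>C. cycle_edges c)"
      by (auto simp: is_two_factor_def)
    show ?thesis unfolding is_two_factor_def
    proof (intro exI[of _ "insert c C"] conjI)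
      show "disjoint_family_on set (insert c C)"
        using C(2,3) unfolding disjoint_family_on_def by blast
    qed (use C c r in auto)
  qed
qed

lemma is_two_factor_iff: "finite V \<Longrightarrow> is_two_factor V H \<longleftrightarrow> two_regular V H"
  using is_two_factor_imp_two_regular two_regular_imp_is_two_factor by blast

lemma two_regular_finite: "finite V \<Longrightarrow> two_regular V H \<Longrightarrow> finite H"
  by (rule finite_subset[of _ "Pow V"]) (auto simp: two_regular_def)

lemma two_regular_Union:
  assumes "two_regular V H" shows "\<Union>H = V"
proof
  show "\<Union>H \<subseteq> V" using assms by (auto simp: two_regular_def)
  show "V \<subseteq> \<Union>H"
  proof
    fix v assume "v \<in> V"
    hence "card (nb H v) = 2" using assms by (simp add: two_regular_def)
    hence "nb H v \<noteq> {}" by auto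
    thus "v \<in> \<Union>H" by (auto simp: nb_def)
  qed
qed

lemma card_incident_eq_nb:
  assumes "\<forall>e\<in>H. card e = 2"
  shows "card {e \<in> H. v \<in> e} = card (nb H v)"
proof -
  have "bij_betw (\<lambda>u. {v, u}) (nb H v) {e \<in> H. v \<in> e}"
    unfolding bij_betw_def
  proof
    show "inj_on (\<lambda>u. {v, u}) (nb H v)" by (auto simp: inj_on_def doubleton_eq_iff)
    show "(\<lambda>u. {v, u}) ` nb H v = {e \<in> H. v \<in> e}"
    proof
      show "{e \<in> H. v \<in> e} \<subseteq> (\<lambda>u. {v, u}) ` nb H v"
      proof
        fix e assume "e \<in> {e \<in> H. v \<in> e}"
        thus "e \<in> (\<lambda>u. {v, u}) ` nb H v"
          using assms edge_eq_nb[of e v] by (metis (mono_tags, lifting) imageI mem_Collect_eq nb_def)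
      qed
    qed (auto simp: nb_def)
  qed
  thus ?thesis by (metis bij_betw_same_card)
qed

text \<open>Handshake lemma, by double counting of incidences.\<close>

lemma degree_sum:
  assumes V: "finite V" and H: "\<forall>e\<in>H. e \<subseteq> V \<and> card e = 2"
  shows "(\<Sum>v\<in>V. card (nb H v)) = 2 * card H"
proof -
  have fH: "finite H" by (rule finite_subset[of _ "Pow V"]) (use assms in auto)
  have "(\<Sum>v\<in>V. card (nb H v)) = (\<Sum>v\<in>V. card {e \<in> H. v \<in> e})"
    using card_incident_eq_nb[of H] H by simp
  also have "\<dots> = (\<Sum>v\<in>V. \<Sum>e\<in>H. if v \<in> e then 1 else 0)"
    using fH by (intro sum.cong refl) (simp add: sum.If_cases Int_def)
  also have "\<dots> = (\<Sum>e\<in>H. \<Sum>v\<in>V. if v \<in> e then 1 else 0)" by (rule sum.swap)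
  also have "\<dots> = (\<Sum>e\<in>H. 2)"
  proof (rule sum.cong[OF refl])
    fix e assume e: "e \<in> H"
    hence "V \<inter> {v. v \<in> e} = e" using H by auto
    thus "(\<Sum>v\<in>V. if v \<in> e then 1 else 0) = (2::nat)" using V e H by (simp add: sum.If_cases)
  qed
  finally show ?thesis by simp
qed

text \<open>Half the degree sum. It lets vertices be counted by edges when a trail is
  switched.\<close>

lemma card_two_regular:
  assumes "finite V" "two_regular V H"
  shows "card H = card V"
  using degree_sum[of V H] assms by (auto simp: two_regular_def)

section \<open>Counting 2-factors and their short cycles\<close>

definition two_factors :: "'a set \<Rightarrow> 'a set set set" where
  "two_factors V = {H. two_regular V H}"

lemma finite_two_factors: "finite V \<Longrightarrow> finite (two_factors V)"
  by (rule finite_subset[of _ "Pow (Pow V)"]) (auto simp: two_factors_def two_regular_def)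

text \<open>Subdivision of the edge \<open>e\<close> by the new vertex \<open>x\<close>.\<close>

definition insert_vertex :: "'a \<Rightarrow> 'a set set \<Rightarrow> 'a set \<Rightarrow> 'a set set" where
  "insert_vertex x H e = (H - {e}) \<union> (\<lambda>u. {x, u}) ` e"

lemma two_regular_insert_vertex:
  assumes H: "two_regular W H" and x: "x \<notin> W" and e: "e \<in> H"
  shows "two_regular (insert x W) (insert_vertex x H e)" (is "two_regular _ ?H")
    and "nb (insert_vertex x H e) x = e"
proof -
  have eW: "e \<subseteq> W" "card e = 2" using H e by (auto simp: two_regular_def)
  have xH: "x \<notin> f" if "f \<in> H" for f using that H x by (auto simp: two_regular_def)
  show nbx: "nb ?H x = e"
    using xH x eW by (auto simp: nb_def insert_vertex_def doubleton_eq_iff)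
  have 1: "f \<subseteq> insert x W \<and> card f = 2" if "f \<in> ?H" for f
    using that H eW x by (auto simp: insert_vertex_def two_regular_def card_insert_if)
  have 2: "card (nb ?H v) = 2" if v: "v \<in> insert x W" for v
  proof (cases "v = x")
    case True thus ?thesis using nbx eW by simp
  next
    case False
    hence vW: "v \<in> W" using v by simp
    hence f2: "finite (nb H v)" by (rule two_regular_finite_nb[OF H])
    have c2: "card (nb H v) = 2" using H vW by (auto simp: two_regular_def)
    show ?thesis
    proof (cases "v \<in> e")
      case True
      obtain u where u: "e = {v, u}" "u \<noteq> v" using edge_eq_nb[OF eW(2) True] .
      have "nb ?H v = insert x (nb H v - {u})"
        using False u by (auto simp: nb_def insert_vertex_def doubleton_eq_iff)
      moreover have "x \<notin> nb H v" using xH by (auto simp: nb_def)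
      moreover have "u \<in> nb H v" using e u by (simp add: nb_def)
      ultimately show ?thesis using c2 f2 by simp
    next
      case False': False
      have "nb ?H v = nb H v"
        using False False' by (auto simp: nb_def insert_vertex_def doubleton_eq_iff)
      thus ?thesis using c2 by simp
    qed
  qed
  show "two_regular (insert x W) ?H" using 1 2 by (simp add: two_regular_def)
qed

text \<open>A 2-factor on \<open>W\<close> has \<open>card W\<close> edges, each of which can be
  subdivided by \<open>x\<close>. The result determines both choices: the neighbours of
  \<open>x\<close> form the edge, and restoring it gives back the 2-factor.\<close>

lemma two_factors_insert_ge:
  assumes W: "finite W" and x: "x \<notin> W"
  shows "card (two_factors W) * card W \<le> card (two_factors (insert x W))"
proof -
  let ?P = "SIGMA H:two_factors W. H"
  have fin: "finite (two_factors W)" using W by (rule finite_two_factors)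
  have "card ?P = (\<Sum>H\<in>two_factors W. card H)"
    by (rule card_SigmaI) (use fin two_regular_finite[OF W] in \<open>auto simp: two_factors_def\<close>)
  also have "\<dots> = (\<Sum>H\<in>two_factors W. card W)"
    by (rule sum.cong) (use card_two_regular[OF W] in \<open>auto simp: two_factors_def\<close>)
  finally have c: "card ?P = card (two_factors W) * card W" by simp
  have "card ?P \<le> card (two_factors (insert x W))"
  proof (rule card_inj_on_le)
    show "finite (two_factors (insert x W))" using W by (simp add: finite_two_factors)
    show "(\<lambda>(H, e). insert_vertex x H e) ` ?P \<subseteq> two_factors (insert x W)"
      using two_regular_insert_vertex(1) x by (force simp: two_factors_def)
    show "inj_on (\<lambda>(H, e). insert_vertex x H e) ?P"
    proof (rule inj_on_inverseI[where g = "\<lambda>H'. (insert (nb H' x) {f \<in> H'. x \<notin> f}, nb H' x)"])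
      fix a assume "a \<in> ?P"
      then obtain H e where a: "a = (H, e)" "two_regular W H" "e \<in> H"
        by (auto simp: two_factors_def)
      have xH: "x \<notin> f" if "f \<in> H" for f using that a x by (auto simp: two_regular_def)
      have "{f \<in> insert_vertex x H e. x \<notin> f} = H - {e}"
        using xH by (auto simp: insert_vertex_def)
      thus "(insert (nb (case a of (H, e) \<Rightarrow> insert_vertex x H e) x)
              {f \<in> case a of (H, e) \<Rightarrow> insert_vertex x H e. x \<notin> f},
            nb (case a of (H, e) \<Rightarrow> insert_vertex x H e) x) = a"
        using two_regular_insert_vertex(2)[OF a(2) x a(3)] a by auto
    qed
  qed
  thus ?thesis using c by simp
qed

text \<open>The vertices of \<open>S\<close> are put back one at a time; with \<open>i\<close>
  vertices present, an insertion multiplies the number of 2-factors by at least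
  \<open>i\<close>.\<close>

lemma two_factors_remove_set:
  assumes "finite V" "S \<subseteq> V"
  shows "card (two_factors (V - S)) * (\<Prod>i\<in>{card V - card S..<card V}. i) \<le> card (two_factors V)"
proof -
  have "finite S" using assms finite_subset by auto
  thus ?thesis using assms(2)
  proof (induction S)
    case empty thus ?case by simp
  next
    case (insert x S)
    let ?m = "card V - card (insert x S)"
    have le: "card (insert x S) \<le> card V" using insert assms(1) by (intro card_mono) auto
    have xs: "V - S = insert x (V - insert x S)" "x \<notin> V - insert x S" using insert by auto
    have cm: "card (V - insert x S) = ?m" using insert assms by (subst card_Diff_subset) auto
    have "{?m..<card V} = insert ?m {card V - card S..<card V}"
      using insert le by auto
    hence "(\<Prod>i\<in>{?m..<card V}. i) = ?m * (\<Prod>i\<in>{card V - card S..<card V}. i)"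
      using insert le by (simp add: prod.insert)
    moreover have "card (two_factors (V - insert x S)) * ?m \<le> card (two_factors (V - S))"
      using two_factors_insert_ge[OF _ xs(2)] assms(1) cm by (subst xs(1)) simp
    ultimately have "card (two_factors (V - insert x S)) * (\<Prod>i\<in>{?m..<card V}. i)
        \<le> card (two_factors (V - S)) * (\<Prod>i\<in>{card V - card S..<card V}. i)"
      using mult_le_mono1 by (simp only: mult.assoc[symmetric])
    also have "\<dots> \<le> card (two_factors V)" using insert by auto
    finally show ?case .
  qed
qed

text \<open>Off this set \<open>H\<close> looks like a path at scale \<open>L\<close>. The
  exploration keeps away from it, and the count of walks with repetitions pays for it.\<close>

definition short_verts :: "'a set set \<Rightarrow> nat \<Rightarrow> 'a set" where
  "short_verts H L = {v. \<exists>c. distinct c \<and> 3 \<le> length c \<and> length c \<le> L \<and> cycle_edges c \<subseteq> H \<and> v \<in> set c}"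

lemma short_verts_subset: "two_regular V H \<Longrightarrow> short_verts H L \<subseteq> V"
  using two_regular_remove_cycle(2) by (fastforce simp: short_verts_def)

lemma cycle_edges_rotate: "cycle_edges (rotate n c) \<subseteq> cycle_edges c"
proof
  fix e assume "e \<in> cycle_edges (rotate n c)"
  then obtain i where i: "i < length c"
    "e = {rotate n c ! i, rotate n c ! (Suc i mod length c)}" by (auto simp: cycle_edges_def)
  let ?l = "length c"
  let ?j = "(n + i) mod ?l"
  have "?l > 0" using i by auto
  hence "e = {c ! ?j, c ! ((n + Suc i mod ?l) mod ?l)}"
    using i by (simp add: nth_rotate)
  moreover have "(n + Suc i mod ?l) mod ?l = Suc ?j mod ?l" by (simp add: mod_simps)
  ultimately show "e \<in> cycle_edges c" using \<open>?l > 0\<close> unfolding cycle_edges_def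
    by (auto intro!: exI[of _ ?j])
qed

lemma cycle_through_hd:
  assumes "v \<in> set c"
  obtains n where "hd (rotate n c) = v"
proof -
  obtain i where i: "i < length c" "c ! i = v" using assms by (metis in_set_conv_nth)
  have "hd (rotate i c) = v" using i by (subst hd_rotate_conv_nth) auto
  thus thesis using that by blast
qed

text \<open>In a random 2-factor a given vertex lies on a cycle of length \<open>k\<close> with
  probability at most 1 / (card V - k). There are (m - 1) ... (m - k + 1) lists of length
  \<open>k\<close> that start at \<open>v\<close>, and prescribing one of them as a cycle leaves a
  2-factor of the other vertices, which costs at least the factor (m - 1) ... (m - k).\<close>

lemma card_two_factors_cycle:
  assumes V: "finite V" and v: "v \<in> V" and k: "3 \<le> k" "k < card V"
  shows "card {H \<in> two_factors V. \<exists>c. distinct c \<and> length c = k \<and> cycle_edges c \<subseteq> H \<and> v \<in> set c}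
          * (card V - k) \<le> card (two_factors V)"
proof -
  define m where "m = card V"
  define Ls where "Ls = (#) v ` {ys. length ys = k - 1 \<and> distinct ys \<and> set ys \<subseteq> V - {v}}"
  define TF where "TF c = {H \<in> two_factors V. cycle_edges c \<subseteq> H}" for c
  have fL: "finite {ys. length ys = k - 1 \<and> distinct ys \<and> set ys \<subseteq> V - {v}}"
    by (rule finite_subset[OF _ finite_lists_length_eq[of "V - {v}" "k - 1"]]) (use V in auto)
  have finL: "finite Ls" using fL by (simp add: Ls_def)
  have cL: "card Ls = (\<Prod>i\<in>{m - k + 1..m - 1}. i)"
  proof -
    have "card Ls = card {ys. length ys = k - 1 \<and> distinct ys \<and> set ys \<subseteq> V - {v}}"
      unfolding Ls_def by (rule card_image) simp
    also have "\<dots> = \<Prod>{card (V - {v}) - (k - 1) + 1 .. card (V - {v})}"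
      by (rule card_lists_distinct_length_eq) (use V v k in auto)
    also have "card (V - {v}) = m - 1" using V v by (simp add: m_def)
    also have "m - 1 - (k - 1) + 1 = m - k + 1" using k by (simp add: m_def)
    finally show ?thesis by simp
  qed
  have sub: "{H \<in> two_factors V. \<exists>c. distinct c \<and> length c = k \<and> cycle_edges c \<subseteq> H \<and> v \<in> set c}
      \<subseteq> (\<Union>c\<in>Ls. TF c)"
  proof clarify
    fix H c assume H: "H \<in> two_factors V" and c: "distinct c" "k = length c" "cycle_edges c \<subseteq> H" "v \<in> set c"
    obtain n where n: "hd (rotate n c) = v" using cycle_through_hd[OF c(4)] .
    define d where "d = rotate n c"
    have d: "distinct d" "length d = k" "cycle_edges d \<subseteq> H" "hd d = v"
      using c n cycle_edges_rotate[of n c] by (auto simp: d_def)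
    have "set d \<subseteq> V" using two_regular_remove_cycle(2)[of V H d] d H k by (auto simp: two_factors_def)
    moreover obtain ys where "d = v # ys" using d k by (cases d) auto
    ultimately have "d \<in> Ls" using d by (auto simp: Ls_def)
    thus "H \<in> (\<Union>c\<in>Ls. TF c)" using d H by (auto simp: TF_def)
  qed
  define P where "P = (\<Prod>i\<in>{m - k..<m}. i)"
  have b: "card (TF c) * P \<le> card (two_factors V)" if "c \<in> Ls" for c
  proof -
    have c: "distinct c" "length c = k" "set c \<subseteq> V" using that k v by (auto simp: Ls_def)
    have "card (TF c) \<le> card (two_factors (V - set c))"
    proof (rule card_inj_on_le)
      show "inj_on (\<lambda>H. H - cycle_edges c) (TF c)" by (auto simp: inj_on_def TF_def)
      show "(\<lambda>H. H - cycle_edges c) ` TF c \<subseteq> two_factors (V - set c)"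
        using two_regular_remove_cycle(1)[of V _ c] c k by (auto simp: TF_def two_factors_def)
    qed (simp add: finite_two_factors V)
    moreover have "card (set c) = k" using distinct_card[OF c(1)] c(2) by simp
    ultimately show ?thesis using two_factors_remove_set[OF V c(3)]
      by (metis (no_types, lifting) P_def m_def le_trans mult_le_mono1)
  qed
  \<comment> \<open>All factors but m - k cancel against the number of lists.\<close>
  have Pm: "P = (m - k) * (\<Prod>i\<in>{m - k + 1..m - 1}. i)"
  proof -
    have "{m - k..<m} = insert (m - k) {m - k + 1..m - 1}" using k by (auto simp: m_def)
    thus ?thesis unfolding P_def by simp
  qed
  have Ppos: "P > 0" unfolding P_def using k by (auto simp: m_def)
  have "card {H \<in> two_factors V. \<exists>c. distinct c \<and> length c = k \<and> cycle_edges c \<subseteq> H \<and> v \<in> set c} * P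
        \<le> card (\<Union>c\<in>Ls. TF c) * P"
    by (intro mult_le_mono1 card_mono sub) (use finL V in \<open>auto simp: TF_def finite_two_factors\<close>)
  also have "\<dots> \<le> (\<Sum>c\<in>Ls. card (TF c)) * P" using finL by (intro mult_le_mono1 card_UN_le)
  also have "\<dots> = (\<Sum>c\<in>Ls. card (TF c) * P)" by (simp add: sum_distrib_right)
  also have "\<dots> \<le> (\<Sum>c\<in>Ls. card (two_factors V))" by (intro sum_mono b)
  also have "\<dots> = card Ls * card (two_factors V)" by simp
  finally have "card {H \<in> two_factors V. \<exists>c. distinct c \<and> length c = k \<and> cycle_edges c \<subseteq> H \<and> v \<in> set c} * (m - k) * card Ls
       \<le> card (two_factors V) * card Ls"
    unfolding Pm cL by (simp add: mult_ac)
  moreover have "card Ls > 0" using Ppos Pm cL by simp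
  ultimately show ?thesis by (simp add: m_def)
qed

text \<open>Union bound over the vertices and the lengths 3 to \<open>L\<close>. While
  \<open>L\<close> is small against \<open>card V\<close>, the mean number of vertices on short
  cycles is of order \<open>L\<close>.\<close>

lemma sum_card_short_verts:
  assumes V: "finite V" and L: "L < card V"
  shows "(\<Sum>H\<in>two_factors V. real (card (short_verts H L)))
          \<le> real (card (two_factors V)) * (real (card V) * real L / (real (card V) - real L))"
proof -
  define Q where "Q k v H \<longleftrightarrow> (\<exists>c. distinct c \<and> length c = k \<and> cycle_edges c \<subseteq> H \<and> v \<in> set c)" for k and v :: 'a and H
  have fin: "finite (two_factors V)" using V by (rule finite_two_factors)
  have 1: "real (card (short_verts H L)) \<le> (\<Sum>v\<in>V. \<Sum>k\<in>{3..L}. if Q k v H then 1 else 0)"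
    if "H \<in> two_factors V" for H
  proof -
    have "short_verts H L \<subseteq> V" using that short_verts_subset by (auto simp: two_factors_def)
    hence "real (card (short_verts H L)) = (\<Sum>v\<in>V. if v \<in> short_verts H L then 1 else 0)"
      using V by (simp add: sum.If_cases Int_absorb1)
    also have "\<dots> \<le> (\<Sum>v\<in>V. \<Sum>k\<in>{3..L}. if Q k v H then 1 else 0)"
    proof (rule sum_mono)
      fix v
      show "(if v \<in> short_verts H L then 1 else 0) \<le> (\<Sum>k\<in>{3..L}. if Q k v H then 1 else (0::real))"
      proof (cases "v \<in> short_verts H L")
        case True
        then obtain k where k: "k \<in> {3..L}" "Q k v H" by (fastforce simp: short_verts_def Q_def)
        have "(if Q k v H then 1 else (0::real)) \<le> (\<Sum>k\<in>{3..L}. if Q k v H then 1 else (0::real))"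
          by (rule member_le_sum) (use k in auto)
        thus ?thesis using k by simp
      next
        case False
        have "0 \<le> (\<Sum>k\<in>{3..L}. if Q k v H then 1 else (0::real))" by (rule sum_nonneg) auto
        thus ?thesis using False by simp
      qed
    qed
    finally show ?thesis .
  qed
  have "(\<Sum>H\<in>two_factors V. real (card (short_verts H L)))
      \<le> (\<Sum>H\<in>two_factors V. \<Sum>v\<in>V. \<Sum>k\<in>{3..L}. if Q k v H then 1 else 0)"
    by (rule sum_mono) (rule 1)
  also have "\<dots> = (\<Sum>v\<in>V. \<Sum>H\<in>two_factors V. \<Sum>k\<in>{3..L}. if Q k v H then 1 else 0)"
    by (rule sum.swap)
  also have "\<dots> = (\<Sum>v\<in>V. \<Sum>k\<in>{3..L}. \<Sum>H\<in>two_factors V. if Q k v H then 1 else 0)"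
    by (intro sum.cong refl sum.swap)
  also have "\<dots> \<le> (\<Sum>v\<in>V. \<Sum>k\<in>{3..L}. real (card (two_factors V)) / (real (card V) - real L))"
  proof (intro sum_mono)
    fix v k assume v: "v \<in> V" and k: "k \<in> {3..L}"
    have eq: "(\<Sum>H\<in>two_factors V. if Q k v H then 1 else (0::real)) = real (card {H \<in> two_factors V. Q k v H})"
      using fin by (simp add: sum.If_cases Int_def)
    have c: "card {H \<in> two_factors V. Q k v H} * (card V - k) \<le> card (two_factors V)"
      unfolding Q_def by (rule card_two_factors_cycle) (use V v k L in auto)
    have "real (card {H \<in> two_factors V. Q k v H}) * (real (card V) - real L)
         \<le> real (card {H \<in> two_factors V. Q k v H}) * real (card V - k)"
      using k L by (intro mult_left_mono) auto
    also have "\<dots> \<le> real (card (two_factors V))" using c by (simp flip: of_nat_mult)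
    finally have "real (card {H \<in> two_factors V. Q k v H}) \<le> real (card (two_factors V)) / (real (card V) - real L)"
      using L by (simp add: field_simps)
    thus "(\<Sum>H\<in>two_factors V. if Q k v H then 1 else 0) \<le> real (card (two_factors V)) / (real (card V) - real L)"
      unfolding eq .
  qed
  also have "\<dots> = real (card V) * (real (card {3..L}) * (real (card (two_factors V)) / (real (card V) - real L)))"
    by simp
  also have "\<dots> \<le> real (card V) * (real L * (real (card (two_factors V)) / (real (card V) - real L)))"
    using L by (intro mult_left_mono mult_right_mono) auto
  finally show ?thesis by (simp add: field_simps)
qed

text \<open>Relabelling the vertices along a bijection preserves degrees.\<close>

lemma card_two_factors_le:
  assumes f: "bij_betw f V W" and V: "finite V"
  shows "card (two_factors V) \<le> card (two_factors W)"
proof (rule card_inj_on_le)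
  have W: "finite W" using f V bij_betw_finite by blast
  show "finite (two_factors W)" using W by (rule finite_two_factors)
  have inj: "inj_on f V" and fV: "f ` V = W" using f by (auto simp: bij_betw_def)
  have injP: "inj_on ((`) f) (Pow V)" using inj by (rule inj_on_image_Pow)
  show "inj_on (\<lambda>H. (`) f ` H) (two_factors V)"
  proof (rule inj_on_subset[of _ "Pow (Pow V)"])
    show "inj_on (\<lambda>H. (`) f ` H) (Pow (Pow V))" using injP by (rule inj_on_image_Pow)
  qed (auto simp: two_factors_def two_regular_def)
  show "(\<lambda>H. (`) f ` H) ` two_factors V \<subseteq> two_factors W"
  proof
    fix H' assume "H' \<in> (\<lambda>H. (`) f ` H) ` two_factors V"
    then obtain H where H: "two_regular V H" "H' = (`) f ` H" by (auto simp: two_factors_def)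
    have 1: "e \<subseteq> W \<and> card e = 2" if e: "e \<in> H'" for e
    proof -
      obtain e0 where e0: "e0 \<in> H" "e = f ` e0" using e H by auto
      hence "e0 \<subseteq> V" "card e0 = 2" using H by (auto simp: two_regular_def)
      thus ?thesis using e0 fV inj card_image inj_on_subset by (metis image_mono)
    qed
    have 2: "card (nb H' w) = 2" if w: "w \<in> W" for w
    proof -
      obtain v where v: "v \<in> V" "w = f v" using w fV by auto
      have sub: "nb H v \<subseteq> V" using two_regular_nb_subset[OF H(1)] by blast
      have "nb H' w = f ` nb H v"
      proof
        show "f ` nb H v \<subseteq> nb H' w"
        proof clarify
          fix a assume "a \<in> nb H v"
          hence "f ` {v, a} \<in> H'" unfolding H(2) nb_def by blast
          thus "f a \<in> nb H' w" using v by (simp add: nb_def)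
        qed
        show "nb H' w \<subseteq> f ` nb H v"
        proof
          fix u assume "u \<in> nb H' w"
          then obtain e where e: "e \<in> H" "{w, u} = f ` e" using H(2) by (auto simp: nb_def)
          have eV: "e \<subseteq> V" "card e = 2" using e H(1) by (auto simp: two_regular_def)
          have "w \<in> f ` e" using e by auto
          hence "v \<in> e" using v eV inj by (metis inj_on_image_mem_iff)
          then obtain a where a: "e = {v, a}" "a \<noteq> v" using edge_eq_nb eV(2) by metis
          have "f a \<noteq> f v" using a eV inj by (auto simp: inj_on_def)
          hence "u = f a" using e(2) a v by (auto simp: doubleton_eq_iff)
          thus "u \<in> f ` nb H v" using a e(1) by (auto simp: nb_def)
        qed
      qed
      moreover have "inj_on f (nb H v)" using inj sub inj_on_subset by blast
      ultimately show ?thesis using H(1) v by (simp add: card_image two_regular_def)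
    qed
    show "H' \<in> two_factors W" using 1 2 by (simp add: two_factors_def two_regular_def)
  qed
qed

text \<open>Since a 2-factor determines its vertex set, this makes the choice of a vertex set
  followed by that of a 2-factor uniform overall.\<close>

lemma card_two_factors_cong:
  assumes "finite V" "finite W" "card V = card W"
  shows "card (two_factors V) = card (two_factors W)"
proof -
  obtain f where "bij_betw f V W" using finite_same_card_bij[OF assms] by blast
  moreover obtain g where "bij_betw g W V" using finite_same_card_bij[OF assms(2,1)] assms(3) by auto
  ultimately show ?thesis using card_two_factors_le assms by (metis le_antisym)
qed

lemma two_factors_nonempty:
  assumes "finite V" "3 \<le> card V"
  shows "two_factors V \<noteq> {}"
proof -
  obtain c where c: "set c = V" "distinct c" using finite_distinct_list[OF assms(1)] by auto
  have l: "3 \<le> length c" using c assms distinct_card by fastforce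
  have "two_regular V (cycle_edges c)"
    using cycle_edge_props[OF c(2) l] card_nb_cycle[OF c(2) l] c(1) by (auto simp: two_regular_def)
  thus ?thesis by (auto simp: two_factors_def)
qed

subsection \<open>Non-backtracking walks along a 2-factor\<close>

definition nb_walk :: "'a set set \<Rightarrow> 'a list \<Rightarrow> bool" where
  "nb_walk H ys \<longleftrightarrow> path_in H ys \<and> (\<forall>i. Suc (Suc i) < length ys \<longrightarrow> ys ! i \<noteq> ys ! Suc (Suc i))"

text \<open>At the first repetition \<open>ys ! i = ys ! j\<close>, an index \<open>i\<close> other
  than 0 would give this vertex three neighbours. So the walk closes up at its starting
  point.\<close>

lemma nb_walk_first_repeat:
  assumes H: "two_regular V H" and ys: "nb_walk H ys" "\<not> distinct ys"
  obtains j where "3 \<le> j" "j < length ys" "distinct (take j ys)" "cycle_edges (take j ys) \<subseteq> H"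
proof -
  have p: "{ys ! i, ys ! Suc i} \<in> H" if "Suc i < length ys" for i
    using ys(1) that by (auto simp: nb_walk_def path_in_def)
  have nbk: "ys ! i \<noteq> ys ! Suc (Suc i)" if "Suc (Suc i) < length ys" for i
    using ys(1) that by (auto simp: nb_walk_def)
  have nl: "ys ! i \<noteq> ys ! Suc i" if "Suc i < length ys" for i
    using p[OF that] H by (auto simp: two_regular_def)
  define R where "R j \<longleftrightarrow> j < length ys \<and> (\<exists>i<j. ys ! i = ys ! j)" for j
  have "\<exists>j. R j" using ys(2) unfolding distinct_conv_nth R_def
    by (metis linorder_neqE_nat)
  define j where "j = (LEAST j. R j)"
  have Rj: "R j" unfolding j_def using \<open>\<exists>j. R j\<close> by (rule LeastI_ex)
  have min: "\<not> R i" if "i < j" for i using that not_less_Least unfolding j_def by blast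
  obtain i where i: "i < j" "ys ! i = ys ! j" "j < length ys" using Rj by (auto simp: R_def)
  have dis: "ys ! a \<noteq> ys ! b" if "a < b" "b < j" for a b
    using min[OF that(2)] that i by (auto simp: R_def)
  have j1: "j = Suc (j - 1)" using i by simp
  have ij: "Suc (Suc i) < j"
  proof -
    have "j \<noteq> Suc i" using nl[of i] i by auto
    moreover have "j \<noteq> Suc (Suc i)" using nbk[of i] i by auto
    ultimately show ?thesis using i by linarith
  qed
  have i0: "i = 0"
  proof (rule ccontr)
    assume "i \<noteq> 0"
    have e1: "{ys ! (i - 1), ys ! i} \<in> H" using p[of "i - 1"] i \<open>i \<noteq> 0\<close> by simp
    have e2: "{ys ! i, ys ! Suc i} \<in> H" using p[of i] i by simp
    have e3: "{ys ! (j - 1), ys ! i} \<in> H" using p[of "j - 1"] i j1 by simp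
    have "{ys ! (i - 1), ys ! Suc i, ys ! (j - 1)} \<subseteq> nb H (ys ! i)"
      using e1 e2 e3 by (auto simp: nb_def insert_commute)
    moreover have "ys ! i \<in> V" using e2 H by (auto simp: two_regular_def)
    ultimately have "ys ! (i - 1) = ys ! Suc i \<or> ys ! Suc i = ys ! (j - 1) \<or> ys ! (i - 1) = ys ! (j - 1)"
      using two_regular_nb_le2[OF H] by blast
    moreover have "ys ! (i - 1) \<noteq> ys ! Suc i" using dis[of "i - 1" "Suc i"] ij by simp
    moreover have "ys ! Suc i \<noteq> ys ! (j - 1)" using dis[of "Suc i" "j - 1"] ij by simp
    moreover have "ys ! (i - 1) \<noteq> ys ! (j - 1)" using dis[of "i - 1" "j - 1"] ij by simp
    ultimately show False by blast
  qed
  show thesis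
  proof (rule that[of j])
    show "3 \<le> j" using ij i0 by simp
    show "distinct (take j ys)" unfolding distinct_conv_nth
      using dis i(3) by (auto, metis linorder_neqE_nat)
    show "cycle_edges (take j ys) \<subseteq> H"
    proof
      fix e assume "e \<in> cycle_edges (take j ys)"
      then obtain a where a: "a < j" "e = {take j ys ! a, take j ys ! cyc_succ j a}"
        using i(3) by (auto simp: cycle_edges_cyc_succ)
      show "e \<in> H"
      proof (cases "Suc a = j")
        case True
        thus ?thesis using a p[of a] i i0 by (auto simp: cyc_succ_def)
      next
        case False
        thus ?thesis using a p[of a] i by (auto simp: cyc_succ_def)
      qed
    qed
  qed (use i in auto)
qed

text \<open>A short cycle is a component of \<open>H\<close>, so its vertex set is closed under
  adjacency.\<close>

lemma short_verts_nb:
  assumes H: "two_regular V H" and v: "v \<in> short_verts H L" and u: "{v, u} \<in> H"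
  shows "u \<in> short_verts H L"
proof -
  obtain c where c: "distinct c" "3 \<le> length c" "length c \<le> L" "cycle_edges c \<subseteq> H" "v \<in> set c"
    using v by (auto simp: short_verts_def)
  have vV: "v \<in> V" using u H by (auto simp: two_regular_def)
  have "nb (cycle_edges c) v \<subseteq> nb H v" using c(4) by (auto simp: nb_def)
  hence "nb (cycle_edges c) v = nb H v"
    using card_nb_cycle[OF c(1,2,5)] two_regular_finite_nb[OF H vV] vV H
    by (metis card_subset_eq two_regular_def)
  hence "{v, u} \<in> cycle_edges c" using u by (auto simp: nb_def)
  hence "u \<in> set c" using cycle_edge_props[OF c(1,2)] by auto
  thus ?thesis using c by (auto simp: short_verts_def)
qed

text \<open>A repetition within \<open>Suc L\<close> vertices closes a cycle of length at most
  \<open>L\<close>, and the walk can never leave that cycle.\<close>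

lemma nb_walk_distinct:
  assumes H: "two_regular V H" and ys: "nb_walk H ys" "length ys \<le> Suc L"
    and i: "i < length ys" "ys ! i \<notin> short_verts H L"
  shows "distinct ys"
proof (rule ccontr)
  assume "\<not> distinct ys"
  then obtain j where j: "3 \<le> j" "j < length ys" "distinct (take j ys)" "cycle_edges (take j ys) \<subseteq> H"
    using nb_walk_first_repeat[OF H ys(1)] by blast
  have "ys ! 0 \<in> set (take j ys)" using j by (auto simp: in_set_conv_nth intro!: exI[of _ 0])
  hence 0: "ys ! 0 \<in> short_verts H L" using j ys(2) unfolding short_verts_def
    by (auto intro!: exI[of _ "take j ys"])
  have "ys ! k \<in> short_verts H L" if "k < length ys" for k
    using that
  proof (induction k)
    case (Suc k)
    thus ?case using short_verts_nb[OF H] ys(1) by (auto simp: nb_walk_def path_in_def)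
  qed (use 0 in simp)
  thus False using i by blast
qed

text \<open>The last vertex has degree 2, hence a neighbour other than the one the walk came
  from.\<close>

lemma nb_walk_extend:
  assumes H: "two_regular V H" and ys: "nb_walk H ys" "2 \<le> length ys"
  obtains y where "nb_walk H (ys @ [y])"
proof -
  define l where "l = length ys"
  have l: "Suc (l - 2) < length ys" "Suc (l - 2) = l - 1" using ys by (auto simp: l_def)
  have e: "{ys ! (l - 2), ys ! (l - 1)} \<in> H" using ys(1) l by (metis nb_walk_def path_in_def)
  hence "card (nb H (ys ! (l - 1))) = 2" using H by (auto simp: two_regular_def)
  moreover have "ys ! (l - 2) \<in> nb H (ys ! (l - 1))" using e by (simp add: nb_def insert_commute)
  ultimately obtain y where y: "y \<in> nb H (ys ! (l - 1))" "y \<noteq> ys ! (l - 2)"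
    by (metis card_2_iff')
  have ne: "ys \<noteq> []" using ys by auto
  have "path_in H (ys @ [y])"
    using ys(1) y ne by (intro path_in_snoc) (auto simp: nb_walk_def nb_def l_def last_conv_nth)
  moreover have "(ys @ [y]) ! i \<noteq> (ys @ [y]) ! Suc (Suc i)" if "Suc (Suc i) < length (ys @ [y])" for i
  proof (cases "Suc (Suc i) < length ys")
    case True thus ?thesis using ys(1) by (auto simp: nb_walk_def nth_append)
  next
    case False
    hence "Suc (Suc i) = length ys" "i = l - 2" using that by (auto simp: l_def)
    thus ?thesis using y ys by (auto simp: nth_append)
  qed
  ultimately show thesis using that by (auto simp: nb_walk_def)
qed

lemma nb_walk_extend_n:
  assumes H: "two_regular V H" and ys: "nb_walk H ys" "2 \<le> length ys"
  obtains zs where "nb_walk H (ys @ zs)" "length zs = k"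
proof -
  have "\<exists>zs. nb_walk H (ys @ zs) \<and> length zs = k"
  proof (induction k)
    case (Suc k)
    then obtain zs where zs: "nb_walk H (ys @ zs)" "length zs = k" by blast
    obtain y where "nb_walk H ((ys @ zs) @ [y])"
      using nb_walk_extend[OF H zs(1)] ys(2) by auto
    thus ?case using zs by (intro exI[of _ "zs @ [y]"]) auto
  qed (use ys in auto)
  thus thesis using that by blast
qed

lemma nb_walk_rev:
  assumes "nb_walk H ys"
  shows "nb_walk H (rev ys)"
proof -
  have e: "{ys ! i, ys ! Suc i} \<in> H" if "Suc i < length ys" for i
    using assms that by (auto simp: nb_walk_def path_in_def)
  have d: "ys ! i \<noteq> ys ! Suc (Suc i)" if "Suc (Suc i) < length ys" for i
    using assms that by (auto simp: nb_walk_def)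
  have "{rev ys ! i, rev ys ! Suc i} \<in> H" if i: "Suc i < length (rev ys)" for i
  proof -
    have "Suc (length ys - Suc (Suc i)) = length ys - Suc i" using i by auto
    thus ?thesis using e[of "length ys - Suc (Suc i)"] i by (simp add: rev_nth insert_commute)
  qed
  moreover have "rev ys ! i \<noteq> rev ys ! Suc (Suc i)" if i: "Suc (Suc i) < length (rev ys)" for i
  proof -
    have "Suc (Suc (length ys - Suc (Suc (Suc i)))) = length ys - Suc i" using i by auto
    moreover have "length ys - Suc i < length ys" using i by simp
    ultimately show ?thesis using d[of "length ys - Suc (Suc (Suc i))"] i by (auto simp: rev_nth)
  qed
  ultimately show ?thesis by (auto simp: nb_walk_def path_in_def)
qed

text \<open>A walk of \<open>A\<close> steps away from \<open>v\<close> is turned round and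
  continued \<open>A\<close> steps past \<open>v\<close>. Its \<open>2 * A + 1\<close> vertices are
  distinct, since a repetition would put \<open>v\<close> on a cycle of length at most
  \<open>2 * A\<close>.\<close>

lemma two_regular_arc:
  assumes H: "two_regular V H" and v: "v \<in> V" "v \<notin> short_verts H (2 * A)" and A: "1 \<le> A"
  obtains p q where "length p = A" "length q = A" "distinct (p @ v # q)"
    "path_in H (v # p)" "path_in H (v # q)"
proof -
  have "card (nb H v) = 2" using H v by (simp add: two_regular_def)
  then obtain u where u: "{v, u} \<in> H" by (metis card.empty ex_in_conv mem_Collect_eq nb_def zero_neq_numeral)
  have "nb_walk H [v, u]" using u by (auto simp: nb_walk_def path_in_def less_Suc_eq)
  then obtain zs where zs: "nb_walk H ([v, u] @ zs)" "length zs = A - 1"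
    using nb_walk_extend_n[OF H, of "[v, u]" "A - 1"] by auto
  define p where "p = u # zs"
  have p: "nb_walk H (v # p)" "length p = A" using zs A by (auto simp: p_def)
  have "2 \<le> length (rev (v # p))" using p A by auto
  then obtain q where q: "nb_walk H (rev (v # p) @ q)" "length q = A"
    using nb_walk_extend_n[OF H nb_walk_rev[OF p(1)]] by blast
  have d: "distinct (rev (v # p) @ q)"
  proof (rule nb_walk_distinct[OF H q(1), where i = A])
    show "(rev (v # p) @ q) ! A \<notin> short_verts H (2 * A)" using v p q by (simp add: nth_append)
  qed (use p q in auto)
  have "path_in H (v # q)" unfolding path_in_def
  proof (intro allI impI)
    fix i assume i: "Suc i < length (v # q)"
    have "{(rev (v # p) @ q) ! (A + i), (rev (v # p) @ q) ! Suc (A + i)} \<in> H"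
      using q p i unfolding nb_walk_def path_in_def by auto
    thus "{(v # q) ! i, (v # q) ! Suc i} \<in> H"
      using p by (cases i) (auto simp: nth_append)
  qed
  moreover have "path_in H (v # p)" using p by (simp add: nb_walk_def)
  moreover have "distinct (p @ v # q)" using d by auto
  ultimately show thesis using p q that by blast
qed

section \<open>Random edge sets\<close>

definition random_subset :: "'a set \<Rightarrow> real \<Rightarrow> 'a set pmf" where
  "random_subset E p = map_pmf (\<lambda>f. {e \<in> E. f e}) (Pi_pmf E False (\<lambda>_. bernoulli_pmf p))"

lemma erdos_renyi_eq: "erdos_renyi n p = random_subset (complete_graph n) p"
  by (simp add: erdos_renyi_def random_subset_def)

lemma set_random_subset: "G \<in> set_pmf (random_subset E p) \<Longrightarrow> G \<subseteq> E"
  by (auto simp: random_subset_def)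

lemma random_subset_empty [simp]: "random_subset {} p = return_pmf {}"
  by (simp add: random_subset_def)

lemma random_subset_insert:
  assumes "finite E" "e \<notin> E"
  shows "random_subset (insert e E) p =
    bind_pmf (bernoulli_pmf p) (\<lambda>b. map_pmf (\<lambda>G. if b then insert e G else G) (random_subset E p))"
proof -
  have "random_subset (insert e E) p =
     bind_pmf (bernoulli_pmf p) (\<lambda>b. bind_pmf (Pi_pmf E False (\<lambda>_. bernoulli_pmf p))
       (\<lambda>f. return_pmf {a \<in> insert e E. (f(e := b)) a}))"
    unfolding random_subset_def using assms
    by (subst Pi_pmf_insert') (simp_all add: map_bind_pmf)
  also have "\<dots> = bind_pmf (bernoulli_pmf p) (\<lambda>b. map_pmf (\<lambda>G. if b then insert e G else G) (random_subset E p))"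
  proof (intro bind_pmf_cong refl)
    fix b
    have "{a \<in> insert e E. (f(e := b)) a} = (if b then insert e {a \<in> E. f a} else {a \<in> E. f a})" for f :: "'a \<Rightarrow> bool"
      using assms(2) by auto
    thus "bind_pmf (Pi_pmf E False (\<lambda>_. bernoulli_pmf p)) (\<lambda>f. return_pmf {a \<in> insert e E. (f(e := b)) a})
       = map_pmf (\<lambda>G. if b then insert e G else G) (random_subset E p)"
      by (simp add: random_subset_def map_pmf_comp map_pmf_def bind_assoc_pmf bind_return_pmf)
  qed
  finally show ?thesis .
qed

lemma prob_bind_pmf:
  "measure_pmf.prob (bind_pmf M f) A = (\<integral>x. measure_pmf.prob (f x) A \<partial>measure_pmf M)"
proof -
  have "ennreal (measure_pmf.prob (bind_pmf M f) A) = emeasure (measure_pmf (bind_pmf M f)) A"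
    by (simp only: measure_pmf.emeasure_eq_measure)
  also have "\<dots> = (\<integral>\<^sup>+x. ennreal (measure_pmf.prob (f x) A) \<partial>measure_pmf M)"
    by (subst emeasure_bind_pmf) (simp only: measure_pmf.emeasure_eq_measure)
  also have "\<dots> = ennreal (\<integral>x. measure_pmf.prob (f x) A \<partial>measure_pmf M)"
    by (intro nn_integral_eq_integral measure_pmf.integrable_const_bound[where B = 1]) auto
  finally show ?thesis by (simp add: integral_nonneg_AE)
qed

lemma measure_bind_bernoulli:
  assumes "0 \<le> p" "p \<le> 1"
  shows "measure_pmf.prob (bind_pmf (bernoulli_pmf p) f) A
     = p * measure_pmf.prob (f True) A + (1 - p) * measure_pmf.prob (f False) A"
proof -
  have "measure_pmf.prob (bind_pmf (bernoulli_pmf p) f) A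
     = (\<integral>b. measure_pmf.prob (f b) A \<partial>bernoulli_pmf p)"
    by (rule prob_bind_pmf)
  also have "\<dots> = p * measure_pmf.prob (f True) A + (1 - p) * measure_pmf.prob (f False) A"
    using assms by simp
  finally show ?thesis .
qed

lemma prob_random_subset_insert:
  assumes "finite E" "e \<notin> E" "0 \<le> p" "p \<le> 1"
  shows "measure_pmf.prob (random_subset (insert e E) p) {G. P G}
     = p * measure_pmf.prob (random_subset E p) {G. P (insert e G)}
       + (1 - p) * measure_pmf.prob (random_subset E p) {G. P G}"
  unfolding random_subset_insert[OF assms(1,2)] measure_bind_bernoulli[OF assms(3,4)]
  by (simp add: vimage_def)

text \<open>A random subset of fewer elements is stochastically smaller; the surplus elements are
  removed one at a time by conditioning on their presence.\<close>

lemma prob_random_subset_antimono: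
  assumes "finite S" "S' \<subseteq> S" "0 \<le> p" "p \<le> 1"
    and P: "\<And>G G'. P G \<Longrightarrow> G' \<subseteq> G \<Longrightarrow> P G'"
  shows "measure_pmf.prob (random_subset S p) {G. P G} \<le> measure_pmf.prob (random_subset S' p) {G. P G}"
proof -
  have "measure_pmf.prob (random_subset (S' \<union> D) p) {G. P G} \<le> measure_pmf.prob (random_subset S' p) {G. P G}"
    if "finite D" "D \<inter> S' = {}" for D
    using that
  proof (induction D)
    case (insert e D)
    have fin: "finite (S' \<union> D)" using insert assms finite_subset by auto
    have "measure_pmf.prob (random_subset (S' \<union> D) p) {G. P (insert e G)}
        \<le> measure_pmf.prob (random_subset (S' \<union> D) p) {G. P G}"
      by (rule measure_pmf.finite_measure_mono) (use P in auto)
    hence "measure_pmf.prob (random_subset (insert e (S' \<union> D)) p) {G. P G}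
        \<le> p * measure_pmf.prob (random_subset (S' \<union> D) p) {G. P G}
          + (1 - p) * measure_pmf.prob (random_subset (S' \<union> D) p) {G. P G}"
      using insert assms(3) by (subst prob_random_subset_insert[OF fin _ assms(3,4)]) (auto intro: mult_left_mono)
    also have "\<dots> = measure_pmf.prob (random_subset (S' \<union> D) p) {G. P G}" by (simp add: algebra_simps)
    also have "\<dots> \<le> measure_pmf.prob (random_subset S' p) {G. P G}" using insert by auto
    finally show ?case by simp
  qed auto
  moreover have "S' \<union> (S - S') = S" using assms(2) by auto
  ultimately show ?thesis using assms(1) by (metis Diff_disjoint Int_commute finite_Diff)
qed

text \<open>One query of an exploration: \<open>e\<close> is revealed, and the elements of
  \<open>S\<close> outside \<open>insert e S'\<close> are given up, which can only raise the
  probability of a decreasing event.\<close>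

lemma prob_random_subset_step:
  assumes S: "finite S" "insert e S' \<subseteq> S" "e \<notin> S'" and p: "0 \<le> p" "p \<le> 1"
    and P: "\<And>G G'. P G \<Longrightarrow> G' \<subseteq> G \<Longrightarrow> P G'"
  shows "measure_pmf.prob (random_subset S p) {G. P G}
     \<le> p * measure_pmf.prob (random_subset S' p) {G. P (insert e G)}
       + (1 - p) * measure_pmf.prob (random_subset S' p) {G. P G}"
proof -
  have "finite S'" using S finite_subset by auto
  have "measure_pmf.prob (random_subset S p) {G. P G}
      \<le> measure_pmf.prob (random_subset (insert e S') p) {G. P G}"
    by (rule prob_random_subset_antimono[OF S(1,2) p]) (use P in blast)
  thus ?thesis using prob_random_subset_insert[OF \<open>finite S'\<close> S(3) p] by simp
qed

text \<open>Common source of the probability that a set is contained in the random set, of the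
  probability that it is avoided, and of the likelihood of an observed graph.\<close>

lemma prob_random_subset_between:
  assumes E: "finite E" "A \<subseteq> B" "B \<subseteq> E" and p: "0 \<le> p" "p \<le> 1"
  shows "measure_pmf.prob (random_subset E p) {G. A \<subseteq> G \<and> G \<subseteq> B} = p ^ card A * (1 - p) ^ card (E - B)"
  using E
proof (induction E arbitrary: A B rule: finite_induct)
  case empty
  thus ?case by simp
next
  case (insert e E)
  let ?M = "\<lambda>Q. measure_pmf.prob (random_subset E p) {G. Q G}"
  have cong: "?M Q = ?M R" if "\<And>G. G \<subseteq> E \<Longrightarrow> Q G = R G" for Q R
    by (rule measure_pmf.finite_measure_eq_AE)
      (use that set_random_subset[of _ E p] in \<open>auto simp: AE_measure_pmf_iff\<close>)
  have eq: "measure_pmf.prob (random_subset (insert e E) p) {G. A \<subseteq> G \<and> G \<subseteq> B} =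
    p * ?M (\<lambda>G. A \<subseteq> insert e G \<and> insert e G \<subseteq> B) + (1 - p) * ?M (\<lambda>G. A \<subseteq> G \<and> G \<subseteq> B)"
    by (rule prob_random_subset_insert) (use insert p in auto)
  consider "e \<in> A" | "e \<notin> A" "e \<in> B" | "e \<notin> B" by blast
  thus ?case
  proof cases
    case 1
    have fA: "finite A"
      by (rule finite_subset[of A "insert e E"]) (use insert.prems insert.hyps in auto)
    have "?M (\<lambda>G. A \<subseteq> insert e G \<and> insert e G \<subseteq> B) = ?M (\<lambda>G. A - {e} \<subseteq> G \<and> G \<subseteq> B - {e})"
      by (rule cong) (use 1 insert in auto)
    also have "\<dots> = p ^ card (A - {e}) * (1 - p) ^ card (E - (B - {e}))"
      using insert by (intro insert.IH) auto
    also have "E - (B - {e}) = insert e E - B" using 1 insert by auto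
    finally have "?M (\<lambda>G. A \<subseteq> insert e G \<and> insert e G \<subseteq> B) = p ^ card (A - {e}) * (1 - p) ^ card (insert e E - B)" .
    moreover have "?M (\<lambda>G. A \<subseteq> G \<and> G \<subseteq> B) = ?M (\<lambda>G. False)"
      by (rule cong) (use 1 insert in auto)
    moreover have "card A = Suc (card (A - {e}))" using 1 fA by (metis card.remove)
    ultimately show ?thesis unfolding eq by simp
  next
    case 2
    have "?M (\<lambda>G. A \<subseteq> insert e G \<and> insert e G \<subseteq> B) = ?M (\<lambda>G. A \<subseteq> G \<and> G \<subseteq> B - {e})"
      by (rule cong) (use 2 insert in auto)
    moreover have "?M (\<lambda>G. A \<subseteq> G \<and> G \<subseteq> B) = ?M (\<lambda>G. A \<subseteq> G \<and> G \<subseteq> B - {e})"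
      by (rule cong) (use 2 insert in auto)
    moreover have "?M (\<lambda>G. A \<subseteq> G \<and> G \<subseteq> B - {e}) = p ^ card A * (1 - p) ^ card (E - (B - {e}))"
      using insert 2 by (intro insert.IH) auto
    moreover have "E - (B - {e}) = insert e E - B" using 2 insert by auto
    ultimately show ?thesis unfolding eq by (simp add: algebra_simps)
  next
    case 3
    have "?M (\<lambda>G. A \<subseteq> insert e G \<and> insert e G \<subseteq> B) = ?M (\<lambda>G. False)"
      by (rule cong) (use 3 in auto)
    moreover have "?M (\<lambda>G. A \<subseteq> G \<and> G \<subseteq> B) = p ^ card A * (1 - p) ^ card (E - B)"
      using insert 3 by (intro insert.IH) auto
    moreover have "card (insert e E - B) = Suc (card (E - B))"
    proof -
      have "insert e E - B = insert e (E - B)" using 3 by auto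
      thus ?thesis using insert by simp
    qed
    ultimately show ?thesis unfolding eq by simp
  qed
qed

lemma prob_random_subset_contains:
  assumes E: "finite E" "A \<subseteq> E" and p: "0 \<le> p" "p \<le> 1"
  shows "measure_pmf.prob (random_subset E p) {G. A \<subseteq> G} = p ^ card A"
proof -
  have "measure_pmf.prob (random_subset E p) {G. A \<subseteq> G} = measure_pmf.prob (random_subset E p) {G. A \<subseteq> G \<and> G \<subseteq> E}"
    by (rule measure_pmf.finite_measure_eq_AE) (use set_random_subset in \<open>auto simp: AE_measure_pmf_iff\<close>)
  thus ?thesis using prob_random_subset_between[OF E(1,2) order_refl p] by simp
qed

lemma prob_random_subset_disjoint:
  assumes E: "finite E" "A \<subseteq> E" and p: "0 \<le> p" "p \<le> 1"
  shows "measure_pmf.prob (random_subset E p) {G. A \<inter> G = {}} = (1 - p) ^ card A"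
proof -
  have "measure_pmf.prob (random_subset E p) {G. A \<inter> G = {}} = measure_pmf.prob (random_subset E p) {G. {} \<subseteq> G \<and> G \<subseteq> E - A}"
    by (rule measure_pmf.finite_measure_eq_AE) (use set_random_subset in \<open>auto simp: AE_measure_pmf_iff\<close>)
  moreover have "E - (E - A) = A" using E by auto
  ultimately show ?thesis using prob_random_subset_between[OF E(1) _ _ p, of "{}" "E - A"] by simp
qed

text \<open>Sprinkling: a random set may be exposed in two independent rounds. Per element this is
  the law of the disjunction of two independent bits.\<close>

lemma random_subset_union:
  assumes E: "finite E" and p: "0 \<le> p" "p \<le> 1" and q: "0 \<le> q" "q \<le> 1"
  shows "random_subset E (1 - (1 - p) * (1 - q)) =
     bind_pmf (random_subset E p) (\<lambda>A. map_pmf (\<lambda>B. A \<union> B) (random_subset E q))"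
  using E
proof (induction E rule: finite_induct)
  case empty
  show ?case by (simp add: bind_return_pmf)
next
  case (insert e E)
  let ?r = "1 - (1 - p) * (1 - q)"
  have r: "0 \<le> ?r" "?r \<le> 1"
  proof -
    have "(1 - p) * (1 - q) \<le> 1 * 1" using p q by (intro mult_mono) auto
    thus "0 \<le> ?r" by simp
    show "?r \<le> 1" using p q by simp
  qed
  have br: "bernoulli_pmf ?r = bind_pmf (bernoulli_pmf p) (\<lambda>a. map_pmf (\<lambda>b. a \<or> b) (bernoulli_pmf q))"
  proof (rule pmf_eqI)
    fix x
    have t: "map_pmf ((\<or>) True) (bernoulli_pmf q) = return_pmf True"
      "map_pmf ((\<or>) False) (bernoulli_pmf q) = bernoulli_pmf q"
      by (simp_all add: map_pmf_idI map_pmf_const[symmetric] cong: map_pmf_cong)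
    show "pmf (bernoulli_pmf ?r) x = pmf (bind_pmf (bernoulli_pmf p) (\<lambda>a. map_pmf (\<lambda>b. a \<or> b) (bernoulli_pmf q))) x"
      using p q r t by (cases x) (simp_all add: pmf_bind algebra_simps)
  qed
  let ?f = "\<lambda>b G. if b then insert e G else G"
  have "random_subset (insert e E) ?r =
    bind_pmf (bernoulli_pmf p) (\<lambda>a. bind_pmf (bernoulli_pmf q) (\<lambda>b.
      bind_pmf (random_subset E p) (\<lambda>A. bind_pmf (random_subset E q) (\<lambda>B.
        return_pmf (?f (a \<or> b) (A \<union> B))))))"
    unfolding random_subset_insert[OF insert(1,2)] insert.IH br
    by (simp add: map_pmf_def bind_assoc_pmf bind_return_pmf)
  also have "\<dots> = bind_pmf (bernoulli_pmf p) (\<lambda>a. bind_pmf (bernoulli_pmf q) (\<lambda>b.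
      bind_pmf (random_subset E p) (\<lambda>A. bind_pmf (random_subset E q) (\<lambda>B.
        return_pmf (?f a A \<union> ?f b B)))))"
    by (intro bind_pmf_cong refl) auto
  also have "\<dots> = bind_pmf (bernoulli_pmf p) (\<lambda>a. bind_pmf (random_subset E p) (\<lambda>A.
      bind_pmf (bernoulli_pmf q) (\<lambda>b. bind_pmf (random_subset E q) (\<lambda>B.
        return_pmf (?f a A \<union> ?f b B)))))"
    by (intro bind_pmf_cong refl bind_commute_pmf)
  also have "\<dots> = bind_pmf (random_subset (insert e E) p) (\<lambda>A. map_pmf (\<lambda>B. A \<union> B) (random_subset (insert e E) q))"
    unfolding random_subset_insert[OF insert(1,2)]
    by (simp add: map_pmf_def bind_assoc_pmf bind_return_pmf)
  finally show ?case .
qed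

lemma finite_complete_graph: "finite (complete_graph n)"
  by (rule finite_subset[of _ "Pow {..<n}"]) (auto simp: complete_graph_def)

lemma card_complete_graph: "card (complete_graph n) = n choose 2"
  using n_subsets[of "{..<n}" 2] by (simp add: complete_graph_def)

lemma card_complete_graph_le: "real (card (complete_graph n)) \<le> real n ^ 2 / 2"
proof -
  have "2 * (n choose 2) \<le> n * (n - 1)" unfolding choose_two by simp
  also have "\<dots> \<le> n * n" by simp
  finally have "2 * (n choose 2) \<le> n * n" .
  hence "real (2 * (n choose 2)) \<le> real (n * n)" by (rule of_nat_mono)
  thus ?thesis by (simp add: card_complete_graph power2_eq_square)
qed

lemma expectation_card_random_subset:
  assumes E: "finite E" and p: "0 \<le> p" "p \<le> 1"
  shows "measure_pmf.expectation (random_subset E p) (\<lambda>G. real (card G)) = p * real (card E)"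
proof -
  have "measure_pmf.expectation (random_subset E p) (\<lambda>G. real (card G))
      = measure_pmf.expectation (random_subset E p) (\<lambda>G. \<Sum>e\<in>E. indicator {G. {e} \<subseteq> G} G)"
  proof (rule integral_cong_AE)
    have "real (card G) = (\<Sum>e\<in>E. indicator {G. {e} \<subseteq> G} G)" if "G \<subseteq> E" for G
    proof -
      have "(\<Sum>e\<in>E. indicator {G. {e} \<subseteq> G} G) = (\<Sum>e\<in>E. if e \<in> G then 1 else (0::real))"
        by (intro sum.cong) (auto simp: indicator_def)
      also have "\<dots> = real (card (E \<inter> G))" using E by (simp add: sum.If_cases Int_def)
      finally show ?thesis using that by (simp add: Int_absorb1)
    qed
    thus "AE G in random_subset E p. real (card G) = (\<Sum>e\<in>E. indicator {G. {e} \<subseteq> G} G)"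
      using set_random_subset[of _ E p] by (subst AE_measure_pmf_iff) blast
  qed auto
  also have "\<dots> = (\<Sum>e\<in>E. measure_pmf.expectation (random_subset E p) (indicator {G. {e} \<subseteq> G}))"
    by (rule Bochner_Integration.integral_sum) (auto intro!: measure_pmf.integrable_const_bound[where B = 1])
  also have "\<dots> = (\<Sum>e\<in>E. p)"
  proof (rule sum.cong[OF refl])
    fix e assume "e \<in> E"
    thus "measure_pmf.expectation (random_subset E p) (indicator {G. {e} \<subseteq> G}) = p"
      using prob_random_subset_contains[OF E _ p, of "{e}"] by simp
  qed
  finally show ?thesis by simp
qed

lemma prob_card_random_subset:
  assumes E: "finite E" and p: "0 \<le> p" "p \<le> 1" and t: "t > 0"
  shows "measure_pmf.prob (random_subset E p) {G. t \<le> real (card G)} \<le> p * real (card E) / t"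
proof -
  have "set_pmf (random_subset E p) \<subseteq> Pow E" using set_random_subset[of _ E p] by auto
  hence "finite (set_pmf (random_subset E p))" using E finite_subset by (metis finite_Pow_iff)
  hence "integrable (random_subset E p) (\<lambda>G. real (card G))"
    by (rule integrable_measure_pmf_finite)
  from integral_Markov_inequality_measure[OF this, of UNIV t]
  have "measure_pmf.prob (random_subset E p) {G. t \<le> real (card G)}
      \<le> measure_pmf.expectation (random_subset E p) (\<lambda>G. real (card G)) / t"
    using t by simp
  thus ?thesis using expectation_card_random_subset[OF E p] by simp
qed

subsection \<open>Message passing\<close>

text \<open>Keeps the two largest values seen so far, with multiplicity; the initial value 0 stands
  for a missing one.\<close>

definition top2_step :: "nat \<Rightarrow> nat \<times> nat \<Rightarrow> nat \<times> nat" where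
  "top2_step x = (\<lambda>(a, b). if a < x then (x, a) else if b < x then (a, x) else (a, b))"

definition top2 :: "nat list \<Rightarrow> nat \<times> nat" where
  "top2 xs = fold top2_step xs (0, 0)"

lemma top2_Nil [simp]: "top2 [] = (0, 0)"
  and top2_snoc [simp]: "top2 (xs @ [x]) = top2_step x (top2 xs)"
  by (simp_all add: top2_def)

text \<open>Message passing knows the two largest child messages but not whose they are. Of any two
  children one has a message at most \<open>b\<close>, which serves the case of two red children;
  and whichever child \<open>c0\<close> is set aside, another one reaches \<open>b\<close> unless
  \<open>b\<close> is 0, which serves a blue child next to a red one.\<close>

lemma top2_props:
  assumes "distinct cs" "top2 (map f cs) = (a, b)"
  shows "b \<le> a" "\<forall>c\<in>set cs. f c \<le> a"
    "\<forall>c\<in>set cs. \<forall>d\<in>set cs. c \<noteq> d \<longrightarrow> f c \<le> b \<or> f d \<le> b"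
    "a = 0 \<or> (\<exists>c\<in>set cs. a = f c)"
    "\<forall>c0. b = 0 \<or> (\<exists>c\<in>set cs. c \<noteq> c0 \<and> b \<le> f c)"
proof -
  have "b \<le> a \<and> (\<forall>c\<in>set cs. f c \<le> a) \<and>
    (\<forall>c\<in>set cs. \<forall>d\<in>set cs. c \<noteq> d \<longrightarrow> f c \<le> b \<or> f d \<le> b) \<and>
    (a = 0 \<or> (\<exists>c\<in>set cs. a = f c)) \<and>
    (\<forall>c0. b = 0 \<or> (\<exists>c\<in>set cs. c \<noteq> c0 \<and> b \<le> f c))"
    using assms
  proof (induction cs arbitrary: a b rule: rev_induct)
    case (snoc x cs)
    obtain a' b' where ab: "top2 (map f cs) = (a', b')" by fastforce
    have IH: "b' \<le> a'" "\<forall>c\<in>set cs. f c \<le> a'"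
      "\<forall>c\<in>set cs. \<forall>d\<in>set cs. c \<noteq> d \<longrightarrow> f c \<le> b' \<or> f d \<le> b'"
      "a' = 0 \<or> (\<exists>c\<in>set cs. a' = f c)"
      "\<And>c0. b' = 0 \<or> (\<exists>c\<in>set cs. c \<noteq> c0 \<and> b' \<le> f c)"
      using snoc.IH[of a' b'] snoc.prems ab by auto
    have xcs: "x \<notin> set cs" using snoc.prems by simp
    have ab2: "(a, b) = top2_step (f x) (a', b')" using snoc.prems ab by simp
    consider "a' < f x" "a = f x" "b = a'" | "f x \<le> a'" "b' < f x" "a = a'" "b = f x"
      | "f x \<le> b'" "a = a'" "b = b'"
      using ab2 IH(1) by (auto simp: top2_step_def split: if_splits)
    thus ?case
    proof cases
      case 1
      have "b = 0 \<or> (\<exists>c\<in>set (cs @ [x]). c \<noteq> c0 \<and> b \<le> f c)" for c0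
      proof (cases "c0 = x")
        case True thus ?thesis using IH(4) 1 xcs by auto
      qed (use 1 in auto)
      thus ?thesis using 1 IH(2) by force
    next
      case 2
      have "b = 0 \<or> (\<exists>c\<in>set (cs @ [x]). c \<noteq> c0 \<and> b \<le> f c)" for c0
      proof (cases "c0 = x")
        case True thus ?thesis using IH(4) 2 xcs by auto
      qed (use 2 in auto)
      thus ?thesis using 2 IH by force
    next
      case 3
      have "b = 0 \<or> (\<exists>c\<in>set (cs @ [x]). c \<noteq> c0 \<and> b \<le> f c)" for c0
        using IH(5)[of c0] 3 by auto
      thus ?thesis using 3 IH by force
    qed
  qed simp
  note * = this
  show "b \<le> a" using * by (rule conjunct1)
  show "\<forall>c\<in>set cs. f c \<le> a" using *[THEN conjunct2] by (rule conjunct1)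
  show "\<forall>c\<in>set cs. \<forall>d\<in>set cs. c \<noteq> d \<longrightarrow> f c \<le> b \<or> f d \<le> b"
    using *[THEN conjunct2, THEN conjunct2] by (rule conjunct1)
  show "a = 0 \<or> (\<exists>c\<in>set cs. a = f c)"
    using *[THEN conjunct2, THEN conjunct2, THEN conjunct2] by (rule conjunct1)
  show "\<forall>c0. b = 0 \<or> (\<exists>c\<in>set cs. c \<noteq> c0 \<and> b \<le> f c)"
    using *[THEN conjunct2, THEN conjunct2, THEN conjunct2] by (rule conjunct2)
qed

definition children :: "nat \<Rightarrow> nat set set \<Rightarrow> nat \<Rightarrow> nat \<Rightarrow> nat list" where
  "children n G u v = filter (\<lambda>c. {u, c} \<in> G \<and> c \<noteq> v) [0..<n]"

text \<open>Message passing for the largest gain (blue minus red edges) of the alternating walks behind an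
  edge; all values are shifted by \<open>K\<close> to stay within the natural numbers.\<close>

primrec msg :: "nat \<Rightarrow> nat set set \<Rightarrow> nat \<Rightarrow> nat \<Rightarrow> nat \<Rightarrow> nat \<Rightarrow> nat" where
  "msg n G K 0 u v = K + 1"
| "msg n G K (Suc t) u v =
    (let (a, b) = top2 (map (\<lambda>c. msg n G K t c u) (children n G u v)) in 1 + min a (2 * K - b))"

text \<open>With messages taken relative to \<open>K\<close>, the test is that their sum exceeds 1.
  Each of the two contains the unit of the edge itself, so one of these units has to be
  discounted.\<close>

definition selected :: "nat \<Rightarrow> nat set set \<Rightarrow> nat \<Rightarrow> nat \<Rightarrow> nat set set" where
  "selected n G K T = {{u, v} | u v. u < v \<and> v < n \<and> {u, v} \<in> G \<and>
      2 * K + 1 < msg n G K T u v + msg n G K T v u}"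

lemma distinct_children: "distinct (children n G u v)"
  by (simp add: children_def)

lemma set_children: "set (children n G u v) = {c. c < n \<and> {u, c} \<in> G \<and> c \<noteq> v}"
  by (auto simp: children_def)

lemma msg_le: "msg n G K t u v \<le> K + t + 1"
proof (induction t arbitrary: u v)
  case (Suc t)
  obtain a b where ab: "top2 (map (\<lambda>c. msg n G K t c u) (children n G u v)) = (a, b)" by fastforce
  have "a = 0 \<or> (\<exists>c. a = msg n G K t c u)"
    using top2_props(4)[OF distinct_children ab] by auto
  hence "a \<le> K + t + 1" using Suc.IH by auto
  thus ?case using ab by simp
qed simp

text \<open>The last vertex of the list is the far end of the walk; the condition is void at both ends.\<close>

fun alt_walk :: "'a set set \<Rightarrow> 'a set \<Rightarrow> 'a list \<Rightarrow> bool" where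
  "alt_walk H V [] = False"
| "alt_walk H V [x] = True"
| "alt_walk H V [y, x] = (y \<noteq> x)"
| "alt_walk H V (y # x # z # ws) =
    (y \<noteq> x \<and> y \<noteq> z \<and> (x \<in> V \<longrightarrow> {y, x} \<in> H \<or> {x, z} \<in> H) \<and> alt_walk H V (x # z # ws))"

fun walk_edges :: "'a list \<Rightarrow> 'a set list" where
  "walk_edges (y # x # ws) = {y, x} # walk_edges (x # ws)"
| "walk_edges _ = []"

definition sgn_edge :: "'a set set \<Rightarrow> 'a set \<Rightarrow> int" where
  "sgn_edge H e = (if e \<in> H then -1 else 1)"

definition walk_gain :: "'a set set \<Rightarrow> 'a list \<Rightarrow> int" where
  "walk_gain H w = sum_list (map (sgn_edge H) (walk_edges w))"

lemma walk_gain_simps [simp]: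
  "walk_gain H (y # x # ws) = sgn_edge H {y, x} + walk_gain H (x # ws)"
  "walk_gain H [x] = 0" "walk_gain H [] = 0"
  by (simp_all add: walk_gain_def)

definition good_walk :: "nat \<Rightarrow> nat set set \<Rightarrow> nat set set \<Rightarrow> nat set \<Rightarrow> nat list \<Rightarrow> bool" where
  "good_walk n G H V w \<longleftrightarrow> alt_walk H V w \<and> set w \<subseteq> {..<n} \<and> set (walk_edges w) \<subseteq> G"

lemma good_walk_Cons:
  assumes "good_walk n G H V (u # c # ws)" "v < n" "v \<noteq> u" "v \<noteq> c" "{v, u} \<in> G"
    "u \<in> V \<Longrightarrow> {v, u} \<in> H \<or> {u, c} \<in> H"
  shows "good_walk n G H V (v # u # c # ws)"
  using assms by (auto simp: good_walk_def)

text \<open>Write M for the message minus \<open>K\<close>. A red edge starts a walk of gain at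
  least - M, and a blue edge one of gain at least M unless the message is at most
  \<open>t + 1\<close>, the value left by dead ends. The size of \<open>K\<close> keeps dead ends
  apart from genuine messages. In the induction on \<open>t\<close>, the child that continues the
  walk depends on the colour of the edge and on which of \<open>a\<close> and \<open>b\<close>
  decides the minimum.\<close>

lemma msg_bounds:
  assumes G: "G \<subseteq> complete_graph n" and HG: "H \<subseteq> G" and H: "two_regular V H"
    and t: "t \<le> T" and K: "2 * T + 2 \<le> K" and e: "{u, v} \<in> G"
  shows "({u, v} \<in> H \<longrightarrow> (\<exists>ws. length ws = t \<and> good_walk n G H V (v # u # ws) \<and>
            - walk_gain H (v # u # ws) \<le> int (msg n G K t u v) - int K))"
    and "({u, v} \<notin> H \<longrightarrow> (\<exists>ws. length ws = t \<and> good_walk n G H V (v # u # ws) \<and>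
            int (msg n G K t u v) - int K \<le> walk_gain H (v # u # ws)) \<or> msg n G K t u v \<le> t + 1)"
proof -
  have vtx: "a < n \<and> b < n \<and> a \<noteq> b" if "{a, b} \<in> G" for a b
    using that G by (auto simp: complete_graph_def card_insert_if split: if_splits)
  have "({u, v} \<in> H \<longrightarrow> (\<exists>ws. length ws = t \<and> good_walk n G H V (v # u # ws) \<and>
            - walk_gain H (v # u # ws) \<le> int (msg n G K t u v) - int K)) \<and>
        ({u, v} \<notin> H \<longrightarrow> (\<exists>ws. length ws = t \<and> good_walk n G H V (v # u # ws) \<and>
            int (msg n G K t u v) - int K \<le> walk_gain H (v # u # ws)) \<or> msg n G K t u v \<le> t + 1)"
    using t e
  proof (induction t arbitrary: u v)
    case 0
    have "good_walk n G H V [v, u]"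
      using 0 vtx[of u v] by (auto simp: good_walk_def insert_commute)
    thus ?case by (auto simp: sgn_edge_def insert_commute)
  next
    case (Suc t)
    have uv: "u < n" "v < n" "v \<noteq> u" "{v, u} \<in> G" using vtx[OF Suc.prems(2)] Suc.prems(2) by (auto simp: insert_commute)
    obtain a b where ab: "top2 (map (\<lambda>c. msg n G K t c u) (children n G u v)) = (a, b)" by fastforce
    note tp = top2_props[OF distinct_children ab]
    define m where "m = msg n G K (Suc t) u v"
    have m: "m = 1 + min a (2 * K - b)" using ab by (simp add: m_def)
    have ch: "c < n" "{c, u} \<in> G" "c \<noteq> v" if "c \<in> set (children n G u v)" for c
      using that by (auto simp: set_children insert_commute)
    have IHr: "\<exists>ws. length ws = t \<and> good_walk n G H V (u # c # ws) \<and>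
            - walk_gain H (u # c # ws) \<le> int (msg n G K t c u) - int K"
      if "c \<in> set (children n G u v)" "{c, u} \<in> H" for c
      using Suc.IH[of c u] ch[OF that(1)] that(2) Suc.prems by auto
    have IHb: "(\<exists>ws. length ws = t \<and> good_walk n G H V (u # c # ws) \<and>
            int (msg n G K t c u) - int K \<le> walk_gain H (u # c # ws)) \<or> msg n G K t c u \<le> t + 1"
      if "c \<in> set (children n G u v)" "{c, u} \<notin> H" for c
      using Suc.IH[of c u] ch[OF that(1)] that(2) Suc.prems by auto
    have aK: "a \<le> K + t + 1" "b \<le> K + t + 1"
      using tp(1,4) msg_le[of n G K t] by (auto intro: order_trans)
    have K2: "2 * t + 4 \<le> K" using K Suc.prems by simp
    show ?case
    proof (cases "{u, v} \<in> H")
      case True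
      have uV: "u \<in> V" using True H by (auto simp: two_regular_def)
      have vn: "v \<in> nb H u" using True by (simp add: nb_def)
      have "card (nb H u) = 2" using H uV by (simp add: two_regular_def)
      then obtain c0 c1 where "nb H u = {c0, c1}" "c0 \<noteq> c1" by (auto simp: card_2_iff)
      \<comment> \<open>The second red edge at \<open>u\<close>.\<close>
      then obtain c where c: "nb H u = {v, c}" "c \<noteq> v" using vn by (cases "c0 = v") auto
      hence cH: "{c, u} \<in> H" by (auto simp: nb_def insert_commute)
      hence cc: "c \<in> set (children n G u v)"
        using vtx[of c u] HG c by (auto simp: set_children insert_commute)
      obtain ws where ws: "length ws = t" "good_walk n G H V (u # c # ws)"
        "- walk_gain H (u # c # ws) \<le> int (msg n G K t c u) - int K" using IHr[OF cc cH] by blast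
      have le_a: "msg n G K t c u \<le> a" using tp(2) cc by auto
      have E: "\<exists>ws. length ws = Suc t \<and> good_walk n G H V (v # u # ws) \<and>
            - walk_gain H (v # u # ws) \<le> int m - int K"
      \<comment> \<open>If \<open>a\<close> decides the minimum, the walk goes on along the second
        red edge at \<open>u\<close>, otherwise along a blue edge to a child that reaches
        \<open>b\<close>.\<close>
      proof (cases "a \<le> 2 * K - b")
        case True': True
        have "good_walk n G H V (v # u # c # ws)"
          using ws uv c True by (intro good_walk_Cons) (auto simp: insert_commute)
        moreover have "- walk_gain H (v # u # c # ws) \<le> int m - int K"
          using ws(3) le_a m True' True by (simp add: sgn_edge_def insert_commute)
        ultimately show ?thesis using ws(1) by (intro exI[of _ "c # ws"]) auto
      next
        case False
        have "b \<noteq> 0" using False aK K2 by auto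
        then obtain d where d: "d \<in> set (children n G u v)" "d \<noteq> c" "b \<le> msg n G K t d u"
          using tp(5) by blast
        have dv: "d \<noteq> v" using ch[OF d(1)] by simp
        hence "d \<notin> nb H u" using c d by auto
        hence dH: "{d, u} \<notin> H" by (simp add: nb_def insert_commute)
        \<comment> \<open>Here \<open>b\<close> exceeds K - t - 1, which lies above every dead-end
          value.\<close>
        have "\<not> msg n G K t d u \<le> t + 1"
        proof
          assume "msg n G K t d u \<le> t + 1"
          hence "b \<le> t + 1" using d by simp
          thus False using False aK K2 by simp
        qed
        then obtain ws' where ws': "length ws' = t" "good_walk n G H V (u # d # ws')"
          "int (msg n G K t d u) - int K \<le> walk_gain H (u # d # ws')" using IHb[OF d(1) dH] by blast
        have "good_walk n G H V (v # u # d # ws')"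
          using ws' uv dv True by (intro good_walk_Cons) (auto simp: insert_commute)
        moreover have "- walk_gain H (v # u # d # ws') \<le> int m - int K"
          using ws'(3) d(3) m False True aK K2 by (simp add: sgn_edge_def insert_commute)
        ultimately show ?thesis using ws'(1) by (intro exI[of _ "d # ws'"]) auto
      qed
      thus ?thesis using True by (simp add: m_def del: msg.simps)
    next
      case False
      hence vuH: "{v, u} \<notin> H" by (simp add: insert_commute)
      have B: "(\<exists>ws. length ws = Suc t \<and> good_walk n G H V (v # u # ws) \<and>
            int m - int K \<le> walk_gain H (v # u # ws)) \<or> m \<le> t + 2"
      proof (cases "u \<in> V")
        case True
        hence "card (nb H u) = 2" using H by (simp add: two_regular_def)
        then obtain c d where cd: "nb H u = {c, d}" "c \<noteq> d" by (auto simp: card_2_iff)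
        have vn: "v \<notin> nb H u" using False by (simp add: nb_def)
        have cdH: "{c, u} \<in> H" "{d, u} \<in> H" using cd by (auto simp: nb_def insert_commute)
        hence cdc: "c \<in> set (children n G u v)" "d \<in> set (children n G u v)"
          using vtx[of c u] vtx[of d u] HG cd vn by (auto simp: set_children insert_commute)
        \<comment> \<open>One of the two red edges at \<open>u\<close> has a message at most the
          second largest value.\<close>
        obtain x where x: "x \<in> {c, d}" "msg n G K t x u \<le> b" using tp(3) cdc cd(2) by blast
        have xc: "x \<in> set (children n G u v)" "{x, u} \<in> H" using x cdc cdH by auto
        obtain ws where ws: "length ws = t" "good_walk n G H V (u # x # ws)"
          "- walk_gain H (u # x # ws) \<le> int (msg n G K t x u) - int K" using IHr[OF xc] by blast
        have "good_walk n G H V (v # u # x # ws)"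
          using ws uv xc ch[OF xc(1)] by (intro good_walk_Cons) (auto simp: insert_commute)
        moreover have "int m - int K \<le> walk_gain H (v # u # x # ws)"
          using ws(3) x(2) m vuH aK K2 by (simp add: sgn_edge_def)
        ultimately show ?thesis using ws(1) by (intro disjI1 exI[of _ "x # ws"]) auto
      next
        case uV: False
        show ?thesis
        proof (cases "a = 0")
          case True thus ?thesis using m by simp
        next
          case a0: False
          then obtain c where c: "c \<in> set (children n G u v)" "a = msg n G K t c u" using tp(4) by auto
          have cH: "{c, u} \<notin> H" using uV H by (auto simp: two_regular_def)
          show ?thesis
          proof (cases "msg n G K t c u \<le> t + 1")
            case True
            hence "m \<le> t + 2" using c m by linarith
            thus ?thesis by blast
          next
            case False
            then obtain ws where ws: "length ws = t" "good_walk n G H V (u # c # ws)"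
              "int (msg n G K t c u) - int K \<le> walk_gain H (u # c # ws)" using IHb[OF c(1) cH] by blast
            have "good_walk n G H V (v # u # c # ws)"
              using ws uv uV ch[OF c(1)] by (intro good_walk_Cons) auto
            moreover have "int m - int K \<le> walk_gain H (v # u # c # ws)"
              using ws(3) c m vuH by (simp add: sgn_edge_def)
            ultimately show ?thesis using ws(1) by (intro disjI1 exI[of _ "c # ws"]) auto
          qed
        qed
      qed
      thus ?thesis using False by (simp add: m_def del: msg.simps)
    qed
  qed
  note * = this
  show "({u, v} \<in> H \<longrightarrow> (\<exists>ws. length ws = t \<and> good_walk n G H V (v # u # ws) \<and>
            - walk_gain H (v # u # ws) \<le> int (msg n G K t u v) - int K))"
    using * by (rule conjunct1)
  show "({u, v} \<notin> H \<longrightarrow> (\<exists>ws. length ws = t \<and> good_walk n G H V (v # u # ws) \<and>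
            int (msg n G K t u v) - int K \<le> walk_gain H (v # u # ws)) \<or> msg n G K t u v \<le> t + 1)"
    using * by (rule conjunct2)
qed

lemma alt_walk_hd_neq: "alt_walk H V (y # x # ws) \<Longrightarrow> y \<noteq> x"
  by (cases ws) auto

text \<open>Both walks contain the middle edge, in opposite directions, so its sign is subtracted
  once. The induction shifts vertices from one walk to the other.\<close>

lemma good_walk_glue:
  assumes "good_walk n G H V (v # u # ws1)" "good_walk n G H V (u # v # ws2)"
  shows "good_walk n G H V (rev ws1 @ u # v # ws2)"
    "walk_gain H (rev ws1 @ u # v # ws2) =
      walk_gain H (v # u # ws1) + walk_gain H (u # v # ws2) - sgn_edge H {u, v}"
proof -
  have "good_walk n G H V (rev ws1 @ u # v # ws2) \<and> walk_gain H (rev ws1 @ u # v # ws2) =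
      walk_gain H (v # u # ws1) + walk_gain H (u # v # ws2) - sgn_edge H {u, v}"
    using assms
  proof (induction ws1 arbitrary: u v ws2)
    case Nil
    thus ?case by (simp add: insert_commute)
  next
    case (Cons x ws1)
    have g: "good_walk n G H V (u # x # ws1)" using Cons.prems by (auto simp: good_walk_def)
    have h: "good_walk n G H V (x # u # v # ws2)"
      using Cons.prems alt_walk_hd_neq[of H V u x ws1]
      by (intro good_walk_Cons) (auto simp: good_walk_def insert_commute)
    show ?case using Cons.IH[OF g h] by (auto simp: insert_commute)
  qed
  thus "good_walk n G H V (rev ws1 @ u # v # ws2)"
    "walk_gain H (rev ws1 @ u # v # ws2) =
      walk_gain H (v # u # ws1) + walk_gain H (u # v # ws2) - sgn_edge H {u, v}" by auto
qed

definition bad_walks :: "nat \<Rightarrow> nat set set \<Rightarrow> nat set set \<Rightarrow> nat set \<Rightarrow> nat \<Rightarrow> nat list set" where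
  "bad_walks n G H V l = {w. length w = l \<and> good_walk n G H V w \<and> 0 \<le> walk_gain H w}"

lemma finite_bad_walks: "finite (bad_walks n G H V l)"
proof (rule finite_subset)
  show "bad_walks n G H V l \<subseteq> {w. set w \<subseteq> {..<n} \<and> length w = l}"
    by (auto simp: bad_walks_def good_walk_def)
qed (rule finite_lists_length_eq, simp)

text \<open>A misclassified edge is the middle of a walk glued from the two walks that its messages
  vouch for, and the threshold in \<open>selected\<close> makes the gain of this walk nonnegative.
  Distinct edges need distinct walks, since the middle can be read off.\<close>

lemma selected_error:
  assumes G: "G \<subseteq> complete_graph n" and HG: "H \<subseteq> G" and H: "two_regular V H"
    and K: "2 * T + 2 \<le> K"
  shows "card (sym_diff H (selected n G K T)) \<le> card (bad_walks n G H V (2 * T + 2))"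
proof -
  have "sym_diff H (selected n G K T) \<subseteq> (\<lambda>w. {w ! T, w ! Suc T}) ` bad_walks n G H V (2 * T + 2)"
  proof
    fix e assume e: "e \<in> sym_diff H (selected n G K T)"
    hence "e \<in> G" using HG by (auto simp: selected_def)
    hence "e \<subseteq> {..<n}" "card e = 2" using G by (auto simp: complete_graph_def)
    then obtain u v where uv: "e = {u, v}" "u < v" "v < n"
      by (auto simp: card_2_iff) (metis insert_commute linorder_neqE_nat)
    have sel: "e \<in> selected n G K T \<longleftrightarrow> 2 * K + 1 < msg n G K T u v + msg n G K T v u"
      using uv \<open>e \<in> G\<close> by (auto simp: selected_def doubleton_eq_iff)
    have uvG: "{u, v} \<in> G" "{v, u} \<in> G" using \<open>e \<in> G\<close> uv by (auto simp: insert_commute)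
    note m1 = msg_bounds[OF G HG H order_refl K uvG(1)] and m2 = msg_bounds[OF G HG H order_refl K uvG(2)]
    have "\<exists>ws1 ws2. length ws1 = T \<and> length ws2 = T \<and> good_walk n G H V (v # u # ws1) \<and>
        good_walk n G H V (u # v # ws2) \<and>
        0 \<le> walk_gain H (v # u # ws1) + walk_gain H (u # v # ws2) - sgn_edge H {u, v}"
    proof (cases "e \<in> H")
      case True
      hence "{u, v} \<in> H" "{v, u} \<in> H" using uv by (auto simp: insert_commute)
      then obtain ws1 ws2 where w: "length ws1 = T" "length ws2 = T" "good_walk n G H V (v # u # ws1)"
          "good_walk n G H V (u # v # ws2)"
          "- walk_gain H (v # u # ws1) \<le> int (msg n G K T u v) - int K"
          "- walk_gain H (u # v # ws2) \<le> int (msg n G K T v u) - int K"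
        using m1(1) m2(1) by blast
      have "\<not> 2 * K + 1 < msg n G K T u v + msg n G K T v u" using e True sel by auto
      hence "0 \<le> walk_gain H (v # u # ws1) + walk_gain H (u # v # ws2) - sgn_edge H {u, v}"
        using w(5,6) \<open>{u, v} \<in> H\<close> by (simp add: sgn_edge_def)
      thus ?thesis using w by blast
    next
      case False
      hence nH: "{u, v} \<notin> H" "{v, u} \<notin> H" using uv by (auto simp: insert_commute)
      have s: "2 * K + 1 < msg n G K T u v + msg n G K T v u" using e False sel by auto
      have "\<not> msg n G K T u v \<le> T + 1" "\<not> msg n G K T v u \<le> T + 1"
        using s msg_le[of n G K T u v] msg_le[of n G K T v u] K by linarith+
      then obtain ws1 ws2 where w: "length ws1 = T" "length ws2 = T" "good_walk n G H V (v # u # ws1)"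
          "good_walk n G H V (u # v # ws2)"
          "int (msg n G K T u v) - int K \<le> walk_gain H (v # u # ws1)"
          "int (msg n G K T v u) - int K \<le> walk_gain H (u # v # ws2)"
        using m1(2) m2(2) nH by blast
      have "0 \<le> walk_gain H (v # u # ws1) + walk_gain H (u # v # ws2) - sgn_edge H {u, v}"
        using w(5,6) s nH by (simp add: sgn_edge_def)
      thus ?thesis using w by blast
    qed
    then obtain ws1 ws2 where w: "length ws1 = T" "length ws2 = T" "good_walk n G H V (v # u # ws1)"
        "good_walk n G H V (u # v # ws2)"
        "0 \<le> walk_gain H (v # u # ws1) + walk_gain H (u # v # ws2) - sgn_edge H {u, v}" by blast
    let ?w = "rev ws1 @ u # v # ws2"
    have "?w \<in> bad_walks n G H V (2 * T + 2)"
      using good_walk_glue[OF w(3,4)] w by (simp add: bad_walks_def)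
    moreover have "e = {?w ! T, ?w ! Suc T}" using uv w by (simp add: nth_append)
    ultimately show "e \<in> (\<lambda>w. {w ! T, w ! Suc T}) ` bad_walks n G H V (2 * T + 2)" by blast
  qed
  thus ?thesis by (rule surj_card_le[OF finite_bad_walks])
qed

subsection \<open>Counting alternating walks\<close>

definition blues :: "'a set set \<Rightarrow> 'a list \<Rightarrow> 'a set list" where
  "blues H w = filter (\<lambda>e. e \<notin> H) (walk_edges w)"

definition reds :: "'a set set \<Rightarrow> 'a list \<Rightarrow> 'a set list" where
  "reds H w = filter (\<lambda>e. e \<in> H) (walk_edges w)"

lemma blues_simps [simp]:
  "blues H (y # x # ws) = (if {y, x} \<in> H then blues H (x # ws) else {y, x} # blues H (x # ws))"
  "blues H [x] = []" "blues H [] = []"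
  by (simp_all add: blues_def)

lemma reds_simps [simp]:
  "reds H (y # x # ws) = (if {y, x} \<in> H then {y, x} # reds H (x # ws) else reds H (x # ws))"
  "reds H [x] = []" "reds H [] = []"
  by (simp_all add: reds_def)

lemma walk_gain_eq: "walk_gain H w = int (length (blues H w)) - int (length (reds H w))"
proof (induction w rule: walk_edges.induct)
  case (1 y x ws)
  thus ?case by (simp add: sgn_edge_def)
qed simp_all

lemma blues_endpoints: "{y, x} \<in> set (blues H w) \<Longrightarrow> y \<in> set w \<and> x \<in> set w"
proof (induction w rule: walk_edges.induct)
  case (1 b a ws)
  thus ?case by (auto split: if_splits simp: doubleton_eq_iff)
qed simp_all

definition alt_walks :: "nat \<Rightarrow> nat set set \<Rightarrow> nat set \<Rightarrow> nat \<Rightarrow> nat list set" where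
  "alt_walks n H V l = {w. length w = l \<and> alt_walk H V w \<and> set w \<subseteq> {..<n}}"

lemma finite_alt_walks: "finite (alt_walks n H V l)"
proof (rule finite_subset)
  show "alt_walks n H V l \<subseteq> {w. set w \<subseteq> {..<n} \<and> length w = l}"
    by (auto simp: alt_walks_def)
qed (rule finite_lists_length_eq, simp)

lemma alt_walk_tl: "alt_walk H V (y # x # ws) \<Longrightarrow> alt_walk H V (x # ws)"
  by (cases ws) auto

text \<open>Walks are extended at the front, where the condition on a new vertex involves only the
  first two vertices of the tail.\<close>

lemma sum_alt_walks_Suc:
  assumes "1 \<le> l"
  shows "(\<Sum>w\<in>alt_walks n H V (Suc l). f w) =
    (\<Sum>w\<in>alt_walks n H V l. \<Sum>y\<in>{y. y # w \<in> alt_walks n H V (Suc l)}. (f (y # w) :: real))"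
proof -
  let ?S = "SIGMA w:alt_walks n H V l. {y. y # w \<in> alt_walks n H V (Suc l)}"
  have fin: "finite {y. y # w \<in> alt_walks n H V (Suc l)}" for w
    by (rule finite_subset[of _ "{..<n}"]) (auto simp: alt_walks_def)
  have "bij_betw (\<lambda>(w, y). y # w) ?S (alt_walks n H V (Suc l))"
    unfolding bij_betw_def
  proof
    show "inj_on (\<lambda>(w, y). y # w) ?S" by (auto simp: inj_on_def)
    show "(\<lambda>(w, y). y # w) ` ?S = alt_walks n H V (Suc l)"
    proof
      show "alt_walks n H V (Suc l) \<subseteq> (\<lambda>(w, y). y # w) ` ?S"
      proof
        fix w assume w: "w \<in> alt_walks n H V (Suc l)"
        then obtain y x ws where "w = y # x # ws"
          using assms by (auto simp: alt_walks_def Suc_le_eq length_Suc_conv neq_Nil_conv)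
        thus "w \<in> (\<lambda>(w, y). y # w) ` ?S"
          using w alt_walk_tl by (force simp: alt_walks_def)
      qed
    qed auto
  qed
  hence "(\<Sum>w\<in>alt_walks n H V (Suc l). f w) = (\<Sum>(w, y)\<in>?S. f (y # w))"
    using sum.reindex_bij_betw[of "\<lambda>(w, y). y # w" ?S "alt_walks n H V (Suc l)" f]
    by (simp add: case_prod_unfold)
  also have "\<dots> = (\<Sum>w\<in>alt_walks n H V l. \<Sum>y\<in>{y. y # w \<in> alt_walks n H V (Suc l)}. f (y # w))"
    using fin finite_alt_walks by (subst sum.Sigma) auto
  finally show ?thesis .
qed

lemma nb_outside: "two_regular V H \<Longrightarrow> x \<notin> V \<Longrightarrow> nb H x = {}"
  by (auto simp: nb_def two_regular_def)

lemma card_nb_le: "two_regular V H \<Longrightarrow> finite (nb H x) \<and> card (nb H x) \<le> 2"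
proof (cases "x \<in> V")
  case True
  assume H: "two_regular V H"
  show ?thesis using two_regular_finite_nb[OF H True] H True by (simp add: two_regular_def)
next
  case False
  assume H: "two_regular V H"
  show ?thesis by (simp add: nb_outside[OF H False])
qed

definition walk_weight :: "'a set set \<Rightarrow> real \<Rightarrow> real \<Rightarrow> 'a list \<Rightarrow> real" where
  "walk_weight H q x w = q ^ length (blues H w) * x ^ length (reds H w)"

text \<open>A positive vector on the three states of the front of a walk. Under the hypotheses of
  \<open>sum_walk_weights\<close> it is a supersolution of the transfer matrix for the eigenvalue
  \<open>rho\<close>.\<close>

fun walk_pot :: "'a set set \<Rightarrow> 'a set \<Rightarrow> real \<Rightarrow> real \<Rightarrow> real \<Rightarrow> 'a list \<Rightarrow> real" where
  "walk_pot H V hR hB hN (y # x # ws) = (if {y, x} \<in> H then hR else if y \<in> V then hB else hN)"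
| "walk_pot H V hR hB hN _ = 1"

text \<open>\<open>c\<close> bounds the number of red continuations. The blue ones vanish if
  \<open>Y \<subseteq> nb H a\<close>, which is the situation where a red edge is forced.\<close>

lemma sum_weighted_neighbours:
  fixes q x hR hB hN :: real
  assumes H: "two_regular V H" and V: "V \<subseteq> {..<n}" and q: "0 \<le> q" and x: "0 \<le> x"
    and h: "0 \<le> hR" "0 \<le> hB" "0 \<le> hN"
    and aV: "q * real (card V) \<le> aV" and aN: "q * (real n - real (card V)) \<le> aN"
    and Y: "Y \<subseteq> {..<n}" and c: "real (card (Y \<inter> nb H a)) \<le> c"
  shows "(\<Sum>y\<in>Y. if {y, a} \<in> H then x * hR else if y \<in> V then q * hB else q * hN) \<le>
       c * x * hR + (if Y \<subseteq> nb H a then 0 else aV * hB + aN * hN)"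
proof -
  let ?f = "\<lambda>y. if {y, a} \<in> H then x * hR else if y \<in> V then q * hB else q * hN"
  have fY: "finite Y" using Y finite_subset by auto
  have nbH: "{y, a} \<in> H \<longleftrightarrow> y \<in> nb H a" for y by (simp add: nb_def insert_commute)
  have "(\<Sum>y\<in>Y. ?f y) = (\<Sum>y\<in>Y \<inter> nb H a. ?f y) + (\<Sum>y\<in>Y - nb H a. ?f y)"
    by (rule sum.Int_Diff[OF fY])
  also have "(\<Sum>y\<in>Y \<inter> nb H a. ?f y) = real (card (Y \<inter> nb H a)) * (x * hR)"
    using nbH by (simp add: sum.cong)
  also have "\<dots> \<le> c * x * hR" using c x h by (simp add: mult.assoc mult_right_mono)
  also have "(\<Sum>y\<in>Y - nb H a. ?f y) \<le> (if Y \<subseteq> nb H a then 0 else aV * hB + aN * hN)"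
  proof (cases "Y \<subseteq> nb H a")
    case True
    hence e: "Y - nb H a = {}" by auto
    show ?thesis unfolding e using True by simp
  next
    case False
    have "(\<Sum>y\<in>Y - nb H a. ?f y) = (\<Sum>y\<in>Y - nb H a. if y \<in> V then q * hB else q * hN)"
      by (rule sum.cong) (auto simp: nbH)
    also have "\<dots> \<le> (\<Sum>y\<in>{..<n}. if y \<in> V then q * hB else q * hN)"
      by (rule sum_mono2) (use Y q h in auto)
    also have "\<dots> = (q * real (card V)) * hB + (q * real (card ({..<n} - V))) * hN"
    proof -
      have "{..<n} \<inter> {y. y \<in> V} = V" "{..<n} \<inter> - {y. y \<in> V} = {..<n} - V" using V by auto
      thus ?thesis by (simp add: sum.If_cases)
    qed
    also have "real (card ({..<n} - V)) = real n - real (card V)"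
      using V by (simp add: card_Diff_subset finite_subset card_mono[of "{..<n}" V, simplified] of_nat_diff)
    also have "(q * real (card V)) * hB + (q * (real n - real (card V))) * hN \<le> aV * hB + aN * hN"
      using aV aN h by (intro add_mono mult_right_mono)
    finally show ?thesis using False by simp
  qed
  finally show ?thesis by simp
qed

lemma sum_walk_weights:
  fixes q x hR hB hN rho :: real
  assumes H: "two_regular V H" and V: "V \<subseteq> {..<n}" and q: "0 \<le> q" and x: "0 \<le> x"
    and h: "1 \<le> hR" "1 \<le> hB" "1 \<le> hN" and rho: "0 \<le> rho"
    and aV: "q * real (card V) \<le> aV" and aN: "q * (real n - real (card V)) \<le> aN"
    and R: "x * hR + (aV * hB + aN * hN) \<le> rho * hR"
    and B: "2 * x * hR \<le> rho * hB" and N: "aV * hB + aN * hN \<le> rho * hN"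
  shows "(\<Sum>w\<in>alt_walks n H V (l + 2). walk_weight H q x w) \<le>
     real n * (2 * x * hR + (aV * hB + aN * hN)) * rho ^ l"
proof -
  let ?S = "\<lambda>l. \<Sum>w\<in>alt_walks n H V l. walk_weight H q x w * walk_pot H V hR hB hN w"
  have h0: "0 \<le> hR" "0 \<le> hB" "0 \<le> hN" using h by auto
  have ww: "0 \<le> walk_weight H q x w" for w using q x by (simp add: walk_weight_def)
  have a0: "0 \<le> aV * hB + aN * hN"
  proof -
    have "card V \<le> n" using card_mono[OF _ V] by simp
    hence "0 \<le> q * real (card V)" "0 \<le> q * (real n - real (card V))" using q by simp_all
    hence "0 \<le> aV" "0 \<le> aN" using aV aN by linarith+
    thus ?thesis using h0 by simp
  qed
  have cons: "walk_weight H q x (y # a # ws) * walk_pot H V hR hB hN (y # a # ws)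
      = walk_weight H q x (a # ws) * (if {y, a} \<in> H then x * hR else if y \<in> V then q * hB else q * hN)"
    for y a ws by (simp add: walk_weight_def)
  have S2: "?S 2 \<le> real n * (2 * x * hR + (aV * hB + aN * hN))"
  proof -
    have "?S (Suc 1) = (\<Sum>w\<in>alt_walks n H V 1. \<Sum>y\<in>{y. y # w \<in> alt_walks n H V (Suc 1)}.
        walk_weight H q x (y # w) * walk_pot H V hR hB hN (y # w))"
      by (rule sum_alt_walks_Suc) simp
    also have "\<dots> \<le> (\<Sum>w\<in>alt_walks n H V 1. 2 * x * hR + (aV * hB + aN * hN))"
    proof (rule sum_mono)
      fix w assume "w \<in> alt_walks n H V 1"
      then obtain a where a: "w = [a]" by (auto simp: alt_walks_def length_Suc_conv)
      let ?Y = "{y. y # w \<in> alt_walks n H V (Suc 1)}"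
      have Y: "?Y \<subseteq> {..<n}" by (auto simp: alt_walks_def)
      have c: "real (card (?Y \<inter> nb H a)) \<le> 2"
      proof -
        have "card (?Y \<inter> nb H a) \<le> card (nb H a)" using card_nb_le[OF H] by (intro card_mono) auto
        thus ?thesis using card_nb_le[OF H, of a] by linarith
      qed
      have "(\<Sum>y\<in>?Y. walk_weight H q x (y # w) * walk_pot H V hR hB hN (y # w))
         = (\<Sum>y\<in>?Y. if {y, a} \<in> H then x * hR else if y \<in> V then q * hB else q * hN)"
        unfolding a cons by (simp add: walk_weight_def)
      also have "\<dots> \<le> 2 * x * hR + (if ?Y \<subseteq> nb H a then 0 else aV * hB + aN * hN)"
        by (rule sum_weighted_neighbours[OF H V q x h0 aV aN Y c])
      also have "\<dots> \<le> 2 * x * hR + (aV * hB + aN * hN)" using a0 by simp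
      finally show "(\<Sum>y\<in>?Y. walk_weight H q x (y # w) * walk_pot H V hR hB hN (y # w))
         \<le> 2 * x * hR + (aV * hB + aN * hN)" .
    qed
    also have "\<dots> = real (card (alt_walks n H V 1)) * (2 * x * hR + (aV * hB + aN * hN))" by simp
    also have "card (alt_walks n H V 1) \<le> card {w. set w \<subseteq> {..<n} \<and> length w = 1}"
      by (rule card_mono) (auto simp: alt_walks_def intro: finite_lists_length_eq)
    hence "real (card (alt_walks n H V 1)) * (2 * x * hR + (aV * hB + aN * hN)) \<le>
        real n * (2 * x * hR + (aV * hB + aN * hN))"
      using a0 x h0 card_lists_length_eq[of "{..<n}" 1] by (intro mult_right_mono) auto
    finally show ?thesis by (simp add: numeral_2_eq_2)
  qed
  have SS: "?S (Suc l) \<le> rho * ?S l" if l: "2 \<le> l" for l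
  proof -
    have "?S (Suc l) = (\<Sum>w\<in>alt_walks n H V l. \<Sum>y\<in>{y. y # w \<in> alt_walks n H V (Suc l)}.
        walk_weight H q x (y # w) * walk_pot H V hR hB hN (y # w))"
      by (rule sum_alt_walks_Suc) (use l in simp)
    also have "\<dots> \<le> (\<Sum>w\<in>alt_walks n H V l. rho * (walk_weight H q x w * walk_pot H V hR hB hN w))"
    proof (rule sum_mono)
      fix w assume w: "w \<in> alt_walks n H V l"
      then obtain a z ws where a: "w = a # z # ws" using l
        by (cases w rule: walk_edges.cases) (auto simp: alt_walks_def)
      let ?Y = "{y. y # w \<in> alt_walks n H V (Suc l)}"
      have Y: "?Y \<subseteq> {..<n}" by (auto simp: alt_walks_def)
      have Y': "y \<noteq> a \<and> y \<noteq> z \<and> (a \<in> V \<longrightarrow> {y, a} \<in> H \<or> {a, z} \<in> H)" if "y \<in> ?Y" for y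
        using that a by (auto simp: alt_walks_def)
      have eq: "(\<Sum>y\<in>?Y. walk_weight H q x (y # w) * walk_pot H V hR hB hN (y # w))
         = walk_weight H q x w * (\<Sum>y\<in>?Y. if {y, a} \<in> H then x * hR else if y \<in> V then q * hB else q * hN)"
        unfolding a cons sum_distrib_left ..
      note sw = sum_weighted_neighbours[OF H V q x h0 aV aN Y]
      have "(\<Sum>y\<in>?Y. if {y, a} \<in> H then x * hR else if y \<in> V then q * hB else q * hN)
          \<le> rho * walk_pot H V hR hB hN w"
      proof -
        consider "{a, z} \<in> H" | "{a, z} \<notin> H" "a \<in> V" | "{a, z} \<notin> H" "a \<notin> V" by blast
        thus ?thesis
        proof cases
          case 1
          have aV': "a \<in> V" using 1 H by (auto simp: two_regular_def)
          have "?Y \<inter> nb H a \<subseteq> nb H a - {z}" using Y' by auto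
          hence "card (?Y \<inter> nb H a) \<le> card (nb H a - {z})" using card_nb_le[OF H] by (intro card_mono) auto
          also have "\<dots> = 1" using 1 H aV' two_regular_finite_nb[OF H aV'] by (simp add: nb_def two_regular_def)
          finally have "real (card (?Y \<inter> nb H a)) \<le> 1" by simp
          from sw[OF this] have "(\<Sum>y\<in>?Y. if {y, a} \<in> H then x * hR else if y \<in> V then q * hB else q * hN)
             \<le> x * hR + (aV * hB + aN * hN)" using a0 by (auto split: if_splits)
          thus ?thesis using R 1 a by simp
        next
          case 2
          have "?Y \<subseteq> nb H a" using Y' 2 by (auto simp: nb_def insert_commute)
          moreover have "real (card (?Y \<inter> nb H a)) \<le> 2"
          proof -
            have "card (?Y \<inter> nb H a) \<le> card (nb H a)" using card_nb_le[OF H] by (intro card_mono) auto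
            thus ?thesis using card_nb_le[OF H, of a] by linarith
          qed
          ultimately have "(\<Sum>y\<in>?Y. if {y, a} \<in> H then x * hR else if y \<in> V then q * hB else q * hN)
             \<le> 2 * x * hR" using sw[of a 2] by simp
          thus ?thesis using B 2 a by simp
        next
          case 3
          have "real (card (?Y \<inter> nb H a)) \<le> 0" using nb_outside[OF H 3(2)] by simp
          from sw[OF this] have "(\<Sum>y\<in>?Y. if {y, a} \<in> H then x * hR else if y \<in> V then q * hB else q * hN)
             \<le> aV * hB + aN * hN" using a0 by (auto split: if_splits)
          thus ?thesis using N 3 a by simp
        qed
      qed
      from mult_left_mono[OF this ww[of w]]
      show "(\<Sum>y\<in>?Y. walk_weight H q x (y # w) * walk_pot H V hR hB hN (y # w))
         \<le> rho * (walk_weight H q x w * walk_pot H V hR hB hN w)"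
        unfolding eq by (simp add: mult_ac)
    qed
    finally show ?thesis by (simp add: sum_distrib_left)
  qed
  have "?S (l + 2) \<le> real n * (2 * x * hR + (aV * hB + aN * hN)) * rho ^ l"
  proof (induction l)
    case 0
    show ?case using S2 by (simp only: add_0 power_0 mult_1_right)
  next
    case (Suc l)
    have "?S (Suc l + 2) \<le> rho * ?S (l + 2)" using SS[of "l + 2"] by simp
    also have "\<dots> \<le> rho * (real n * (2 * x * hR + (aV * hB + aN * hN)) * rho ^ l)"
      using Suc rho by (intro mult_left_mono)
    finally show ?case by (simp add: mult_ac)
  qed
  moreover have "(\<Sum>w\<in>alt_walks n H V (l + 2). walk_weight H q x w) \<le> ?S (l + 2)"
  proof (rule sum_mono)
    fix w assume "w \<in> alt_walks n H V (l + 2)"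
    then obtain a b ws where "w = a # b # ws" by (auto simp: alt_walks_def length_Suc_conv)
    hence "1 \<le> walk_pot H V hR hB hN w" using h by simp
    thus "walk_weight H q x w \<le> walk_weight H q x w * walk_pot H V hR hB hN w"
      using ww[of w] by (metis mult.right_neutral mult_left_mono)
  qed
  ultimately show ?thesis by linarith
qed

subsection \<open>Walks that repeat an edge outside the 2-factor\<close>

primrec reach :: "'a set set \<Rightarrow> nat \<Rightarrow> 'a \<Rightarrow> 'a set" where
  "reach H 0 z = {z}"
| "reach H (Suc r) z = reach H r z \<union> (\<Union>y\<in>reach H r z. nb H y)"

lemma card_reach:
  assumes H: "two_regular V H"
  shows "finite (reach H r z) \<and> card (reach H r z) \<le> 3 ^ r"
proof (induction r)
  case (Suc r)
  have f: "finite (\<Union>y\<in>reach H r z. nb H y)" using Suc card_nb_le[OF H] by auto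
  have "card (\<Union>y\<in>reach H r z. nb H y) \<le> (\<Sum>y\<in>reach H r z. card (nb H y))"
    using Suc by (intro card_UN_le) auto
  also have "\<dots> \<le> (\<Sum>y\<in>reach H r z. 2)" using card_nb_le[OF H] by (intro sum_mono) auto
  finally have "card (\<Union>y\<in>reach H r z. nb H y) \<le> 2 * 3 ^ r" using Suc by simp
  moreover have "card (reach H (Suc r) z) \<le> card (reach H r z) + card (\<Union>y\<in>reach H r z. nb H y)"
    by (simp add: card_Un_le)
  ultimately show ?case using Suc f by simp
qed simp

lemma reach_mono: "r \<le> s \<Longrightarrow> reach H r z \<subseteq> reach H s z"
  by (induction s) (auto simp: le_Suc_eq)

lemma path_in_reach:
  assumes "path_in H rs" "rs \<noteq> []" "length rs \<le> Suc r"
  shows "last rs \<in> reach H r (hd rs)"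
  using assms
proof (induction rs arbitrary: r rule: rev_induct)
  case (snoc y rs)
  show ?case
  proof (cases "rs = []")
    case True
    have "y \<in> reach H 0 y" by simp
    thus ?thesis using True reach_mono[of 0 r H y] by auto
  next
    case False
    then obtain r' where r: "r = Suc r'" using snoc.prems by (cases r) auto
    have p: "path_in H rs" using snoc.prems(1) unfolding path_in_def
    proof (intro allI impI)
      fix i assume a: "\<forall>i. Suc i < length (rs @ [y]) \<longrightarrow> {(rs @ [y]) ! i, (rs @ [y]) ! Suc i} \<in> H" "Suc i < length rs"
      thus "{rs ! i, rs ! Suc i} \<in> H" using a(1)[rule_format, of i] by (simp add: nth_append)
    qed
    have "Suc (length rs - 1) < length (rs @ [y])" using False by simp
    hence "{(rs @ [y]) ! (length rs - 1), (rs @ [y]) ! Suc (length rs - 1)} \<in> H"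
      using snoc.prems(1) unfolding path_in_def by blast
    hence "{last rs, y} \<in> H" using False by (simp add: nth_append last_conv_nth)
    moreover have "last rs \<in> reach H r' (hd rs)" using snoc.IH[OF p False, of r'] snoc.prems r by simp
    ultimately show ?thesis using False r by (auto simp: nb_def)
  qed
qed simp

text \<open>The places at which a walk may meet its own past: within \<open>L\<close> red steps of
  it, or on a short red cycle, where a red run returns to itself.\<close>

definition near :: "'a set set \<Rightarrow> nat \<Rightarrow> 'a list \<Rightarrow> 'a set" where
  "near H L ws = (\<Union>z\<in>set ws. reach H L z) \<union> short_verts H L"

fun coincidence :: "'a set set \<Rightarrow> nat \<Rightarrow> 'a list \<Rightarrow> bool" where
  "coincidence H L (y # x # ws) = (coincidence H L (x # ws) \<or>
     ({y, x} \<notin> H \<and> {y, x} \<notin> set (blues H (x # ws)) \<and> y \<in> near H L (x # ws)))"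
| "coincidence H L _ = False"

text \<open>Splits a walk at its foremost blue edge; up to there it is a non-backtracking red
  run.\<close>

lemma blue_trace:
  assumes "alt_walk H V w" "blues H w \<noteq> []"
  shows "\<exists>rs q rest. w = rs @ q # rest \<and> rs \<noteq> [] \<and> nb_walk H rs \<and> {last rs, q} \<notin> H
     \<and> blues H w = {last rs, q} # blues H (q # rest)"
  using assms
proof (induction w rule: walk_edges.induct)
  case (1 y x ws)
  show ?case
  proof (cases "{y, x} \<in> H")
    case False
    thus ?thesis by (intro exI[of _ "[y]"] exI[of _ x] exI[of _ ws]) (auto simp: nb_walk_def path_in_def)
  next
    case True
    have "alt_walk H V (x # ws)" "blues H (x # ws) \<noteq> []" using 1 True by (auto dest: alt_walk_tl)
    then obtain rs q rest where r: "x # ws = rs @ q # rest" "rs \<noteq> []" "nb_walk H rs" "{last rs, q} \<notin> H"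
       "blues H (x # ws) = {last rs, q} # blues H (q # rest)" using 1 by blast
    obtain rs' where rs: "rs = x # rs'" using r(1,2) by (cases rs) auto
    have "nb_walk H (y # rs)" unfolding nb_walk_def path_in_def
    proof (intro conjI allI impI)
      fix i assume "Suc i < length (y # rs)"
      thus "{(y # rs) ! i, (y # rs) ! Suc i} \<in> H"
        using r(3) True rs by (cases i) (auto simp: nb_walk_def path_in_def)
    next
      fix i assume i: "Suc (Suc i) < length (y # rs)"
      show "(y # rs) ! i \<noteq> (y # rs) ! Suc (Suc i)"
      proof (cases i)
        case 0
        then obtain z rs'' where "rs' = z # rs''" using i rs by (cases rs') auto
        thus ?thesis using 0 1(2) r(1) rs by auto
      next
        case (Suc j) thus ?thesis using r(3) i by (auto simp: nb_walk_def)
      qed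
    qed
    thus ?thesis using r True rs by (intro exI[of _ "y # rs"] exI[of _ q] exI[of _ rest]) auto
  qed
qed simp_all

lemma coincidence_append:
  "coincidence H L ws \<Longrightarrow> coincidence H L (rs @ ws)"
proof (induction rs)
  case (Cons a rs)
  obtain b bs where "rs @ ws = b # bs" using Cons.prems by (cases "rs @ ws") auto
  thus ?case using Cons by auto
qed simp

text \<open>Suppose \<open>{y, x}\<close> occurs again behind \<open>x\<close>, and follow the red
  run \<open>rs\<close> from \<open>x\<close> up to the next blue edge \<open>{last rs, q}\<close>.
  If \<open>x\<close> occurs behind that edge, the run connects \<open>last rs\<close> to the past,
  and the edge is a coincidence. Otherwise the edge is the repeated one itself; then the red run
  starts and ends at \<open>x\<close>, not trivially since the walk does not backtrack, and so lies
  on a short cycle.\<close>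

lemma repeated_blue_coincidence:
  assumes H: "two_regular V H"
  shows "alt_walk H V w \<Longrightarrow> length w \<le> Suc L \<Longrightarrow> \<not> distinct (blues H w) \<Longrightarrow> coincidence H L w"
proof (induction w rule: walk_edges.induct)
  case (1 y x ws)
  show ?case
  proof (cases "distinct (blues H (x # ws))")
    case False
    thus ?thesis using 1 alt_walk_tl by fastforce
  next
    case True
    hence yx: "{y, x} \<notin> H" "{y, x} \<in> set (blues H (x # ws))"
      using 1(4) by (auto split: if_splits)
    have aw: "alt_walk H V (x # ws)" using 1(2) by (rule alt_walk_tl)
    have "blues H (x # ws) \<noteq> []" using yx(2) by auto
    then obtain rs q rest where r: "x # ws = rs @ q # rest" "rs \<noteq> []" "nb_walk H rs" "{last rs, q} \<notin> H"
       "blues H (x # ws) = {last rs, q} # blues H (q # rest)" using blue_trace[OF aw] by blast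
    have hd: "hd rs = x" using r(1,2) by (cases rs) auto
    have len: "length rs \<le> Suc L"
    proof -
      have "length (x # ws) = length rs + Suc (length rest)" unfolding r(1) by simp
      thus ?thesis using 1(3) by simp
    qed
    have "last rs \<in> near H L (q # rest)"
    proof (cases "x \<in> set (q # rest)")
      case True
      have "last rs \<in> reach H L x" using path_in_reach[of H rs L] r len hd by (auto simp: nb_walk_def)
      thus ?thesis using True by (auto simp: near_def)
    next
      case False
      hence "{y, x} \<notin> set (blues H (q # rest))" using blues_endpoints by fastforce
      hence "{y, x} = {last rs, q}" using yx r(5) by auto
      hence eq: "x = last rs" "y = q" using False by (auto simp: doubleton_eq_iff)
      \<comment> \<open>A run of a single vertex would make the walk go from \<open>y\<close> to
        \<open>x\<close> and straight back.\<close>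
      have "length rs \<noteq> 1"
      proof
        assume "length rs = 1"
        hence "rs = [x]" using hd by (cases rs) auto
        hence "ws = q # rest" using r(1) by simp
        thus False using 1(2) eq by simp
      qed
      hence "2 \<le> length rs" using r(2) by (cases rs) (auto simp: Suc_le_eq)
      hence nd: "\<not> distinct rs" using hd eq(1)
        by (cases rs) (auto split: if_splits)
      have "last rs \<in> short_verts H L"
      proof (rule ccontr)
        assume a: "last rs \<notin> short_verts H L"
        have "distinct rs"
          by (rule nb_walk_distinct[OF H r(3) len, of "length rs - 1"])
            (use a r(2) in \<open>auto simp: last_conv_nth\<close>)
        thus False using nd by simp
      qed
      thus ?thesis by (simp add: near_def)
    qed
    moreover have "{last rs, q} \<notin> set (blues H (q # rest))" using True r(5) by simp
    ultimately have "coincidence H L (last rs # q # rest)" using r(4) by simp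
    hence "coincidence H L (butlast rs @ last rs # q # rest)" by (rule coincidence_append)
    moreover have "butlast rs @ last rs # q # rest = x # ws" using r(1,2)
      by (metis append.assoc append_Cons append_Nil append_butlast_last_id)
    ultimately show ?thesis by simp
  qed
qed simp_all

lemma card_near:
  assumes H: "two_regular V H" and V: "finite V"
  shows "finite (near H L ws) \<and> card (near H L ws) \<le> length ws * 3 ^ L + card (short_verts H L)"
proof -
  have fs: "finite (short_verts H L)" using short_verts_subset[OF H] V finite_subset by blast
  have "card (\<Union>z\<in>set ws. reach H L z) \<le> (\<Sum>z\<in>set ws. card (reach H L z))"
    by (rule card_UN_le) simp
  also have "\<dots> \<le> (\<Sum>z\<in>set ws. 3 ^ L)" using card_reach[OF H] by (intro sum_mono) auto
  also have "\<dots> \<le> length ws * 3 ^ L" by (simp add: card_length)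
  finally have "card (\<Union>z\<in>set ws. reach H L z) \<le> length ws * 3 ^ L" .
  moreover have "card (near H L ws) \<le> card (\<Union>z\<in>set ws. reach H L z) + card (short_verts H L)"
    unfolding near_def by (rule card_Un_le)
  ultimately show ?thesis using fs card_reach[OF H] by (auto simp: near_def)
qed

text \<open>Probability that all blue edges of the walk are present; a repeated edge is paid for
  once.\<close>

definition blue_prob :: "'a set set \<Rightarrow> real \<Rightarrow> 'a list \<Rightarrow> real" where
  "blue_prob H p w = p ^ card (set (blues H w))"

text \<open>An extension costs at most the factor \<open>K\<close>: 2 for red edges,
  \<open>L\<close> for returns to visited vertices, which need not bring a new factor
  \<open>p\<close>, and \<mu> for fresh vertices. At a coincidence the cost is \<open>p * B\<close>
  instead, and \<open>p * real n \<le> \<mu>\<close> uses up the factor \<open>n\<close> of the free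
  end point. So walks with a coincidence are few compared with \<open>n\<close>.\<close>

lemma sum_coincidences:
  fixes p :: real
  assumes H: "two_regular V H" and V: "V \<subseteq> {..<n}" and p: "0 \<le> p" "p \<le> 1" "p * real n \<le> \<mu>"
    and l: "l \<le> L"
  defines "K \<equiv> 2 + \<mu> + real L"
    and "B \<equiv> real (Suc L) * 3 ^ L + real (card (short_verts H L))"
  shows "(\<Sum>w\<in>alt_walks n H V (Suc l). blue_prob H p w) \<le> real n * K ^ l"
    "(\<Sum>w\<in>alt_walks n H V (Suc l). if coincidence H L w then blue_prob H p w else 0)
       \<le> real l * K ^ l * (\<mu> * B)"
proof -
  have \<mu>: "0 \<le> \<mu>" using p by (meson mult_nonneg_nonneg of_nat_0_le_iff order_trans)
  have K1: "1 \<le> K" using \<mu> by (simp add: K_def)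
  have fV: "finite V" using V finite_subset by auto
  have B0: "0 \<le> B" by (simp add: B_def)
  have bp: "0 \<le> blue_prob H p w" for w using p by (simp add: blue_prob_def)
  have fin: "finite {y. y # w \<in> alt_walks n H V (Suc l)}" for w l
    by (rule finite_subset[of _ "{..<n}"]) (auto simp: alt_walks_def)
  have step: "(\<Sum>y\<in>{y. y # w \<in> alt_walks n H V (Suc (Suc l))}. blue_prob H p (y # w)) \<le> K * blue_prob H p w"
    if w: "w \<in> alt_walks n H V (Suc l)" and l: "Suc l \<le> L" for w l
  proof -
    let ?Y = "{y. y # w \<in> alt_walks n H V (Suc (Suc l))}"
    obtain a ws where a: "w = a # ws" using w by (cases w) (auto simp: alt_walks_def)
    have lw: "length w = Suc l" using w by (simp add: alt_walks_def)
    \<comment> \<open>Red neighbours, visited vertices and fresh vertices; only the last kind is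
      certain to bring a new blue edge.\<close>
    define Y1 where "Y1 = ?Y \<inter> nb H a"
    define Y2 where "Y2 = (?Y - nb H a) \<inter> set w"
    define Y3 where "Y3 = ?Y - nb H a - set w"
    have Y: "?Y = Y1 \<union> Y2 \<union> Y3" "Y1 \<inter> Y2 = {}" "(Y1 \<union> Y2) \<inter> Y3 = {}" "finite Y1" "finite Y2" "finite Y3"
      using fin by (auto simp: Y1_def Y2_def Y3_def)
    have bl: "blue_prob H p (y # w) \<le> blue_prob H p w" for y
    proof -
      have "card (set (blues H w)) \<le> card (set (blues H (y # w)))"
        using a by (intro card_mono) auto
      thus ?thesis unfolding blue_prob_def using p(1,2) by (rule power_decreasing)
    qed
    have new: "blue_prob H p (y # w) = p * blue_prob H p w" if "y \<in> Y3" for y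
    proof -
      have "{y, a} \<notin> H" "y \<notin> set w" using that by (auto simp: Y3_def nb_def insert_commute)
      moreover have "{y, a} \<notin> set (blues H w)" using \<open>y \<notin> set w\<close> blues_endpoints by fastforce
      ultimately show ?thesis using a by (simp add: blue_prob_def)
    qed
    have "card Y1 \<le> 2"
      using card_nb_le[OF H, of a] by (auto simp: Y1_def intro: order_trans[OF card_mono])
    moreover have "card Y2 \<le> Suc l"
    proof -
      have "card Y2 \<le> card (set w)" by (rule card_mono) (auto simp: Y2_def)
      thus ?thesis using card_length[of w] lw by simp
    qed
    moreover have "card Y3 \<le> n"
    proof -
      have "card Y3 \<le> card {..<n}" by (rule card_mono) (auto simp: Y3_def alt_walks_def)
      thus ?thesis by simp
    qed
    ultimately have c: "real (card Y1) \<le> 2" "real (card Y2) \<le> real L" "real (card Y3) \<le> real n"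
      using l by auto
    have "(\<Sum>y\<in>?Y. blue_prob H p (y # w)) = (\<Sum>y\<in>Y1. blue_prob H p (y # w)) + (\<Sum>y\<in>Y2. blue_prob H p (y # w)) + (\<Sum>y\<in>Y3. blue_prob H p (y # w))"
      unfolding Y(1) using Y by (simp add: sum.union_disjoint)
    also have "\<dots> \<le> (\<Sum>y\<in>Y1. blue_prob H p w) + (\<Sum>y\<in>Y2. blue_prob H p w) + (\<Sum>y\<in>Y3. p * blue_prob H p w)"
      by (intro add_mono sum_mono bl) (simp add: new)
    also have "\<dots> = (real (card Y1) + real (card Y2) + p * real (card Y3)) * blue_prob H p w"
      by (simp add: algebra_simps)
    also have "\<dots> \<le> (2 + real L + p * real n) * blue_prob H p w"
      using c p bp by (intro mult_right_mono add_mono mult_left_mono) auto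
    also have "\<dots> \<le> K * blue_prob H p w"
      using p bp by (intro mult_right_mono) (auto simp: K_def)
    finally show ?thesis .
  qed
  have Y1: "(\<Sum>w\<in>alt_walks n H V (Suc 0). blue_prob H p w) \<le> real n"
  proof -
    have "(\<Sum>w\<in>alt_walks n H V (Suc 0). blue_prob H p w) = real (card (alt_walks n H V (Suc 0)))"
    proof -
      have "blue_prob H p w = 1" if "w \<in> alt_walks n H V (Suc 0)" for w
        using that by (auto simp: alt_walks_def length_Suc_conv blue_prob_def)
      thus ?thesis by simp
    qed
    also have "card (alt_walks n H V (Suc 0)) \<le> card {w. set w \<subseteq> {..<n} \<and> length w = Suc 0}"
      by (rule card_mono) (auto simp: alt_walks_def intro: finite_lists_length_eq)
    hence "real (card (alt_walks n H V (Suc 0))) \<le> real n"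
      using card_lists_length_eq[of "{..<n}" "Suc 0"] by simp
    finally show ?thesis .
  qed
  have YY: "l \<le> L \<Longrightarrow> (\<Sum>w\<in>alt_walks n H V (Suc l). blue_prob H p w) \<le> real n * K ^ l" for l
  proof (induction l)
    case 0 thus ?case using Y1 by simp
  next
    case (Suc l)
    have "(\<Sum>w\<in>alt_walks n H V (Suc (Suc l)). blue_prob H p w) =
       (\<Sum>w\<in>alt_walks n H V (Suc l). \<Sum>y\<in>{y. y # w \<in> alt_walks n H V (Suc (Suc l))}. blue_prob H p (y # w))"
      by (rule sum_alt_walks_Suc) simp
    also have "\<dots> \<le> (\<Sum>w\<in>alt_walks n H V (Suc l). K * blue_prob H p w)"
      by (intro sum_mono step) (use Suc in auto)
    also have "\<dots> = K * (\<Sum>w\<in>alt_walks n H V (Suc l). blue_prob H p w)" by (simp add: sum_distrib_left)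
    also have "\<dots> \<le> K * (real n * K ^ l)" using Suc K1 by (intro mult_left_mono) auto
    finally show ?case by (simp add: mult_ac)
  qed
  thus "(\<Sum>w\<in>alt_walks n H V (Suc l). blue_prob H p w) \<le> real n * K ^ l" using l by blast
  let ?C = "\<lambda>w. if coincidence H L w then blue_prob H p w else 0"
  have "l \<le> L \<Longrightarrow> (\<Sum>w\<in>alt_walks n H V (Suc l). ?C w) \<le> real l * K ^ l * (\<mu> * B)" for l
  proof (induction l)
    case 0
    have "?C w = 0" if "w \<in> alt_walks n H V (Suc 0)" for w
      using that by (auto simp: alt_walks_def length_Suc_conv)
    thus ?case by simp
  next
    case (Suc l)
    have "(\<Sum>w\<in>alt_walks n H V (Suc (Suc l)). ?C w) =
       (\<Sum>w\<in>alt_walks n H V (Suc l). \<Sum>y\<in>{y. y # w \<in> alt_walks n H V (Suc (Suc l))}. ?C (y # w))"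
      by (rule sum_alt_walks_Suc) simp
    also have "\<dots> \<le> (\<Sum>w\<in>alt_walks n H V (Suc l). K * ?C w + (p * B) * blue_prob H p w)"
    proof (rule sum_mono)
      fix w assume w: "w \<in> alt_walks n H V (Suc l)"
      let ?Y = "{y. y # w \<in> alt_walks n H V (Suc (Suc l))}"
      obtain a ws where a: "w = a # ws" using w by (cases w) (auto simp: alt_walks_def)
      have lw: "length w = Suc l" using w by (simp add: alt_walks_def)
      show "(\<Sum>y\<in>?Y. ?C (y # w)) \<le> K * ?C w + (p * B) * blue_prob H p w"
      proof (cases "coincidence H L w")
        case True
        hence "(\<Sum>y\<in>?Y. ?C (y # w)) = (\<Sum>y\<in>?Y. blue_prob H p (y # w))" using a by simp
        also have "\<dots> \<le> K * blue_prob H p w" by (rule step[OF w]) (use Suc in simp)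
        finally show ?thesis using True p B0 bp[of w] by (simp add: add_increasing2)
      next
        case False
        have "(\<Sum>y\<in>?Y. ?C (y # w)) \<le> (\<Sum>y\<in>?Y. if y \<in> near H L w then p * blue_prob H p w else 0)"
        proof (rule sum_mono)
          fix y
          show "?C (y # w) \<le> (if y \<in> near H L w then p * blue_prob H p w else 0)"
            using False a p bp[of w] by (auto simp: blue_prob_def)
        qed
        also have "\<dots> \<le> (\<Sum>y\<in>near H L w. p * blue_prob H p w)"
        proof -
          have "(\<Sum>y\<in>?Y. if y \<in> near H L w then p * blue_prob H p w else 0)
             = (\<Sum>y\<in>?Y \<inter> near H L w. p * blue_prob H p w)"
            using fin by (simp add: sum.If_cases Int_def)
          also have "\<dots> \<le> (\<Sum>y\<in>near H L w. p * blue_prob H p w)"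
            by (rule sum_mono2) (use card_near[OF H fV] p bp[of w] in auto)
          finally show ?thesis .
        qed
        also have "\<dots> = real (card (near H L w)) * (p * blue_prob H p w)" by simp
        also have "\<dots> \<le> B * (p * blue_prob H p w)"
        proof (rule mult_right_mono)
          have "card (near H L w) \<le> Suc L * 3 ^ L + card (short_verts H L)"
          proof -
            have "length w * 3 ^ L \<le> Suc L * 3 ^ L" using lw Suc.prems by (intro mult_le_mono1) auto
            thus ?thesis using card_near[OF H fV, of L w] by linarith
          qed
          hence "real (card (near H L w)) \<le> real (Suc L * 3 ^ L + card (short_verts H L))" by (rule of_nat_mono)
          thus "real (card (near H L w)) \<le> B" by (simp add: B_def algebra_simps)
        qed (use p bp[of w] in auto)
        finally show ?thesis using False by (simp add: mult_ac)
      qed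
    qed
    also have "\<dots> = K * (\<Sum>w\<in>alt_walks n H V (Suc l). ?C w) + (p * B) * (\<Sum>w\<in>alt_walks n H V (Suc l). blue_prob H p w)"
      by (simp add: sum.distrib sum_distrib_left)
    also have "\<dots> \<le> K * (real l * K ^ l * (\<mu> * B)) + (p * B) * (real n * K ^ l)"
      using Suc YY[of l] K1 p B0 by (intro add_mono mult_left_mono) auto
    \<comment> \<open>The probability of the coincident edge absorbs the number of end
      points.\<close>
    also have "(p * B) * (real n * K ^ l) = (p * real n) * (B * K ^ l)" by simp
    also have "\<dots> \<le> \<mu> * (B * K ^ l)" using p B0 K1 by (intro mult_right_mono) auto
    also have "\<dots> \<le> \<mu> * (B * K ^ Suc l)"
      using K1 \<mu> B0 by (intro mult_left_mono power_increasing) auto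
    finally show ?case by (simp add: algebra_simps)
  qed
  thus "(\<Sum>w\<in>alt_walks n H V (Suc l). ?C w) \<le> real l * K ^ l * (\<mu> * B)" using l by blast
qed

section \<open>Expectation over the blue edges\<close>

lemma good_walk_iff_blues:
  assumes "alt_walk H V w" "set w \<subseteq> {..<n}"
  shows "good_walk n (G0 \<union> H) H V w \<longleftrightarrow> set (blues H w) \<subseteq> G0"
  using assms by (auto simp: good_walk_def blues_def)

lemma blues_complete:
  assumes "alt_walk H V w" "set w \<subseteq> {..<n}"
  shows "set (blues H w) \<subseteq> complete_graph n"
  using assms
proof (induction w rule: walk_edges.induct)
  case (1 y x ws)
  have "y \<noteq> x" using 1(2) by (rule alt_walk_hd_neq)
  moreover have "alt_walk H V (x # ws)" using 1(2) by (rule alt_walk_tl)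
  ultimately show ?case using 1 by (auto simp: complete_graph_def)
qed simp_all

text \<open>A walk with distinct blue edges, at least as many as red ones, has probability p^blue =
  (p / x)^blue x^blue, which is at most its tilted weight because \<open>x \<le> 1\<close>. A walk
  with a repeated blue edge contains a coincidence.\<close>

lemma expected_bad_walks:
  fixes p :: real
  assumes H: "two_regular V H" and V: "V \<subseteq> {..<n}" and p: "0 \<le> p" "p \<le> 1" "p * real n \<le> \<mu>"
    and x: "0 < x" "x \<le> 1"
    and h: "1 \<le> hR" "1 \<le> hB" "1 \<le> hN" and rho: "0 \<le> rho"
    and aV: "p / x * real (card V) \<le> aV" and aN: "p / x * (real n - real (card V)) \<le> aN"
    and R: "x * hR + (aV * hB + aN * hN) \<le> rho * hR"
    and B: "2 * x * hR \<le> rho * hB" and N: "aV * hB + aN * hN \<le> rho * hN"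
    and L: "1 \<le> L"
  shows "measure_pmf.expectation (random_subset (complete_graph n) p)
      (\<lambda>G0. real (card (bad_walks n (G0 \<union> H) H V (Suc L)))) \<le>
     real n * (2 * x * hR + (aV * hB + aN * hN)) * rho ^ (L - 1) +
     real L * (2 + \<mu> + real L) ^ L * (\<mu> * (real (Suc L) * 3 ^ L + real (card (short_verts H L))))"
proof -
  let ?M = "random_subset (complete_graph n) p"
  let ?W = "{w \<in> alt_walks n H V (Suc L). 0 \<le> walk_gain H w}"
  have fW: "finite ?W" using finite_alt_walks by auto
  have card_eq: "real (card (bad_walks n (G0 \<union> H) H V (Suc L))) = (\<Sum>w\<in>?W. indicator {G. set (blues H w) \<subseteq> G} G0)" for G0
  proof -
    have "bad_walks n (G0 \<union> H) H V (Suc L) = {w \<in> ?W. set (blues H w) \<subseteq> G0}"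
      using good_walk_iff_blues[of H V _ n G0]
      by (auto simp: bad_walks_def alt_walks_def good_walk_def)
    moreover have "(\<Sum>w\<in>?W. indicator {G. set (blues H w) \<subseteq> G} G0) = (\<Sum>w\<in>?W. if set (blues H w) \<subseteq> G0 then 1 else (0::real))"
      by (rule sum.cong) (auto simp: indicator_def)
    ultimately show ?thesis using fW by (simp add: sum.If_cases Int_def)
  qed
  have "measure_pmf.expectation ?M (\<lambda>G0. real (card (bad_walks n (G0 \<union> H) H V (Suc L))))
      = (\<Sum>w\<in>?W. measure_pmf.expectation ?M (indicator {G. set (blues H w) \<subseteq> G}))"
    unfolding card_eq
    by (rule Bochner_Integration.integral_sum) (auto intro!: measure_pmf.integrable_const_bound[where B = 1])
  also have "\<dots> = (\<Sum>w\<in>?W. blue_prob H p w)"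
  proof (rule sum.cong[OF refl])
    fix w assume "w \<in> ?W"
    hence "set (blues H w) \<subseteq> complete_graph n" using blues_complete[of H V w n] by (simp add: alt_walks_def)
    thus "measure_pmf.expectation ?M (indicator {G. set (blues H w) \<subseteq> G}) = blue_prob H p w"
      using prob_random_subset_contains[OF finite_complete_graph _ p(1,2)] by (simp add: blue_prob_def)
  qed
  also have "\<dots> \<le> (\<Sum>w\<in>?W. walk_weight H (p / x) x w + (if coincidence H L w then blue_prob H p w else 0))"
  proof (rule sum_mono)
    fix w assume w: "w \<in> ?W"
    have ww: "0 \<le> walk_weight H (p / x) x w" using p x by (simp add: walk_weight_def)
    show "blue_prob H p w \<le> walk_weight H (p / x) x w + (if coincidence H L w then blue_prob H p w else 0)"
    proof (cases "distinct (blues H w)")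
      case True
      have le: "length (reds H w) \<le> length (blues H w)" using w by (simp add: walk_gain_eq)
      have "blue_prob H p w = p ^ length (blues H w)" using True by (simp add: blue_prob_def distinct_card)
      also have "\<dots> = (p / x) ^ length (blues H w) * x ^ length (blues H w)"
        using x by (simp add: power_divide)
      also have "\<dots> \<le> (p / x) ^ length (blues H w) * x ^ length (reds H w)"
        using le x p by (intro mult_left_mono power_decreasing) auto
      finally have "blue_prob H p w \<le> walk_weight H (p / x) x w" by (simp add: walk_weight_def)
      moreover have "0 \<le> (if coincidence H L w then blue_prob H p w else 0)"
        using p by (simp add: blue_prob_def)
      ultimately show ?thesis by linarith
    next
      case False
      hence "coincidence H L w"
        using w repeated_blue_coincidence[OF H, of w L] by (auto simp: alt_walks_def)
      thus ?thesis using ww by simp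
    qed
  qed
  also have "\<dots> \<le> (\<Sum>w\<in>alt_walks n H V (Suc L). walk_weight H (p / x) x w + (if coincidence H L w then blue_prob H p w else 0))"
    by (rule sum_mono2) (use p x finite_alt_walks in \<open>auto simp: walk_weight_def blue_prob_def intro!: add_nonneg_nonneg\<close>)
  also have "\<dots> = (\<Sum>w\<in>alt_walks n H V (Suc L). walk_weight H (p / x) x w) +
      (\<Sum>w\<in>alt_walks n H V (Suc L). if coincidence H L w then blue_prob H p w else 0)"
    by (rule sum.distrib)
  also have "(\<Sum>w\<in>alt_walks n H V (Suc L). walk_weight H (p / x) x w) \<le>
       real n * (2 * x * hR + (aV * hB + aN * hN)) * rho ^ (L - 1)"
  proof -
    have "(\<Sum>w\<in>alt_walks n H V ((L - 1) + 2). walk_weight H (p / x) x w) \<le>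
       real n * (2 * x * hR + (aV * hB + aN * hN)) * rho ^ (L - 1)"
      by (rule sum_walk_weights[OF H V _ _ h rho aV aN R B N]) (use p x in auto)
    moreover have "L - 1 + 2 = Suc L" using L by simp
    ultimately show ?thesis by simp
  qed
  also have "(\<Sum>w\<in>alt_walks n H V (Suc L). if coincidence H L w then blue_prob H p w else 0) \<le>
     real L * (2 + \<mu> + real L) ^ L * (\<mu> * (real (Suc L) * 3 ^ L + real (card (short_verts H L))))"
    by (rule sum_coincidences(2)[OF H V p order_refl])
  finally show ?thesis by simp
qed

subsection \<open>Depth-first exploration of alternating trails\<close>

text \<open>An entry of the depth-first stack: a trail, the balance (red minus blue) at its end, the number of
  vertices outside \<open>V\<close> since the last red edge, the list of marks (positions where a red segment
  starts, with the balance there), and the set of vertices already queried from its end.\<close>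

datatype item = Item (iv: "nat list") (ib: int) (ii: nat) (il: "(nat \<times> int) list") (iD: "nat set")

text \<open>\<open>P \<beta> i\<close> is the worth of an unqueried trail end of balance \<open>\<beta>\<close> that left \<open>V\<close> \<open>i\<close> steps ago.
  The potential of a stack, its total worth minus \<open>\<kappa>\<close> per used vertex, has positive drift, and the
  probability of failure is at most exponentially small in it.\<close>

locale exploration =
  fixes n :: nat and V :: "nat set" and H :: "nat set set" and A :: nat and B :: int
    and p :: real and P :: "int \<Rightarrow> nat \<Rightarrow> real" and Pmax \<epsilon> rV rN \<theta> \<kappa> u :: real and l :: nat
  assumes H: "two_regular V H" and V: "V \<subseteq> {..<n}" and A: "1 \<le> A" and B: "0 \<le> B"
    and p: "0 \<le> p" "p \<le> 1"
    and P0: "\<And>\<beta> i. 0 \<le> P \<beta> i" and Pmax: "\<And>\<beta> i. P \<beta> i \<le> Pmax"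
    and P_outside: "\<And>\<beta> i. B < \<bar>\<beta>\<bar> \<or> A \<le> i \<Longrightarrow> P \<beta> i = 0"
    and \<epsilon>: "0 < \<epsilon>" and \<theta>: "0 < \<theta>" and \<kappa>: "0 \<le> \<kappa>" and u: "0 \<le> u"
    and drift: "\<And>\<beta> i. \<bar>\<beta>\<bar> \<le> B \<Longrightarrow> i < A \<Longrightarrow> P \<beta> i * (1 + \<epsilon>) \<le>
        rV * (\<Sum>a\<in>{1..A}. 2 * P (\<beta> - 1 + int a) 0) + rN * P (\<beta> - 1) (Suc i)"
    and rV: "rV \<le> p * (real (card V) - real (card (short_verts H (2 * A))) - 3 ^ A * u)"
    and rN: "rN \<le> p * (real n - real (card V) - u)"
    and exponent: "\<And>\<beta> i w. w = (\<Sum>a\<in>{1..A}. 2 * P (\<beta> - 1 + int a) 0) \<or> w = P \<beta> i \<Longrightarrow> 0 < w \<Longrightarrow>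
        \<theta> * w / (1 + \<epsilon>) \<le> 1 - exp (- \<theta> * (w - \<kappa> * real (2 * A + 1)))"
    and root_gain: "\<kappa> * real (2 * A + 1) \<le> (\<Sum>a\<in>{1..A}. 2 * P (int a) 0)"
    and root_exists: "3 ^ A * u + real (card (short_verts H (2 * A))) < real (card V)"
    and l: "4 * real A * real l * Pmax \<le> \<kappa> * u"
begin

lemma finV: "finite V"
  using V finite_subset by blast

lemma Pmax0: "0 \<le> Pmax"
  using P0 Pmax order_trans by blast

text \<open>Worth created by landing at a vertex of \<open>V\<close>: the blue edge lowers the
  balance by one, and the trail may leave after 1 to \<open>A\<close> red edges in either of two
  directions. All these ends are pushed at once.\<close>

definition gainV :: "int \<Rightarrow> real" where
  "gainV \<beta> = (\<Sum>a\<in>{1..A}. 2 * P (\<beta> - 1 + int a) 0)"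

definition gain :: "int \<Rightarrow> nat \<Rightarrow> nat \<Rightarrow> real" where
  "gain \<beta> i y = (if y \<in> V then gainV \<beta> else P (\<beta> - 1) (Suc i))"

lemma gain0: "0 \<le> gain \<beta> i y"
  using P0 by (auto simp: gain_def gainV_def intro!: sum_nonneg)

definition arc :: "nat \<Rightarrow> nat list \<times> nat list" where
  "arc w = (SOME (a, b). length a = A \<and> length b = A \<and> distinct (a @ w # b) \<and>
      path_in H (w # a) \<and> path_in H (w # b))"

definition ball :: "nat \<Rightarrow> nat set" where
  "ball w = set (fst (arc w) @ w # snd (arc w))"

lemma arc:
  assumes "w \<in> V" "w \<notin> short_verts H (2 * A)"
  shows "length (fst (arc w)) = A" "length (snd (arc w)) = A" "distinct (fst (arc w) @ w # snd (arc w))"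
    "path_in H (w # fst (arc w))" "path_in H (w # snd (arc w))"
proof -
  obtain a b where "length a = A" "length b = A" "distinct (a @ w # b)"
      "path_in H (w # a)" "path_in H (w # b)"
    using two_regular_arc[OF H assms A] .
  hence "\<exists>x. case x of (a, b) \<Rightarrow> length a = A \<and> length b = A \<and> distinct (a @ w # b) \<and>
      path_in H (w # a) \<and> path_in H (w # b)" by (intro exI[of _ "(a, b)"]) simp
  hence *: "case arc w of (a, b) \<Rightarrow> length a = A \<and> length b = A \<and> distinct (a @ w # b) \<and>
      path_in H (w # a) \<and> path_in H (w # b)"
    unfolding arc_def by (rule someI_ex)
  show "length (fst (arc w)) = A" "length (snd (arc w)) = A" "distinct (fst (arc w) @ w # snd (arc w))"
    "path_in H (w # fst (arc w))" "path_in H (w # snd (arc w))"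
    using * unfolding case_prod_unfold by blast+
qed

lemma path_in_set:
  assumes "path_in H (w # c)" "w \<in> V" shows "set (w # c) \<subseteq> V"
proof
  fix x assume "x \<in> set (w # c)"
  then obtain j where j: "j < length (w # c)" "x = (w # c) ! j" by (metis in_set_conv_nth)
  show "x \<in> V"
  proof (cases j)
    case 0 thus ?thesis using j assms by simp
  next
    case (Suc k)
    hence "{(w # c) ! k, (w # c) ! Suc k} \<in> H" using assms(1) j unfolding path_in_def by auto
    thus ?thesis using H j Suc by (auto simp: two_regular_def)
  qed
qed

lemma ball_props:
  assumes "w \<in> V" "w \<notin> short_verts H (2 * A)"
  shows "ball w \<subseteq> V" "card (ball w) = 2 * A + 1" "nb H w \<subseteq> ball w"
proof -
  note a = arc[OF assms]
  show "ball w \<subseteq> V" using path_in_set[OF a(4) assms(1)] path_in_set[OF a(5) assms(1)]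
    by (auto simp: ball_def)
  show "card (ball w) = 2 * A + 1" unfolding ball_def using a by (simp only: distinct_card) simp
  obtain x xs where x: "fst (arc w) = x # xs" using a(1) A by (cases "fst (arc w)") auto
  obtain y ys where y: "snd (arc w) = y # ys" using a(2) A by (cases "snd (arc w)") auto
  have "{w, x} \<in> H" "{w, y} \<in> H" using a(4,5) x y by (auto simp: path_in_def)
  hence sub: "{x, y} \<subseteq> nb H w" by (auto simp: nb_def)
  have "x \<noteq> y" using a(3) x y by auto
  hence "{x, y} = nb H w" using sub H assms(1) two_regular_finite_nb[OF H assms(1)]
    by (intro card_subset_eq) (auto simp: two_regular_def)
  thus "nb H w \<subseteq> ball w" using x y by (auto simp: ball_def)
qed

lemma path_in_rev: "path_in H ys \<Longrightarrow> path_in H (rev ys)"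
  unfolding path_in_def
proof (intro allI impI)
  fix i assume a: "\<forall>i. Suc i < length ys \<longrightarrow> {ys ! i, ys ! Suc i} \<in> H" "Suc i < length (rev ys)"
  have "Suc (length ys - Suc (Suc i)) = length ys - Suc i" using a(2) by auto
  thus "{rev ys ! i, rev ys ! Suc i} \<in> H"
    using a(1)[rule_format, of "length ys - Suc (Suc i)"] a(2) by (simp add: rev_nth insert_commute)
qed

lemma path_in_take: "path_in H ys \<Longrightarrow> path_in H (take k ys)"
  by (auto simp: path_in_def)

text \<open>Read from the far side: a used vertex spoils only the landing points within
  \<open>A\<close> red steps, at most \<open>3 ^ A\<close> of them.\<close>

lemma ball_reach:
  assumes "w \<in> V" "w \<notin> short_verts H (2 * A)" "x \<in> ball w"
  shows "w \<in> reach H A x"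
proof -
  note a = arc[OF assms(1,2)]
  have *: "w \<in> reach H A x" if c: "length c = A" "path_in H (w # c)" and x: "x \<in> set (w # c)" for c
  proof -
    obtain j where j: "j < length (w # c)" "(w # c) ! j = x" using x by (metis in_set_conv_nth)
    let ?t = "take (Suc j) (w # c)"
    have "last (rev ?t) \<in> reach H A (hd (rev ?t))"
      using j c by (intro path_in_reach path_in_rev path_in_take) auto
    moreover have "last (rev ?t) = w" by simp
    moreover have "hd (rev ?t) = x"
    proof -
      have "hd (rev ?t) = last ?t" by (simp add: hd_rev)
      also have "\<dots> = ?t ! (length ?t - 1)" by (rule last_conv_nth) simp
      also have "length ?t - 1 = j" using j by simp
      finally show ?thesis using j by (simp del: take_Suc_Cons)
    qed
    ultimately show ?thesis by simp
  qed
  have "x \<in> set (w # fst (arc w)) \<or> x \<in> set (w # snd (arc w))" using assms(3) by (auto simp: ball_def)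
  thus ?thesis using *[OF a(1,4)] *[OF a(2,5)] by blast
qed

definition candV :: "nat set \<Rightarrow> nat set" where
  "candV U = {w \<in> V - short_verts H (2 * A). ball w \<inter> U = {}}"

definition cand :: "nat set \<Rightarrow> nat set" where
  "cand U = candV U \<union> ({..<n} - V - U)"

lemma card_candV:
  assumes "finite U"
  shows "real (card V) - real (card (short_verts H (2 * A))) - 3 ^ A * real (card U) \<le> real (card (candV U))"
proof -
  have fs: "finite (short_verts H (2 * A))" using short_verts_subset[OF H] finV finite_subset by blast
  have "V \<subseteq> candV U \<union> short_verts H (2 * A) \<union> (\<Union>x\<in>U. reach H A x)"
    using ball_reach by (auto simp: candV_def)
  hence "card V \<le> card (candV U \<union> short_verts H (2 * A) \<union> (\<Union>x\<in>U. reach H A x))"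
    using fs assms card_reach[OF H] finV by (intro card_mono) (auto simp: candV_def)
  also have "\<dots> \<le> card (candV U) + card (short_verts H (2 * A)) + card (\<Union>x\<in>U. reach H A x)"
    by (meson add_le_mono card_Un_le le_trans order_refl)
  also have "card (\<Union>x\<in>U. reach H A x) \<le> (\<Sum>x\<in>U. card (reach H A x))" using assms by (rule card_UN_le)
  also have "(\<Sum>x\<in>U. card (reach H A x)) \<le> (\<Sum>x\<in>U. 3 ^ A)" using card_reach[OF H] by (intro sum_mono) auto
  finally have "card V \<le> card (candV U) + card (short_verts H (2 * A)) + card U * 3 ^ A" by simp
  hence "real (card V) \<le> real (card (candV U) + card (short_verts H (2 * A)) + card U * 3 ^ A)" by (rule of_nat_mono)
  thus ?thesis by (simp add: mult.commute)
qed

text \<open>The bounds by \<open>A\<close> on red stretches and on excursions make marks occur at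
  bounded distances; the bound by \<open>B\<close> on the balance before a landing leaves few values
  for the balances recorded in marks.\<close>

inductive trail :: "nat set set \<Rightarrow> nat list \<Rightarrow> int \<Rightarrow> nat \<Rightarrow> (nat \<times> int) list \<Rightarrow> bool" for X where
  root: "path_in H rs \<Longrightarrow> distinct rs \<Longrightarrow> 2 \<le> length rs \<Longrightarrow> length rs \<le> Suc A \<Longrightarrow>
    trail X rs (int (length rs) - 1) 0 [(0, 0)]"
| outside: "trail X vs \<beta> i Ls \<Longrightarrow> y \<notin> V \<Longrightarrow> y \<notin> set vs \<Longrightarrow> {last vs, y} \<in> X \<Longrightarrow> Suc i < A \<Longrightarrow>
    trail X (vs @ [y]) (\<beta> - 1) (Suc i) Ls"
| landing: "trail X vs \<beta> i Ls \<Longrightarrow> path_in H rs \<Longrightarrow> distinct rs \<Longrightarrow> 2 \<le> length rs \<Longrightarrow> length rs \<le> Suc A \<Longrightarrow>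
    set rs \<inter> set vs = {} \<Longrightarrow> {last vs, hd rs} \<in> X \<Longrightarrow> {last vs, hd rs} \<notin> H \<Longrightarrow> \<bar>\<beta>\<bar> \<le> B \<Longrightarrow>
    trail X (vs @ rs) (\<beta> - 1 + (int (length rs) - 1)) 0 (Ls @ [(length vs, \<beta> - 1)])"

lemma trail_mono:
  assumes "trail X vs \<beta> i Ls" "X \<subseteq> X'" shows "trail X' vs \<beta> i Ls"
  using assms
proof (induction rule: trail.induct)
  case (root rs)
  show ?case by (rule trail.root[OF root(1-4)])
next
  case (outside vs \<beta> i Ls y)
  show ?case by (rule trail.outside) (use outside in auto)
next
  case (landing vs \<beta> i Ls rs)
  show ?case by (rule trail.landing) (use landing in auto)
qed

lemma trail_nonempty: "trail X vs \<beta> i Ls \<Longrightarrow> vs \<noteq> []"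
  by (induction rule: trail.induct) auto

definition long_trail :: "nat set set \<Rightarrow> bool" where
  "long_trail X \<longleftrightarrow> (\<exists>vs \<beta> i Ls. trail X vs \<beta> i Ls \<and> set vs \<subseteq> {..<n} \<and> l \<le> length vs)"

lemma long_trail_mono: "long_trail X \<Longrightarrow> X \<subseteq> X' \<Longrightarrow> long_trail X'"
  unfolding long_trail_def using trail_mono by blast

text \<open>The pairs not queried yet.\<close>

definition av :: "item list \<Rightarrow> nat set \<Rightarrow> nat set set" where
  "av st U = {{last (iv it), y} | it y. it \<in> set st \<and> y < n \<and> y \<notin> U \<and> y \<notin> iD it} \<union>
     {{a, b} | a b. a < n \<and> b < n \<and> a \<noteq> b \<and> a \<notin> U \<and> b \<notin> U}"

text \<open>A push adds at most \<open>2 * A\<close> entries, and its trails are longer than the one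
  below, so the height of the stack is bounded by the length of its top trail. As long as no trail
  is long, the total worth of the stack is small.\<close>

fun stack_ok :: "item list \<Rightarrow> bool" where
  "stack_ok [] = True"
| "stack_ok (it # st) = (length (it # st) \<le> 2 * A * length (iv it) \<and> stack_ok st)"

definition item_ok :: "nat set set \<Rightarrow> nat set \<Rightarrow> item \<Rightarrow> bool" where
  "item_ok X U it \<longleftrightarrow> trail X (iv it) (ib it) (ii it) (il it) \<and> \<bar>ib it\<bar> \<le> B \<and> ii it < A \<and>
     set (iv it) \<subseteq> U \<and> iD it \<subseteq> {..<n}"

definition state_ok :: "item list \<Rightarrow> nat set \<Rightarrow> nat set set \<Rightarrow> bool" where
  "state_ok st U X \<longleftrightarrow> (\<forall>it\<in>set st. item_ok X U it) \<and> distinct (map (last \<circ> iv) st) \<and> stack_ok st \<and> U \<subseteq> {..<n}"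

text \<open>Each query from a trail end is charged its expected gain divided by 1 + \<epsilon>,
  whether or not it succeeds. By the drift condition the charges reach the initial worth once all
  candidates have been queried.\<close>

definition worth :: "item \<Rightarrow> real" where
  "worth it = P (ib it) (ii it) - (\<Sum>y\<in>iD it. p * gain (ib it) (ii it) y / (1 + \<epsilon>))"

text \<open>Conditional probability of failure: \<open>X\<close> holds the edges found so far, and
  only the pairs in \<open>av\<close> are still random.\<close>

definition fail :: "item list \<Rightarrow> nat set \<Rightarrow> nat set set \<Rightarrow> real" where
  "fail st U X = measure_pmf.prob (random_subset (av st U) p) {G. \<not> long_trail (X \<union> G)}"

lemma item_last:
  assumes "item_ok X U it" shows "last (iv it) \<in> U" "iv it \<noteq> []"
proof -
  show "iv it \<noteq> []" using assms trail_nonempty[of X "iv it"] unfolding item_ok_def by blast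
  thus "last (iv it) \<in> U" using assms by (auto simp: item_ok_def)
qed

lemma finite_av:
  assumes "state_ok st U X" shows "finite (av st U)"
proof (rule finite_subset)
  show "av st U \<subseteq> Pow {..<n}"
  proof
    fix e assume e: "e \<in> av st U"
    have "last (iv it) < n" if "it \<in> set st" for it
      using item_last(1)[of X U it] that assms by (auto simp: state_ok_def)
    thus "e \<in> Pow {..<n}" using e by (auto simp: av_def)
  qed
qed simp

lemma stack_ok_append:
  assumes "stack_ok st" "\<forall>it\<in>set new. N \<le> 2 * A * length (iv it)" "length st + length new \<le> N"
  shows "stack_ok (new @ st)"
  using assms(2,3) by (induction new) (use assms(1) in auto)

definition arcs_of :: "nat list \<Rightarrow> int \<Rightarrow> (nat \<times> int) list \<Rightarrow> nat list \<Rightarrow> item list" where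
  "arcs_of vs \<beta> Ls rs = map (\<lambda>a. Item (vs @ take (Suc a) rs) (\<beta> + int a) 0 (Ls @ [(length vs, \<beta>)]) {})
     (filter (\<lambda>a. \<bar>\<beta> + int a\<bar> \<le> B) [1..<Suc A])"

definition pushed :: "nat list \<Rightarrow> int \<Rightarrow> (nat \<times> int) list \<Rightarrow> nat \<Rightarrow> item list" where
  "pushed vs \<beta> Ls w = arcs_of vs \<beta> Ls (w # fst (arc w)) @ arcs_of vs \<beta> Ls (w # snd (arc w))"

lemma worth_new: "worth (Item vs \<beta> i Ls {}) = P \<beta> i"
  by (simp add: worth_def)

lemma worth_arcs_of: "(\<Sum>it\<leftarrow>arcs_of vs \<beta> Ls rs. worth it) = (\<Sum>a\<in>{1..A}. P (\<beta> + int a) 0)"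
proof -
  have "(\<Sum>it\<leftarrow>arcs_of vs \<beta> Ls rs. worth it) = (\<Sum>a\<leftarrow>filter (\<lambda>a. \<bar>\<beta> + int a\<bar> \<le> B) [1..<Suc A]. P (\<beta> + int a) 0)"
    by (simp only: arcs_of_def map_map comp_def worth_new)
  also have "\<dots> = (\<Sum>a\<leftarrow>[1..<Suc A]. P (\<beta> + int a) 0)"
    by (rule sum_list_map_filter) (use P_outside in auto)
  also have "\<dots> = (\<Sum>a\<in>{1..<Suc A}. P (\<beta> + int a) 0)" by (rule sum_list_distinct_conv_sum_set[of "[1..<Suc A]", simplified set_upt]) simp
  also have "{1..<Suc A} = {1..A}" by auto
  finally show ?thesis .
qed

lemma worth_pushed: "(\<Sum>it\<leftarrow>pushed vs (\<beta> - 1) Ls w. worth it) = gainV \<beta>"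
  by (simp add: pushed_def worth_arcs_of gainV_def sum_distrib_left[symmetric])

lemma pushed_props:
  assumes w: "w \<in> candV U" and it: "it \<in> set (pushed vs \<beta> Ls w)"
  obtains rs a where "1 \<le> a" "a \<le> A" "length rs = Suc A" "hd rs = w" "path_in H rs" "distinct rs"
    "set rs \<subseteq> ball w" "it = Item (vs @ take (Suc a) rs) (\<beta> + int a) 0 (Ls @ [(length vs, \<beta>)]) {}"
    "\<bar>\<beta> + int a\<bar> \<le> B"
proof -
  have w': "w \<in> V" "w \<notin> short_verts H (2 * A)" using w by (auto simp: candV_def)
  note a = arc[OF w']
  have "it \<in> set (arcs_of vs \<beta> Ls (w # fst (arc w))) \<or> it \<in> set (arcs_of vs \<beta> Ls (w # snd (arc w)))"
    using it by (simp add: pushed_def)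
  then obtain c where c: "it \<in> set (arcs_of vs \<beta> Ls (w # c))" "c = fst (arc w) \<or> c = snd (arc w)"
    by blast
  then obtain a where "1 \<le> a" "a \<le> A" "\<bar>\<beta> + int a\<bar> \<le> B"
    "it = Item (vs @ take (Suc a) (w # c)) (\<beta> + int a) 0 (Ls @ [(length vs, \<beta>)]) {}"
    by (auto simp: arcs_of_def simp del: upt_Suc take_Suc_Cons)
  thus thesis using c(2) a by (intro that[of a "w # c"]) (auto simp: ball_def simp del: take_Suc_Cons)
qed

lemma length_pushed: "length (pushed vs \<beta> Ls w) \<le> 2 * A"
proof -
  have "length (arcs_of vs \<beta> Ls rs) \<le> A" for rs
    using length_filter_le[of _ "[1..<Suc A]"] by (simp add: arcs_of_def del: upt_Suc)
  from this[of "w # fst (arc w)"] this[of "w # snd (arc w)"] show ?thesis by (simp add: pushed_def)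
qed

lemma last_take_Suc:
  assumes "a < length rs" shows "last (take (Suc a) rs) = rs ! a"
proof -
  have "take (Suc a) rs \<noteq> []" using assms by auto
  hence "last (take (Suc a) rs) = take (Suc a) rs ! (length (take (Suc a) rs) - 1)" by (rule last_conv_nth)
  also have "\<dots> = rs ! a" using assms by (cases "length rs = Suc a") (auto simp: min_def)
  finally show ?thesis .
qed

lemma ends_arcs_of:
  assumes "length c = A"
  shows "map (last \<circ> iv) (arcs_of vs \<beta> Ls (w # c)) = map (\<lambda>a. c ! (a - 1)) (filter (\<lambda>a. \<bar>\<beta> + int a\<bar> \<le> B) [1..<Suc A])"
proof -
  have "last (vs @ take (Suc a) (w # c)) = c ! (a - 1)" if "1 \<le> a" "a < Suc A" for a
  proof -
    have "last (vs @ take (Suc a) (w # c)) = last (take (Suc a) (w # c))" by simp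
    also have "\<dots> = (w # c) ! a" using that assms by (intro last_take_Suc) auto
    finally show ?thesis using that by (simp add: nth_Cons')
  qed
  thus ?thesis by (simp add: arcs_of_def del: upt_Suc take_Suc_Cons)
qed

text \<open>Different ends on the stack keep the pairs queried from them distinct.\<close>

lemma distinct_ends_pushed:
  assumes w: "w \<in> candV U"
  shows "distinct (map (last \<circ> iv) (pushed vs \<beta> Ls w))"
    "set (map (last \<circ> iv) (pushed vs \<beta> Ls w)) \<subseteq> ball w"
proof -
  have w': "w \<in> V" "w \<notin> short_verts H (2 * A)" using w by (auto simp: candV_def)
  note a = arc[OF w']
  have d: "distinct (map (\<lambda>a. c ! (a - 1)) (filter (\<lambda>a. \<bar>\<beta> + int a\<bar> \<le> B) [1..<Suc A]))"
    "set (map (\<lambda>a. c ! (a - 1)) (filter (\<lambda>a. \<bar>\<beta> + int a\<bar> \<le> B) [1..<Suc A])) \<subseteq> set c"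
    if "length c = A" "distinct c" for c
    using that by (auto simp: distinct_map inj_on_def nth_eq_iff_index_eq simp del: upt_Suc)
  have c: "distinct (fst (arc w))" "distinct (snd (arc w))" "set (fst (arc w)) \<inter> set (snd (arc w)) = {}"
    using a(3) by auto
  show "distinct (map (last \<circ> iv) (pushed vs \<beta> Ls w))"
    unfolding pushed_def map_append ends_arcs_of[OF a(1)] ends_arcs_of[OF a(2)] distinct_append
    using d[OF a(1) c(1)] d[OF a(2) c(2)] c(3) by blast
  show "set (map (last \<circ> iv) (pushed vs \<beta> Ls w)) \<subseteq> ball w"
    unfolding pushed_def map_append ends_arcs_of[OF a(1)] ends_arcs_of[OF a(2)] set_append
    using d(2)[OF a(1) c(1)] d(2)[OF a(2) c(2)] by (auto simp: ball_def)
qed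

lemma item_ok_mono: "item_ok X U it \<Longrightarrow> X \<subseteq> X' \<Longrightarrow> U \<subseteq> U' \<Longrightarrow> item_ok X' U' it"
  unfolding item_ok_def using trail_mono by blast

text \<open>The offset \<kappa> u / 2 is chosen for the moment when more than \<open>u\<close>
  vertices are used: the stack then has worth at most \<kappa> u / 2, and the bound is at least 1,
  hence trivial. Initially it equals exp (- \<theta> \<kappa> u / 2).\<close>

definition bound :: "item list \<Rightarrow> nat set \<Rightarrow> real" where
  "bound st U = exp (- \<theta> * ((\<Sum>it\<leftarrow>st. worth it) - \<kappa> * real (card U) + \<kappa> * u / 2))"

lemma fail_le_1: "fail st U X \<le> 1"
  by (simp add: fail_def)

lemma fail_antimono:
  assumes "finite (av st U)" "av st' U' \<subseteq> av st U"
  shows "fail st U X \<le> fail st' U' X"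
  unfolding fail_def using assms p
  by (intro prob_random_subset_antimono) (auto dest: long_trail_mono[of _ "X \<union> _"] intro: long_trail_mono)

text \<open>Both outcomes are compared with the same pool \<open>av st1 U1\<close> of remaining
  pairs; after a success, part of that pool may be given up.\<close>

lemma fail_step:
  assumes fin: "finite (av st U)" and e: "insert e (av st1 U1) \<subseteq> av st U" "e \<notin> av st1 U1"
     "av st2 U2 \<subseteq> av st1 U1"
    and X: "X' = insert e X"
  shows "fail st U X \<le> p * fail st2 U2 X' + (1 - p) * fail st1 U1 X"
proof -
  have anti: "\<not> long_trail (X \<union> G')" if "\<not> long_trail (X \<union> G)" "G' \<subseteq> G" for G G'
    using that long_trail_mono[of "X \<union> G'" "X \<union> G"] by blast
  have "fail st U X \<le> p * measure_pmf.prob (random_subset (av st1 U1) p) {G. \<not> long_trail (X \<union> insert e G)}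
      + (1 - p) * fail st1 U1 X"
    unfolding fail_def by (rule prob_random_subset_step[OF fin e(1,2) p]) (rule anti)
  also have "measure_pmf.prob (random_subset (av st1 U1) p) {G. \<not> long_trail (X \<union> insert e G)} = fail st1 U1 X'"
    using X by (simp add: fail_def)
  also have "p * fail st1 U1 X' + (1 - p) * fail st1 U1 X \<le> p * fail st2 U2 X' + (1 - p) * fail st1 U1 X"
    using e fin p finite_subset by (intro add_mono mult_left_mono fail_antimono) auto
  finally show ?thesis .
qed

text \<open>The supermartingale inequality of one query. By \<open>exponent\<close>, 1 - p (1 - exp
  (- \<theta> (w - \<kappa> (2 A + 1)))) is at most 1 - \<theta> c, hence at most exp (- \<theta>
  c), which compensates the charge \<open>c\<close>.\<close>

lemma query_bound:
  assumes w: "0 < w" "w = gainV \<beta> \<or> w = P \<beta>' i'" and c: "c = p * w / (1 + \<epsilon>)"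
    and U: "card U' \<le> card U + (2 * A + 1)"
  shows "p * exp (- \<theta> * (s - c + w - \<kappa> * real (card U') + r)) + (1 - p) * exp (- \<theta> * (s - c - \<kappa> * real (card U) + r))
     \<le> exp (- \<theta> * (s - \<kappa> * real (card U) + r))"
proof -
  let ?k = "\<kappa> * real (2 * A + 1)"
  let ?E = "exp (- \<theta> * (s - \<kappa> * real (card U) + r))"
  have ex: "\<theta> * w / (1 + \<epsilon>) \<le> 1 - exp (- \<theta> * (w - ?k))"
    using w exponent[of w \<beta> 0] exponent[of w \<beta>' i'] by (auto simp: gainV_def)
  have "\<kappa> * real (card U') \<le> \<kappa> * (real (card U) + real (2 * A + 1))"
    using U \<kappa> by (intro mult_left_mono) linarith+
  hence "s - c + w - \<kappa> * real (card U') + r \<ge> (s - \<kappa> * real (card U) + r) + (- c) + (w - ?k)"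
    by (simp add: algebra_simps)
  hence "exp (- \<theta> * (s - c + w - \<kappa> * real (card U') + r)) \<le>
      exp (- \<theta> * ((s - \<kappa> * real (card U) + r) + (- c) + (w - ?k)))" using \<theta> by simp
  also have "\<dots> = ?E * exp (\<theta> * c) * exp (- \<theta> * (w - ?k))"
    by (simp add: exp_add[symmetric] algebra_simps)
  finally have 1: "exp (- \<theta> * (s - c + w - \<kappa> * real (card U') + r)) \<le> ?E * exp (\<theta> * c) * exp (- \<theta> * (w - ?k))" .
  have 2: "exp (- \<theta> * (s - c - \<kappa> * real (card U) + r)) = ?E * exp (\<theta> * c)"
    by (simp add: exp_add[symmetric] algebra_simps)
  have "p * exp (- \<theta> * (s - c + w - \<kappa> * real (card U') + r)) + (1 - p) * exp (- \<theta> * (s - c - \<kappa> * real (card U) + r))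
     \<le> p * (?E * exp (\<theta> * c) * exp (- \<theta> * (w - ?k))) + (1 - p) * (?E * exp (\<theta> * c))"
    unfolding 2 using 1 p by (intro add_mono mult_left_mono) auto
  also have "\<dots> = ?E * (exp (\<theta> * c) * (1 - p * (1 - exp (- \<theta> * (w - ?k)))))"
    by (simp add: algebra_simps)
  also have "\<dots> \<le> ?E * 1"
  proof (rule mult_left_mono)
    have "\<theta> * c = p * (\<theta> * w / (1 + \<epsilon>))" using c by simp
    also have "\<dots> \<le> p * (1 - exp (- \<theta> * (w - ?k)))" using ex p by (intro mult_left_mono)
    finally have "1 - p * (1 - exp (- \<theta> * (w - ?k))) \<le> 1 + (- \<theta> * c)" by simp
    also have "\<dots> \<le> exp (- \<theta> * c)" by (rule exp_ge_add_one_self)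
    finally have "exp (\<theta> * c) * (1 - p * (1 - exp (- \<theta> * (w - ?k)))) \<le> exp (\<theta> * c) * exp (- \<theta> * c)"
      by (intro mult_left_mono) auto
    thus "exp (\<theta> * c) * (1 - p * (1 - exp (- \<theta> * (w - ?k)))) \<le> 1" by (simp add: exp_add[symmetric])
  qed simp
  finally show ?thesis by simp
qed

lemma av_query:
  assumes st: "state_ok (it # st) U X" and y: "y < n" "y \<notin> U" "y \<notin> iD it"
  defines "it' \<equiv> Item (iv it) (ib it) (ii it) (il it) (insert y (iD it))"
  shows "insert {last (iv it), y} (av (it' # st) U) \<subseteq> av (it # st) U"
    "{last (iv it), y} \<notin> av (it' # st) U"
proof -
  let ?z = "last (iv it)"
  have ok: "item_ok X U it" "\<forall>j\<in>set st. item_ok X U j" using st by (auto simp: state_ok_def)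
  have z: "?z \<in> U" using item_last(1)[OF ok(1)] .
  have nz: "?z \<notin> (\<lambda>x. last (iv x)) ` set st" using st by (simp add: state_ok_def comp_def)
  have zj: "last (iv j) \<in> U" "last (iv j) \<noteq> ?z" if "j \<in> set st" for j
  proof -
    show "last (iv j) \<in> U" using item_last(1)[of X U j] ok(2) that by blast
    show "last (iv j) \<noteq> ?z" using nz imageI[OF that, of "\<lambda>x. last (iv x)"] by metis
  qed
  have "av (it' # st) U \<subseteq> av (it # st) U"
  proof
    fix e assume "e \<in> av (it' # st) U"
    then consider (a) j x where "e = {last (iv j), x}" "j \<in> set (it' # st)" "x < n" "x \<notin> U" "x \<notin> iD j"
      | (b) "e \<in> {{a, b} | a b. a < n \<and> b < n \<and> a \<noteq> b \<and> a \<notin> U \<and> b \<notin> U}"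
      by (auto simp: av_def)
    thus "e \<in> av (it # st) U"
    proof cases
      case a
      show ?thesis
      proof (cases "j = it'")
        case True
        hence "e = {?z, x}" "x \<notin> iD it" using a by (auto simp: it'_def)
        thus ?thesis using a unfolding av_def by (intro UnI1) auto
      next
        case False
        thus ?thesis using a unfolding av_def by (intro UnI1) auto
      qed
    next
      case b thus ?thesis unfolding av_def by blast
    qed
  qed
  moreover have "{?z, y} \<in> av (it # st) U" using y unfolding av_def by (intro UnI1) auto
  ultimately show "insert {?z, y} (av (it' # st) U) \<subseteq> av (it # st) U" by simp
  show "{?z, y} \<notin> av (it' # st) U"
  proof
    assume "{?z, y} \<in> av (it' # st) U"
    then consider (a) j x where "{?z, y} = {last (iv j), x}" "j \<in> set (it' # st)" "x < n" "x \<notin> U" "x \<notin> iD j"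
      | (b) a b where "{?z, y} = {a, b}" "a \<notin> U" "b \<notin> U"
      by (auto simp: av_def)
    thus False
    proof cases
      case a
      have "last (iv j) \<in> U" using a(2) z zj by (auto simp: it'_def)
      hence eq: "last (iv j) = ?z" "x = y" using a(1,4) y z by (auto simp: doubleton_eq_iff)
      hence "j = it'" using a(2) zj by auto
      thus False using a(5) eq by (simp add: it'_def)
    next
      case b thus False using z by (auto simp: doubleton_eq_iff)
    qed
  qed
qed

lemma av_push:
  assumes "\<forall>it\<in>set new. last (iv it) \<in> W" "W \<inter> U = {}" "W \<subseteq> {..<n}"
  shows "av (new @ st) (U \<union> W) \<subseteq> av st U"
proof
  fix e assume "e \<in> av (new @ st) (U \<union> W)"
  then consider (a) j x where "e = {last (iv j), x}" "j \<in> set new" "x < n" "x \<notin> U \<union> W"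
    | (b) j x where "e = {last (iv j), x}" "j \<in> set st" "x < n" "x \<notin> U \<union> W" "x \<notin> iD j"
    | (c) a b where "e = {a, b}" "a < n" "b < n" "a \<noteq> b" "a \<notin> U \<union> W" "b \<notin> U \<union> W"
    by (auto simp: av_def)
  thus "e \<in> av st U"
  proof cases
    case a
    have "last (iv j) \<in> W" "last (iv j) < n" "last (iv j) \<notin> U" "last (iv j) \<noteq> x" using a assms by auto
    thus ?thesis using a unfolding av_def by blast
  next
    case b thus ?thesis unfolding av_def by blast
  next
    case c thus ?thesis unfolding av_def by blast
  qed
qed

text \<open>All candidates with positive gain have been charged. As at most \<open>u\<close>
  vertices are used, \<open>rV\<close> and \<open>rN\<close> bound the numbers of candidates from
  below, and the drift condition makes the total charge at least the initial worth.\<close>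

lemma worth_pop:
  assumes it: "item_ok X U it" and U: "U \<subseteq> {..<n}" "real (card U) \<le> u"
    and exhausted: "\<forall>y\<in>cand U. 0 < gain (ib it) (ii it) y \<longrightarrow> y \<in> iD it"
  shows "worth it \<le> 0"
proof -
  let ?g = "gain (ib it) (ii it)"
  have fU: "finite U" using U finite_subset by blast
  have fD: "finite (iD it)" using it finite_subset by (auto simp: item_ok_def)
  have fc: "finite (candV U)" using finV by (simp add: candV_def)
  have VU: "candV U \<subseteq> V" by (auto simp: candV_def)
  have gV: "0 \<le> gainV (ib it)" using P0 by (auto simp: gainV_def intro!: sum_nonneg)
  have "P (ib it) (ii it) * (1 + \<epsilon>) \<le> rV * gainV (ib it) + rN * P (ib it - 1) (Suc (ii it))"
    unfolding gainV_def using it by (intro drift) (auto simp: item_ok_def)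
  also have "rV \<le> p * real (card (candV U))"
  proof -
    have "3 ^ A * real (card U) \<le> 3 ^ A * u" using U(2) by (intro mult_left_mono) auto
    hence "real (card V) - real (card (short_verts H (2 * A))) - 3 ^ A * u \<le> real (card (candV U))"
      using card_candV[OF fU] by linarith
    thus ?thesis using rV p(1) mult_left_mono order_trans by blast
  qed
  hence "rV * gainV (ib it) \<le> p * real (card (candV U)) * gainV (ib it)" using gV by (rule mult_right_mono)
  also have "rN \<le> p * real (card ({..<n} - V - U))"
  proof -
    have "card {..<n} \<le> card (({..<n} - V - U) \<union> V \<union> U)"
      using fU finV by (intro card_mono) auto
    also have "\<dots> \<le> card ({..<n} - V - U) + card V + card U"
      by (meson add_le_mono card_Un_le le_trans order_refl)
    finally have "real n - real (card V) - u \<le> real (card ({..<n} - V - U))" using U(2) by simp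
    thus ?thesis using rN p(1) mult_left_mono order_trans by blast
  qed
  hence "rN * P (ib it - 1) (Suc (ii it)) \<le> p * real (card ({..<n} - V - U)) * P (ib it - 1) (Suc (ii it))"
    using P0 by (rule mult_right_mono)
  finally have "P (ib it) (ii it) * (1 + \<epsilon>) \<le> p * real (card (candV U)) * gainV (ib it) +
      p * real (card ({..<n} - V - U)) * P (ib it - 1) (Suc (ii it))" by simp
  also have "\<dots> = (\<Sum>y\<in>candV U. p * ?g y) + (\<Sum>y\<in>{..<n} - V - U. p * ?g y)"
  proof -
    have "(\<Sum>y\<in>candV U. p * ?g y) = (\<Sum>y\<in>candV U. p * gainV (ib it))"
      by (rule sum.cong) (use VU in \<open>auto simp: gain_def\<close>)
    moreover have "(\<Sum>y\<in>{..<n} - V - U. p * ?g y) = (\<Sum>y\<in>{..<n} - V - U. p * P (ib it - 1) (Suc (ii it)))"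
      by (rule sum.cong) (auto simp: gain_def)
    ultimately show ?thesis by simp
  qed
  also have "\<dots> = (\<Sum>y\<in>cand U. p * ?g y)"
    unfolding cand_def by (rule sum.union_disjoint[symmetric]) (use fc VU in auto)
  also have "\<dots> = (\<Sum>y\<in>cand U \<inter> iD it. p * ?g y)"
  proof (rule sum.mono_neutral_right)
    show "finite (cand U)" using fc by (simp add: cand_def)
    show "\<forall>y\<in>cand U - cand U \<inter> iD it. p * ?g y = 0"
    proof
      fix y assume "y \<in> cand U - cand U \<inter> iD it"
      hence "\<not> 0 < ?g y" using exhausted by blast
      thus "p * ?g y = 0" using gain0[of "ib it" "ii it" y] by simp
    qed
  qed auto
  also have "\<dots> \<le> (\<Sum>y\<in>iD it. p * ?g y)"
    by (rule sum_mono2) (use fD p gain0 in auto)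
  finally have "P (ib it) (ii it) \<le> (\<Sum>y\<in>iD it. p * ?g y) / (1 + \<epsilon>)"
    using \<epsilon> by (simp add: field_simps)
  thus ?thesis by (simp add: worth_def sum_divide_distrib)
qed

lemma pushed_item_ok:
  assumes w: "w \<in> candV U" and it: "it \<in> set (pushed vs \<beta> Ls w)"
    and base: "vs = [] \<and> \<beta> = 0 \<and> Ls = [] \<or>
      (trail X vs (\<beta> + 1) i Ls \<and> \<bar>\<beta> + 1\<bar> \<le> B \<and> set vs \<subseteq> U \<and> {last vs, w} \<in> X)"
  shows "item_ok X (U \<union> ball w) it" "Suc (length vs) \<le> length (iv it)"
proof -
  obtain rs a where r: "1 \<le> a" "a \<le> A" "length rs = Suc A" "hd rs = w" "path_in H rs" "distinct rs"
    "set rs \<subseteq> ball w" "it = Item (vs @ take (Suc a) rs) (\<beta> + int a) 0 (Ls @ [(length vs, \<beta>)]) {}"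
    "\<bar>\<beta> + int a\<bar> \<le> B" using pushed_props[OF w it] by blast
  let ?t = "take (Suc a) rs"
  have t: "path_in H ?t" "distinct ?t" "2 \<le> length ?t" "length ?t \<le> Suc A" "int (length ?t) - 1 = int a"
    "hd ?t = w" "set ?t \<subseteq> ball w"
    using r path_in_take by (auto dest: in_set_takeD)
  have w': "w \<in> V" "w \<notin> short_verts H (2 * A)" "ball w \<inter> U = {}" using w by (auto simp: candV_def)
  have "trail X (vs @ ?t) (\<beta> + int a) 0 (Ls @ [(length vs, \<beta>)])"
    using base
  proof
    assume "vs = [] \<and> \<beta> = 0 \<and> Ls = []"
    thus ?thesis using trail.root[OF t(1-4), of X] t(5) by simp
  next
    assume b: "trail X vs (\<beta> + 1) i Ls \<and> \<bar>\<beta> + 1\<bar> \<le> B \<and> set vs \<subseteq> U \<and> {last vs, w} \<in> X"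
    hence tr: "trail X vs (\<beta> + 1) i Ls" and lu: "last vs \<in> U"
      using trail_nonempty by auto
    have nH: "{last vs, hd ?t} \<notin> H"
    proof
      assume "{last vs, hd ?t} \<in> H"
      hence "last vs \<in> nb H w" using t(6) by (simp add: nb_def insert_commute)
      thus False using ball_props(3)[OF w'(1,2)] w'(3) lu by blast
    qed
    have "trail X (vs @ ?t) (\<beta> + 1 - 1 + (int (length ?t) - 1)) 0 (Ls @ [(length vs, \<beta> + 1 - 1)])"
      by (rule trail.landing[OF tr t(1-4)]) (use b t w' nH in auto)
    thus ?thesis using t(5) by simp
  qed
  moreover have "set vs \<subseteq> U" using base by auto
  ultimately show "item_ok X (U \<union> ball w) it" using r t(7) A by (auto simp: item_ok_def)
  show "Suc (length vs) \<le> length (iv it)" using r by simp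
qed

text \<open>Induction on the run of the exploration, measured by used vertices, queried pairs and
  height of the stack. The bound is trivial once a trail is long or more than \<open>u\<close>
  vertices are used. Otherwise an empty stack gets a new root, an exhausted end is popped, and an
  open end queries a candidate of positive gain.\<close>

theorem fail_bound:
  "state_ok st U X \<Longrightarrow> fail st U X \<le> bound st U"
proof (induction "(st, U)" arbitrary: st U X rule: wf_induct_rule[OF wf_measures[of
     "[\<lambda>(st, U). n - card U, \<lambda>(st, U). (\<Sum>it\<leftarrow>st. n - card (iD it)), \<lambda>(st, U). length st]"]])
  case (1 st U X)
  have IH: "fail st' U' X' \<le> bound st' U'"
    if "state_ok st' U' X'" "n - card U' < n - card U \<or> n - card U' = n - card U \<and>
       ((\<Sum>it\<leftarrow>st'. n - card (iD it)) < (\<Sum>it\<leftarrow>st. n - card (iD it)) \<or>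
        (\<Sum>it\<leftarrow>st'. n - card (iD it)) = (\<Sum>it\<leftarrow>st. n - card (iD it)) \<and> length st' < length st)" for st' U' X'
    using 1(1)[of st' U' X'] that by auto
  have ok: "\<forall>it\<in>set st. item_ok X U it" "distinct (map (last \<circ> iv) st)" "stack_ok st" "U \<subseteq> {..<n}"
    using 1(2) by (auto simp: state_ok_def)
  have fU: "finite U" using ok(4) finite_subset by blast
  have fav: "finite (av st U)" using finite_av[OF 1(2)] .
  have card_grow: "n - card (U \<union> W) < n - card U" if "W \<subseteq> {..<n}" "W \<inter> U = {}" "W \<noteq> {}" for W
  proof -
    have "card U < card (U \<union> W)" using that fU finite_subset[of W "{..<n}"] by (intro psubset_card_mono) auto
    moreover have "card (U \<union> W) \<le> n" using card_mono[of "{..<n}" "U \<union> W"] that ok(4) by simp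
    ultimately show ?thesis by linarith
  qed
  show ?case
  proof (cases "\<exists>it\<in>set st. l \<le> length (iv it)")
    case True
    then obtain it where it: "it \<in> set st" "l \<le> length (iv it)" by blast
    have "trail X (iv it) (ib it) (ii it) (il it)" "set (iv it) \<subseteq> {..<n}"
      using ok(1,4) it by (auto simp: item_ok_def)
    hence "long_trail X" using it by (auto simp: long_trail_def)
    hence "{G. \<not> long_trail (X \<union> G)} = {}" using long_trail_mono by blast
    hence "fail st U X = 0" by (simp add: fail_def)
    thus ?thesis by (simp add: bound_def)
  next
    case short: False
    show ?thesis
    proof (cases "real (card U) \<le> u")
      case False
      \<comment> \<open>No trail has reached length \<open>l\<close>, so the stack is low and has
        worth at most \<kappa> u / 2.\<close>
      have len: "real (length st) \<le> 2 * real A * real l"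
      proof (cases st)
        case (Cons it st')
        have "length st \<le> 2 * A * length (iv it)" using ok(3) Cons by simp
        also have "\<dots> \<le> 2 * A * l" using short Cons by (intro mult_le_mono2) auto
        finally have "real (length st) \<le> real (2 * A * l)" by (rule of_nat_mono)
        thus ?thesis by simp
      qed simp
      have "(\<Sum>it\<leftarrow>st. worth it) \<le> (\<Sum>it\<leftarrow>st. Pmax)"
      proof (rule sum_list_mono)
        fix it
        have "0 \<le> (\<Sum>y\<in>iD it. p * gain (ib it) (ii it) y / (1 + \<epsilon>))"
          using p gain0 \<epsilon> by (intro sum_nonneg divide_nonneg_pos mult_nonneg_nonneg) auto
        thus "worth it \<le> Pmax" using Pmax[of "ib it" "ii it"] by (simp add: worth_def)
      qed
      also have "\<dots> = real (length st) * Pmax" by (simp add: sum_list_triv)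
      also have "\<dots> \<le> 2 * real A * real l * Pmax" using len Pmax0 by (rule mult_right_mono)
      finally have "(\<Sum>it\<leftarrow>st. worth it) \<le> \<kappa> * u / 2" using l by simp
      moreover have "\<kappa> * u \<le> \<kappa> * real (card U)" using False \<kappa> by (intro mult_left_mono) auto
      ultimately have "(\<Sum>it\<leftarrow>st. worth it) - \<kappa> * real (card U) + \<kappa> * u / 2 \<le> 0" by linarith
      hence "1 \<le> bound st U" unfolding bound_def using \<theta> by (simp add: mult_nonneg_nonpos)
      thus ?thesis using fail_le_1[of st U X] by linarith
    next
      case Uu: True
      show ?thesis
      proof (cases st)
        case Nil
        have "0 < real (card (candV U))"
        proof -
          have "3 ^ A * real (card U) \<le> 3 ^ A * u" using Uu by (intro mult_left_mono) auto
          thus ?thesis using card_candV[OF fU] root_exists by linarith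
        qed
        hence "candV U \<noteq> {}" by auto
        then obtain w where w: "w \<in> candV U" by blast
        have w': "w \<in> V" "w \<notin> short_verts H (2 * A)" "ball w \<inter> U = {}" using w by (auto simp: candV_def)
        note bp = ball_props[OF w'(1,2)]
        let ?st = "pushed [] 0 [] w" and ?U = "U \<union> ball w"
        have ends: "\<forall>it\<in>set ?st. last (iv it) \<in> ball w"
          using distinct_ends_pushed(2)[OF w, of "[]" 0 "[]"] by (simp add: image_subset_iff)
        have sok: "state_ok ?st ?U X" unfolding state_ok_def
        proof (intro conjI ballI)
          fix it assume "it \<in> set ?st"
          thus "item_ok X ?U it" using pushed_item_ok(1)[OF w] by blast
        next
          have "stack_ok (?st @ [])"
          proof (rule stack_ok_append[where N = "2 * A"])
            show "\<forall>it\<in>set ?st. 2 * A \<le> 2 * A * length (iv it)"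
            proof
              fix it assume "it \<in> set ?st"
              hence "Suc 0 \<le> length (iv it)" using pushed_item_ok(2)[OF w, of it "[]" 0 "[]"] by auto
              thus "2 * A \<le> 2 * A * length (iv it)" by simp
            qed
          qed (use length_pushed in auto)
          thus "stack_ok ?st" by simp
        qed (use distinct_ends_pushed(1)[OF w] bp V ok(4) in auto)
        have "fail st U X \<le> fail ?st ?U X"
        proof (rule fail_antimono[OF fav])
          have "ball w \<subseteq> {..<n}" using bp(1) V by blast
          from av_push[OF ends w'(3) this, of "[]"] show "av ?st ?U \<subseteq> av st U" using Nil by simp
        qed
        also have "\<dots> \<le> bound ?st ?U"
        proof (rule IH[OF sok])
          have "w \<in> ball w" by (simp add: ball_def)
          hence "n - card ?U < n - card U" using bp(1) V w'(3) by (intro card_grow) blast+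
          thus "n - card ?U < n - card U \<or> n - card ?U = n - card U \<and>
            ((\<Sum>it\<leftarrow>?st. n - card (iD it)) < (\<Sum>it\<leftarrow>st. n - card (iD it)) \<or>
             (\<Sum>it\<leftarrow>?st. n - card (iD it)) = (\<Sum>it\<leftarrow>st. n - card (iD it)) \<and> length ?st < length st)"
            by blast
        qed
        also have "\<dots> \<le> bound st U"
        proof -
          have v: "(\<Sum>it\<leftarrow>?st. worth it) = gainV 1" using worth_pushed[of "[]" 1 "[]" w] by simp
          have g1: "gainV 1 = (\<Sum>a\<in>{1..A}. 2 * P (int a) 0)" by (simp add: gainV_def)
          have "real (card ?U) \<le> real (card U) + real (2 * A + 1)"
            using card_Un_le[of U "ball w"] bp(2) by linarith
          hence "\<kappa> * real (card ?U) \<le> \<kappa> * (real (card U) + real (2 * A + 1))" using \<kappa> by (rule mult_left_mono)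
          hence "\<kappa> * real (card ?U) \<le> \<kappa> * real (card U) + \<kappa> * real (2 * A + 1)" by (simp add: distrib_left)
          \<comment> \<open>The worth of a new root covers the charge for its ball, by
            \<open>root_gain\<close>.\<close>
          hence "0 - \<kappa> * real (card U) \<le> gainV 1 - \<kappa> * real (card ?U)" using root_gain g1 by linarith
          thus ?thesis unfolding bound_def v Nil using \<theta> by simp
        qed
        finally show ?thesis .
      next
        case (Cons it st')
        let ?g = "gain (ib it) (ii it)"
        have itok: "item_ok X U it" using ok(1) Cons by simp
        have fD: "finite (iD it)" "iD it \<subseteq> {..<n}" using itok finite_subset by (auto simp: item_ok_def)
        have z: "last (iv it) \<in> U" using item_last(1)[OF itok] .
        show ?thesis
        proof (cases "\<forall>y\<in>cand U. 0 < ?g y \<longrightarrow> y \<in> iD it")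
          case True
          have "state_ok st' U X" using 1(2) Cons by (auto simp: state_ok_def)
          have "fail st U X \<le> fail st' U X" using fav Cons by (intro fail_antimono) (auto simp: av_def)
          also have "\<dots> \<le> bound st' U"
            by (rule IH[OF \<open>state_ok st' U X\<close>]) (use Cons in auto)
          also have "\<dots> \<le> bound st U"
            using worth_pop[OF itok ok(4) Uu True] \<theta> Cons by (simp add: bound_def)
          finally show ?thesis .
        next
          case False
          then obtain y where y: "y \<in> cand U" "0 < ?g y" "y \<notin> iD it" by blast
          have yU: "y \<notin> U" "y < n"
            using y(1) V by (auto simp: cand_def candV_def ball_def)
          let ?it = "Item (iv it) (ib it) (ii it) (il it) (insert y (iD it))"
          let ?st1 = "?it # st'"
          let ?e = "{last (iv it), y}"
          let ?X = "insert ?e X"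
          note avq = av_query[OF 1(2)[unfolded Cons] yU(2,1) y(3)]
          have ok1: "state_ok ?st1 U X"
            using 1(2) Cons yU by (auto simp: state_ok_def item_ok_def)
          have ok1X: "\<forall>j\<in>set ?st1. item_ok ?X U j"
            using ok1 item_ok_mono[of X U _ ?X U] by (auto simp: state_ok_def)
          have sum_D: "(\<Sum>it\<leftarrow>?st1. n - card (iD it)) < (\<Sum>it\<leftarrow>st. n - card (iD it))"
          proof -
            have "card (insert y (iD it)) \<le> n" using card_mono[of "{..<n}" "insert y (iD it)"] fD yU by simp
            thus ?thesis using Cons y(3) fD by simp
          qed
          have f1: "fail ?st1 U X \<le> bound ?st1 U" by (rule IH[OF ok1]) (use sum_D in auto)
          define c where "c = p * ?g y / (1 + \<epsilon>)"
          have v1: "(\<Sum>it\<leftarrow>?st1. worth it) = (\<Sum>it\<leftarrow>st. worth it) - c"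
            using Cons y(3) fD by (simp add: worth_def c_def)
          have len_st: "length ?st1 \<le> 2 * A * length (iv it)" using ok(3) Cons by simp
          have dis1: "distinct (map (last \<circ> iv) ?st1)" "set (map (last \<circ> iv) ?st1) \<subseteq> U"
            using ok1 item_last(1)[of X U] z by (auto simp: state_ok_def)
          have so1: "stack_ok ?st1" using ok1 by (simp add: state_ok_def)
          \<comment> \<open>A hit in \<open>V\<close> pushes the ends of both arcs and uses the
            ball, a hit outside pushes one longer trail and uses one vertex; in both cases the added
            worth is the gain.\<close>
          obtain new W where new: "\<forall>j\<in>set new. last (iv j) \<in> W" "W \<inter> U = {}" "W \<subseteq> {..<n}" "W \<noteq> {}"
            "state_ok (new @ ?st1) (U \<union> W) ?X" "(\<Sum>j\<leftarrow>new. worth j) = ?g y" "card W \<le> 2 * A + 1"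
          proof (cases "y \<in> V")
            case True
            hence w: "y \<in> candV U" using y(1) by (auto simp: cand_def)
            have w': "y \<in> V" "y \<notin> short_verts H (2 * A)" "ball y \<inter> U = {}" using w by (auto simp: candV_def)
            note bp = ball_props[OF w'(1,2)]
            let ?new = "pushed (iv it) (ib it - 1) (il it) y"
            have ends: "set (map (last \<circ> iv) ?new) \<subseteq> ball y" using distinct_ends_pushed(2)[OF w] .
            have base: "trail ?X (iv it) (ib it - 1 + 1) (ii it) (il it) \<and> \<bar>ib it - 1 + 1\<bar> \<le> B \<and>
                set (iv it) \<subseteq> U \<and> {last (iv it), y} \<in> ?X"
              using itok trail_mono[of X _ _ _ _ ?X] by (auto simp: item_ok_def)
            note pi = pushed_item_ok[OF w _ disjI2[OF base]]
            have "state_ok (?new @ ?st1) (U \<union> ball y) ?X" unfolding state_ok_def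
            proof (intro conjI ballI)
              fix j assume "j \<in> set (?new @ ?st1)"
              thus "item_ok ?X (U \<union> ball y) j"
                using pi(1) ok1X item_ok_mono[of ?X U _ ?X "U \<union> ball y"] by auto
            next
              show "distinct (map (last \<circ> iv) (?new @ ?st1))"
                unfolding map_append distinct_append
                using distinct_ends_pushed(1)[OF w] dis1 ends w'(3) by blast
              show "stack_ok (?new @ ?st1)"
              proof (rule stack_ok_append[OF so1, where N = "2 * A * Suc (length (iv it))"])
                show "\<forall>j\<in>set ?new. 2 * A * Suc (length (iv it)) \<le> 2 * A * length (iv j)"
                  using pi(2) by (intro ballI mult_le_mono2) auto
                show "length ?st1 + length ?new \<le> 2 * A * Suc (length (iv it))"
                  using len_st length_pushed[of "iv it" "ib it - 1" "il it" y] by simp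
              qed
              show "U \<union> ball y \<subseteq> {..<n}" using ok(4) bp(1) V by auto
            qed
            moreover have "(\<Sum>j\<leftarrow>?new. worth j) = ?g y" using True worth_pushed by (simp add: gain_def)
            ultimately show thesis using ends bp V w'(3)
              by (intro that[of ?new "ball y"]) (auto simp: ball_def)
          next
            case False
            hence g: "?g y = P (ib it - 1) (Suc (ii it))" by (simp add: gain_def)
            \<comment> \<open>\<open>P\<close> vanishes outside the window, so a positive gain
              certifies that the new end is admissible.\<close>
            have val: "\<bar>ib it - 1\<bar> \<le> B" "Suc (ii it) < A" using y(2) P_outside[of "ib it - 1" "Suc (ii it)"] g
              by (auto simp: not_less not_le) (metis less_irrefl not_le)+
            let ?j = "Item (iv it @ [y]) (ib it - 1) (Suc (ii it)) (il it) {}"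
            have tr: "trail ?X (iv it) (ib it) (ii it) (il it)" "set (iv it) \<subseteq> U"
              using itok trail_mono[of X _ _ _ _ ?X] by (auto simp: item_ok_def)
            have trj: "trail ?X (iv it @ [y]) (ib it - 1) (Suc (ii it)) (il it)"
              by (rule trail.outside[OF tr(1)]) (use False tr(2) yU val in auto)
            have "state_ok ([?j] @ ?st1) (U \<union> {y}) ?X" unfolding state_ok_def
            proof (intro conjI ballI)
              fix k assume "k \<in> set ([?j] @ ?st1)"
              thus "item_ok ?X (U \<union> {y}) k"
                using trj tr(2) val ok1X item_ok_mono[of ?X U _ ?X "U \<union> {y}"] by (auto simp: item_ok_def[of _ _ ?j])
            next
              show "distinct (map (last \<circ> iv) ([?j] @ ?st1))"
                using dis1 yU by auto
              show "stack_ok ([?j] @ ?st1)"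
                by (rule stack_ok_append[OF so1, where N = "2 * A * Suc (length (iv it))"]) (use len_st A in auto)
              show "U \<union> {y} \<subseteq> {..<n}" using ok(4) yU by auto
            qed
            moreover have "(\<Sum>j\<leftarrow>[?j]. worth j) = ?g y" using g by (simp add: worth_def)
            ultimately show thesis using yU by (intro that[of "[?j]" "{y}"]) auto
          qed
          let ?st2 = "new @ ?st1" and ?U2 = "U \<union> W"
          have f2: "fail ?st2 ?U2 ?X \<le> bound ?st2 ?U2"
            by (rule IH[OF new(5)]) (use card_grow[OF new(3,2,4)] in auto)
          have "fail st U X \<le> p * fail ?st2 ?U2 ?X + (1 - p) * fail ?st1 U X"
            by (rule fail_step[OF fav, where e = ?e]) (use avq av_push[OF new(1-3)] Cons in auto)
          also have "\<dots> \<le> p * bound ?st2 ?U2 + (1 - p) * bound ?st1 U"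
            using f1 f2 p by (intro add_mono mult_left_mono) auto
          also have "\<dots> = p * exp (- \<theta> * ((\<Sum>it\<leftarrow>st. worth it) - c + ?g y - \<kappa> * real (card ?U2) + \<kappa> * u / 2))
              + (1 - p) * exp (- \<theta> * ((\<Sum>it\<leftarrow>st. worth it) - c - \<kappa> * real (card U) + \<kappa> * u / 2))"
          proof -
            have v2: "(\<Sum>it\<leftarrow>?st2. worth it) = (\<Sum>it\<leftarrow>st. worth it) - c + ?g y"
              using v1 new(6) by simp
            show ?thesis unfolding bound_def v1 v2 ..
          qed
          also have "\<dots> \<le> exp (- \<theta> * ((\<Sum>it\<leftarrow>st. worth it) - \<kappa> * real (card U) + \<kappa> * u / 2))"
          proof (rule query_bound)
            show "?g y = gainV (ib it) \<or> ?g y = P (ib it - 1) (Suc (ii it))" by (simp add: gain_def)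
            show "card ?U2 \<le> card U + (2 * A + 1)" using card_Un_le[of U W] new(7) by linarith
          qed (use y c_def in auto)
          also have "\<dots> = bound st U" by (simp add: bound_def)
          finally show ?thesis .
        qed
      qed
    qed
  qed
qed

text \<open>With an empty stack and no used vertex all pairs are available, and the potential is
  just the offset.\<close>

theorem long_trail_prob:
  "measure_pmf.prob (random_subset (complete_graph n) p) {G. \<not> long_trail G} \<le> exp (- \<theta> * (\<kappa> * u / 2))"
proof -
  have "av [] {} = complete_graph n"
    by (auto simp: av_def complete_graph_def card_2_iff)
  moreover have "state_ok [] {} {}" by (simp add: state_ok_def)
  ultimately show ?thesis using fail_bound[of "[]" "{}" "{}"] by (simp add: fail_def bound_def)
qed

end

subsection \<open>Switching along closed alternating trails\<close>

definition orbit_edges :: "('b \<Rightarrow> 'a) \<Rightarrow> ('b \<Rightarrow> 'b) \<Rightarrow> 'b set \<Rightarrow> 'a set set" where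
  "orbit_edges f nx J = (\<lambda>j. {f j, f (nx j)}) ` J"

text \<open>Closed trails given by a permutation \<open>nx\<close> of positions, possibly several at
  once, so that no cyclic order has to be written down. The last two conditions exclude loops and
  trails of length 2, which makes the edges of different positions distinct.\<close>

locale orbit =
  fixes f :: "nat \<Rightarrow> 'a" and nx :: "nat \<Rightarrow> nat" and J :: "nat set"
  assumes finJ: "finite J" and bij: "bij_betw nx J J" and inj: "inj_on f J"
    and nx1: "\<And>j. j \<in> J \<Longrightarrow> nx j \<noteq> j" and nx2: "\<And>j. j \<in> J \<Longrightarrow> nx (nx j) \<noteq> j"
begin

abbreviation "F \<equiv> orbit_edges f nx J"

lemma nxJ: "j \<in> J \<Longrightarrow> nx j \<in> J"
  using bij by (auto simp: bij_betw_def)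

lemma prev: assumes "j \<in> J" obtains i where "i \<in> J" "nx i = j"
  using bij assms by (metis bij_betw_def imageE)

lemma f_eq: "i \<in> J \<Longrightarrow> j \<in> J \<Longrightarrow> f i = f j \<longleftrightarrow> i = j"
  using inj by (auto simp: inj_on_def)

lemma inj_edges: "inj_on (\<lambda>j. {f j, f (nx j)}) J"
proof (rule inj_onI)
  fix i j assume ij: "i \<in> J" "j \<in> J" "{f i, f (nx i)} = {f j, f (nx j)}"
  hence "i = j \<or> (i = nx j \<and> nx i = j)"
    using f_eq nxJ by (auto simp: doubleton_eq_iff)
  thus "i = j" using nx2 ij by auto
qed

lemma card_edge: assumes "e \<in> F" shows "card e = 2 \<and> e \<subseteq> f ` J"
proof -
  obtain j where j: "j \<in> J" "e = {f j, f (nx j)}" using assms by (auto simp: orbit_edges_def)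
  have "f j \<noteq> f (nx j)" using f_eq[OF j(1) nxJ[OF j(1)]] nx1[OF j(1)] by auto
  thus ?thesis using j nxJ[OF j(1)] by auto
qed

lemma nb_edges:
  assumes "i \<in> J" "nx i = j"
  shows "nb F (f j) = {f i, f (nx j)}" "card (nb F (f j)) = 2"
proof -
  have j: "j \<in> J" using assms nxJ by auto
  have "x \<in> nb F (f j) \<longleftrightarrow> x \<in> {f i, f (nx j)}" for x
  proof -
    have "x \<in> nb F (f j) \<longleftrightarrow> (\<exists>k\<in>J. {f j, x} = {f k, f (nx k)})" by (auto simp: nb_def orbit_edges_def)
    also have "\<dots> \<longleftrightarrow> (\<exists>k\<in>J. (k = j \<and> x = f (nx k)) \<or> (nx k = j \<and> x = f k))"
      using f_eq nxJ j by (auto simp: doubleton_eq_iff)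
    also have "\<dots> \<longleftrightarrow> x = f (nx j) \<or> (\<exists>k\<in>J. nx k = j \<and> x = f k)" using j by auto
    also have "\<dots> \<longleftrightarrow> x = f (nx j) \<or> x = f i"
      using assms bij by (metis bij_betw_def inj_onD)
    finally show ?thesis by auto
  qed
  thus nb: "nb F (f j) = {f i, f (nx j)}" by blast
  have "i \<noteq> nx j" using nx2[OF assms(1)] assms(2) by auto
  thus "card (nb F (f j)) = 2" unfolding nb using f_eq[OF assms(1) nxJ[OF j]] by simp
qed

lemma nb_edges_outside: "v \<notin> f ` J \<Longrightarrow> nb F v = {}"
  using card_edge by (force simp: nb_def)

lemma Union_edges: "\<Union>F = f ` J"
  using card_edge by (auto simp: orbit_edges_def)

text \<open>A trail vertex of \<open>V\<close> loses one red edge and gains a blue one, or loses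
  both red edges and leaves the 2-factor; a trail vertex outside \<open>V\<close> gains two edges.
  Balance keeps the number of edges, which in a 2-regular graph is the number of vertices.\<close>

lemma switch:
  assumes H: "two_regular V H" and V: "finite V"
    and alt: "\<And>i. i \<in> J \<Longrightarrow> f (nx i) \<in> V \<Longrightarrow> {f i, f (nx i)} \<in> H \<or> {f (nx i), f (nx (nx i))} \<in> H"
    and bal: "(\<Sum>j\<in>J. if {f j, f (nx j)} \<in> H then 1 else -1 :: int) = 0"
  shows "\<exists>V'. V' \<subseteq> V \<union> f ` J \<and> card V' = card V \<and> two_regular V' (sym_diff H F)"
proof -
  let ?H = "sym_diff H F"
  have fH: "finite H" using two_regular_finite[OF V H] .
  have fF: "finite F" unfolding orbit_edges_def using finJ by simp
  have cF: "card (F \<inter> H) = card (F - H)"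
  proof -
    have "F \<inter> H = (\<lambda>j. {f j, f (nx j)}) ` {j \<in> J. {f j, f (nx j)} \<in> H}"
      "F - H = (\<lambda>j. {f j, f (nx j)}) ` {j \<in> J. {f j, f (nx j)} \<notin> H}"
      by (auto simp: orbit_edges_def)
    hence 1: "card (F \<inter> H) = card {j \<in> J. {f j, f (nx j)} \<in> H}" "card (F - H) = card {j \<in> J. {f j, f (nx j)} \<notin> H}"
      using inj_edges by (metis (no_types, lifting) card_image inj_on_subset mem_Collect_eq subsetI)+
    have "(\<Sum>j\<in>J. if {f j, f (nx j)} \<in> H then 1 else -1 :: int)
      = int (card {j \<in> J. {f j, f (nx j)} \<in> H}) - int (card {j \<in> J. {f j, f (nx j)} \<notin> H})"
      using finJ by (simp add: sum.If_cases Int_def Collect_neg_eq[symmetric])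
    thus ?thesis using bal 1 by simp
  qed
  define V' where "V' = {v \<in> V \<union> f ` J. nb ?H v \<noteq> {}}"
  have fV': "finite V'" using V finJ by (simp add: V'_def)
  have nbH: "nb ?H v = sym_diff (nb H v) (nb F v)" for v by (auto simp: nb_def)
  have c2: "card (nb ?H v) = 2" if v: "v \<in> V'" for v
  proof (cases "v \<in> f ` J")
    case False
    hence "v \<in> V" "nb ?H v = nb H v" using v nb_edges_outside[OF False] nbH by (auto simp: V'_def)
    thus ?thesis using H by (auto simp: two_regular_def)
  next
    case True
    then obtain j where j: "j \<in> J" "v = f j" by auto
    obtain i where i: "i \<in> J" "nx i = j" using prev[OF j(1)] .
    note nbF = nb_edges[OF i, folded j(2)]
    show ?thesis
    proof (cases "v \<in> V")
      case False
      hence "nb H v = {}" using nb_outside[OF H] by simp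
      thus ?thesis using nbH[of v] nbF(2) by simp
    next
      case True
      have c: "card (nb H v) = 2" "finite (nb H v)"
        using H True two_regular_finite_nb[OF H True] by (auto simp: two_regular_def)
      have fnF: "finite (nb F v)" using nbF(1) by simp
      \<comment> \<open>The trail enters or leaves \<open>v\<close> by a red edge. If both its edges
        there are red, nothing is left at \<open>v\<close>, which then does not belong to
        \<open>V'\<close>.\<close>
      have "nb H v \<inter> nb F v \<noteq> {}"
        using alt[OF i(1)] True i j nbF(1) by (auto simp: nb_def insert_commute)
      hence pos: "0 < card (nb H v \<inter> nb F v)" using c by (simp add: card_gt_0_iff)
      have ne: "nb ?H v \<noteq> {}" using v by (simp add: V'_def)
      have "card (nb H v \<inter> nb F v) \<noteq> 2"
      proof
        assume "card (nb H v \<inter> nb F v) = 2"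
        hence "nb H v \<inter> nb F v = nb H v" by (intro card_subset_eq[OF c(2)]) (use c in auto)
        moreover have "nb H v \<inter> nb F v = nb F v"
          using \<open>card (nb H v \<inter> nb F v) = 2\<close> by (intro card_subset_eq[OF fnF]) (use nbF(2) in auto)
        ultimately have "nb H v = nb F v" by blast
        thus False using ne nbH[of v] by auto
      qed
      moreover have "card (nb H v \<inter> nb F v) \<le> 2" using card_mono[OF c(2), of "nb H v \<inter> nb F v"] c by auto
      ultimately have one: "card (nb H v \<inter> nb F v) = 1" using pos by linarith
      have "card (nb ?H v) = card (nb H v - nb F v) + card (nb F v - nb H v)"
        unfolding nbH using c(2) fnF by (intro card_Un_disjoint) auto
      also have "card (nb H v - nb F v) = 1" using one c fnF by (simp add: card_Diff_subset_Int)
      also have "card (nb F v - nb H v) = 1"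
        using one nbF(2) fnF c by (simp add: card_Diff_subset_Int Int_commute)
      finally show ?thesis by simp
    qed
  qed
  have e2: "e \<subseteq> V' \<and> card e = 2" if e: "e \<in> ?H" for e
  proof -
    have ce: "card e = 2" "e \<subseteq> V \<union> f ` J" using e H card_edge by (auto simp: two_regular_def)
    have "v \<in> V'" if ve: "v \<in> e" for v
    proof -
      obtain x where "e = {v, x}" using edge_eq_nb[OF ce(1) ve] by metis
      hence "x \<in> nb ?H v" using e by (simp add: nb_def)
      thus ?thesis using ce ve by (auto simp: V'_def)
    qed
    thus ?thesis using ce by auto
  qed
  have reg: "two_regular V' ?H" using e2 c2 by (simp add: two_regular_def)
  have "card V' = card ?H" using card_two_regular[OF fV' reg] by simp
  also have "\<dots> = card (H - F) + card (F - H)" using fH fF by (intro card_Un_disjoint) auto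
  also have "\<dots> = card (H - F) + card (H \<inter> F)" using cF by (simp add: Int_commute)
  also have "\<dots> = card H" using fH by (metis add.commute card_Int_Diff)
  also have "\<dots> = card V" using card_two_regular[OF V H] .
  finally show ?thesis using reg by (intro exI[of _ V']) (auto simp: V'_def)
qed

end

subsection \<open>Long cycles in expanding digraphs\<close>

text \<open>Expansion for sets of size \<open>k\<close> only, which is all that a sparse random
  digraph offers.\<close>

definition joined :: "nat set \<Rightarrow> (nat \<Rightarrow> nat \<Rightarrow> bool) \<Rightarrow> nat \<Rightarrow> bool" where
  "joined M R k \<longleftrightarrow> (\<forall>A B. A \<subseteq> M \<longrightarrow> B \<subseteq> M \<longrightarrow> A \<inter> B = {} \<longrightarrow> card A = k \<longrightarrow> card B = k \<longrightarrow>
     (\<exists>a\<in>A. \<exists>b\<in>B. R a b))"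

lemma joined_ge:
  assumes "joined M R k" "A \<subseteq> M" "B \<subseteq> M" "A \<inter> B = {}" "k \<le> card A" "k \<le> card B" "finite M"
  shows "\<exists>a\<in>A. \<exists>b\<in>B. R a b"
proof -
  obtain A' where A': "A' \<subseteq> A" "card A' = k" using assms by (meson obtain_subset_with_card_n)
  obtain B' where B': "B' \<subseteq> B" "card B' = k" using assms by (meson obtain_subset_with_card_n)
  have "A' \<subseteq> M" "B' \<subseteq> M" "A' \<inter> B' = {}" using A' B' assms(2,3,4) by auto
  hence "\<exists>a\<in>A'. \<exists>b\<in>B'. R a b"
    using assms(1) A'(2) B'(2) unfolding joined_def by blast
  thus ?thesis using A' B' by blast
qed

text \<open>The state of a depth-first search halfway: \<open>P\<close> is the active path, \<open>D\<close> the finished vertices.\<close>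

lemma dfs_partition:
  assumes "finite S"
  shows "\<exists>P D T. distinct P \<and> set P \<union> D \<union> T = S \<and> set P \<inter> D = {} \<and> set P \<inter> T = {} \<and> D \<inter> T = {} \<and>
     (\<forall>i. Suc i < length P \<longrightarrow> R (P ! i) (P ! Suc i)) \<and> (\<forall>d\<in>D. \<forall>t\<in>T. \<not> R d t) \<and> card D = card T"
proof -
  define C where "C P D T \<longleftrightarrow> distinct P \<and> set P \<union> D \<union> T = S \<and> set P \<inter> D = {} \<and> set P \<inter> T = {} \<and> D \<inter> T = {} \<and>
     (\<forall>i. Suc i < length P \<longrightarrow> R (P ! i) (P ! Suc i)) \<and> (\<forall>d\<in>D. \<forall>t\<in>T. \<not> R d t)" for P D T
  \<comment> \<open>Each step of the search moves one vertex from \<open>T\<close> to the path or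
    from the path to \<open>D\<close>, so card T - card D falls by exactly one and meets 0.\<close>
  have "\<exists>P D T. C P D T \<and> card D = card T" if "C P D T" "card D \<le> card T" for P D T
    using that
  proof (induction "card T - card D" arbitrary: P D T)
    case 0
    thus ?case by (intro exI[of _ P] exI[of _ D] exI[of _ T]) auto
  next
    case (Suc m)
    have c: "distinct P" "set P \<union> D \<union> T = S" "set P \<inter> D = {}" "set P \<inter> T = {}" "D \<inter> T = {}"
     "\<And>i. Suc i < length P \<Longrightarrow> R (P ! i) (P ! Suc i)" "\<forall>d\<in>D. \<forall>t\<in>T. \<not> R d t"
      using Suc.prems(1) by (auto simp: C_def)
    have fin: "finite D" "finite T" using c(2) assms by (auto intro: finite_subset)
    have T: "T \<noteq> {}" using Suc.hyps(2) by auto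
    have ext: ?case if t: "t \<in> T" "P = [] \<or> R (last P) t" for t
    proof -
      have "R ((P @ [t]) ! i) ((P @ [t]) ! Suc i)" if i: "Suc i < length (P @ [t])" for i
      proof (cases "Suc i < length P")
        case True thus ?thesis using c(6) by (simp add: nth_append)
      next
        case False
        hence "Suc i = length P" using i by simp
        moreover have "P \<noteq> []" using calculation by auto
        moreover have "i = length P - 1" using calculation by simp
        ultimately show ?thesis using t(2) by (simp add: nth_append last_conv_nth)
      qed
      hence "C (P @ [t]) D (T - {t})" using c t unfolding C_def by auto
      moreover have "card (T - {t}) = card T - 1" using t fin by simp
      ultimately show ?thesis using Suc.hyps Suc.prems(2) by (intro Suc.hyps(1)[of "T - {t}" D "P @ [t]"]) auto
    qed
    show ?case
    proof (cases "P = []")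
      case True thus ?thesis using T ext by blast
    next
      case False
      show ?thesis
      proof (cases "\<exists>t\<in>T. R (last P) t")
        case True thus ?thesis using ext by blast
      next
        case no: False
        obtain Q x where Q: "P = Q @ [x]" using False by (metis rev_exhaust)
        have "R (Q ! i) (Q ! Suc i)" if "Suc i < length Q" for i
          using c(6)[of i] that Q by (simp add: nth_append)
        hence "C Q (insert x D) T" using c Q no unfolding C_def by auto
        moreover have "card (insert x D) = Suc (card D)" using c Q fin by auto
        ultimately show ?thesis using Suc.hyps Suc.prems(2) by (intro Suc.hyps(1)[of T "insert x D" Q]) auto
      qed
    qed
  qed
  moreover have "C [] {} S" by (simp add: C_def)
  ultimately have "\<exists>P D T. C P D T \<and> card D = card T" by (metis card.empty le0)
  thus ?thesis unfolding C_def by blast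
qed

text \<open>At the halfway point no arc leads from the finished to the untouched vertices, so there
  are fewer than \<open>k\<close> of either kind, and the path covers the rest. An arc from its last
  \<open>k\<close> to its first \<open>k\<close> vertices closes a cycle that omits at most
  \<open>2 * k\<close> more.\<close>

lemma joined_cycle:
  assumes J: "joined M R k" and M: "finite M" and S: "S \<subseteq> M" and k: "1 \<le> k" "4 * k \<le> card S"
  shows "\<exists>T \<sigma>. T \<subseteq> S \<and> card (S - T) \<le> 4 * k \<and> bij_betw \<sigma> T T \<and> (\<forall>g\<in>T. R g (\<sigma> g))"
proof -
  have fS: "finite S" using S M finite_subset by auto
  obtain P D T where P: "distinct P" "set P \<union> D \<union> T = S" "set P \<inter> D = {}" "set P \<inter> T = {}" "D \<inter> T = {}"
     "\<And>i. Suc i < length P \<Longrightarrow> R (P ! i) (P ! Suc i)" "\<forall>d\<in>D. \<forall>t\<in>T. \<not> R d t" "card D = card T"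
    using dfs_partition[OF fS, of R] by blast
  have fin: "finite D" "finite T" using P(2) fS by (auto intro: finite_subset)
  have "card D < k"
  proof (rule ccontr)
    assume "\<not> card D < k"
    hence "\<exists>a\<in>D. \<exists>b\<in>T. R a b" using P S by (intro joined_ge[OF J _ _ P(5) _ _ M]) auto
    thus False using P(7) by blast
  qed
  moreover have "card S = length P + card D + card T"
  proof -
    have "card S = card (set P \<union> D) + card T" unfolding P(2)[symmetric]
      using P fin by (intro card_Un_disjoint) auto
    also have "card (set P \<union> D) = card (set P) + card D" using P fin by (intro card_Un_disjoint) auto
    also have "card (set P) = length P" using P(1) by (rule distinct_card)
    finally show ?thesis by simp
  qed
  ultimately have len: "card S \<le> length P + 2 * k" "card S = length P + card D + card T" using P(8) by auto
  define N where "N = length P"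
  have Nk: "2 * k \<le> N" using len k by (simp add: N_def)
  have inj: "inj_on ((!) P) {..<N}" using P(1) by (auto simp: inj_on_def nth_eq_iff_index_eq N_def)
  have "\<exists>a\<in>(!) P ` {N - k..<N}. \<exists>b\<in>(!) P ` {..<k}. R a b"
  proof (rule joined_ge[OF J _ _ _ _ _ M])
    show "(!) P ` {N - k..<N} \<subseteq> M" "(!) P ` {..<k} \<subseteq> M"
      using P(2) S Nk by (auto simp: N_def)
    show "(!) P ` {N - k..<N} \<inter> (!) P ` {..<k} = {}"
      using Nk P(1) by (auto simp: nth_eq_iff_index_eq N_def)
    have "inj_on ((!) P) {N - k..<N}" by (rule inj_on_subset[OF inj]) auto
    moreover have "inj_on ((!) P) {..<k}" by (rule inj_on_subset[OF inj]) (use Nk k in auto)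
    ultimately show "k \<le> card ((!) P ` {N - k..<N})" "k \<le> card ((!) P ` {..<k})" using Nk by (auto simp: card_image)
  qed
  then obtain i j where ij: "N - k \<le> i" "i < N" "j < k" "R (P ! i) (P ! j)" by auto
  have jle: "j \<le> i" using ij Nk by linarith
  define I where "I = {j..i}"
  define T' where "T' = (!) P ` I"
  define pos where "pos = the_inv_into {..<N} ((!) P)"
  have pos: "pos (P ! a) = a" if "a < N" for a
    unfolding pos_def using inj that by (intro the_inv_into_f_f) auto
  define \<sigma> where "\<sigma> g = P ! (if pos g = i then j else Suc (pos g))" for g
  have \<sigma>: "\<sigma> (P ! a) = P ! (if a = i then j else Suc a)" if "a \<in> I" for a
    using pos[of a] that ij by (simp add: \<sigma>_def I_def)
  have injI: "inj_on ((!) P) I" by (rule inj_on_subset[OF inj]) (use ij in \<open>auto simp: I_def\<close>)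
  have T'S: "T' \<subseteq> set P" using ij by (auto simp: T'_def I_def N_def)
  have "bij_betw \<sigma> T' T'"
  proof -
    have sub: "\<sigma> ` T' \<subseteq> T'" using \<sigma> jle by (auto simp: T'_def I_def)
    have "T' \<subseteq> \<sigma> ` T'"
    proof
      fix g assume "g \<in> T'"
      then obtain a where a: "a \<in> I" "g = P ! a" by (auto simp: T'_def)
      show "g \<in> \<sigma> ` T'"
      proof (cases "a = j")
        case True
        have "i \<in> I" using jle by (simp add: I_def)
        thus ?thesis using \<sigma>[of i] True a unfolding T'_def by (metis (full_types) imageI)
      next
        case False
        hence "a - 1 \<in> I" "a - 1 \<noteq> i" "Suc (a - 1) = a" using a by (auto simp: I_def)
        thus ?thesis using \<sigma>[of "a - 1"] a by (auto simp: T'_def intro!: image_eqI[of _ \<sigma> "P ! (a - 1)"])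
      qed
    qed
    hence "\<sigma> ` T' = T'" using sub by blast
    moreover have "finite T'" by (simp add: T'_def I_def)
    ultimately show ?thesis using eq_card_imp_inj_on[of T' \<sigma>] by (simp add: bij_betw_def)
  qed
  moreover have "R g (\<sigma> g)" if "g \<in> T'" for g
  proof -
    obtain a where a: "a \<in> I" "g = P ! a" using \<open>g \<in> T'\<close> by (auto simp: T'_def)
    show ?thesis using \<sigma>[OF a(1)] a ij P(6)[of a] by (auto simp: I_def N_def)
  qed
  moreover have "T' \<subseteq> S" using T'S P(2) by auto
  moreover have "card (S - T') \<le> 4 * k"
  proof -
    have "card T' = card I" unfolding T'_def using injI by (rule card_image)
    also have "\<dots> = Suc i - j" by (simp add: I_def)
    finally have "N - 2 * k \<le> card T'" using ij by linarith
    moreover have "card (S - T') = card S - card T'" using \<open>T' \<subseteq> S\<close> fS by (intro card_Diff_subset) (auto intro: finite_subset)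
    ultimately show ?thesis using len N_def by linarith
  qed
  ultimately show ?thesis by blast
qed

lemma sum_power_card_Pow:
  fixes x :: real assumes "finite M" shows "(\<Sum>D\<in>Pow M. x ^ card D) = (1 + x) ^ card M"
  using assms
proof (induction M rule: finite_induct)
  case (insert a M)
  have "(\<Sum>D\<in>Pow (insert a M). x ^ card D) = (\<Sum>D\<in>Pow M. x ^ card D) + (\<Sum>D\<in>insert a ` Pow M. x ^ card D)"
    unfolding Pow_insert using insert by (intro sum.union_disjoint) auto
  also have "(\<Sum>D\<in>insert a ` Pow M. x ^ card D) = (\<Sum>D\<in>Pow M. x ^ card (insert a D))"
    using insert by (subst sum.reindex) (auto simp: inj_on_def)
  also have "\<dots> = (\<Sum>D\<in>Pow M. x * x ^ card D)"
  proof (rule sum.cong[OF refl])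
    fix D assume "D \<in> Pow M"
    hence "finite D" "a \<notin> D" using insert finite_subset by auto
    thus "x ^ card (insert a D) = x * x ^ card D" by simp
  qed
  finally show ?case using insert by (simp add: sum_distrib_left[symmetric] algebra_simps)
qed simp

text \<open>Chernoff bound: each set \<open>D\<close> is weighted by
  \<open>x ^ card D\<close>.\<close>

lemma card_small_subsets:
  fixes x :: real assumes M: "finite M" and x: "0 < x" "x \<le> 1"
  shows "real (card {D. D \<subseteq> M \<and> card D \<le> j}) * x ^ j \<le> (1 + x) ^ card M"
proof -
  have "real (card {D. D \<subseteq> M \<and> card D \<le> j}) * x ^ j = (\<Sum>D\<in>{D. D \<subseteq> M \<and> card D \<le> j}. x ^ j)" by simp
  also have "\<dots> \<le> (\<Sum>D\<in>{D. D \<subseteq> M \<and> card D \<le> j}. x ^ card D)"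
    using x by (intro sum_mono power_decreasing) auto
  also have "\<dots> \<le> (\<Sum>D\<in>Pow M. x ^ card D)" using M x by (intro sum_mono2) auto
  finally show ?thesis using sum_power_card_Pow[OF M] by simp
qed

text \<open>Every set of at least \<open>4 k\<close> points contains a cycle missing at most \<open>4 k\<close> of them, so the cycle
  sets together with few deleted points account for nearly all subsets.\<close>

lemma many_cycle_sets:
  assumes J: "joined M R k" and M: "finite M" and k: "1 \<le> k"
  defines "N \<equiv> card {D. D \<subseteq> M \<and> card D \<le> 4 * k}"
  defines "\<T> \<equiv> {T. T \<subseteq> M \<and> (\<exists>\<sigma>. bij_betw \<sigma> T T \<and> (\<forall>g\<in>T. R g (\<sigma> g)))}"
  shows "2 ^ card M \<le> (card \<T> + 1) * N"
proof -
  define \<S> where "\<S> = {S. S \<subseteq> M \<and> 4 * k \<le> card S}"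
  have "\<exists>T. T \<in> \<T> \<and> T \<subseteq> S \<and> card (S - T) \<le> 4 * k" if S: "S \<in> \<S>" for S
  proof -
    obtain T \<sigma> where "T \<subseteq> S" "card (S - T) \<le> 4 * k" "bij_betw \<sigma> T T" "\<forall>g\<in>T. R g (\<sigma> g)"
      using joined_cycle[OF J M _ k, of S] S by (auto simp: \<S>_def)
    thus ?thesis using S by (auto simp: \<T>_def \<S>_def)
  qed
  then obtain t where t: "\<And>S. S \<in> \<S> \<Longrightarrow> t S \<in> \<T> \<and> t S \<subseteq> S \<and> card (S - t S) \<le> 4 * k" by metis
  let ?D = "{D. D \<subseteq> M \<and> card D \<le> 4 * k}"
  have finD: "finite ?D" using M by simp
  have finT: "finite \<T>" using M by (simp add: \<T>_def)
  have "card \<S> \<le> card (\<T> \<times> ?D)"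
  proof (rule card_inj_on_le)
    show "inj_on (\<lambda>S. (t S, S - t S)) \<S>"
    proof (rule inj_onI)
      fix S S' assume s: "S \<in> \<S>" "S' \<in> \<S>" "(t S, S - t S) = (t S', S' - t S')"
      have "S = t S \<union> (S - t S)" "S' = t S' \<union> (S' - t S')" using t[OF s(1)] t[OF s(2)] by auto
      thus "S = S'" using s(3) by auto
    qed
    show "(\<lambda>S. (t S, S - t S)) ` \<S> \<subseteq> \<T> \<times> ?D" using t by (auto simp: \<S>_def)
    show "finite (\<T> \<times> ?D)" using finT finD by simp
  qed
  hence 1: "card \<S> \<le> card \<T> * N" by (simp add: card_cartesian_product N_def)
  have "Pow M \<subseteq> \<S> \<union> ?D" by (auto simp: \<S>_def)
  hence "card (Pow M) \<le> card (\<S> \<union> ?D)" using M by (intro card_mono) (auto simp: \<S>_def)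
  also have "\<dots> \<le> card \<S> + card ?D" by (rule card_Un_le)
  finally have "2 ^ card M \<le> card \<S> + N" using M by (simp add: card_Pow N_def)
  thus ?thesis using 1 by simp
qed

subsection \<open>Closing a long trail in many ways\<close>

definition bal :: "'a set set \<Rightarrow> 'a list \<Rightarrow> nat \<Rightarrow> int" where
  "bal H vs k = (\<Sum>j<k. if {vs ! j, vs ! Suc j} \<in> H then 1 else -1)"

definition alt_path :: "'a set set \<Rightarrow> 'a set \<Rightarrow> 'a set set \<Rightarrow> 'a list \<Rightarrow> bool" where
  "alt_path H V X vs \<longleftrightarrow> distinct vs \<and> path_in (H \<union> X) vs \<and>
     (\<forall>j. Suc (Suc j) < length vs \<longrightarrow> vs ! Suc j \<in> V \<longrightarrow>
        {vs ! j, vs ! Suc j} \<in> H \<or> {vs ! Suc j, vs ! Suc (Suc j)} \<in> H)"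

lemma bal_append1: "k < length vs \<Longrightarrow> bal H (vs @ ws) k = bal H vs k"
  unfolding bal_def by (intro sum.cong) (auto simp: nth_append)

lemma bal_append2:
  assumes "vs \<noteq> []" "r < length ws"
  shows "bal H (vs @ ws) (length vs + r) =
    bal H vs (length vs - 1) + (if {last vs, hd ws} \<in> H then 1 else -1) + bal H ws r"
  using assms(2)
proof (induction r)
  case 0
  obtain m where m: "length vs = Suc m" using assms(1) by (cases vs) auto
  have "bal H (vs @ ws) (length vs) = bal H (vs @ ws) (length vs - 1) +
     (if {(vs @ ws) ! (length vs - 1), (vs @ ws) ! length vs} \<in> H then 1 else -1)"
    by (simp add: m bal_def)
  also have "(vs @ ws) ! (length vs - 1) = last vs" using assms(1) by (simp add: nth_append last_conv_nth)
  also have "(vs @ ws) ! length vs = hd ws" using 0 by (simp add: nth_append hd_conv_nth)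
  also have "bal H (vs @ ws) (length vs - 1) = bal H vs (length vs - 1)" using assms(1) by (intro bal_append1) simp
  finally show ?case by (simp add: bal_def)
next
  case (Suc r)
  thus ?case by (simp add: bal_def nth_append)
qed

lemma bal_red: "path_in H rs \<Longrightarrow> r < length rs \<Longrightarrow> bal H rs r = int r"
  unfolding bal_def path_in_def by (induction r) auto

text \<open>The joining edge is not counted on as red, so an end in \<open>V\<close> on either side
  of it has to bring a red edge of its own.\<close>

lemma alt_path_append:
  assumes vs: "alt_path H V X vs" "vs \<noteq> []" and ws: "distinct ws" "set ws \<inter> set vs = {}" "ws \<noteq> []"
    "path_in H ws" and e: "{last vs, hd ws} \<in> X"
    and v: "last vs \<in> V \<Longrightarrow> 2 \<le> length vs \<and> {vs ! (length vs - 2), vs ! (length vs - 1)} \<in> H"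
    and w: "hd ws \<in> V \<Longrightarrow> 2 \<le> length ws"
  shows "alt_path H V X (vs @ ws)"
proof -
  let ?us = "vs @ ws" and ?l = "length vs"
  have l0: "0 < ?l" using vs(2) by simp
  have lnth: "vs ! (?l - 1) = last vs" "ws ! 0 = hd ws" using vs(2) ws(3) by (simp_all add: last_conv_nth hd_conv_nth)
  have edge: "{?us ! j, ?us ! Suc j} =
      (if Suc j < ?l then {vs ! j, vs ! Suc j} else if j = ?l - 1 then {last vs, hd ws} else {ws ! (j - ?l), ws ! Suc (j - ?l)})"
    if "Suc j < length ?us" for j
  proof -
    consider "Suc j < ?l" | "j = ?l - 1" "Suc j = ?l" | "?l \<le> j" using l0 by linarith
    thus ?thesis
    proof cases
      case 3
      hence "Suc j - ?l = Suc (j - ?l)" by simp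
      thus ?thesis using 3 l0 by (auto simp: nth_append)
    qed (use lnth in \<open>auto simp: nth_append\<close>)
  qed
  have p: "path_in (H \<union> X) ?us" unfolding path_in_def
  proof (intro allI impI)
    fix j assume j: "Suc j < length ?us"
    consider "Suc j < ?l" | "j = ?l - 1" "\<not> Suc j < ?l" | "?l \<le> j" "j \<noteq> ?l - 1" "\<not> Suc j < ?l" using l0 by linarith
    thus "{?us ! j, ?us ! Suc j} \<in> H \<union> X"
    proof cases
      case 1 thus ?thesis unfolding edge[OF j] using vs(1) by (auto simp: alt_path_def path_in_def)
    next
      case 2 thus ?thesis unfolding edge[OF j] using e by simp
    next
      case 3
      hence "Suc (j - ?l) < length ws" using j by auto
      hence "{ws ! (j - ?l), ws ! Suc (j - ?l)} \<in> H" using ws(4) unfolding path_in_def by blast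
      thus ?thesis unfolding edge[OF j] using 3 by simp
    qed
  qed
  have "{?us ! j, ?us ! Suc j} \<in> H \<or> {?us ! Suc j, ?us ! Suc (Suc j)} \<in> H"
    if j: "Suc (Suc j) < length ?us" "?us ! Suc j \<in> V" for j
  proof -
    consider "Suc (Suc j) < ?l" | "Suc (Suc j) = ?l" | "Suc j = ?l" | "?l \<le> j" by linarith
    thus ?thesis
    proof cases
      case 1
      thus ?thesis using vs(1) j by (auto simp: alt_path_def nth_append)
    next
      case 2
      hence "j = ?l - 2" "Suc j = ?l - 1" by auto
      moreover have "last vs \<in> V" using j(2) calculation lnth l0 by (simp add: nth_append)
      ultimately have "{vs ! j, vs ! Suc j} \<in> H" using v by simp
      thus ?thesis using 2 by (simp add: nth_append)
    next
      case 3
      have "hd ws \<in> V" using j(2) 3 lnth by (simp add: nth_append)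
      hence "Suc 0 < length ws" using w by simp
      hence "{ws ! 0, ws ! Suc 0} \<in> H" using ws(4) unfolding path_in_def by blast
      thus ?thesis using 3 by (simp add: nth_append)
    next
      case 4
      hence "Suc (j - ?l) < length ws" using j by auto
      hence "{ws ! (j - ?l), ws ! Suc (j - ?l)} \<in> H" using ws(4) unfolding path_in_def by blast
      thus ?thesis using 4 by (simp add: nth_append Suc_diff_le)
    qed
  qed
  moreover have "distinct ?us" using vs(1) ws by (auto simp: alt_path_def)
  ultimately show ?thesis using p by (auto simp: alt_path_def)
qed

lemma edge_append1: "Suc k < length vs \<Longrightarrow> {(vs @ ws) ! k, (vs @ ws) ! Suc k} = {vs ! k, vs ! Suc k}"
  by (simp add: nth_append)

definition (in exploration) marks_ok :: "nat list \<Rightarrow> (nat \<times> int) list \<Rightarrow> bool" where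
  "marks_ok vs Ls \<longleftrightarrow> sorted_wrt (\<lambda>x y. fst x + 2 \<le> fst y) Ls \<and>
     (\<forall>x\<in>set Ls. Suc (fst x) < length vs \<and> {vs ! fst x, vs ! Suc (fst x)} \<in> H \<and>
        bal H vs (fst x) = snd x \<and> \<bar>snd x\<bar> \<le> B + 1)"

lemma (in exploration) marks_ok_append:
  assumes "marks_ok vs Ls" shows "marks_ok (vs @ ws) Ls"
  using assms by (auto simp: marks_ok_def edge_append1 bal_append1)

text \<open>The last inequality makes the marks dense: a mark accounts for at most
  \<open>A + 1\<close> vertices of its red segment and \<open>A - 1\<close> vertices outside
  \<open>V\<close>, and the term \<open>A - 1 - i\<close> reserves room for the rest of the current
  excursion.\<close>

lemma (in exploration) trail_props:
  assumes "trail X vs \<beta> i Ls"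
  shows "alt_path H V X vs \<and> vs \<noteq> [] \<and> bal H vs (length vs - 1) = \<beta> \<and> i < A \<and>
    (i = 0 \<longrightarrow> 2 \<le> length vs \<and> {vs ! (length vs - 2), vs ! (length vs - 1)} \<in> H) \<and>
    (0 < i \<longrightarrow> last vs \<notin> V) \<and> marks_ok vs Ls \<and> length vs + (A - 1 - i) \<le> 2 * A * length Ls"
  using assms
proof (induction rule: trail.induct)
  case (root rs)
  have p: "{rs ! j, rs ! Suc j} \<in> H" if "Suc j < length rs" for j using root(1) that by (simp add: path_in_def)
  have "Suc (length rs - 2) = length rs - 1" using root(3) by simp
  hence "{rs ! (length rs - 2), rs ! (length rs - 1)} \<in> H" using p[of "length rs - 2"] root(3) by simp
  moreover have "bal H rs (length rs - 1) = int (length rs) - 1" using bal_red[OF root(1), of "length rs - 1"] root(3) by simp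
  ultimately show ?case using root A B p
    by (auto simp: alt_path_def path_in_def marks_ok_def bal_def)
next
  case (outside vs \<beta> i Ls y)
  have IH: "alt_path H V X vs" "vs \<noteq> []" "bal H vs (length vs - 1) = \<beta>"
    "i = 0 \<Longrightarrow> 2 \<le> length vs \<and> {vs ! (length vs - 2), vs ! (length vs - 1)} \<in> H"
    "0 < i \<Longrightarrow> last vs \<notin> V" "marks_ok vs Ls" "length vs + (A - 1 - i) \<le> 2 * A * length Ls"
    using outside.IH by auto
  have yH: "{last vs, y} \<notin> H" using outside(2) H by (auto simp: two_regular_def)
  have "alt_path H V X (vs @ [y])"
    by (rule alt_path_append[OF IH(1,2)]) (use IH(4,5) outside in \<open>auto simp: path_in_def\<close>)
  moreover have "bal H (vs @ [y]) (length vs + 0) = \<beta> - 1"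
    using bal_append2[OF IH(2), of 0 "[y]" H] IH(3) yH by (simp add: bal_def)
  ultimately show ?case using marks_ok_append[OF IH(6), of "[y]"] IH(7) outside(2,5) by auto
next
  case (landing vs \<beta> i Ls rs)
  have IH: "alt_path H V X vs" "vs \<noteq> []" "bal H vs (length vs - 1) = \<beta>"
    "i = 0 \<Longrightarrow> 2 \<le> length vs \<and> {vs ! (length vs - 2), vs ! (length vs - 1)} \<in> H"
    "0 < i \<Longrightarrow> last vs \<notin> V" "marks_ok vs Ls" "length vs + (A - 1 - i) \<le> 2 * A * length Ls" "i < A"
    using landing.IH by auto
  have rs0: "rs \<noteq> []" using landing by auto
  have p: "{rs ! j, rs ! Suc j} \<in> H" if "Suc j < length rs" for j using landing(2) that by (simp add: path_in_def)
  have alt: "alt_path H V X (vs @ rs)"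
    by (rule alt_path_append[OF IH(1,2)]) (use IH(4,5) landing rs0 in auto)
  have b: "bal H (vs @ rs) (length vs + r) = \<beta> - 1 + int r" if "r < length rs" for r
    using bal_append2[OF IH(2) that, of H] IH(3) landing(8) bal_red[OF landing(2) that] by simp
  have lst: "{(vs @ rs) ! (length (vs @ rs) - 2), (vs @ rs) ! (length (vs @ rs) - 1)} \<in> H"
  proof -
    obtain r where r: "length rs = Suc (Suc r)" using landing(4) by (metis add_2_eq_Suc le_Suc_ex)
    have "length (vs @ rs) - 2 = length vs + r" "length (vs @ rs) - 1 = length vs + Suc r"
      using r by auto
    thus ?thesis using p[of r] r by (simp only: nth_append_length_plus)
  qed
  have e0: "{(vs @ rs) ! length vs, (vs @ rs) ! Suc (length vs)} \<in> H"
    using p[of 0] landing(4) by (simp add: nth_append)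
  have bl: "bal H (vs @ rs) (length (vs @ rs) - 1) = \<beta> - 1 + (int (length rs) - 1)"
  proof -
    have "length (vs @ rs) - 1 = length vs + (length rs - 1)" using rs0 by (cases rs) auto
    thus ?thesis using b[of "length rs - 1"] landing(4) by simp
  qed
  have m: "marks_ok (vs @ rs) (Ls @ [(length vs, \<beta> - 1)])"
    using marks_ok_append[OF IH(6), of rs] IH(6) e0 b[of 0] landing(4,9) rs0
    by (auto simp: marks_ok_def sorted_wrt_append) 
  have "length (vs @ rs) + (A - 1 - 0) \<le> 2 * A * length (Ls @ [(length vs, \<beta> - 1)])"
    using IH(7) landing(5) A by simp
  thus ?case using alt IH(2) bl lst m A landing(4) by simp
qed

lemma pigeonhole_marks:
  assumes "\<forall>x\<in>set Ls. \<bar>snd x\<bar> \<le> (C::int)" "0 \<le> C" "sorted_wrt (\<lambda>x y. fst x + 2 \<le> (fst y :: nat)) Ls"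
  obtains b ks where "sorted_wrt (\<lambda>x y. x + 2 \<le> y) ks" "\<forall>k\<in>set ks. (k, b) \<in> set Ls"
    "length Ls \<le> nat (2 * C + 1) * length ks"
proof -
  define cnt where "cnt b = length (filter (\<lambda>x. snd x = b) Ls)" for b
  have "length Ls = (\<Sum>b\<in>{-C..C}. length (filter (\<lambda>x. snd x = b) Ls))"
    using assms(1)
  proof (induction Ls)
    case (Cons a Ls)
    hence a: "snd a \<in> {-C..C}" by auto
    have "(\<Sum>b\<in>{-C..C}. length (filter (\<lambda>x. snd x = b) (a # Ls)))
       = (\<Sum>b\<in>{-C..C}. (if b = snd a then 1 else 0) + length (filter (\<lambda>x. snd x = b) Ls))"
      by (intro sum.cong) auto
    also have "\<dots> = 1 + (\<Sum>b\<in>{-C..C}. length (filter (\<lambda>x. snd x = b) Ls))"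
      using a by (simp add: sum.distrib)
    also have "\<dots> = length (a # Ls)" using Cons by simp
    finally show ?case by (rule sym)
  qed simp
  hence "length Ls = (\<Sum>b\<in>{-C..C}. cnt b)" by (simp only: cnt_def)
  moreover have "\<exists>b\<in>{-C..C}. (\<Sum>b\<in>{-C..C}. cnt b) \<le> nat (2 * C + 1) * cnt b"
  proof (rule ccontr)
    assume a: "\<not> ?thesis"
    define S where "S = (\<Sum>b\<in>{-C..C}. cnt b)"
    have c: "card {-C..C} = nat (2 * C + 1)" using assms(2) by simp
    have "(\<Sum>b\<in>{-C..C}. nat (2 * C + 1) * cnt b) < (\<Sum>b\<in>{-C..C}. S)"
      by (rule sum_strict_mono) (use a assms(2) in \<open>auto simp: S_def not_le\<close>)
    thus False using c by (simp add: S_def sum_distrib_left)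
  qed
  ultimately obtain b where b: "length Ls \<le> nat (2 * C + 1) * cnt b" by auto
  let ?ks = "map fst (filter (\<lambda>x. snd x = b) Ls)"
  have "sorted_wrt (\<lambda>x y. x + 2 \<le> y) ?ks"
    using sorted_wrt_filter[OF assms(3)] by (simp add: sorted_wrt_map)
  thus thesis using b by (intro that[of ?ks b]) (auto simp: cnt_def)
qed

text \<open>The marks are red edges at positions of equal balance, in \<open>M\<close> consecutive groups of \<open>2 D\<close>. A blue edge
  from the far end of a mark in the second half of one group to the near end of a mark in the first
  half of another links the groups. A path segment from a first half to the far end of a mark in the
  second half has balance 1, which the blue link cancels, so a cycle of links is a balanced closed trail.\<close>

locale marked_path =
  fixes n :: nat and V :: "nat set" and H X :: "nat set set" and vs :: "nat list" and ks :: "nat list"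
    and b :: int and D M :: nat
  assumes H: "two_regular V H" and V: "V \<subseteq> {..<n}" and alt: "alt_path H V X vs" and vsn: "set vs \<subseteq> {..<n}"
    and ks: "sorted_wrt (\<lambda>x y. x + 2 \<le> y) ks"
    and mark: "\<And>k. k \<in> set ks \<Longrightarrow> Suc k < length vs \<and> {vs ! k, vs ! Suc k} \<in> H \<and> bal H vs k = b"
    and D: "1 \<le> D" and M: "2 * D * M \<le> length ks"
begin

definition ins :: "nat \<Rightarrow> nat set" where "ins g = (\<lambda>j. ks ! (2 * D * g + j)) ` {..<D}"
definition outs :: "nat \<Rightarrow> nat set" where "outs g = (\<lambda>j. ks ! (2 * D * g + D + j)) ` {..<D}"

definition link :: "nat set set \<Rightarrow> nat \<Rightarrow> nat \<Rightarrow> bool" where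
  "link Y g h \<longleftrightarrow> (\<exists>x\<in>outs g. \<exists>i\<in>ins h. {vs ! Suc x, vs ! i} \<in> Y - H)"

lemma ks_less: "i < j \<Longrightarrow> j < length ks \<Longrightarrow> ks ! i + 2 \<le> ks ! j"
  using ks sorted_wrt_nth_less by blast

lemma ks_inj: "i < length ks \<Longrightarrow> j < length ks \<Longrightarrow> ks ! i = ks ! j \<longleftrightarrow> i = j"
  using ks_less[of i j] ks_less[of j i] by (cases i j rule: linorder_cases) auto

text \<open>Marks are at least two apart, so the far end of a marked edge is never itself a
  mark.\<close>

lemma Suc_notin_ks: "k \<in> set ks \<Longrightarrow> Suc k \<notin> set ks"
proof
  assume "k \<in> set ks" "Suc k \<in> set ks"
  then obtain i j where "i < length ks" "j < length ks" "ks ! i = k" "ks ! j = Suc k" by (metis in_set_conv_nth)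
  thus False using ks_less[of i j] ks_less[of j i] by (cases i j rule: linorder_cases) auto
qed

lemma group_bound: assumes "g < M" "j < 2 * D" shows "2 * D * g + j < length ks"
proof -
  have "2 * D * g + j < 2 * D * Suc g" using assms(2) by simp
  also have "\<dots> \<le> 2 * D * M" using assms(1) by (intro mult_le_mono2) simp
  finally show ?thesis using M by simp
qed

lemma ins_ks: "g < M \<Longrightarrow> ins g \<subseteq> set ks" and outs_ks: "g < M \<Longrightarrow> outs g \<subseteq> set ks"
  using group_bound[of g] by (auto simp: ins_def outs_def add.assoc)

lemma ins_index: assumes "i \<in> ins g" obtains j where "j < D" "i = ks ! (2 * D * g + j)"
  using assms by (auto simp: ins_def)
lemma outs_index: assumes "i \<in> outs g" obtains j where "D \<le> j" "j < 2 * D" "i = ks ! (2 * D * g + j)"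
proof -
  obtain j where "j < D" "i = ks ! (2 * D * g + D + j)" using assms by (auto simp: outs_def)
  thus thesis by (intro that[of "D + j"]) (auto simp: add.assoc)
qed

lemma group_index: assumes "i \<in> ins g \<union> outs g" obtains j where "j < 2 * D" "i = ks ! (2 * D * g + j)"
proof (cases "i \<in> ins g")
  case True
  then obtain j where "j < D" "i = ks ! (2 * D * g + j)" by (rule ins_index)
  thus thesis by (intro that[of j]) auto
next
  case False
  hence "i \<in> outs g" using assms by simp
  then obtain j where "D \<le> j" "j < 2 * D" "i = ks ! (2 * D * g + j)" by (rule outs_index)
  thus thesis by (intro that[of j]) auto
qed

lemma in_less_out: assumes "g < M" "i \<in> ins g" "x \<in> outs g" shows "i < x"
proof -
  obtain j where j: "j < D" "i = ks ! (2 * D * g + j)" using ins_index[OF assms(2)] .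
  obtain j' where j': "D \<le> j'" "j' < 2 * D" "x = ks ! (2 * D * g + j')" using outs_index[OF assms(3)] .
  show ?thesis using ks_less[of "2 * D * g + j" "2 * D * g + j'"] group_bound[OF assms(1) j'(2)] j j' by simp
qed

lemma group_less:
  assumes "g < h" "h < M" "i \<in> ins g \<union> outs g" "x \<in> ins h \<union> outs h" shows "Suc i < x"
proof -
  obtain j where j: "j < 2 * D" "i = ks ! (2 * D * g + j)" using group_index[OF assms(3)] .
  obtain j' where j': "j' < 2 * D" "x = ks ! (2 * D * h + j')" using group_index[OF assms(4)] .
  have "2 * D * g + j < 2 * D * Suc g" using j(1) by simp
  also have "\<dots> \<le> 2 * D * h" using assms(1) by (intro mult_le_mono2) simp
  finally have "2 * D * g + j < 2 * D * h + j'" by simp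
  from ks_less[OF this group_bound[OF assms(2) j'(1)]] show ?thesis using j j' by simp
qed

lemma in_neq_out: assumes "g < M" "h < M" "i \<in> ins g" "x \<in> outs h" shows "i \<noteq> x"
  using in_less_out[of g i x] group_less[of g h i x] group_less[of h g x i] assms
  by (cases g h rule: linorder_cases) auto

lemma card_ins: "g < M \<Longrightarrow> card (ins g) = D" and card_outs: "g < M \<Longrightarrow> card (outs g) = D"
proof -
  assume g: "g < M"
  have "inj_on (\<lambda>j. ks ! (2 * D * g + j)) {..<D}"
    using group_bound[OF g] by (auto simp: inj_on_def ks_inj)
  thus "card (ins g) = D" by (simp add: ins_def card_image)
  have "inj_on (\<lambda>j. ks ! (2 * D * g + D + j)) {..<D}"
    using group_bound[OF g] by (auto simp: inj_on_def ks_inj add.assoc)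
  thus "card (outs g) = D" by (simp add: outs_def card_image)
qed

lemma vs_inj: "i < length vs \<Longrightarrow> j < length vs \<Longrightarrow> vs ! i = vs ! j \<longleftrightarrow> i = j"
  using alt by (auto simp: alt_path_def nth_eq_iff_index_eq)

text \<open>The trail has one block for each group in \<open>T\<close>, from an \<open>ins\<close>
  position to the far end of an \<open>outs\<close> mark, and links jump from block to block as
  \<sigma> prescribes. A block meets only marks of its own group, so \<open>T\<close> can be read
  off from the changed edges; different sets \<open>T\<close> therefore give different
  2-factors.\<close>

theorem switch_cycle_set:
  assumes T: "T \<subseteq> {..<M}" and \<sigma>: "bij_betw \<sigma> T T" and lk: "\<forall>g\<in>T. link Y g (\<sigma> g)"
  shows "\<exists>V' H'. V' \<subseteq> {..<n} \<and> card V' = card V \<and> two_regular V' H' \<and> H' \<subseteq> H \<union> X \<union> Y \<and>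
    T = {g. g < M \<and> (\<exists>i\<in>ins g. vs ! i \<in> \<Union>(sym_diff H H'))}"
proof -
  have "\<forall>g\<in>T. \<exists>xi. fst xi \<in> outs g \<and> snd xi \<in> ins (\<sigma> g) \<and> {vs ! Suc (fst xi), vs ! snd xi} \<in> Y - H"
    using lk unfolding link_def by fastforce
  then obtain ch where ch: "\<forall>g\<in>T. fst (ch g) \<in> outs g \<and> snd (ch g) \<in> ins (\<sigma> g) \<and> {vs ! Suc (fst (ch g)), vs ! snd (ch g)} \<in> Y - H"
    by metis
  define ou where "ou g = fst (ch g)" for g
  define \<tau> where "\<tau> = the_inv_into T \<sigma>"
  define inn where "inn g = snd (ch (\<tau> g))" for g
  have \<sigma>T: "\<sigma> g \<in> T" and \<tau>\<sigma>: "\<tau> (\<sigma> g) = g" if "g \<in> T" for g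
    using \<sigma> that by (auto simp: bij_betw_def \<tau>_def the_inv_into_f_f)
  have \<tau>T: "\<tau> g \<in> T" and \<sigma>\<tau>: "\<sigma> (\<tau> g) = g" if "g \<in> T" for g
    using \<sigma> that by (auto simp: bij_betw_def \<tau>_def the_inv_into_into f_the_inv_into_f)
  have TM: "g < M" if "g \<in> T" for g using T that by auto
  have ou: "ou g \<in> outs g" if "g \<in> T" for g using ch that by (simp add: ou_def)
  have inn: "inn g \<in> ins g" if "g \<in> T" for g using ch \<tau>T[OF that] \<sigma>\<tau>[OF that] by (auto simp: inn_def)
  have lnk: "{vs ! Suc (ou g), vs ! inn (\<sigma> g)} \<in> Y - H" if "g \<in> T" for g
    using ch that \<tau>\<sigma>[OF that] by (simp add: ou_def inn_def)
  have ouk: "ou g \<in> set ks" and innk: "inn g \<in> set ks" if "g \<in> T" for g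
    using ou[OF that] inn[OF that] ins_ks outs_ks TM[OF that] by auto
  have io: "inn g < ou g" if "g \<in> T" for g using in_less_out[OF TM[OF that] inn[OF that] ou[OF that]] .
  have blk: "Suc (ou g) < inn h" if "g \<in> T" "h \<in> T" "g < h" for g h
    using group_less[OF that(3) TM[OF that(2)]] ou[OF that(1)] inn[OF that(2)] by blast
  define blo where "blo g = {inn g..Suc (ou g)}" for g
  define J where "J = (\<Union>g\<in>T. blo g)"
  have disj: "blo g \<inter> blo h = {}" if "g \<in> T" "h \<in> T" "g \<noteq> h" for g h
    using blk[OF that(1,2)] blk[OF that(2,1)] that(3) by (cases g h rule: linorder_cases) (auto simp: blo_def)
  have finT: "finite T" using T finite_subset by auto
  have finJ: "finite J" using finT by (auto simp: J_def blo_def)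
  have Jlen: "j < length vs" if jJ: "j \<in> J" for j
  proof -
    obtain g where "g \<in> T" "j \<le> Suc (ou g)" using jJ by (auto simp: J_def blo_def)
    thus ?thesis using mark[OF ouk[of g]] by auto
  qed
  \<comment> \<open>Inside a block the path is followed; the end of a block jumps to the block of
    the linked group. \<open>Suc (ou g)\<close> is never a mark, which keeps the ends of blocks
    apart from their starts.\<close>
  define nx where "nx j = (if \<exists>g\<in>T. j = Suc (ou g) then inn (\<sigma> (THE g. g \<in> T \<and> j = Suc (ou g))) else Suc j)" for j
  have ou_inj: "g = h" if "g \<in> T" "h \<in> T" "ou g = ou h" for g h
  proof (rule ccontr)
    assume "g \<noteq> h"
    hence "blo g \<inter> blo h = {}" using disj that by blast
    moreover have "ou g \<in> blo g" "ou h \<in> blo h"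
      using io[OF that(1)] io[OF that(2)] by (simp_all add: blo_def)
    ultimately show False using that(3) by auto
  qed
  have nx_out: "nx (Suc (ou g)) = inn (\<sigma> g)" if g: "g \<in> T" for g
  proof -
    have "(THE h. h \<in> T \<and> Suc (ou g) = Suc (ou h)) = g" using ou_inj g by (intro the_equality) auto
    thus ?thesis using g by (auto simp: nx_def)
  qed
  have nx_Suc: "nx j = Suc j" if "\<forall>g\<in>T. j \<noteq> Suc (ou g)" for j using that by (auto simp: nx_def)
  have nx_ks: "nx k = Suc k" if "k \<in> set ks" for k
    using Suc_notin_ks[OF ouk] that by (intro nx_Suc) auto
  have jblo: "j \<noteq> Suc (ou h)" if "g \<in> T" "h \<in> T" "j \<in> blo g" "j \<noteq> Suc (ou g)" for g h j
    using disj[of g h] that io[of h] by (cases "g = h") (auto simp: blo_def)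
  have nxJ: "nx j \<in> J" if jJ: "j \<in> J" for j
  proof -
    obtain g where g: "g \<in> T" "j \<in> blo g" using jJ by (auto simp: J_def)
    show ?thesis
    proof (cases "j = Suc (ou g)")
      case True
      have "inn (\<sigma> g) \<in> blo (\<sigma> g)" using io[OF \<sigma>T[OF g(1)]] by (simp add: blo_def)
      thus ?thesis using True nx_out[OF g(1)] \<sigma>T[OF g(1)] by (auto simp: J_def)
    next
      case False
      hence "nx j = Suc j" using jblo[OF g(1) _ g(2)] by (intro nx_Suc) blast
      moreover have "Suc j \<in> blo g" using False g(2) by (auto simp: blo_def)
      ultimately show ?thesis using g by (auto simp: J_def)
    qed
  qed
  have bijnx: "bij_betw nx J J"
  proof -
    have "J \<subseteq> nx ` J"
    proof
      fix j assume "j \<in> J"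
      then obtain g where g: "g \<in> T" "j \<in> blo g" by (auto simp: J_def)
      show "j \<in> nx ` J"
      proof (cases "j = inn g")
        case True
        have "Suc (ou (\<tau> g)) \<in> blo (\<tau> g)" using io[OF \<tau>T[OF g(1)]] by (simp add: blo_def)
        hence "Suc (ou (\<tau> g)) \<in> J" using \<tau>T[OF g(1)] by (auto simp: J_def)
        moreover have "nx (Suc (ou (\<tau> g))) = j" using nx_out[OF \<tau>T[OF g(1)]] \<sigma>\<tau>[OF g(1)] True by simp
        ultimately show ?thesis by blast
      next
        case False
        hence p: "j - 1 \<in> blo g" "Suc (j - 1) = j" "j - 1 \<noteq> Suc (ou g)" using g(2) by (auto simp: blo_def)
        hence "nx (j - 1) = j" using jblo[OF g(1) _ p(1)] nx_Suc[of "j - 1"] by fastforce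
        moreover have "j - 1 \<in> J" using p g by (auto simp: J_def)
        ultimately show ?thesis by (metis imageI)
      qed
    qed
    hence "nx ` J = J" using nxJ by blast
    thus ?thesis using eq_card_imp_inj_on[OF finJ, of nx] by (simp add: bij_betw_def)
  qed
  have inn_out: "inn g \<noteq> ou h" if "g \<in> T" "h \<in> T" for g h
    using in_neq_out[OF TM[OF that(1)] TM[OF that(2)] inn[OF that(1)] ou[OF that(2)]] .
  have inn_Suc: "inn g \<noteq> Suc (ou h)" if "g \<in> T" "h \<in> T" for g h
    using Suc_notin_ks[OF ouk[OF that(2)]] innk[OF that(1)] by auto
  interpret o: orbit "(!) vs" nx J
  proof
    show "finite J" "bij_betw nx J J" by fact+
    show "inj_on ((!) vs) J" using Jlen vs_inj by (auto simp: inj_on_def)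
    fix j assume "j \<in> J"
    then obtain g where g: "g \<in> T" "j \<in> blo g" by (auto simp: J_def)
    show "nx j \<noteq> j"
    proof (cases "j = Suc (ou g)")
      case True thus ?thesis using nx_out[OF g(1)] inn_Suc[OF \<sigma>T[OF g(1)] g(1)] by simp
    next
      case False
      hence "nx j = Suc j" using jblo[OF g(1) _ g(2)] by (intro nx_Suc) blast
      thus ?thesis by simp
    qed
    show "nx (nx j) \<noteq> j"
    proof (cases "j = Suc (ou g)")
      case True
      have "nx (inn (\<sigma> g)) = Suc (inn (\<sigma> g))" using innk[OF \<sigma>T[OF g(1)]] by (rule nx_ks)
      thus ?thesis using True nx_out[OF g(1)] inn_out[OF \<sigma>T[OF g(1)] g(1)] by simp
    next
      case False
      hence e: "nx j = Suc j" using jblo[OF g(1) _ g(2)] by (intro nx_Suc) blast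
      show ?thesis
      proof (cases "\<exists>h\<in>T. Suc j = Suc (ou h)")
        case True
        then obtain h where "h \<in> T" "j = ou h" by auto
        thus ?thesis using e nx_out[of h] inn_out[OF \<sigma>T] by simp
      next
        case False thus ?thesis using e nx_Suc[of "Suc j"] by simp
      qed
    qed
  qed
  have edge_path: "{vs ! j, vs ! Suc j} \<in> H \<union> X" if "Suc j < length vs" for j
    using alt that by (auto simp: alt_path_def path_in_def)
  have FY: "o.F \<subseteq> H \<union> X \<union> Y"
  proof
    fix e assume "e \<in> o.F"
    then obtain j where j: "j \<in> J" "e = {vs ! j, vs ! nx j}" by (auto simp: orbit_edges_def)
    then obtain g where g: "g \<in> T" "j \<in> blo g" by (auto simp: J_def)
    show "e \<in> H \<union> X \<union> Y"
    proof (cases "j = Suc (ou g)")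
      case True thus ?thesis using j nx_out[OF g(1)] lnk[OF g(1)] by simp
    next
      case False
      hence e: "nx j = Suc j" using jblo[OF g(1) _ g(2)] by (intro nx_Suc) blast
      have "Suc j < length vs" using Jlen[OF nxJ[OF j(1)]] e by simp
      thus ?thesis using edge_path[of j] j e by auto
    qed
  qed
  let ?c = "\<lambda>j. if {vs ! j, vs ! nx j} \<in> H then 1 else -1 :: int"
  \<comment> \<open>From balance \<open>b\<close> at its entry to \<open>b + 1\<close> behind the
    red mark at its exit, each block contributes 1, and the blue link takes it back.\<close>
  have sumJ: "(\<Sum>j\<in>J. ?c j) = 0"
  proof -
    have "(\<Sum>j\<in>J. ?c j) = (\<Sum>g\<in>T. \<Sum>j\<in>blo g. ?c j)"
      unfolding J_def by (rule sum.UNION_disjoint) (use finT disj in \<open>auto simp: blo_def\<close>)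
    also have "\<dots> = (\<Sum>g\<in>T. 0)"
    proof (rule sum.cong[OF refl])
      fix g assume g: "g \<in> T"
      have b1: "blo g = insert (Suc (ou g)) {inn g..<Suc (ou g)}" using io[OF g] by (auto simp: blo_def)
      have "(\<Sum>j\<in>blo g. ?c j) = ?c (Suc (ou g)) + (\<Sum>j\<in>{inn g..<Suc (ou g)}. ?c j)"
        unfolding b1 by simp
      also have "?c (Suc (ou g)) = -1" using nx_out[OF g] lnk[OF g] by simp
      also have "(\<Sum>j\<in>{inn g..<Suc (ou g)}. ?c j) = (\<Sum>j\<in>{inn g..<Suc (ou g)}. if {vs ! j, vs ! Suc j} \<in> H then 1 else -1)"
      proof (rule sum.cong[OF refl])
        fix j assume j: "j \<in> {inn g..<Suc (ou g)}"
        hence "j \<in> blo g" "j \<noteq> Suc (ou g)" by (auto simp: blo_def)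
        hence "nx j = Suc j" using jblo[OF g] by (intro nx_Suc) blast
        thus "?c j = (if {vs ! j, vs ! Suc j} \<in> H then 1 else -1)" by simp
      qed
      also have "\<dots> = bal H vs (Suc (ou g)) - bal H vs (inn g)"
      proof -
        have "{..<Suc (ou g)} = {..<inn g} \<union> {inn g..<Suc (ou g)}" using io[OF g] by auto
        thus ?thesis unfolding bal_def by (simp only: sum.union_disjoint[of "{..<inn g}" "{inn g..<Suc (ou g)}"] finite_lessThan finite_atLeastLessThan ivl_disj_int)
      qed
      also have "bal H vs (Suc (ou g)) = b + 1" using mark[OF ouk[OF g]] by (simp add: bal_def)
      also have "bal H vs (inn g) = b" using mark[OF innk[OF g]] by simp
      finally show "(\<Sum>j\<in>blo g. ?c j) = 0" by simp
    qed
    finally show ?thesis by simp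
  qed
  \<comment> \<open>Both ends of a link carry the red edge of a mark; elsewhere the condition is
    inherited from the path.\<close>
  have altJ: "{vs ! i, vs ! nx i} \<in> H \<or> {vs ! nx i, vs ! nx (nx i)} \<in> H" if i: "i \<in> J" "vs ! nx i \<in> V" for i
  proof -
    obtain g where g: "g \<in> T" "i \<in> blo g" using i by (auto simp: J_def)
    show ?thesis
    proof (cases "i = Suc (ou g)")
      case True
      have "nx i = inn (\<sigma> g)" using True nx_out[OF g(1)] by simp
      moreover have "nx (inn (\<sigma> g)) = Suc (inn (\<sigma> g))" using innk[OF \<sigma>T[OF g(1)]] by (rule nx_ks)
      ultimately show ?thesis using mark[OF innk[OF \<sigma>T[OF g(1)]]] by simp
    next
      case False
      hence e: "nx i = Suc i" using jblo[OF g(1) _ g(2)] by (intro nx_Suc) blast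
      show ?thesis
      proof (cases "\<exists>h\<in>T. Suc i = Suc (ou h)")
        case True
        then obtain h where "h \<in> T" "i = ou h" by auto
        thus ?thesis using e mark[OF ouk[of h]] by simp
      next
        case False
        hence e2: "nx (Suc i) = Suc (Suc i)" by (intro nx_Suc) blast
        have "Suc (Suc i) < length vs" using Jlen[OF nxJ[OF nxJ[OF i(1)]]] e e2 by simp
        thus ?thesis using alt i(2) e e2 by (auto simp: alt_path_def)
      qed
    qed
  qed
  have fV: "finite V" using V finite_subset by blast
  obtain V' where V': "V' \<subseteq> V \<union> (!) vs ` J" "card V' = card V" "two_regular V' (sym_diff H o.F)"
    using o.switch[OF H fV altJ sumJ] by blast
  have "(!) vs ` J \<subseteq> {..<n}"
  proof
    fix v assume "v \<in> (!) vs ` J"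
    then obtain j where "j \<in> J" "v = vs ! j" by auto
    thus "v \<in> {..<n}" using nth_mem[OF Jlen] vsn by blast
  qed
  hence "V' \<subseteq> {..<n}" using V'(1) V by blast
  moreover have "sym_diff H o.F \<subseteq> H \<union> X \<union> Y" using FY by auto
  \<comment> \<open>The trail passes an \<open>ins\<close> position of each group in
    \<open>T\<close> and none of any other group.\<close>
  moreover have "T = {g. g < M \<and> (\<exists>i\<in>ins g. vs ! i \<in> \<Union>(sym_diff H (sym_diff H o.F)))}"
  proof -
    have "sym_diff H (sym_diff H o.F) = o.F" by auto
    hence U: "\<Union>(sym_diff H (sym_diff H o.F)) = (!) vs ` J" using o.Union_edges by simp
    have "g \<in> T \<longleftrightarrow> g < M \<and> (\<exists>i\<in>ins g. vs ! i \<in> (!) vs ` J)" for g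
    proof
      assume g: "g \<in> T"
      have "inn g \<in> blo g" using io[OF g] by (simp add: blo_def)
      hence "inn g \<in> J" using g by (auto simp: J_def)
      thus "g < M \<and> (\<exists>i\<in>ins g. vs ! i \<in> (!) vs ` J)" using inn[OF g] TM[OF g] by blast
    next
      assume a: "g < M \<and> (\<exists>i\<in>ins g. vs ! i \<in> (!) vs ` J)"
      then obtain i j where ij: "i \<in> ins g" "j \<in> J" "vs ! i = vs ! j" by auto
      have "i \<in> set ks" using ins_ks a ij by auto
      hence "i < length vs" using mark by fastforce
      hence "i = j" using vs_inj ij Jlen by auto
      then obtain h where h: "h \<in> T" "i \<in> blo h" using ij by (auto simp: J_def)
      have "\<not> g < h" using group_less[of g h i "inn h"] TM[OF h(1)] ij(1) inn[OF h(1)] h(2) by (auto simp: blo_def)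
      moreover have "\<not> h < g" using group_less[of h g "ou h" i] a ij(1) ou[OF h(1)] h(2) by (auto simp: blo_def)
      ultimately show "g \<in> T" using h by (metis linorder_neqE_nat)
    qed
    thus ?thesis unfolding U by blast
  qed
  ultimately show ?thesis using V'(2,3) by blast
qed

definition alternatives :: "nat set set \<Rightarrow> nat set set set" where
  "alternatives G = {H'. \<exists>V'. V' \<subseteq> {..<n} \<and> card V' = card V \<and> two_regular V' H' \<and> H' \<subseteq> G}"

text \<open>Every cycle set of the digraph of links is read off from some alternative 2-factor, so
  there are at least as many alternatives as cycle sets.\<close>

lemma card_alternatives:
  assumes J: "joined {..<M} (link Y) k" and k: "1 \<le> k" and G: "H \<union> X \<union> Y \<subseteq> G"
  shows "2 ^ M \<le> (card (alternatives G) + 1) * card {D. D \<subseteq> {..<M} \<and> card D \<le> 4 * k}"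
proof -
  let ?T = "{T. T \<subseteq> {..<M} \<and> (\<exists>\<sigma>. bij_betw \<sigma> T T \<and> (\<forall>g\<in>T. link Y g (\<sigma> g)))}"
  let ?r = "\<lambda>H'. {g. g < M \<and> (\<exists>i\<in>ins g. vs ! i \<in> \<Union>(sym_diff H H'))}"
  have sub: "?T \<subseteq> ?r ` alternatives G"
  proof
    fix T assume "T \<in> ?T"
    then obtain \<sigma> where "T \<subseteq> {..<M}" "bij_betw \<sigma> T T" "\<forall>g\<in>T. link Y g (\<sigma> g)" by blast
    from switch_cycle_set[OF this] obtain V' H' where "V' \<subseteq> {..<n}" "card V' = card V" "two_regular V' H'"
      "H' \<subseteq> H \<union> X \<union> Y" "T = ?r H'" by blast
    thus "T \<in> ?r ` alternatives G" using G unfolding alternatives_def by blast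
  qed
  have fin: "finite (alternatives G)"
  proof (rule finite_subset)
    show "alternatives G \<subseteq> Pow (Pow {..<n})" by (auto simp: alternatives_def two_regular_def)
  qed simp
  have le: "card ?T \<le> card (alternatives G)" by (rule surj_card_le[OF fin sub])
  have "2 ^ card {..<M} \<le> (card ?T + 1) * card {D. D \<subseteq> {..<M} \<and> card D \<le> 4 * k}"
    by (rule many_cycle_sets[OF J _ k]) simp
  also have "\<dots> \<le> (card (alternatives G) + 1) * card {D. D \<subseteq> {..<M} \<and> card D \<le> 4 * k}"
    using le by (intro mult_le_mono1) simp
  finally show ?thesis by simp
qed

text \<open>Union bound over the at most \<open>4 ^ M\<close> pairs of disjoint families of
  \<open>k\<close> groups. Between two families there are \<open>(k * D) * (k * D)\<close> possible
  links, of which at most \<open>2 * (k * D)\<close> are red.\<close>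

lemma prob_joined:
  fixes q :: real
  assumes q: "0 \<le> q" "q \<le> 1" and k: "1 \<le> k"
  shows "measure_pmf.prob (random_subset (complete_graph n) q) {Y. \<not> joined {..<M} (link Y) k}
    \<le> 4 ^ M * (1 - q) ^ ((k * D) * (k * D) - 2 * (k * D))"
proof -
  let ?E = "complete_graph n" and ?N = "(k * D) * (k * D) - 2 * (k * D)"
  let ?P = "{(A, B). A \<subseteq> {..<M} \<and> B \<subseteq> {..<M} \<and> A \<inter> B = {} \<and> card A = k \<and> card B = k}"
  define Q where "Q A B = (\<lambda>(x, i). {vs ! Suc x, vs ! i}) ` ((\<Union>g\<in>A. outs g) \<times> (\<Union>h\<in>B. ins h)) - H" for A B
  have QE: "Q A B \<subseteq> ?E" and cQ: "?N \<le> card (Q A B)" if AB: "(A, B) \<in> ?P" for A B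
  proof -
    have ABM: "A \<subseteq> {..<M}" "B \<subseteq> {..<M}" "card A = k" "card B = k" using AB by auto
    let ?O = "\<Union>g\<in>A. outs g" and ?I = "\<Union>h\<in>B. ins h"
    have Oks: "?O \<subseteq> set ks" and Iks: "?I \<subseteq> set ks" using ABM ins_ks outs_ks by blast+
    have dj: "outs g \<inter> outs h = {}" "ins g \<inter> ins h = {}" if "g < M" "h < M" "g \<noteq> h" for g h
      using group_less[of g h] group_less[of h g] that
      by (cases g h rule: linorder_cases; fastforce)+
    have finA: "finite A" "finite B" using ABM finite_subset by auto
    have fin1: "finite (outs g)" "finite (ins g)" for g by (simp_all add: outs_def ins_def)
    have dA: "\<forall>g\<in>A. \<forall>h\<in>A. g \<noteq> h \<longrightarrow> outs g \<inter> outs h = {}"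
      using dj(1) ABM(1) by (meson lessThan_iff subsetD)
    have dB: "\<forall>g\<in>B. \<forall>h\<in>B. g \<noteq> h \<longrightarrow> ins g \<inter> ins h = {}"
      using dj(2) ABM(2) by (meson lessThan_iff subsetD)
    have "card ?O = (\<Sum>g\<in>A. card (outs g))"
      by (rule card_UN_disjoint[OF finA(1) _ dA]) (use fin1 in auto)
    also have "\<dots> = (\<Sum>g\<in>A. D)" by (rule sum.cong) (use card_outs ABM in auto)
    finally have cO: "card ?O = k * D" using ABM by simp
    have "card ?I = (\<Sum>g\<in>B. card (ins g))"
      by (rule card_UN_disjoint[OF finA(2) _ dB]) (use fin1 in auto)
    also have "\<dots> = (\<Sum>g\<in>B. D)" by (rule sum.cong) (use card_ins ABM in auto)
    finally have cI: "card ?I = k * D" using ABM by simp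
    have lenO: "Suc x < length vs" if "x \<in> ?O" for x using Oks mark that by blast
    have lenI: "i < length vs" if "i \<in> ?I" for i using Iks mark that by (meson Suc_lessD subsetD)
    have ne: "Suc x \<noteq> i" if "x \<in> ?O" "i \<in> ?I" for x i using Suc_notin_ks Oks Iks that by blast
    have inj: "inj_on (\<lambda>(x, i). {vs ! Suc x, vs ! i}) (?O \<times> ?I)"
    proof (rule inj_onI)
      fix a a' assume "a \<in> ?O \<times> ?I" "a' \<in> ?O \<times> ?I"
        and e: "(case a of (x, i) \<Rightarrow> {vs ! Suc x, vs ! i}) = (case a' of (x, i) \<Rightarrow> {vs ! Suc x, vs ! i})"
      then obtain x i x' i' where aa: "a = (x, i)" "a' = (x', i')" "x \<in> ?O" "i \<in> ?I" "x' \<in> ?O" "i' \<in> ?I"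
        by (metis (no_types, lifting) mem_Sigma_iff surj_pair)
      hence a: "x \<in> ?O" "i \<in> ?I" "x' \<in> ?O" "i' \<in> ?I" "{vs ! Suc x, vs ! i} = {vs ! Suc x', vs ! i'}"
        using e by auto
      have "vs ! Suc x \<noteq> vs ! i'" using vs_inj lenO[OF a(1)] lenI[OF a(4)] ne[OF a(1,4)] by blast
      hence "vs ! Suc x = vs ! Suc x'" "vs ! i = vs ! i'" using a(5) by (auto simp: doubleton_eq_iff)
      thus "a = a'" using vs_inj lenO[OF a(1)] lenO[OF a(3)] lenI[OF a(2)] lenI[OF a(4)] aa(1,2) by simp
    qed
    let ?Q0 = "(\<lambda>(x, i). {vs ! Suc x, vs ! i}) ` (?O \<times> ?I)"
    have c0: "card ?Q0 = (k * D) * (k * D)" using inj cO cI by (simp add: card_image card_cartesian_product)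
    have finQ0: "finite ?Q0" using finA fin1 by auto
    \<comment> \<open>A red pair is determined by its end at an \<open>ins\<close> position and one
      of the at most two red neighbours there.\<close>
    have "?Q0 \<inter> H \<subseteq> (\<Union>i\<in>?I. (\<lambda>y. {y, vs ! i}) ` nb H (vs ! i))"
    proof
      fix e assume "e \<in> ?Q0 \<inter> H"
      then obtain x i where xi: "x \<in> ?O" "i \<in> ?I" "e = {vs ! Suc x, vs ! i}" "e \<in> H" by auto
      hence "vs ! Suc x \<in> nb H (vs ! i)" by (simp add: nb_def insert_commute)
      thus "e \<in> (\<Union>i\<in>?I. (\<lambda>y. {y, vs ! i}) ` nb H (vs ! i))" using xi by blast
    qed
    hence "card (?Q0 \<inter> H) \<le> card (\<Union>i\<in>?I. (\<lambda>y. {y, vs ! i}) ` nb H (vs ! i))"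
      using card_nb_le[OF H] finA fin1 by (intro card_mono) auto
    also have "\<dots> \<le> (\<Sum>i\<in>?I. card ((\<lambda>y. {y, vs ! i}) ` nb H (vs ! i)))"
      using finA fin1 by (intro card_UN_le) auto
    also have "\<dots> \<le> (\<Sum>i\<in>?I. 2)"
    proof (rule sum_mono)
      fix i
      have "card ((\<lambda>y. {y, vs ! i}) ` nb H (vs ! i)) \<le> card (nb H (vs ! i))"
        using card_nb_le[OF H] by (intro card_image_le) blast
      thus "card ((\<lambda>y. {y, vs ! i}) ` nb H (vs ! i)) \<le> 2" using card_nb_le[OF H, of "vs ! i"] by linarith
    qed
    finally have "card (?Q0 \<inter> H) \<le> 2 * (k * D)" using cI by simp
    moreover have "card (Q A B) = card ?Q0 - card (?Q0 \<inter> H)"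
      unfolding Q_def using finQ0 by (simp add: card_Diff_subset_Int)
    ultimately show "?N \<le> card (Q A B)" using c0 by linarith
    show "Q A B \<subseteq> ?E"
    proof
      fix e assume "e \<in> Q A B"
      then obtain x i where xi: "x \<in> ?O" "i \<in> ?I" "e = {vs ! Suc x, vs ! i}" by (auto simp: Q_def)
      have "vs ! Suc x \<noteq> vs ! i" using vs_inj lenO[OF xi(1)] lenI[OF xi(2)] ne[OF xi(1,2)] by blast
      moreover have "vs ! Suc x < n" "vs ! i < n" using vsn lenO[OF xi(1)] lenI[OF xi(2)] nth_mem by blast+
      ultimately show "e \<in> ?E" using xi by (simp add: complete_graph_def)
    qed
  qed
  have finP: "finite ?P" by (rule finite_subset[of _ "Pow {..<M} \<times> Pow {..<M}"]) auto
  have "{Y. \<not> joined {..<M} (link Y) k} \<subseteq> (\<Union>(A, B)\<in>?P. {Y. Q A B \<inter> Y = {}})"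
  proof
    fix Y assume "Y \<in> {Y. \<not> joined {..<M} (link Y) k}"
    then obtain A B where AB: "(A, B) \<in> ?P" "\<not> (\<exists>a\<in>A. \<exists>b\<in>B. link Y a b)" by (auto simp: joined_def)
    have "Q A B \<inter> Y = {}" using AB(2) by (auto simp: Q_def link_def)
    thus "Y \<in> (\<Union>(A, B)\<in>?P. {Y. Q A B \<inter> Y = {}})" using AB(1) by blast
  qed
  hence "measure_pmf.prob (random_subset ?E q) {Y. \<not> joined {..<M} (link Y) k}
    \<le> measure_pmf.prob (random_subset ?E q) (\<Union>x\<in>?P. {Y. Q (fst x) (snd x) \<inter> Y = {}})"
    by (intro measure_pmf.finite_measure_mono) (auto simp: case_prod_unfold)
  also have "\<dots> \<le> (\<Sum>x\<in>?P. measure_pmf.prob (random_subset ?E q) {Y. Q (fst x) (snd x) \<inter> Y = {}})"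
    using finP by (intro measure_pmf.finite_measure_subadditive_finite) auto
  also have "\<dots> \<le> (\<Sum>x\<in>?P. (1 - q) ^ ?N)"
  proof (rule sum_mono)
    fix x assume x: "x \<in> ?P"
    hence x': "(fst x, snd x) \<in> ?P" by simp
    have "measure_pmf.prob (random_subset ?E q) {Y. Q (fst x) (snd x) \<inter> Y = {}} = (1 - q) ^ card (Q (fst x) (snd x))"
      by (rule prob_random_subset_disjoint[OF finite_complete_graph QE[OF x'] q])
    also have "\<dots> \<le> (1 - q) ^ ?N" using q cQ[OF x'] by (intro power_decreasing) auto
    finally show "measure_pmf.prob (random_subset ?E q) {Y. Q (fst x) (snd x) \<inter> Y = {}} \<le> (1 - q) ^ ?N" .
  qed
  also have "\<dots> = real (card ?P) * (1 - q) ^ ?N" by simp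
  also have "\<dots> \<le> 4 ^ M * (1 - q) ^ ?N"
  proof (rule mult_right_mono)
    have "card ?P \<le> card (Pow {..<M} \<times> Pow {..<M})" by (rule card_mono) auto
    also have "\<dots> = 2 ^ M * 2 ^ M" by (simp add: card_cartesian_product card_Pow)
    also have "\<dots> = (4::nat) ^ M" by (simp add: power_mult_distrib[symmetric])
    finally have "real (card ?P) \<le> real (4 ^ M)" by (rule of_nat_mono)
    thus "real (card ?P) \<le> 4 ^ M" by simp
  qed (use q in simp)
  finally show ?thesis .
qed

end

subsection \<open>Weights for the exploration\<close>

text \<open>\<open>rV\<close> and \<open>rN\<close> stand for the mean numbers of usable blue
  neighbours of a trail end inside and outside \<open>V\<close>; the drift condition asks for growth
  by 1 + \<epsilon> in spite of the cut-offs \<open>A\<close> and \<open>B\<close>.\<close>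

definition supercritical_weights :: "nat \<Rightarrow> int \<Rightarrow> (int \<Rightarrow> nat \<Rightarrow> real) \<Rightarrow> real \<Rightarrow> real \<Rightarrow> real \<Rightarrow> bool" where
  "supercritical_weights A B P \<epsilon> rV rN \<longleftrightarrow> 1 \<le> A \<and> 0 \<le> B \<and> 0 < \<epsilon> \<and> (\<forall>\<beta> i. 0 \<le> P \<beta> i) \<and>
     (\<forall>\<beta> i. B < \<bar>\<beta>\<bar> \<or> A \<le> i \<longrightarrow> P \<beta> i = 0) \<and>
     (\<forall>\<beta> i. \<bar>\<beta>\<bar> \<le> B \<longrightarrow> i < A \<longrightarrow> P \<beta> i * (1 + \<epsilon>) \<le>
        rV * (\<Sum>a\<in>{1..A}. 2 * P (\<beta> - 1 + int a) 0) + rN * P (\<beta> - 1) (Suc i)) \<and>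
     0 < (\<Sum>a\<in>{1..A}. 2 * P (int a) 0)"

text \<open>Meant for \<delta> = 1. With no vertices outside \<open>V\<close>, one red edge per
  landing restores the balance, and the two directions give the growth rate
  \<open>2 * rV\<close>.\<close>

lemma supercritical_weights_full:
  assumes "1 < 2 * rV"
  shows "supercritical_weights 1 1 (\<lambda>\<beta> i. if \<bar>\<beta>\<bar> \<le> 1 \<and> i < 1 then 1 else 0) (2 * rV - 1) rV rN"
  using assms by (auto simp: supercritical_weights_def)

text \<open>The weights are a positive eigenfunction of the tilted step kernel, cut off by a slowly varying
  cosine: the tilt \<open>x powr \<beta>\<close> makes the kernel symmetric in the balance, so that the cosine costs only
  a factor close to 1.\<close>

lemma supercritical_weights_exist:
  fixes rV rN :: real
  assumes rV: "0 < rV" and rN: "0 < rN" "rN < 1" and super: "(1 - sqrt rN)\<^sup>2 < 2 * rV"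
  shows "\<exists>A B P \<epsilon>. supercritical_weights A B P \<epsilon> rV rN"
proof -
  define x where "x = sqrt rN"
  have x: "0 < x" "x < 1" "x * x = rN" using rN by (auto simp: x_def)
  \<comment> \<open>After the tilt, a red stretch of length \<open>a\<close> and an excursion of
    \<open>b\<close> blue edges contribute x^(a - 1) x^(b - 1). Hence the growth rate 2 rV (S A)^2,
    which tends to 2 rV / (1 - x)^2 > 1.\<close>
  define S where "S A = (\<Sum>a\<in>{1..A}. x ^ (a - 1))" for A :: nat
  have S_eq: "S A = (\<Sum>a<A. x ^ a)" for A
    unfolding S_def by (rule sum.reindex_bij_witness[of _ Suc "\<lambda>a. a - 1"]) auto
  have "(\<lambda>A. S A) \<longlonglongrightarrow> 1 / (1 - x)"
    using geometric_sums[of x] x unfolding S_eq sums_def by simp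
  hence "(\<lambda>A. 2 * rV * (S A)\<^sup>2) \<longlonglongrightarrow> 2 * rV * (1 / (1 - x))\<^sup>2" by (intro tendsto_intros)
  moreover have "1 < 2 * rV * (1 / (1 - x))\<^sup>2"
    using super x by (simp add: x_def power_divide field_simps)
  ultimately have "eventually (\<lambda>A. 1 < 2 * rV * (S A)\<^sup>2) sequentially" by (rule order_tendstoD)
  hence "eventually (\<lambda>A. 1 < 2 * rV * (S A)\<^sup>2 \<and> 1 \<le> A) sequentially"
    using eventually_ge_at_top[of 1] by (rule eventually_conj)
  then obtain A where A: "1 < 2 * rV * (S A)\<^sup>2" "1 \<le> A" by (metis (mono_tags, lifting) eventually_sequentially order_refl)
  define \<rho> where "\<rho> = 2 * rV * (S A)\<^sup>2"
  have "((\<lambda>t. \<rho> * cos (t * real A)) \<longlongrightarrow> \<rho> * cos (0 * real A)) (at_right 0)"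
    by (intro tendsto_intros)
  hence "eventually (\<lambda>t. 1 < \<rho> * cos (t * real A)) (at_right 0)"
    using A by (intro order_tendstoD(1)) (auto simp: \<rho>_def)
  moreover have "eventually (\<lambda>t. t < 1 / real A) (at_right 0)"
    using A by (intro eventually_at_rightI[of 0 "1 / real A"]) auto
  moreover have "eventually (\<lambda>t. (0::real) < t) (at_right 0)" by (rule eventually_at_right_less)
  ultimately have "eventually (\<lambda>t. 1 < \<rho> * cos (t * real A) \<and> t < 1 / real A \<and> 0 < t) (at_right 0)"
    by (intro eventually_conj)
  then obtain t where t: "1 < \<rho> * cos (t * real A)" "t < 1 / real A" "0 < t"
    using eventually_happens'[OF trivial_limit_at_right_real] by blast
  have tA: "t * real A \<le> 1" using t(2) A by (simp add: field_simps)
  \<comment> \<open>The positive arch of a cosine of long period, extended by 0.\<close>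
  define g where "g \<beta> = (if t * \<bar>real_of_int \<beta>\<bar> \<le> pi / 2 then cos (t * real_of_int \<beta>) else 0)" for \<beta>
  have g0: "0 \<le> g \<beta>" for \<beta>
  proof -
    have "0 \<le> cos (t * real_of_int \<beta>)" if "t * \<bar>real_of_int \<beta>\<bar> \<le> pi / 2"
    proof (rule cos_ge_zero)
      have "\<bar>t * real_of_int \<beta>\<bar> \<le> pi / 2" using that t(3) by (simp add: abs_mult)
      thus "- (pi / 2) \<le> t * real_of_int \<beta>" "t * real_of_int \<beta> \<le> pi / 2" by (simp_all add: abs_le_iff)
    qed
    thus ?thesis by (simp add: g_def)
  qed
  \<comment> \<open>Beyond the arch the cosine stays nonpositive up to 3 pi / 2, so the cut-off only
    increases it; \<open>t * real A \<le> 1\<close> keeps all relevant shifts below that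
    point.\<close>
  have g_cos: "cos (t * real_of_int \<beta>) \<le> g \<beta>" if "t * \<bar>real_of_int \<beta>\<bar> \<le> 3 * pi / 2" for \<beta>
  proof (cases "t * \<bar>real_of_int \<beta>\<bar> \<le> pi / 2")
    case False
    have "cos (t * real_of_int \<beta>) = cos \<bar>t * real_of_int \<beta>\<bar>" by (rule cos_abs_real[symmetric])
    also have "\<bar>t * real_of_int \<beta>\<bar> = t * \<bar>real_of_int \<beta>\<bar>" using t(3) by (simp add: abs_mult)
    also have "cos (t * \<bar>real_of_int \<beta>\<bar>) = - cos (t * \<bar>real_of_int \<beta>\<bar> - pi)" by simp
    also have "\<dots> \<le> 0" using cos_ge_zero[of "t * \<bar>real_of_int \<beta>\<bar> - pi"] that False by simp
    finally show ?thesis using False by (simp add: g_def)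
  qed (simp add: g_def)
  define C where "C = cos (t * real A)"
  \<comment> \<open>Addition theorem: the shifts \<open>s\<close> and \<open>- s\<close> together
    multiply the cosine by 2 cos (t s), which is at least 2 C.\<close>
  have gC: "2 * C * g \<beta> \<le> g (\<beta> + s) + g (\<beta> - s)" if s: "\<bar>s\<bar> \<le> int A" for \<beta> s
  proof (cases "t * \<bar>real_of_int \<beta>\<bar> \<le> pi / 2")
    case False thus ?thesis using g0[of "\<beta> + s"] g0[of "\<beta> - s"] by (simp add: g_def)
  next
    case True
    have sA: "t * \<bar>real_of_int s\<bar> \<le> t * real A" using s t(3) by (intro mult_left_mono) linarith+
    have pi1: "1 \<le> pi" using pi_gt3 by simp
    have "t * \<bar>real_of_int (\<beta> + s)\<bar> \<le> t * (\<bar>real_of_int \<beta>\<bar> + \<bar>real_of_int s\<bar>)"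
      "t * \<bar>real_of_int (\<beta> - s)\<bar> \<le> t * (\<bar>real_of_int \<beta>\<bar> + \<bar>real_of_int s\<bar>)"
      using t(3) by (intro mult_left_mono; simp)+
    hence "t * \<bar>real_of_int (\<beta> + s)\<bar> \<le> 3 * pi / 2" "t * \<bar>real_of_int (\<beta> - s)\<bar> \<le> 3 * pi / 2"
      using True sA tA pi1 by (simp_all add: distrib_left)
    from g_cos[OF this(1)] g_cos[OF this(2)]
    have "cos (t * real_of_int \<beta> + t * real_of_int s) + cos (t * real_of_int \<beta> - t * real_of_int s) \<le> g (\<beta> + s) + g (\<beta> - s)"
      by (simp add: algebra_simps)
    moreover have "cos (t * real_of_int \<beta> + t * real_of_int s) + cos (t * real_of_int \<beta> - t * real_of_int s)
        = 2 * cos (t * real_of_int s) * cos (t * real_of_int \<beta>)"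
      by (simp add: cos_add cos_diff)
    moreover have "C \<le> cos (t * real_of_int s)"
    proof -
      have "cos (t * real A) \<le> cos (t * \<bar>real_of_int s\<bar>)"
        using sA tA pi1 t(3) by (intro cos_monotone_0_pi_le) auto
      also have "t * \<bar>real_of_int s\<bar> = \<bar>t * real_of_int s\<bar>" using t(3) by (simp add: abs_mult)
      also have "cos \<bar>t * real_of_int s\<bar> = cos (t * real_of_int s)" by (rule cos_abs_real)
      finally show ?thesis by (simp add: C_def)
    qed
    hence "2 * C * g \<beta> \<le> 2 * cos (t * real_of_int s) * g \<beta>" using g0 by (intro mult_right_mono) auto
    ultimately show ?thesis using True by (simp add: g_def)
  qed
  define L where "L \<beta> = x powr real_of_int \<beta> * g \<beta>" for \<beta>
  have L0: "0 \<le> L \<beta>" for \<beta> using g0 by (simp add: L_def)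
  \<comment> \<open>Mean value of the landings still open to a trail end: \<open>b - 1\<close>
    further steps outside \<open>V\<close> and a landing edge, valued by \<open>L\<close> at the
    balance reached.\<close>
  define Q where "Q \<beta> i = (\<Sum>b\<in>{1..A - i}. rV * rN ^ (b - 1) * L (\<beta> - int b))" for \<beta> i
  have Q0: "0 \<le> Q \<beta> i" for \<beta> i using rV rN L0 by (auto simp: Q_def intro!: sum_nonneg)
  have Q_rec: "Q \<beta> i = rV * L (\<beta> - 1) + rN * Q (\<beta> - 1) (Suc i)" if i: "i < A" for \<beta> i
  proof -
    obtain m where m: "A - i = Suc m" "A - Suc i = m" using i by (metis Suc_diff_Suc)
    have "Q \<beta> i = rV * L (\<beta> - 1) + (\<Sum>b\<in>{Suc 1..Suc m}. rV * rN ^ (b - 1) * L (\<beta> - int b))"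
      unfolding Q_def m by (subst sum.atLeast_Suc_atMost) auto
    also have "(\<Sum>b\<in>{Suc 1..Suc m}. rV * rN ^ (b - 1) * L (\<beta> - int b)) = (\<Sum>b\<in>{1..m}. rV * rN ^ b * L (\<beta> - 1 - int b))"
      by (subst sum.shift_bounds_cl_Suc_ivl) (simp add: algebra_simps)
    also have "\<dots> = (\<Sum>b\<in>{1..m}. rN * (rV * rN ^ (b - 1) * L (\<beta> - 1 - int b)))"
    proof (rule sum.cong[OF refl])
      fix b assume "b \<in> {1..m}"
      then obtain c where "b = Suc c" by (cases b) auto
      thus "rV * rN ^ b * L (\<beta> - 1 - int b) = rN * (rV * rN ^ (b - 1) * L (\<beta> - 1 - int b))" by simp
    qed
    also have "\<dots> = rN * Q (\<beta> - 1) (Suc i)" unfolding Q_def m by (simp add: sum_distrib_left)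
    finally show ?thesis .
  qed
  define \<epsilon>0 where "\<epsilon>0 = \<rho> * C - 1"
  have \<epsilon>0: "0 < \<epsilon>0" using t(1) by (simp add: \<epsilon>0_def C_def)
  have land: "(1 + \<epsilon>0) * L \<beta> \<le> (\<Sum>a\<in>{1..A}. 2 * Q (\<beta> + int a) 0)" for \<beta>
  proof -
    let ?w = "\<lambda>a b. x ^ (a - 1) * x ^ (b - 1)"
    have "(\<Sum>a\<in>{1..A}. 2 * Q (\<beta> + int a) 0) = (\<Sum>a\<in>{1..A}. \<Sum>b\<in>{1..A}. 2 * rV * x powr real_of_int \<beta> * (?w a b * g (\<beta> + (int a - int b))))"
    proof (rule sum.cong[OF refl])
      fix a assume a0: "a \<in> {1..A}"
      have "2 * Q (\<beta> + int a) 0 = (\<Sum>b\<in>{1..A}. 2 * (rV * rN ^ (b - 1) * L (\<beta> + int a - int b)))"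
        by (simp add: Q_def sum_distrib_left)
      also have "\<dots> = (\<Sum>b\<in>{1..A}. 2 * rV * x powr real_of_int \<beta> * (?w a b * g (\<beta> + (int a - int b))))"
      proof (rule sum.cong[OF refl])
      fix b assume b0: "b \<in> {1..A}"
      note a = a0 b0
      obtain a' b' where ab: "a = Suc a'" "b = Suc b'" using a by (cases a; cases b) auto
      have "rN ^ b' = x ^ b' * x ^ b'" by (simp add: x(3)[symmetric] power_mult_distrib)
      moreover have "x powr real_of_int (\<beta> + int a - int b) = x powr real_of_int \<beta> * x powr real a' / x powr real b'"
        using x by (simp add: ab powr_add[symmetric] powr_diff[symmetric] add_diff_eq)
      moreover have "x powr real a' = x ^ a'" "x powr real b' = x ^ b'" using x by (simp_all add: powr_realpow)
      ultimately show "2 * (rV * rN ^ (b - 1) * L (\<beta> + int a - int b)) = 2 * rV * x powr real_of_int \<beta> * (?w a b * g (\<beta> + (int a - int b)))"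
        using x by (simp add: L_def ab add_diff_eq)
      qed
      finally show "2 * Q (\<beta> + int a) 0 = (\<Sum>b\<in>{1..A}. 2 * rV * x powr real_of_int \<beta> * (?w a b * g (\<beta> + (int a - int b))))" .
    qed
    also have "\<dots> = rV * x powr real_of_int \<beta> * (2 * (\<Sum>a\<in>{1..A}. \<Sum>b\<in>{1..A}. ?w a b * g (\<beta> + (int a - int b))))"
      by (simp add: sum_distrib_left mult_ac)
    \<comment> \<open>Exchanging \<open>a\<close> and \<open>b\<close> symmetrises the kernel, so
      that the shifts a - b and b - a occur together.\<close>
    also have "2 * (\<Sum>a\<in>{1..A}. \<Sum>b\<in>{1..A}. ?w a b * g (\<beta> + (int a - int b)))
       = (\<Sum>a\<in>{1..A}. \<Sum>b\<in>{1..A}. ?w a b * g (\<beta> + (int a - int b))) + (\<Sum>b\<in>{1..A}. \<Sum>a\<in>{1..A}. ?w a b * g (\<beta> + (int a - int b)))"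
      by (subst (2) sum.swap) simp
    also have "\<dots> = (\<Sum>a\<in>{1..A}. \<Sum>b\<in>{1..A}. ?w a b * (g (\<beta> + (int a - int b)) + g (\<beta> - (int a - int b))))"
      by (simp add: sum.distrib distrib_left algebra_simps)
    also have "\<dots> \<ge> (\<Sum>a\<in>{1..A}. \<Sum>b\<in>{1..A}. ?w a b * (2 * C * g \<beta>))"
      using x gC by (intro sum_mono mult_left_mono) auto
    hence "rV * x powr real_of_int \<beta> * (\<Sum>a\<in>{1..A}. \<Sum>b\<in>{1..A}. ?w a b * (g (\<beta> + (int a - int b)) + g (\<beta> - (int a - int b))))
       \<ge> rV * x powr real_of_int \<beta> * (\<Sum>a\<in>{1..A}. \<Sum>b\<in>{1..A}. ?w a b * (2 * C * g \<beta>))"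
      using rV by (intro mult_left_mono) auto
    moreover have "(\<Sum>a\<in>{1..A}. \<Sum>b\<in>{1..A}. ?w a b * (2 * C * g \<beta>)) = (S A)\<^sup>2 * (2 * C * g \<beta>)"
      by (simp only: S_def power2_eq_square sum_product) (simp only: sum_distrib_right sum_distrib_left mult.assoc)
    ultimately have "rV * x powr real_of_int \<beta> * ((S A)\<^sup>2 * (2 * C * g \<beta>)) \<le> (\<Sum>a\<in>{1..A}. 2 * Q (\<beta> + int a) 0)"
      by simp
    moreover have "rV * x powr real_of_int \<beta> * ((S A)\<^sup>2 * (2 * C * g \<beta>)) = (1 + \<epsilon>0) * L \<beta>"
      by (simp add: \<epsilon>0_def \<rho>_def L_def)
    ultimately show ?thesis by simp
  qed
  \<comment> \<open>The surplus of a whole round is spread over the \<open>A\<close> possible steps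
    of an excursion, so that every single step has strict drift.\<close>
  obtain \<kappa> where \<kappa>: "1 < \<kappa>" "\<kappa> ^ A \<le> 1 + \<epsilon>0"
  proof
    let ?k = "root A (1 + \<epsilon>0)"
    show "1 < ?k" using A \<epsilon>0 by simp
    show "?k ^ A \<le> 1 + \<epsilon>0" using A \<epsilon>0 by simp
  qed
  define P where "P \<beta> i = (if i < A then \<kappa> ^ i * Q \<beta> i else 0)" for \<beta> i
  \<comment> \<open>Beyond this bound \<open>L\<close> vanishes at all balances within distance
    \<open>A\<close>.\<close>
  define B where "B = \<lceil>pi / (2 * t)\<rceil> + int A"
  have B0: "0 \<le> B"
  proof -
    have "0 \<le> pi / (2 * t)" using t(3) by simp
    hence "0 \<le> \<lceil>pi / (2 * t)\<rceil>" by linarith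
    thus ?thesis by (simp add: B_def)
  qed
  have P0: "0 \<le> P \<beta> i" for \<beta> i using Q0 \<kappa> by (simp add: P_def)
  have Pout: "P \<beta> i = 0" if "B < \<bar>\<beta>\<bar>" for \<beta> i
  proof -
    have "L (\<beta> - int b) = 0" if "b \<in> {1..A - i}" for b
    proof -
      have "\<lceil>pi / (2 * t)\<rceil> < \<bar>\<beta> - int b\<bar>" using \<open>B < \<bar>\<beta>\<bar>\<close> that by (auto simp: B_def)
      hence "pi / (2 * t) < real_of_int \<bar>\<beta> - int b\<bar>" by linarith
      hence "\<not> t * \<bar>real_of_int (\<beta> - int b)\<bar> \<le> pi / 2" using t(3) by (simp add: field_simps)
      thus ?thesis by (simp add: L_def g_def)
    qed
    thus ?thesis by (simp add: P_def Q_def)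
  qed
  have PQ: "P \<beta> 0 = Q \<beta> 0" for \<beta> using A by (simp add: P_def)
  have "supercritical_weights A B P (\<kappa> - 1) rV rN" unfolding supercritical_weights_def
  proof (intro conjI allI impI)
    show "1 \<le> A" "0 \<le> B" "0 < \<kappa> - 1" "\<And>\<beta> i. 0 \<le> P \<beta> i" using A B0 \<kappa> P0 by auto
    have "P \<beta> i = 0" if "A \<le> i" for \<beta> i using that by (simp add: P_def)
    thus "\<And>\<beta> i. B < \<bar>\<beta>\<bar> \<or> A \<le> i \<Longrightarrow> P \<beta> i = 0" using Pout by blast
    fix \<beta> i assume "\<bar>\<beta>\<bar> \<le> B" and i: "i < A"
    have "P \<beta> i * (1 + (\<kappa> - 1)) = \<kappa> ^ Suc i * (rV * L (\<beta> - 1) + rN * Q (\<beta> - 1) (Suc i))"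
      using i Q_rec[OF i] by (simp add: P_def)
    also have "\<dots> = rV * (\<kappa> ^ Suc i * L (\<beta> - 1)) + rN * (\<kappa> ^ Suc i * Q (\<beta> - 1) (Suc i))"
      by (simp add: algebra_simps)
    also have "\<kappa> ^ Suc i * Q (\<beta> - 1) (Suc i) = P (\<beta> - 1) (Suc i)" by (simp add: P_def Q_def)
    also have "\<kappa> ^ Suc i * L (\<beta> - 1) \<le> (\<Sum>a\<in>{1..A}. 2 * P (\<beta> - 1 + int a) 0)"
    proof -
      have "\<kappa> ^ Suc i \<le> \<kappa> ^ A" using \<kappa> i by (intro power_increasing) auto
      hence "\<kappa> ^ Suc i * L (\<beta> - 1) \<le> (1 + \<epsilon>0) * L (\<beta> - 1)" using \<kappa>(2) L0 by (intro mult_right_mono) auto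
      thus ?thesis using land[of "\<beta> - 1"] by (simp add: PQ)
    qed
    finally show "P \<beta> i * (1 + (\<kappa> - 1)) \<le> rV * (\<Sum>a\<in>{1..A}. 2 * P (\<beta> - 1 + int a) 0) + rN * P (\<beta> - 1) (Suc i)"
      using rV by simp
  next
    have "L 0 = 1" using x by (simp add: L_def g_def)
    thus "0 < (\<Sum>a\<in>{1..A}. 2 * P (int a) 0)" using land[of 0] \<epsilon>0 by (simp add: PQ)
  qed
  thus ?thesis by blast
qed

text \<open>The exponential moment condition holds because the positive gains take finitely many values.\<close>

lemma exploration_constants:
  assumes W: "supercritical_weights A B P \<epsilon> rV rN"
  obtains Pmax \<theta> \<kappa> where "0 < Pmax" "\<And>\<beta> i. P \<beta> i \<le> Pmax" "0 < \<theta>" "0 < \<kappa>"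
    "\<And>\<beta> i w. w = (\<Sum>a\<in>{1..A}. 2 * P (\<beta> - 1 + int a) 0) \<or> w = P \<beta> i \<Longrightarrow> 0 < w \<Longrightarrow>
        \<theta> * w / (1 + \<epsilon>) \<le> 1 - exp (- \<theta> * (w - \<kappa> * real (2 * A + 1)))"
    "\<kappa> * real (2 * A + 1) \<le> (\<Sum>a\<in>{1..A}. 2 * P (int a) 0)"
proof -
  have A: "1 \<le> A" and B: "0 \<le> B" and \<epsilon>: "0 < \<epsilon>" and P0: "\<And>\<beta> i. 0 \<le> P \<beta> i"
    and out: "\<And>\<beta> i. B < \<bar>\<beta>\<bar> \<or> A \<le> i \<Longrightarrow> P \<beta> i = 0"
    and root: "0 < (\<Sum>a\<in>{1..A}. 2 * P (int a) 0)"
    using W by (auto simp: supercritical_weights_def)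
  let ?g = "\<lambda>\<beta>. \<Sum>a\<in>{1..A}. 2 * P (\<beta> - 1 + int a) 0"
  let ?R = "{-(B + int A)..B + int A + 1}"
  define S where "S = {w. 0 < w \<and> (w \<in> ?g ` ?R \<or> w \<in> (\<lambda>(\<beta>, i). P \<beta> i) ` ({-B..B} \<times> {..<A}))}"
  have finS: "finite S" by (rule finite_subset[of _ "?g ` ?R \<union> (\<lambda>(\<beta>, i). P \<beta> i) ` ({-B..B} \<times> {..<A})"]) (auto simp: S_def)
  have inS: "w \<in> S" if "w = ?g \<beta> \<or> w = P \<beta> i" "0 < w" for w \<beta> i
    using that(1)
  proof
    assume w: "w = ?g \<beta>"
    have "\<beta> \<in> ?R"
    proof (rule ccontr)
      assume "\<beta> \<notin> ?R"
      hence "P (\<beta> - 1 + int a) 0 = 0" if "a \<in> {1..A}" for a using that by (intro out) auto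
      hence "?g \<beta> = 0" by simp
      thus False using w that(2) by simp
    qed
    thus ?thesis using w that(2) by (auto simp: S_def)
  next
    assume w: "w = P \<beta> i"
    have "\<bar>\<beta>\<bar> \<le> B \<and> i < A" using out[of \<beta> i] w that(2) by (metis less_irrefl not_le)
    hence "(\<beta>, i) \<in> {-B..B} \<times> {..<A}" by auto
    thus ?thesis using w that(2) unfolding S_def by force
  qed
  have gS: "?g 1 \<in> S" using root by (intro inS[of _ 1 0]) auto
  define lo where "lo = Min S"
  define hi where "hi = Max S"
  have lohi: "lo \<le> w" "w \<le> hi" if "w \<in> S" for w using that finS by (auto simp: lo_def hi_def)
  have lo0: "0 < lo" unfolding lo_def using finS gS by (subst Min_gr_iff) (auto simp: S_def)
  have hi0: "0 < hi" using lohi[OF gS] lo0 by linarith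
  define c where "c = \<epsilon> / (1 + \<epsilon>)"
  have c: "0 < c" "c < 1" using \<epsilon> by (auto simp: c_def)
  \<comment> \<open>The charge for a ball is at most the fraction c / 2 of any positive gain, and
    \<theta> keeps the exponent at most c / 2. Since (1 - c) (1 + c / 2) <= 1 - c / 2, both losses
    fit into 1 / (1 + \<epsilon>) = 1 - c.\<close>
  define \<kappa> where "\<kappa> = lo * c / (2 * real (2 * A + 1))"
  define \<theta> where "\<theta> = c / (2 * hi)"
  have \<kappa>1: "\<kappa> * real (2 * A + 1) = lo * c / 2"
  proof -
    have *: "lo * c / (2 * d) * d = lo * c / 2" if "d \<noteq> 0" for d :: real using that by simp
    show ?thesis unfolding \<kappa>_def by (rule *) simp
  qed
  show thesis
  proof (rule that[of hi \<theta> \<kappa>])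
    show "0 < hi" by fact
    show "P \<beta> i \<le> hi" for \<beta> i
    proof (cases "P \<beta> i = 0")
      case False
      hence "P \<beta> i \<in> S" using P0[of \<beta> i] by (intro inS[of _ \<beta> i]) auto
      thus ?thesis by (rule lohi)
    qed (use hi0 in simp)
    show \<theta>: "0 < \<theta>" using c hi0 by (simp add: \<theta>_def)
    show "0 < \<kappa>" using lo0 c by (simp add: \<kappa>_def)
    show "\<kappa> * real (2 * A + 1) \<le> (\<Sum>a\<in>{1..A}. 2 * P (int a) 0)"
    proof -
      have "lo * c / 2 \<le> lo" using lo0 c by (simp add: field_simps)
      also have "\<dots> \<le> ?g 1" using lohi(1)[OF gS] .
      finally show ?thesis unfolding \<kappa>1 by simp
    qed
    fix \<beta> i w assume "w = ?g \<beta> \<or> w = P \<beta> i" "0 < w"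
    hence wS: "w \<in> S" by (rule inS)
    note lw = lohi[OF wS]
    define y where "y = \<theta> * (w - \<kappa> * real (2 * A + 1))"
    have "lo * c / 2 \<le> w * c / 2" using lw(1) c by simp
    have yw: "y \<le> \<theta> * w" using \<theta> lo0 c unfolding y_def \<kappa>1 by (intro mult_left_mono) auto
    have "w * c / 2 \<le> w" using c \<open>0 < w\<close> by (simp add: field_simps)
    hence y0: "0 \<le> y" unfolding y_def \<kappa>1 using \<theta> \<open>lo * c / 2 \<le> w * c / 2\<close> by (intro mult_nonneg_nonneg) auto
    have y1: "1 + y \<le> 1 + c / 2"
    proof -
      have "y \<le> \<theta> * hi" using yw lw(2) \<theta> by (meson mult_left_mono less_imp_le order_trans)
      thus ?thesis using hi0 by (simp add: \<theta>_def)
    qed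
    have "w * (1 - c / 2) \<le> w - \<kappa> * real (2 * A + 1)"
      unfolding \<kappa>1 using \<open>lo * c / 2 \<le> w * c / 2\<close> by (simp add: algebra_simps)
    hence yl: "\<theta> * (w * (1 - c / 2)) \<le> y" unfolding y_def using \<theta> by (intro mult_left_mono) auto
    have "\<theta> * w / (1 + \<epsilon>) = \<theta> * w * (1 - c)" using \<epsilon> by (simp add: c_def field_simps)
    also have "\<dots> \<le> \<theta> * (w * (1 - c / 2)) / (1 + c / 2)"
    proof -
      have "(1 - c) * (1 + c / 2) \<le> 1 - c / 2" using c by (simp add: algebra_simps)
      hence "\<theta> * w * ((1 - c) * (1 + c / 2)) \<le> \<theta> * w * (1 - c / 2)"
        using \<theta> \<open>0 < w\<close> by (intro mult_left_mono) auto
      thus ?thesis using c by (simp add: pos_le_divide_eq mult_ac)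
    qed
    also have "\<dots> \<le> y / (1 + c / 2)" using yl c by (intro divide_right_mono) auto
    also have "\<dots> \<le> y / (1 + y)" using y0 y1 by (intro divide_left_mono) (auto intro!: mult_pos_pos)
    also have "\<dots> = 1 - 1 / (1 + y)" using y0 by (simp add: field_simps)
    also have "\<dots> \<le> 1 - exp (- y)"
    proof -
      have "1 + y \<le> exp y" by (rule exp_ge_add_one_self)
      hence "exp (- y) \<le> 1 / (1 + y)" using y0 by (simp add: exp_minus field_simps)
      thus ?thesis by simp
    qed
    finally show "\<theta> * w / (1 + \<epsilon>) \<le> 1 - exp (- \<theta> * (w - \<kappa> * real (2 * A + 1)))"
      by (simp add: y_def)
  qed
qed

subsection \<open>Exponentially many alternative 2-factors\<close>

definition factors_in :: "nat \<Rightarrow> nat \<Rightarrow> nat set set \<Rightarrow> nat set set set" where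
  "factors_in n m G = {H. \<exists>V. V \<subseteq> {..<n} \<and> card V = m \<and> two_regular V H \<and> H \<subseteq> G}"

lemma prob_bind_le:
  assumes "\<And>x. x \<in> set_pmf M \<Longrightarrow> x \<notin> Bad \<Longrightarrow> measure_pmf.prob (f x) E \<le> a" "0 \<le> a"
  shows "measure_pmf.prob (bind_pmf M f) E \<le> measure_pmf.prob M Bad + a"
proof -
  have b1: "measure_pmf.prob (f x) E \<le> 1 + a" for x
    using measure_pmf.prob_le_1[of "f x" E] assms(2) by linarith
  have "measure_pmf.prob (bind_pmf M f) E = (\<integral>x. measure_pmf.prob (f x) E \<partial>measure_pmf M)"
    by (rule prob_bind_pmf)
  also have "\<dots> \<le> (\<integral>x. indicator Bad x + a \<partial>measure_pmf M)"
  proof (rule integral_mono_AE)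
    show "integrable M (\<lambda>x. measure_pmf.prob (f x) E)" "integrable M (\<lambda>x. indicator Bad x + a :: real)"
      using assms(2) b1
      by (auto intro!: measure_pmf.integrable_const_bound[where B = "1 + a"] AE_pmfI simp: indicator_def)
    show "AE x in M. measure_pmf.prob (f x) E \<le> indicator Bad x + a"
      unfolding AE_measure_pmf_iff
    proof
      fix x assume x: "x \<in> set_pmf M"
      show "measure_pmf.prob (f x) E \<le> indicator Bad x + a"
      proof (cases "x \<in> Bad")
        case True
        thus ?thesis using b1[of x] by simp
      qed (use assms x in auto)
    qed
  qed
  also have "\<dots> = measure_pmf.prob M Bad + a"
    by (subst Bochner_Integration.integral_add) (auto intro!: measure_pmf.integrable_const_bound[where B = 1])
  finally show ?thesis .
qed

text \<open>1 < sqrt (2 lam2 \<delta>) + sqrt (lam2 (1 - \<delta>)) is the criterion of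
  \<open>supercritical_weights_exist\<close> for \<open>rV = lam2 * \<delta>\<close> and
  \<open>rN = lam2 * (1 - \<delta>)\<close>. The gap below \<open>lam1\<close> leaves room for the
  vertices that the exploration uses up.\<close>

lemma threshold_weights:
  fixes \<delta> lam1 lam2 :: real
  assumes \<delta>: "0 < \<delta>" "\<delta> \<le> 1" and lam: "1 / (sqrt (2 * \<delta>) + sqrt (1 - \<delta>))\<^sup>2 < lam2" "lam2 < lam1"
    "lam1 * (1 - \<delta>) < 1"
  shows "\<exists>A B P \<epsilon> rV rN. supercritical_weights A B P \<epsilon> rV rN \<and> rV < lam1 * \<delta> \<and> rN < lam1 * (1 - \<delta>)"
proof -
  define s where "s = sqrt (2 * \<delta>) + sqrt (1 - \<delta>)"
  have s: "0 < s" using \<delta> by (auto simp: s_def add_pos_nonneg)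
  have l2: "0 < lam2" using lam(1) s by (smt (verit) divide_pos_pos s_def zero_less_power)
  have "1 < lam2 * s\<^sup>2" using lam(1) s by (simp add: s_def field_simps)
  hence "1 < sqrt (lam2 * s\<^sup>2)" by simp
  hence sup: "1 < sqrt (2 * (lam2 * \<delta>)) + sqrt (lam2 * (1 - \<delta>))"
    using s l2 by (simp add: real_sqrt_mult s_def distrib_left mult_ac)
  show ?thesis
  proof (cases "\<delta> = 1")
    case True
    hence "1 < sqrt (2 * lam2)" using sup by simp
    hence "1 < 2 * lam2" by simp
    \<comment> \<open>\<open>rN\<close> has to lie strictly below lam1 (1 - \<delta>) = 0, so a
      negative value is taken.\<close>
    from supercritical_weights_full[OF this, of "- 1"] True lam show ?thesis
      by (intro exI conjI) auto
  next
    case False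
    hence d: "0 < 1 - \<delta>" using \<delta> by simp
    have rN: "0 < lam2 * (1 - \<delta>)" "lam2 * (1 - \<delta>) < lam1 * (1 - \<delta>)" using d l2 lam by auto
    have rV: "0 < lam2 * \<delta>" "lam2 * \<delta> < lam1 * \<delta>" using \<delta> l2 lam by auto
    have "1 - sqrt (lam2 * (1 - \<delta>)) < sqrt (2 * (lam2 * \<delta>))" using sup by simp
    moreover have "0 \<le> 1 - sqrt (lam2 * (1 - \<delta>))" using rN lam(3) by simp
    ultimately have "(1 - sqrt (lam2 * (1 - \<delta>)))\<^sup>2 < (sqrt (2 * (lam2 * \<delta>)))\<^sup>2"
      by (intro power_strict_mono) auto
    hence "(1 - sqrt (lam2 * (1 - \<delta>)))\<^sup>2 < 2 * (lam2 * \<delta>)" using rV by simp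
    from supercritical_weights_exist[OF rV(1) rN(1) _ this] rN rV lam(3) show ?thesis by fastforce
  qed
qed

text \<open>At x = 1 / 16 the bound of \<open>card_small_subsets\<close> is (17 / 16)^(128 k) 16^(4
  k), and (17 / 16)^8 <= 2. Deleting at most \<open>4 * k\<close> of \<open>128 * k\<close> groups
  thus costs 32 k of 128 k bits.\<close>

lemma subset_count_bound:
  assumes "1 \<le> k"
  shows "card {D. D \<subseteq> {..<128 * k} \<and> card D \<le> 4 * k} \<le> 2 ^ (32 * k)"
proof -
  let ?c = "card {D. D \<subseteq> {..<128 * k} \<and> card D \<le> 4 * k}"
  have "real ?c * (1 / 16) ^ (4 * k) \<le> (1 + 1 / 16) ^ card {..<128 * k}"
    by (rule card_small_subsets) auto
  also have "(1 + 1 / 16 :: real) ^ card {..<128 * k} = ((17 / 16) ^ 8) ^ (16 * k)"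
    by (simp add: power_mult[symmetric])
  also have "\<dots> \<le> 2 ^ (16 * k)" by (intro power_mono) (simp_all add: power_numeral_reduce)
  finally have "real ?c \<le> 2 ^ (16 * k) * 16 ^ (4 * k)" by (simp add: power_divide field_simps)
  also have "(16::real) ^ (4 * k) = (2 ^ 4) ^ (4 * k)" by simp
  also have "\<dots> = 2 ^ (16 * k)" by (simp only: power_mult[symmetric]) simp
  also have "(2::real) ^ (16 * k) * 2 ^ (16 * k) = 2 ^ (32 * k)" by (simp add: power_add[symmetric])
  finally have "real ?c \<le> real (2 ^ (32 * k))" by simp
  thus ?thesis by (simp only: of_nat_le_iff)
qed

text \<open>A trail of length at least \<open>l\<close> has at least l / (2 A) marks, whose balances
  take at most 2 B + 3 values, so \<open>128 * k\<close> groups of \<open>2 * D\<close> marks of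
  equal balance fit in. If the sprinkled edges join the groups, at least 2^(95 k) 2-factors
  arise.\<close>

lemma (in exploration) many_factors_if_long_trail:
  assumes long: "long_trail X" and q: "0 \<le> q" "q \<le> 1" and D: "1 \<le> D" and k: "1 \<le> k"
    and size: "2 * D * (128 * k) * (2 * A * nat (2 * B + 3)) \<le> l"
  shows "measure_pmf.prob (random_subset (complete_graph n) q)
      {Y. card (factors_in n (card V) (H \<union> (X \<union> Y))) < 2 ^ (95 * k)}
    \<le> 4 ^ (128 * k) * (1 - q) ^ ((k * D) * (k * D) - 2 * (k * D))"
proof -
  obtain vs \<beta> i Ls where tr: "trail X vs \<beta> i Ls" "set vs \<subseteq> {..<n}" "l \<le> length vs"
    using long by (auto simp: long_trail_def)
  have pr: "alt_path H V X vs" "marks_ok vs Ls" "length vs \<le> 2 * A * length Ls"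
    using trail_props[OF tr(1)] by auto
  have m: "\<forall>x\<in>set Ls. \<bar>snd x\<bar> \<le> B + 1" "sorted_wrt (\<lambda>x y. fst x + 2 \<le> fst y) Ls"
    using pr(2) by (auto simp: marks_ok_def)
  obtain b ks where ks: "sorted_wrt (\<lambda>x y. x + 2 \<le> y) ks" "\<forall>k\<in>set ks. (k, b) \<in> set Ls"
    "length Ls \<le> nat (2 * (B + 1) + 1) * length ks"
    using pigeonhole_marks[OF m(1) _ m(2)] B by (metis add_nonneg_nonneg zero_le_one)
  have e: "nat (2 * (B + 1) + 1) = nat (2 * B + 3)" by (simp add: algebra_simps)
  have "2 * D * (128 * k) * (2 * A * nat (2 * B + 3)) \<le> 2 * A * length Ls" using size tr(3) pr(3) by linarith
  also have "\<dots> \<le> 2 * A * (nat (2 * B + 3) * length ks)" using ks(3) e by (intro mult_le_mono2) simp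
  finally have "2 * D * (128 * k) * (2 * A * nat (2 * B + 3)) \<le> length ks * (2 * A * nat (2 * B + 3))"
    by (simp add: mult_ac)
  moreover have "0 < 2 * A * nat (2 * B + 3)" using A B by simp
  ultimately have len: "2 * D * (128 * k) \<le> length ks" by (simp only: mult_le_cancel2)
  interpret mp: marked_path n V H X vs ks b D "128 * k"
  proof
    show "two_regular V H" "V \<subseteq> {..<n}" "alt_path H V X vs" "set vs \<subseteq> {..<n}" "1 \<le> D"
      "sorted_wrt (\<lambda>x y. x + 2 \<le> y) ks" "2 * D * (128 * k) \<le> length ks"
      using H V pr(1) tr(2) D ks(1) len by (simp_all only:)
    fix j assume "j \<in> set ks"
    hence "(j, b) \<in> set Ls" using ks(2) by blast
    thus "Suc j < length vs \<and> {vs ! j, vs ! Suc j} \<in> H \<and> bal H vs j = b"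
      using pr(2) by (force simp: marks_ok_def)
  qed
  have "{Y. card (factors_in n (card V) (H \<union> (X \<union> Y))) < 2 ^ (95 * k)}
      \<subseteq> {Y. \<not> joined {..<128 * k} (mp.link Y) k}"
  proof clarify
    fix Y assume few: "card (factors_in n (card V) (H \<union> (X \<union> Y))) < 2 ^ (95 * k)"
      and J: "joined {..<128 * k} (mp.link Y) k"
    have "mp.alternatives (H \<union> (X \<union> Y)) = factors_in n (card V) (H \<union> (X \<union> Y))"
      by (simp add: mp.alternatives_def factors_in_def)
    hence "2 ^ (128 * k) \<le> (card (factors_in n (card V) (H \<union> (X \<union> Y))) + 1) * card {D. D \<subseteq> {..<128 * k} \<and> card D \<le> 4 * k}"
      using mp.card_alternatives[OF J k, of "H \<union> (X \<union> Y)"] by (simp add: Un_assoc)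
    also have "\<dots> \<le> 2 ^ (95 * k) * 2 ^ (32 * k)"
      using few subset_count_bound[OF k] by (intro mult_le_mono) auto
    also have "\<dots> = 2 ^ (127 * k)" by (simp add: power_add[symmetric])
    finally have "128 * k \<le> 127 * k" by simp
    thus False using k by simp
  qed
  hence "measure_pmf.prob (random_subset (complete_graph n) q)
      {Y. card (factors_in n (card V) (H \<union> (X \<union> Y))) < 2 ^ (95 * k)}
    \<le> measure_pmf.prob (random_subset (complete_graph n) q) {Y. \<not> joined {..<128 * k} (mp.link Y) k}"
    by (intro measure_pmf.finite_measure_mono) auto
  also have "\<dots> \<le> 4 ^ (128 * k) * (1 - q) ^ ((k * D) * (k * D) - 2 * (k * D))"
    by (rule mp.prob_joined[OF q k])
  finally show ?thesis .
qed

text \<open>As \<open>k * D\<close> is of order \<open>n\<close>, the exponent q (k D)^2 / 2 is at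
  least e \<nu> k D / 1024 >= 300 k, which beats the entropy term 4^(128 k) <= exp (256 k).\<close>

lemma expansion_failure_bound:
  fixes q e \<nu> :: real
  assumes q: "e / real n \<le> q" "q \<le> 1" and e: "0 < e" and n: "0 < n" and \<nu>: "0 < \<nu>"
    and kD: "\<nu> * real n / 512 \<le> real (k * D)" "4 \<le> k * D" and D: "1024 * 300 \<le> e * \<nu> * real D" and k: "1 \<le> k"
  shows "4 ^ (128 * k) * (1 - q) ^ ((k * D) * (k * D) - 2 * (k * D)) \<le> 1 / 8"
proof -
  let ?N = "(k * D) * (k * D) - 2 * (k * D)"
  have q0: "0 < q" using q e n by (meson divide_pos_pos less_le_trans of_nat_0_less_iff)
  have N: "real (k * D) * real (k * D) / 2 \<le> real ?N"
  proof -
    have "2 * (2 * (k * D)) \<le> (k * D) * (k * D)" using kD(2) mult_le_mono1[of 4 "k * D" "k * D"] by simp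
    hence "(k * D) * (k * D) \<le> 2 * ?N" by linarith
    hence "real ((k * D) * (k * D)) \<le> real (2 * ?N)" by (rule of_nat_mono)
    thus ?thesis by simp
  qed
  have "(1 - q) ^ ?N \<le> exp (- q) ^ ?N"
    using q by (intro power_mono exp_minus_ge) auto
  also have "\<dots> = exp (- (q * real ?N))" by (simp add: exp_of_nat_mult[symmetric] mult_ac)
  also have "\<dots> \<le> exp (- (300 * real k))"
  proof -
    have "300 * real k = (1024 * 300) * (real k / 1024)" by simp
    also have "\<dots> \<le> (e * \<nu> * real D) * (real k / 1024)" using D by (intro mult_right_mono) auto
    also have "\<dots> = e / real n * ((\<nu> * real n / 512) * real (k * D) / 2)" using n by simp
    also have "\<dots> \<le> e / real n * (real (k * D) * real (k * D) / 2)"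
      using kD(1) e by (intro mult_left_mono divide_right_mono mult_right_mono) auto
    also have "\<dots> \<le> q * real ?N" using q N q0 e by (intro mult_mono) auto
    finally show ?thesis by simp
  qed
  finally have 1: "(1 - q) ^ ?N \<le> exp (- (300 * real k))" .
  have e2: "(4::real) \<le> exp 2"
  proof -
    have "(2::real) \<le> exp 1" using exp_ge_add_one_self[of 1] by simp
    hence "2 * 2 \<le> exp 1 * exp (1::real)" by (intro mult_mono) auto
    thus ?thesis by (simp add: exp_add[symmetric])
  qed
  have "(4::real) ^ (128 * k) \<le> exp 2 ^ (128 * k)" using e2 by (intro power_mono) auto
  also have "\<dots> = exp (256 * real k)" by (simp add: exp_of_nat_mult[symmetric] mult_ac)
  finally have "4 ^ (128 * k) * (1 - q) ^ ?N \<le> exp (256 * real k) * exp (- (300 * real k))"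
    using 1 q by (intro mult_mono) auto
  also have "\<dots> = exp (- (44 * real k))" by (simp add: exp_add[symmetric])
  also have "\<dots> \<le> exp (- 44)" using k by simp
  also have "\<dots> \<le> 1 / 8"
  proof -
    have "8 \<le> exp (44::real)" using exp_ge_add_one_self[of 44] by linarith
    thus ?thesis by (simp add: exp_minus field_simps)
  qed
  finally show ?thesis .
qed

text \<open>The density is split: \<open>lam1 / n\<close>, still above the threshold, feeds the
  exploration, and the remainder feeds the links. If at most \<eta> n vertices are used and at most
  \<eta> n lie on short cycles, the mean numbers of usable blue neighbours are still at least
  \<open>rV\<close> and \<open>rN\<close>.\<close>

theorem many_factors:
  fixes \<delta> lam :: real
  assumes \<delta>: "0 < \<delta>" "\<delta> \<le> 1" and lam: "1 / (sqrt (2 * \<delta>) + sqrt (1 - \<delta>))\<^sup>2 < lam"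
  shows "\<exists>\<eta>>0. \<exists>c>0. \<exists>L N. \<forall>n\<ge>N. \<forall>V H. V \<subseteq> {..<n} \<longrightarrow> card V = nat \<lfloor>\<delta> * real n\<rfloor> \<longrightarrow> two_regular V H \<longrightarrow>
     real (card (short_verts H L)) \<le> \<eta> * real n \<longrightarrow>
     measure_pmf.prob (random_subset (complete_graph n) (lam / real n))
       {G0. real (card (factors_in n (card V) (H \<union> G0))) < 2 powr (c * real n)} \<le> 1 / 4"
proof -
  define s where "s = sqrt (2 * \<delta>) + sqrt (1 - \<delta>)"
  have s: "0 < s" using \<delta> by (auto simp: s_def add_pos_nonneg)
  \<comment> \<open>\<open>lam1\<close> also has to satisfy lam1 (1 - \<delta>) < 1, for the sake of
    \<open>rN < 1\<close> in the weights; the threshold itself leaves room for this.\<close>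
  have crit: "1 / s\<^sup>2 * (1 - \<delta>) < 1"
  proof -
    have "sqrt (1 - \<delta>) < s" using \<delta> by (simp add: s_def)
    hence "(sqrt (1 - \<delta>))\<^sup>2 < s\<^sup>2" using \<delta> by (intro power_strict_mono) auto
    thus ?thesis using s \<delta> by (simp add: field_simps)
  qed
  obtain lam1 where l1: "1 / s\<^sup>2 < lam1" "lam1 < lam" "lam1 * (1 - \<delta>) < 1"
  proof (cases "\<delta> = 1")
    case True
    obtain z where "1 / s\<^sup>2 < z" "z < lam" using lam dense unfolding s_def by blast
    thus thesis using True by (intro that[of z]) auto
  next
    case False
    hence d: "0 < 1 - \<delta>" using \<delta> by simp
    have "1 / s\<^sup>2 < min lam (1 / (1 - \<delta>))" using crit lam d by (simp add: s_def pos_less_divide_eq)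
    then obtain z where "1 / s\<^sup>2 < z" "z < min lam (1 / (1 - \<delta>))" using dense by blast
    thus thesis using d by (intro that[of z]) (auto simp: pos_less_divide_eq)
  qed
  obtain lam2 where l2: "1 / s\<^sup>2 < lam2" "lam2 < lam1" using l1(1) dense by blast
  have lam10: "0 < lam1" using l1(1) s by (smt (verit) divide_pos_pos zero_less_power)
  obtain A B P \<epsilon> rV rN where W: "supercritical_weights A B P \<epsilon> rV rN" and r: "rV < lam1 * \<delta>" "rN < lam1 * (1 - \<delta>)"
    using threshold_weights[OF \<delta> l2[unfolded s_def] l1(3)] by blast
  have A: "1 \<le> A" and B: "0 \<le> B" using W by (auto simp: supercritical_weights_def)
  obtain Pmax \<theta> \<kappa> where c: "0 < Pmax" "\<And>\<beta> i. P \<beta> i \<le> Pmax" "0 < \<theta>" "0 < \<kappa>"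
    "\<And>\<beta> i w. w = (\<Sum>a\<in>{1..A}. 2 * P (\<beta> - 1 + int a) 0) \<or> w = P \<beta> i \<Longrightarrow> 0 < w \<Longrightarrow>
        \<theta> * w / (1 + \<epsilon>) \<le> 1 - exp (- \<theta> * (w - \<kappa> * real (2 * A + 1)))"
    "\<kappa> * real (2 * A + 1) \<le> (\<Sum>a\<in>{1..A}. 2 * P (int a) 0)"
    using exploration_constants[OF W] by blast
  \<comment> \<open>Loss in units of \<eta> n: \<open>3 ^ A\<close> for landing points spoiled by
    used vertices, 1 for short cycles, 1 for the rounding in \<open>card V\<close>.\<close>
  define T where "T = 2 + (3::real) ^ A"
  have T: "2 < T" by (simp add: T_def)
  define \<eta> where "\<eta> = Min {(lam1 * \<delta> - rV) / (lam1 * T), (lam1 * (1 - \<delta>) - rN) / lam1, \<delta> / (2 * T)}"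
  have \<eta>: "0 < \<eta>" using r lam10 T \<delta> by (simp add: \<eta>_def)
  have \<eta>1: "rV \<le> lam1 * (\<delta> - T * \<eta>)"
  proof -
    have "\<eta> \<le> (lam1 * \<delta> - rV) / (lam1 * T)" by (simp add: \<eta>_def)
    thus ?thesis using lam10 T by (simp add: field_simps)
  qed
  have \<eta>2: "rN \<le> lam1 * (1 - \<delta> - \<eta>)"
  proof -
    have "\<eta> \<le> (lam1 * (1 - \<delta>) - rN) / lam1" by (simp add: \<eta>_def)
    thus ?thesis using lam10 by (simp add: field_simps)
  qed
  have \<eta>3: "T * \<eta> < \<delta>"
  proof -
    have "\<eta> \<le> \<delta> / (2 * T)" by (simp add: \<eta>_def)
    thus ?thesis using T \<delta> by (simp add: field_simps)
  qed
  \<comment> \<open>The largest trail length, relative to \<open>n\<close>, that the condition on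
    \<open>l\<close> in \<open>exploration\<close> admits.\<close>
  define \<mu> where "\<mu> = \<kappa> * \<eta> / (4 * real A * Pmax)"
  have \<mu>: "0 < \<mu>" using c \<eta> A by (simp add: \<mu>_def)
  define b where "b = 2 * A * nat (2 * B + 3)"
  have b: "0 < b" using A B by (simp add: b_def)
  define \<nu> where "\<nu> = \<mu> / (2 * real b)"
  have \<nu>: "0 < \<nu>" using \<mu> b by (simp add: \<nu>_def)
  define e where "e = lam - lam1"
  have e: "0 < e" using l1 by (simp add: e_def)
  \<comment> \<open>Large enough for the links to beat the entropy in
    \<open>expansion_failure_bound\<close>.\<close>
  define D where "D = nat \<lceil>1024 * 300 / (e * \<nu>)\<rceil> + 4"
  have D: "4 \<le> D" "1024 * 300 \<le> e * \<nu> * real D"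
  proof -
    show "4 \<le> D" by (simp add: D_def)
    have "1024 * 300 / (e * \<nu>) \<le> real D" unfolding D_def by linarith
    thus "1024 * 300 \<le> e * \<nu> * real D" using e \<nu> by (simp add: field_simps)
  qed
  \<comment> \<open>Gives 256 D k b <= \<mu> n / 2, which is at most the length \<open>l\<close> of
    the trail.\<close>
  define kk where "kk n = nat \<lfloor>\<nu> * real n / (256 * real D)\<rfloor>" for n
  have "eventually (\<lambda>n. \<nu> * real n \<ge> 512 * real D \<and> 1 \<le> \<eta> * real n \<and> 1 \<le> (\<mu> / 2) * real n \<and>
      exp (- \<theta> * (\<kappa> * (\<eta> * real n) / 2)) \<le> 1 / 8 \<and> lam < real n \<and> 0 < n) sequentially"
  proof (intro eventually_conj)
    show "eventually (\<lambda>n. \<nu> * real n \<ge> 512 * real D) sequentially" using \<nu> by real_asymp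
    show "eventually (\<lambda>n. 1 \<le> \<eta> * real n) sequentially" using \<eta> by real_asymp
    show "eventually (\<lambda>n. 1 \<le> (\<mu> / 2) * real n) sequentially" using \<mu> by real_asymp
    show "eventually (\<lambda>n. exp (- \<theta> * (\<kappa> * (\<eta> * real n) / 2)) \<le> 1 / 8) sequentially"
      using \<eta> c(3,4) by real_asymp
    show "eventually (\<lambda>n. lam < real n) sequentially" by real_asymp
    show "eventually (\<lambda>n. (0::nat) < n) sequentially" by (rule eventually_gt_at_top)
  qed
  then obtain N where N: "\<And>n. n \<ge> N \<Longrightarrow> \<nu> * real n \<ge> 512 * real D \<and> 1 \<le> \<eta> * real n \<and> 1 \<le> (\<mu> / 2) * real n \<and>
      exp (- \<theta> * (\<kappa> * (\<eta> * real n) / 2)) \<le> 1 / 8 \<and> lam < real n \<and> 0 < n"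
    unfolding eventually_sequentially by blast
  have c0: "0 < \<nu> / (512 * real D)" using \<nu> D by simp
  show ?thesis
  proof (rule exI[of _ \<eta>], rule conjI[OF \<eta>], rule exI[of _ "\<nu> / (512 * real D)"], rule conjI[OF c0],
      rule exI[of _ "2 * A"], rule exI[of _ N], intro allI impI)
    fix n V H
    assume n: "n \<ge> N" and V: "V \<subseteq> {..<n}" "card V = nat \<lfloor>\<delta> * real n\<rfloor>" and H: "two_regular V H"
      and short: "real (card (short_verts H (2 * A))) \<le> \<eta> * real n"
    note Nn = N[OF n]
    have n0: "0 < n" using Nn by simp
    define p where "p = lam1 / real n"
    have p: "0 < p" "p < 1" using lam10 l1 Nn by (auto simp: p_def)
    \<comment> \<open>Solves 1 - (1 - p) (1 - q) = lam / n, as sprinkling demands.\<close>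
    define q where "q = (lam / real n - p) / (1 - p)"
    have q: "0 \<le> q" "q \<le> 1" "e / real n \<le> q"
    proof -
      have d: "lam / real n - p = e / real n" by (simp add: p_def e_def diff_divide_distrib)
      have "lam / real n \<le> 1" using Nn by simp
      thus "q \<le> 1" using p by (simp add: q_def)
      have "0 \<le> e / real n" using e by simp
      thus "0 \<le> q" using p e unfolding q_def d by (intro divide_nonneg_nonneg) simp_all
      have "(e / real n) * (1 - p) \<le> (e / real n) * 1" using p e by (intro mult_left_mono) auto
      thus "e / real n \<le> q" using p unfolding q_def d by (subst pos_le_divide_eq) auto
    qed
    have pq: "1 - (1 - p) * (1 - q) = lam / real n"
    proof -
      have "(1 - p) * q = lam / real n - p" using p by (simp add: q_def)
      thus ?thesis by (simp add: algebra_simps)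
    qed
    have cV: "\<delta> * real n - 1 \<le> real (card V)" "real (card V) \<le> \<delta> * real n"
    proof -
      have "0 \<le> \<delta> * real n" using \<delta> by simp
      hence "real (card V) = real_of_int \<lfloor>\<delta> * real n\<rfloor>" using V(2) by simp
      thus "\<delta> * real n - 1 \<le> real (card V)" "real (card V) \<le> \<delta> * real n" by linarith+
    qed
    define l where "l = nat \<lfloor>\<mu> * real n\<rfloor>"
    have l: "real l \<le> \<mu> * real n" "\<mu> / 2 * real n \<le> real l"
    proof -
      have m0: "0 \<le> \<mu> * real n" using \<mu> by simp
      thus "real l \<le> \<mu> * real n" by (simp add: l_def)
      have "\<mu> * real n - 1 \<le> real l" using m0 unfolding l_def by linarith
      thus "\<mu> / 2 * real n \<le> real l" using Nn by linarith
    qed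
    interpret ex: exploration n V H A B p P Pmax \<epsilon> rV rN \<theta> \<kappa> "\<eta> * real n" l
    proof
      show "two_regular V H" "V \<subseteq> {..<n}" "1 \<le> A" "0 \<le> B" by fact+
      show "0 \<le> p" "p \<le> 1" "0 < \<theta>" "0 \<le> \<kappa>" "0 \<le> \<eta> * real n" using p c \<eta> by auto
      show "0 < \<epsilon>" "\<And>\<beta> i. 0 \<le> P \<beta> i" "\<And>\<beta> i. B < \<bar>\<beta>\<bar> \<or> A \<le> i \<Longrightarrow> P \<beta> i = 0"
        using W by (auto simp: supercritical_weights_def)
      show "\<And>\<beta> i. P \<beta> i \<le> Pmax" by fact
      show "P \<beta> i * (1 + \<epsilon>) \<le> rV * (\<Sum>a\<in>{1..A}. 2 * P (\<beta> - 1 + int a) 0) + rN * P (\<beta> - 1) (Suc i)"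
        if "\<bar>\<beta>\<bar> \<le> B" "i < A" for \<beta> i using W that by (auto simp: supercritical_weights_def)
      show "rV \<le> p * (real (card V) - real (card (short_verts H (2 * A))) - 3 ^ A * (\<eta> * real n))"
      proof -
        have "(\<delta> - T * \<eta>) * real n \<le> real (card V) - real (card (short_verts H (2 * A))) - 3 ^ A * (\<eta> * real n)"
          using cV(1) short Nn by (simp add: T_def algebra_simps)
        hence "p * ((\<delta> - T * \<eta>) * real n) \<le> p * (real (card V) - real (card (short_verts H (2 * A))) - 3 ^ A * (\<eta> * real n))"
          using p by (intro mult_left_mono) auto
        moreover have "p * ((\<delta> - T * \<eta>) * real n) = lam1 * (\<delta> - T * \<eta>)" using n0 by (simp add: p_def)
        ultimately show ?thesis using \<eta>1 by linarith
      qed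
      show "rN \<le> p * (real n - real (card V) - \<eta> * real n)"
      proof -
        have "(1 - \<delta> - \<eta>) * real n \<le> real n - real (card V) - \<eta> * real n" using cV(2) by (simp add: algebra_simps)
        hence "p * ((1 - \<delta> - \<eta>) * real n) \<le> p * (real n - real (card V) - \<eta> * real n)" using p by (intro mult_left_mono) auto
        moreover have "p * ((1 - \<delta> - \<eta>) * real n) = lam1 * (1 - \<delta> - \<eta>)" using n0 by (simp add: p_def)
        ultimately show ?thesis using \<eta>2 by linarith
      qed
      show "\<theta> * w / (1 + \<epsilon>) \<le> 1 - exp (- \<theta> * (w - \<kappa> * real (2 * A + 1)))"
        if "w = (\<Sum>a\<in>{1..A}. 2 * P (\<beta> - 1 + int a) 0) \<or> w = P \<beta> i" "0 < w" for \<beta> i w by (rule c(5)[OF that])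
      show "\<kappa> * real (2 * A + 1) \<le> (\<Sum>a\<in>{1..A}. 2 * P (int a) 0)" by fact
      show "3 ^ A * (\<eta> * real n) + real (card (short_verts H (2 * A))) < real (card V)"
      proof -
        have "3 ^ A * (\<eta> * real n) + real (card (short_verts H (2 * A))) + 1 \<le> T * \<eta> * real n"
          using short Nn by (simp add: T_def algebra_simps)
        also have "\<dots> < \<delta> * real n" using \<eta>3 n0 by simp
        finally show ?thesis using cV(1) by linarith
      qed
      show "4 * real A * real l * Pmax \<le> \<kappa> * (\<eta> * real n)"
      proof -
        have "4 * real A * real l * Pmax = (4 * real A * Pmax) * real l" by simp
        also have "\<dots> \<le> (4 * real A * Pmax) * (\<mu> * real n)" using l(1) c A by (intro mult_left_mono) auto
        also have "\<dots> = \<kappa> * (\<eta> * real n)" using c A by (simp add: \<mu>_def)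
        finally show ?thesis by simp
      qed
    qed
    define k where "k = kk n"
    have x2: "2 \<le> \<nu> * real n / (256 * real D)" using Nn D by (simp add: field_simps)
    have k: "real k \<le> \<nu> * real n / (256 * real D)" "\<nu> * real n / (512 * real D) \<le> real k" "1 \<le> k"
    proof -
      have f: "real k = real_of_int \<lfloor>\<nu> * real n / (256 * real D)\<rfloor>" using x2 unfolding k_def kk_def by simp
      show "real k \<le> \<nu> * real n / (256 * real D)" unfolding f by linarith
      have h: "\<nu> * real n / (512 * real D) = (\<nu> * real n / (256 * real D)) / 2" by simp
      have "\<nu> * real n / (256 * real D) - 1 \<le> real k" unfolding f by linarith
      moreover have "y / 2 \<le> z" if "y - 1 \<le> z" "2 \<le> y" for y z :: real using that by linarith
      ultimately show "\<nu> * real n / (512 * real D) \<le> real k" unfolding h using x2 by blast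
      have "1 < real k + 1" "1 \<le> real k" using x2 unfolding f by linarith+
      thus "1 \<le> k" by simp
    qed
    have size: "2 * D * (128 * k) * (2 * A * nat (2 * B + 3)) \<le> l"
    proof -
      have "real (2 * D * (128 * k) * b) = 256 * real D * real b * real k" by simp
      also have "\<dots> \<le> 256 * real D * real b * (\<nu> * real n / (256 * real D))"
        using k(1) by (intro mult_left_mono) auto
      also have "\<dots> = \<mu> / 2 * real n" using D b by (simp add: \<nu>_def)
      also have "\<dots> \<le> real l" by (rule l(2))
      finally show ?thesis unfolding b_def[symmetric] by (simp only: of_nat_le_iff)
    qed
    have fb: "4 ^ (128 * k) * (1 - q) ^ ((k * D) * (k * D) - 2 * (k * D)) \<le> 1 / 8"
    proof (rule expansion_failure_bound[OF q(3,2) e n0 \<nu>])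
      show "\<nu> * real n / 512 \<le> real (k * D)" using k(2) D by (simp add: field_simps)
      show "4 \<le> k * D" using k(3) D(1) mult_le_mono[of 1 k 4 D] by simp
    qed (use D k in auto)
    let ?E = "complete_graph n"
    let ?few = "{G0. real (card (factors_in n (card V) (H \<union> G0))) < 2 powr (\<nu> / (512 * real D) * real n)}"
    have pk: "2 powr (\<nu> / (512 * real D) * real n) \<le> real (2 ^ (95 * k))"
    proof -
      have "2 powr (\<nu> / (512 * real D) * real n) \<le> 2 powr (real (95 * k))"
        using k(2) by (intro powr_mono) auto
      also have "\<dots> = real (2 ^ (95 * k))" by (subst powr_realpow) auto
      finally show ?thesis .
    qed
    have "random_subset ?E (lam / real n) = bind_pmf (random_subset ?E p) (\<lambda>X. map_pmf (\<lambda>Y. X \<union> Y) (random_subset ?E q))"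
      unfolding pq[symmetric] using p q by (intro random_subset_union finite_complete_graph) auto
    hence "measure_pmf.prob (random_subset ?E (lam / real n)) ?few
      \<le> measure_pmf.prob (random_subset ?E p) {X. \<not> ex.long_trail X} + 1 / 8"
    proof (simp only:, intro prob_bind_le)
      fix X assume "X \<notin> {X. \<not> ex.long_trail X}"
      hence "ex.long_trail X" by simp
      have "measure_pmf.prob (map_pmf (\<lambda>Y. X \<union> Y) (random_subset ?E q)) ?few
        = measure_pmf.prob (random_subset ?E q) {Y. X \<union> Y \<in> ?few}" by (simp add: vimage_def)
      also have "\<dots> \<le> measure_pmf.prob (random_subset ?E q) {Y. card (factors_in n (card V) (H \<union> (X \<union> Y))) < 2 ^ (95 * k)}"
      proof (rule measure_pmf.finite_measure_mono)
        show "{Y. X \<union> Y \<in> ?few} \<subseteq> {Y. card (factors_in n (card V) (H \<union> (X \<union> Y))) < 2 ^ (95 * k)}"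
        proof
          fix Y assume "Y \<in> {Y. X \<union> Y \<in> ?few}"
          hence "real (card (factors_in n (card V) (H \<union> (X \<union> Y)))) < real (2 ^ (95 * k))"
            using pk by (simp only: mem_Collect_eq)
          thus "Y \<in> {Y. card (factors_in n (card V) (H \<union> (X \<union> Y))) < 2 ^ (95 * k)}"
            by (simp only: of_nat_less_iff mem_Collect_eq)
        qed
      qed simp
      also have "\<dots> \<le> 4 ^ (128 * k) * (1 - q) ^ ((k * D) * (k * D) - 2 * (k * D))"
        using D by (intro ex.many_factors_if_long_trail[OF \<open>ex.long_trail X\<close> q(1,2) _ k(3) size]) simp
      also have "\<dots> \<le> 1 / 8" by (rule fb)
      finally show "measure_pmf.prob (map_pmf (\<lambda>Y. X \<union> Y) (random_subset ?E q)) ?few \<le> 1 / 8" .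
    qed simp
    also have "\<dots> \<le> exp (- \<theta> * (\<kappa> * (\<eta> * real n) / 2)) + 1 / 8" using ex.long_trail_prob by simp
    also have "\<dots> \<le> 1 / 4" using Nn by simp
    finally show "measure_pmf.prob (random_subset ?E (lam / real n)) ?few \<le> 1 / 4" .
  qed
qed

subsection \<open>The posterior law of the planted 2-factor\<close>

definition random_two_factor :: "nat \<Rightarrow> nat \<Rightarrow> nat set set pmf" where
  "random_two_factor n m =
     bind_pmf (pmf_of_set {V. V \<subseteq> {..<n} \<and> card V = m}) (\<lambda>V. pmf_of_set (two_factors V))"

lemma finite_vertex_sets: "finite {V. V \<subseteq> {..<n::nat} \<and> card V = m}"
  by (rule finite_subset[of _ "Pow {..<n}"]) auto

lemma vertex_sets_nonempty: "m \<le> n \<Longrightarrow> {V. V \<subseteq> {..<n::nat} \<and> card V = m} \<noteq> {}"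
  using obtain_subset_with_card_n[of m "{..<n}"] by force

text \<open>The hidden 2-factor and the background graph are independent, so the former may be drawn
  first; everything is then estimated for fixed \<open>H\<close>.\<close>

lemma planted_cycles_eq:
  assumes "nat \<lfloor>\<delta> * real n\<rfloor> \<le> n"
  shows "planted_cycles n lam \<delta> = bind_pmf (random_two_factor n (nat \<lfloor>\<delta> * real n\<rfloor>))
     (\<lambda>H. map_pmf (\<lambda>G0. (H, G0 \<union> H)) (random_subset (complete_graph n) (lam / real n)))"
proof -
  let ?Vs = "{V. V \<subseteq> {..<n} \<and> card V = nat \<lfloor>\<delta> * real n\<rfloor>}"
  have "bind_pmf (pmf_of_set ?Vs) (\<lambda>V. bind_pmf (pmf_of_set {H. is_two_factor V H}) (\<lambda>H. return_pmf (H, G0 \<union> H)))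
     = bind_pmf (pmf_of_set ?Vs) (\<lambda>V. bind_pmf (pmf_of_set (two_factors V)) (\<lambda>H. return_pmf (H, G0 \<union> H)))" for G0
  proof (rule bind_pmf_cong[OF refl])
    fix V assume "V \<in> set_pmf (pmf_of_set ?Vs)"
    hence "V \<in> ?Vs" by (subst (asm) set_pmf_of_set[OF vertex_sets_nonempty[OF assms] finite_vertex_sets])
    hence "finite V" using finite_subset by blast
    hence "{H. is_two_factor V H} = two_factors V" by (simp add: is_two_factor_iff two_factors_def)
    thus "bind_pmf (pmf_of_set {H. is_two_factor V H}) (\<lambda>H. return_pmf (H, G0 \<union> H))
      = bind_pmf (pmf_of_set (two_factors V)) (\<lambda>H. return_pmf (H, G0 \<union> H))" by simp
  qed
  hence "planted_cycles n lam \<delta> = bind_pmf (random_subset (complete_graph n) (lam / real n))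
      (\<lambda>G0. bind_pmf (random_two_factor n (nat \<lfloor>\<delta> * real n\<rfloor>)) (\<lambda>H. return_pmf (H, G0 \<union> H)))"
    by (simp add: planted_cycles_def random_two_factor_def erdos_renyi_eq bind_assoc_pmf)
  also have "\<dots> = bind_pmf (random_two_factor n (nat \<lfloor>\<delta> * real n\<rfloor>))
      (\<lambda>H. bind_pmf (random_subset (complete_graph n) (lam / real n)) (\<lambda>G0. return_pmf (H, G0 \<union> H)))"
    by (rule bind_commute_pmf)
  finally show ?thesis by (simp add: map_pmf_def)
qed

context
  fixes n m :: nat
  assumes m: "3 \<le> m" "m \<le> n"
begin

lemma set_random_two_factor:
  "H \<in> set_pmf (random_two_factor n m) \<longleftrightarrow> (\<exists>V. V \<subseteq> {..<n} \<and> card V = m \<and> two_regular V H)"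
proof -
  have "set_pmf (pmf_of_set (two_factors V)) = two_factors V" if "V \<subseteq> {..<n}" "card V = m" for V
  proof (rule set_pmf_of_set)
    have "finite V" using that finite_subset by blast
    thus "two_factors V \<noteq> {}" "finite (two_factors V)" using two_factors_nonempty finite_two_factors m that by auto
  qed
  thus ?thesis unfolding random_two_factor_def set_bind_pmf
    by (subst set_pmf_of_set[OF vertex_sets_nonempty[OF m(2)] finite_vertex_sets]) (auto simp: two_factors_def)
qed

lemma set_random_two_factor_subset: "H \<in> set_pmf (random_two_factor n m) \<Longrightarrow> H \<subseteq> complete_graph n"
  by (auto simp: set_random_two_factor complete_graph_def two_regular_def)

lemma card_random_two_factor:
  assumes "H \<in> set_pmf (random_two_factor n m)"
  shows "card H = m"
proof -
  obtain V where V: "V \<subseteq> {..<n}" "card V = m" "two_regular V H" using assms set_random_two_factor by blast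
  have "finite V" using V(1) finite_subset by blast
  thus ?thesis using card_two_regular V by blast
qed

text \<open>The law is uniform: a 2-factor determines its vertex set as the union of its edges, and
  all vertex sets of size \<open>m\<close> carry equally many 2-factors.\<close>

lemma pmf_random_two_factor:
  "\<exists>w. \<forall>H. pmf (random_two_factor n m) H = (if H \<in> factors_in n m UNIV then w else 0)"
proof -
  let ?Vs = "{V. V \<subseteq> {..<n} \<and> card V = m}"
  define w where "w = 1 / real (card (two_factors {..<m})) / real (card ?Vs)"
  have "pmf (random_two_factor n m) H = (if H \<in> factors_in n m UNIV then w else 0)" for H
  proof (cases "H \<in> factors_in n m UNIV")
    case False
    thus ?thesis using set_random_two_factor[of H] by (auto simp: factors_in_def pmf_eq_0_set_pmf)
  next
    case True
    then obtain V0 where V0: "V0 \<in> ?Vs" "two_regular V0 H" by (auto simp: factors_in_def)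
    have one: "pmf (pmf_of_set (two_factors V)) H = (if V = V0 then 1 / real (card (two_factors {..<m})) else 0)" if V: "V \<in> ?Vs" for V
    proof -
      have fV: "finite V" using V finite_subset by blast
      have "two_factors V \<noteq> {}" "finite (two_factors V)" using two_factors_nonempty finite_two_factors m V fV by auto
      moreover have "card (two_factors V) = card (two_factors {..<m})" using V fV by (intro card_two_factors_cong) auto
      moreover have "H \<in> two_factors V \<longleftrightarrow> V = V0"
        using two_regular_Union[OF V0(2)] two_regular_Union[of V H] V0(2) by (auto simp: two_factors_def)
      ultimately show ?thesis by (simp add: pmf_of_set indicator_def)
    qed
    have "pmf (random_two_factor n m) H = (\<Sum>V\<in>?Vs. pmf (pmf_of_set (two_factors V)) H) / real (card ?Vs)"
      unfolding random_two_factor_def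
      by (rule pmf_bind_pmf_of_set[OF vertex_sets_nonempty[OF m(2)] finite_vertex_sets])
    also have "(\<Sum>V\<in>?Vs. pmf (pmf_of_set (two_factors V)) H) = (\<Sum>V\<in>?Vs. if V = V0 then 1 / real (card (two_factors {..<m})) else 0)"
      using one by (intro sum.cong) auto
    also have "\<dots> = 1 / real (card (two_factors {..<m}))"
      using V0(1) by (subst sum.delta[OF finite_vertex_sets]) simp
    finally show ?thesis using True by (simp add: w_def)
  qed
  thus ?thesis by blast
qed

lemma expected_short_verts:
  assumes L: "L < m"
  shows "(\<integral>H. real (card (short_verts H L)) \<partial>measure_pmf (random_two_factor n m))
     \<le> real m * real L / (real m - real L)"
proof -
  let ?Vs = "{V. V \<subseteq> {..<n} \<and> card V = m}" and ?b = "real m * real L / (real m - real L)"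
  have V: "finite V" "finite (two_factors V)" "two_factors V \<noteq> {}" "card V = m" if "V \<in> ?Vs" for V
  proof -
    show "finite V" using that finite_subset by blast
    thus "finite (two_factors V)" "two_factors V \<noteq> {}" "card V = m"
      using two_factors_nonempty finite_two_factors m that by auto
  qed
  have "(\<integral>H. real (card (short_verts H L)) \<partial>measure_pmf (random_two_factor n m))
    = (\<Sum>V\<in>?Vs. (\<integral>H. real (card (short_verts H L)) \<partial>measure_pmf (pmf_of_set (two_factors V))) / real (card ?Vs))"
    unfolding random_two_factor_def
  proof (subst pmf_expectation_bind_pmf_of_set[OF vertex_sets_nonempty[OF m(2)] finite_vertex_sets])
    show "finite (set_pmf (pmf_of_set (two_factors V)))" if "V \<in> ?Vs" for V
      by (subst set_pmf_of_set[OF V(3,2)[OF that]]) (rule V(2)[OF that])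
  qed (simp add: divide_inverse mult.commute)
  also have "\<dots> \<le> (\<Sum>V\<in>?Vs. ?b / real (card ?Vs))"
  proof (intro sum_mono divide_right_mono)
    fix V assume V': "V \<in> ?Vs"
    note v = V[OF V']
    have "(\<integral>H. real (card (short_verts H L)) \<partial>measure_pmf (pmf_of_set (two_factors V)))
       = (\<Sum>H\<in>two_factors V. real (card (short_verts H L))) / real (card (two_factors V))"
      using v by (simp add: integral_pmf_of_set)
    also have "\<dots> \<le> ?b"
    proof -
      have "0 < real (card (two_factors V))" using v by (simp add: card_gt_0_iff)
      thus ?thesis using sum_card_short_verts[OF v(1), of L] L v(4) by (simp add: pos_divide_le_eq mult.commute)
    qed
    finally show "(\<integral>H. real (card (short_verts H L)) \<partial>measure_pmf (pmf_of_set (two_factors V))) \<le> ?b" .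
  qed simp
  also have "\<dots> = ?b"
    using finite_vertex_sets[of n m] vertex_sets_nonempty[OF m(2)] by (simp add: card_gt_0_iff)
  finally show ?thesis .
qed

lemma prob_random_two_factor_short:
  assumes L: "L < m" and t: "0 < t"
  shows "measure_pmf.prob (random_two_factor n m) {H. t < real (card (short_verts H L))}
     \<le> real m * real L / (real m - real L) / t"
proof -
  let ?M = "random_two_factor n m" and ?B = "{H. t < real (card (short_verts H L))}"
  have "finite (set_pmf ?M)"
    by (rule finite_subset[of _ "Pow (complete_graph n)"])
       (use set_random_two_factor_subset in \<open>auto simp: finite_complete_graph\<close>)
  hence "(\<integral>H. t * indicator ?B H \<partial>measure_pmf ?M) \<le> (\<integral>H. real (card (short_verts H L)) \<partial>measure_pmf ?M)"
    by (intro integral_mono integrable_measure_pmf_finite) (auto simp: indicator_def)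
  hence "t * measure_pmf.prob ?M ?B \<le> real m * real L / (real m - real L)"
    using expected_short_verts[OF L] by simp
  thus ?thesis unfolding pos_le_divide_eq[OF t] by (simp only: mult.commute)
qed

end

lemma pmf_bind_map_pair:
  "pmf (bind_pmf M (\<lambda>x. map_pmf (\<lambda>y. (x, u x y)) R)) (a, b) = pmf M a * measure_pmf.prob R {y. u a y = b}"
proof -
  have "pmf (map_pmf (\<lambda>y. (x, u x y)) R) (a, b) = indicator {a} x * measure_pmf.prob R {y. u a y = b}" for x
    by (cases "x = a") (auto simp: pmf_map vimage_def)
  hence "pmf (bind_pmf M (\<lambda>x. map_pmf (\<lambda>y. (x, u x y)) R)) (a, b)
     = (\<integral>x. indicator {a} x * measure_pmf.prob R {y. u a y = b} \<partial>measure_pmf M)"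
    by (simp add: pmf_bind)
  also have "\<dots> = measure_pmf.prob M {a} * measure_pmf.prob R {y. u a y = b}" by simp
  finally show ?thesis by (simp add: measure_pmf_single)
qed

text \<open>The weight depends on \<open>H\<close> only through its number of edges: given \<open>G\<close>, all
  2-factors of the right size in \<open>G\<close> are equally likely.\<close>

lemma pmf_planted_cycles:
  assumes m: "m = nat \<lfloor>\<delta> * real n\<rfloor>" "3 \<le> m" "m \<le> n" and p: "0 \<le> lam / real n" "lam / real n \<le> 1"
  shows "\<exists>w. \<forall>H G. pmf (planted_cycles n lam \<delta>) (H, G)
     = (if G \<subseteq> complete_graph n \<and> H \<in> factors_in n m G then w G else 0)"
proof -
  let ?E = "complete_graph n" and ?p = "lam / real n"
  obtain w0 where w0: "\<And>H. pmf (random_two_factor n m) H = (if H \<in> factors_in n m UNIV then w0 else 0)"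
    using pmf_random_two_factor[OF m(2,3)] by blast
  define w where "w G = w0 * (?p ^ (card G - m) * (1 - ?p) ^ card (?E - G))" for G
  have "pmf (planted_cycles n lam \<delta>) (H, G) = (if G \<subseteq> ?E \<and> H \<in> factors_in n m G then w G else 0)" for H G
  proof -
    have eq: "pmf (planted_cycles n lam \<delta>) (H, G) = pmf (random_two_factor n m) H
        * measure_pmf.prob (random_subset ?E ?p) {G0. G0 \<union> H = G}"
      using planted_cycles_eq[of \<delta> n lam] m by (simp add: pmf_bind_map_pair)
    show ?thesis
    proof (cases "H \<in> factors_in n m UNIV")
      case False
      thus ?thesis using eq w0 by (auto simp: factors_in_def)
    next
      case True
      then obtain V where V: "V \<subseteq> {..<n}" "card V = m" "two_regular V H" by (auto simp: factors_in_def)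
      have fV: "finite V" using V finite_subset by blast
      have HE: "H \<subseteq> ?E" using V by (auto simp: complete_graph_def two_regular_def)
      have cH: "card H = m" "finite H" using card_two_regular[OF fV V(3)] two_regular_finite[OF fV V(3)] V(2) by auto
      have fac: "H \<in> factors_in n m G \<longleftrightarrow> H \<subseteq> G" using V by (auto simp: factors_in_def)
      show ?thesis
      proof (cases "H \<subseteq> G \<and> G \<subseteq> ?E")
        case t: True
        have "{G0. G0 \<union> H = G} = {G0. G - H \<subseteq> G0 \<and> G0 \<subseteq> G}" using t by auto
        hence "measure_pmf.prob (random_subset ?E ?p) {G0. G0 \<union> H = G} = ?p ^ card (G - H) * (1 - ?p) ^ card (?E - G)"
          using t prob_random_subset_between[OF finite_complete_graph _ _ p, of "G - H" G n] by auto
        moreover have "card (G - H) = card G - m" using t cH by (simp add: card_Diff_subset)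
        ultimately show ?thesis using eq w0 True t fac by (simp add: w_def)
      next
        case False
        have "measure_pmf.prob (random_subset ?E ?p) {G0. G0 \<union> H = G} = 0"
          unfolding measure_pmf_zero_iff using set_random_subset[of _ ?E ?p] False HE by fastforce
        thus ?thesis using eq False fac by auto
      qed
    qed
  qed
  thus ?thesis by (intro exI[of _ w] allI)
qed

subsection \<open>Recovery from a nearly uniform posterior\<close>

text \<open>The posterior of \<open>H\<close> given \<open>G\<close> is uniform on
  \<open>F G\<close>, and outside \<open>Bad\<close> any output \<open>H'\<close> is hit by at most
  a fraction \<open>r\<close> of \<open>F G\<close>. Averaging over the output covers every
  randomized estimator.\<close>

lemma prob_success_le:
  fixes P :: "('h \<times> 'g) pmf" and e :: "'g \<Rightarrow> 'k pmf"
  assumes pmf: "\<And>H G. pmf P (H, G) = (if G \<in> Gs \<and> H \<in> F G then w G else 0)"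
    and fin: "finite Gs" "\<And>G. G \<in> Gs \<Longrightarrow> finite (F G)"
    and hit: "\<And>G H'. G \<in> Gs \<Longrightarrow> G \<notin> Bad \<Longrightarrow> real (card {H \<in> F G. hit H H'}) \<le> r * real (card (F G))"
    and r: "0 \<le> r"
  shows "measure_pmf.prob (bind_pmf P (\<lambda>(H, G). map_pmf (Pair H) (e G))) {(H, H'). hit H H'}
     \<le> r + measure_pmf.prob P {(H, G). G \<in> Bad}"
proof -
  define A where "A = (\<lambda>(G, H). (H, G)) ` Sigma Gs F"
  have finA: "finite A" using fin by (simp add: A_def finite_SigmaI)
  have setP: "set_pmf P \<subseteq> A"
  proof
    fix x assume x: "x \<in> set_pmf P"
    obtain H G where HG: "x = (H, G)" by (cases x)
    have "pmf P (H, G) \<noteq> 0" using x HG by (simp add: set_pmf_iff)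
    hence "(G, H) \<in> Sigma Gs F" using pmf[of H G] by (auto split: if_splits)
    thus "x \<in> A" unfolding A_def HG by force
  qed
  have E: "(\<integral>x. f x \<partial>measure_pmf P) = (\<Sum>G\<in>Gs. w G * (\<Sum>H\<in>F G. f (H, G)))" for f :: "_ \<Rightarrow> real"
  proof -
    have "(\<integral>x. f x \<partial>measure_pmf P) = (\<Sum>x\<in>A. pmf P x *\<^sub>R f x)"
      by (rule integral_measure_pmf[OF finA]) (use setP in auto)
    also have "\<dots> = (\<Sum>(G, H)\<in>Sigma Gs F. pmf P (H, G) * f (H, G))"
      unfolding A_def by (subst sum.reindex) (auto simp: inj_on_def case_prod_unfold)
    also have "\<dots> = (\<Sum>G\<in>Gs. \<Sum>H\<in>F G. pmf P (H, G) * f (H, G))"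
      by (rule sum.Sigma[symmetric]) (use fin in auto)
    also have "\<dots> = (\<Sum>G\<in>Gs. \<Sum>H\<in>F G. w G * f (H, G))" by (intro sum.cong refl) (auto simp: pmf)
    finally show ?thesis by (simp add: sum_distrib_left)
  qed
  let ?s = "\<lambda>(H, G). measure_pmf.prob (e G) {H'. hit H H'}"
  let ?b = "\<lambda>(H, G). r + indicator Bad G"
  have inner: "w G * (\<Sum>H\<in>F G. ?s (H, G)) \<le> w G * (\<Sum>H\<in>F G. ?b (H, G))" if G: "G \<in> Gs" for G
  proof (cases "F G = {}")
    case False
    then obtain H where "H \<in> F G" by blast
    \<comment> \<open>The sign of \<open>w G\<close> is known only where it is a probability, hence
      the case distinction on \<open>F G\<close>.\<close>
    hence "0 \<le> w G" using pmf[of H G] G pmf_nonneg[of P "(H, G)"] by simp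
    moreover have "(\<Sum>H\<in>F G. ?s (H, G)) \<le> (\<Sum>H\<in>F G. ?b (H, G))"
    proof (cases "G \<in> Bad")
      case True
      thus ?thesis using r by (intro sum_mono) (auto intro: order_trans[OF measure_pmf.prob_le_1])
    next
      case nb: False
      have "(\<Sum>H\<in>F G. ?s (H, G)) = (\<Sum>H\<in>F G. \<integral>H'. indicator {H'. hit H H'} H' \<partial>measure_pmf (e G))" by simp
      also have "\<dots> = (\<integral>H'. (\<Sum>H\<in>F G. indicator {H'. hit H H'} H') \<partial>measure_pmf (e G))"
        by (rule Bochner_Integration.integral_sum[symmetric])
           (auto intro!: measure_pmf.integrable_const_bound[where B = 1])
      also have "\<dots> = (\<integral>H'. real (card {H \<in> F G. hit H H'}) \<partial>measure_pmf (e G))"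
        using fin(2)[OF G] by (intro Bochner_Integration.integral_cong refl) (simp add: indicator_def sum.If_cases Int_def)
      also have "\<dots> \<le> r * real (card (F G))"
        by (rule measure_pmf.integral_le_const)
           (auto intro!: measure_pmf.integrable_const_bound[where B = "r * real (card (F G))"] hit[OF G nb] AE_pmfI)
      finally show ?thesis using nb by (simp add: mult.commute)
    qed
    ultimately show ?thesis by (intro mult_left_mono)
  qed simp
  have "measure_pmf.prob (bind_pmf P (\<lambda>(H, G). map_pmf (Pair H) (e G))) {(H, H'). hit H H'}
     = (\<integral>x. ?s x \<partial>measure_pmf P)"
    by (subst prob_bind_pmf) (auto intro!: Bochner_Integration.integral_cong simp: vimage_def)
  also have "\<dots> \<le> (\<integral>x. ?b x \<partial>measure_pmf P)"
    unfolding E by (intro sum_mono inner)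
  also have "(\<integral>x. ?b x \<partial>measure_pmf P) = (\<integral>x. r + indicator {(H, G). G \<in> Bad} x \<partial>measure_pmf P)"
    by (intro Bochner_Integration.integral_cong refl) (auto simp: indicator_def)
  also have "\<dots> = r + measure_pmf.prob P {(H, G). G \<in> Bad}"
    by (subst Bochner_Integration.integral_add) (auto intro!: measure_pmf.integrable_const_bound[where B = 1])
  finally show ?thesis .
qed

text \<open>As \<open>H \<subseteq> G\<close>, the set \<open>H\<close> is determined by the part of
  its difference to \<open>S\<close> inside \<open>G\<close>. Restricting to \<open>G\<close> allows
  outputs \<open>S\<close> with edges outside \<open>G\<close>.\<close>

lemma card_near_subsets:
  fixes x :: real
  assumes G: "finite G" and x: "0 < x" "x \<le> 1" and \<F>: "\<And>H. H \<in> \<F> \<Longrightarrow> H \<subseteq> G"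
  shows "real (card {H \<in> \<F>. finite (sym_diff H S) \<and> card (sym_diff H S) \<le> j}) * x ^ j \<le> (1 + x) ^ card G"
proof -
  let ?N = "{H \<in> \<F>. finite (sym_diff H S) \<and> card (sym_diff H S) \<le> j}" and ?D = "{D. D \<subseteq> G \<and> card D \<le> j}"
  have "card ?N \<le> card ?D"
  proof (rule card_inj_on_le)
    show "inj_on (\<lambda>H. sym_diff H S \<inter> G) ?N"
    proof (rule inj_onI)
      fix H1 H2 assume "H1 \<in> ?N" "H2 \<in> ?N" and eq: "sym_diff H1 S \<inter> G = sym_diff H2 S \<inter> G"
      hence "H1 \<subseteq> G" "H2 \<subseteq> G" using \<F> by auto
      thus "H1 = H2" using eq by blast
    qed
    show "(\<lambda>H. sym_diff H S \<inter> G) ` ?N \<subseteq> ?D"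
    proof (clarsimp)
      fix H assume "finite (H - S)" "finite (S - H)" "card (sym_diff H S) \<le> j"
      thus "card (sym_diff H S \<inter> G) \<le> j" using card_mono[of "sym_diff H S" "sym_diff H S \<inter> G"] by simp
    qed
    show "finite ?D" by (rule finite_subset[of _ "Pow G"]) (use G in auto)
  qed
  hence "real (card ?N) * x ^ j \<le> real (card ?D) * x ^ j" using x by (intro mult_right_mono) auto
  also have "\<dots> \<le> (1 + x) ^ card G" by (rule card_small_subsets[OF G x])
  finally show ?thesis .
qed

subsection \<open>Impossibility above the threshold\<close>

definition joint_law :: "real \<Rightarrow> real \<Rightarrow> estimator \<Rightarrow> nat \<Rightarrow> (nat set set \<times> nat set set) pmf" where
  "joint_law lam \<delta> est n = bind_pmf (planted_cycles n lam \<delta>) (\<lambda>(H, G). map_pmf (Pair H) (est n G))"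

lemma expected_error_eq:
  "expected_error lam \<delta> est n = (\<integral>(H, H'). reconstruction_error H H' \<partial>measure_pmf (joint_law lam \<delta> est n))"
proof -
  have "joint_law lam \<delta> est n = bind_pmf (planted_cycles n lam \<delta>) (\<lambda>(H, G). bind_pmf (est n G) (\<lambda>H'. return_pmf (H, H')))"
    by (simp add: joint_law_def map_pmf_def)
  thus ?thesis by (simp add: expected_error_def)
qed

lemma set_planted_cycles:
  assumes m: "m = nat \<lfloor>\<delta> * real n\<rfloor>" "3 \<le> m" "m \<le> n" and HG: "(H, G) \<in> set_pmf (planted_cycles n lam \<delta>)"
  shows "H \<in> set_pmf (random_two_factor n m)" "H \<subseteq> G" "G \<subseteq> complete_graph n"
proof -
  from HG obtain G0 where *: "H \<in> set_pmf (random_two_factor n m)" "G = G0 \<union> H"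
    "G0 \<in> set_pmf (random_subset (complete_graph n) (lam / real n))"
    using planted_cycles_eq[of \<delta> n lam] m by (auto)
  show "H \<in> set_pmf (random_two_factor n m)" "H \<subseteq> G" "G \<subseteq> complete_graph n"
    using * set_random_subset[OF *(3)] set_random_two_factor_subset[OF m(2,3) *(1)] by auto
qed

lemma set_joint_law:
  assumes m: "m = nat \<lfloor>\<delta> * real n\<rfloor>" "3 \<le> m" "m \<le> n" and est: "is_estimator est"
    and HH: "(H, H') \<in> set_pmf (joint_law lam \<delta> est n)"
  shows "H \<subseteq> complete_graph n" "H' \<subseteq> complete_graph n" "card H = m"
proof -
  from HH obtain G where *: "(H, G) \<in> set_pmf (planted_cycles n lam \<delta>)" "H' \<in> set_pmf (est n G)"
    by (auto simp: joint_law_def)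
  note s = set_planted_cycles[OF m *(1)]
  show "H \<subseteq> complete_graph n" using s by auto
  show "H' \<subseteq> complete_graph n" using s(3) *(2) est unfolding is_estimator_def by blast
  show "card H = m" by (rule card_random_two_factor[OF m(2,3) s(1)])
qed

text \<open>Markov's inequality. Finiteness is part of the event because infinite sets have
  cardinality 0.\<close>

lemma expected_error_ge:
  assumes m: "m = nat \<lfloor>\<delta> * real n\<rfloor>" "3 \<le> m" "m \<le> n" and est: "is_estimator est" and \<epsilon>: "0 \<le> \<epsilon>"
    and hit: "measure_pmf.prob (joint_law lam \<delta> est n)
      {(H, H'). finite (sym_diff H H') \<and> card (sym_diff H H') \<le> nat \<lfloor>\<epsilon> * real m\<rfloor>} \<le> a"
  shows "\<epsilon> * (1 - a) \<le> expected_error lam \<delta> est n"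
proof -
  let ?J = "joint_law lam \<delta> est n" and ?E = "complete_graph n"
  let ?hit = "{(H, H'). finite (sym_diff H H') \<and> card (sym_diff H H') \<le> nat \<lfloor>\<epsilon> * real m\<rfloor>}"
  have "set_pmf ?J \<subseteq> Pow ?E \<times> Pow ?E"
  proof (rule subrelI)
    fix H H' assume "(H, H') \<in> set_pmf ?J"
    from set_joint_law[OF m est this] show "(H, H') \<in> Pow ?E \<times> Pow ?E" by simp
  qed
  hence fin: "finite (set_pmf ?J)" by (rule finite_subset) (simp add: finite_complete_graph)
  have "\<epsilon> * (1 - a) \<le> \<epsilon> * measure_pmf.prob ?J (- ?hit)"
    using hit \<epsilon> by (intro mult_left_mono) (simp_all add: measure_pmf.prob_compl[of ?hit, simplified] Compl_eq_Diff_UNIV)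
  also have "\<dots> = (\<integral>x. \<epsilon> * indicator (- ?hit) x \<partial>measure_pmf ?J)" by simp
  also have "\<dots> \<le> (\<integral>(H, H'). reconstruction_error H H' \<partial>measure_pmf ?J)"
  proof (rule integral_mono_AE)
    show "integrable ?J (\<lambda>x. \<epsilon> * indicator (- ?hit) x)" "integrable ?J (\<lambda>(H, H'). reconstruction_error H H')"
      using fin by (auto intro!: integrable_measure_pmf_finite)
    show "AE x in ?J. \<epsilon> * indicator (- ?hit) x \<le> (case x of (H, H') \<Rightarrow> reconstruction_error H H')"
    proof (rule AE_pmfI)
      fix x assume x: "x \<in> set_pmf ?J"
      obtain H H' where HH: "x = (H, H')" by (cases x)
      note s = set_joint_law[OF m est x[unfolded HH]]
      have f: "finite (sym_diff H H')" using s finite_subset[OF _ finite_complete_graph[of n]] by blast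
      show "\<epsilon> * indicator (- ?hit) x \<le> (case x of (H, H') \<Rightarrow> reconstruction_error H H')"
      proof (cases "x \<in> ?hit")
        case False
        hence "nat \<lfloor>\<epsilon> * real m\<rfloor> < card (sym_diff H H')" using f HH by simp
        hence "\<epsilon> * real m \<le> real (card (sym_diff H H'))" by linarith
        hence "\<epsilon> \<le> real (card (sym_diff H H')) / real m" using m(2) by (simp add: pos_le_divide_eq)
        thus ?thesis using False HH s by (simp add: reconstruction_error_def)
      qed (simp add: HH reconstruction_error_def)
    qed
  qed
  finally show ?thesis by (simp add: expected_error_eq)
qed

text \<open>With 4 d = c ln 2, the supply 2^(c n) = exp (4 d n) is divided up: d n in the exponent
  for (1 + x)^k, by the choice of \<open>x\<close>; d n for x^j with j <= \<epsilon> n, by the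
  choice of \<epsilon>; and 2 d n for the bound on the success probability.\<close>

lemma success_constants:
  fixes c lam :: real
  assumes c: "0 < c" and lam: "0 < lam"
  obtains x \<epsilon> where "0 < x" "x \<le> 1" "0 < \<epsilon>"
    "\<And>n m k. m \<le> n \<Longrightarrow> real k \<le> (4 * lam + 1) * real n \<Longrightarrow>
       (1 + x) ^ k \<le> exp (- (c * ln 2 / 2) * real n) * 2 powr (c * real n) * x ^ nat \<lfloor>\<epsilon> * real m\<rfloor>"
proof -
  define d where "d = c * ln 2 / 4"
  have d: "0 < d" using c by (simp add: d_def)
  define x where "x = min 1 (d / (4 * lam + 1))"
  have x: "0 < x" "x \<le> 1" "x * (4 * lam + 1) \<le> d"
  proof -
    show "0 < x" "x \<le> 1" using d lam by (auto simp: x_def)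
    have "x \<le> d / (4 * lam + 1)" by (simp add: x_def)
    thus "x * (4 * lam + 1) \<le> d" using lam by (simp add: pos_le_divide_eq)
  qed
  define \<epsilon> where "\<epsilon> = d / (1 - ln x)"
  have lx: "ln x \<le> 0" using x by simp
  have \<epsilon>: "0 < \<epsilon>" "\<epsilon> * - ln x \<le> d"
  proof -
    show e0: "0 < \<epsilon>" using d lx by (simp add: \<epsilon>_def)
    have "\<epsilon> * (1 - ln x) = d" using lx by (simp add: \<epsilon>_def)
    thus "\<epsilon> * - ln x \<le> d" using e0 by (simp add: algebra_simps)
  qed
  show thesis
  proof (rule that[OF x(1,2) \<epsilon>(1)])
    fix n m k :: nat assume mn: "m \<le> n" and k: "real k \<le> (4 * lam + 1) * real n"
    let ?j = "nat \<lfloor>\<epsilon> * real m\<rfloor>"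
    have "(1 + x) ^ k \<le> exp x ^ k" using x by (intro power_mono exp_ge_add_one_self) auto
    also have "\<dots> = exp (x * real k)" by (simp add: exp_of_nat_mult[symmetric] mult.commute)
    also have "\<dots> \<le> exp (d * real n)"
    proof -
      have "x * real k \<le> x * ((4 * lam + 1) * real n)" using x k by (intro mult_left_mono) auto
      also have "\<dots> = (x * (4 * lam + 1)) * real n" by simp
      also have "\<dots> \<le> d * real n" using x by (intro mult_right_mono) auto
      finally show ?thesis by simp
    qed
    finally have 1: "(1 + x) ^ k \<le> exp (d * real n)" .
    have "exp (- (d * real n)) \<le> exp (real ?j * ln x)"
    proof -
      have "real ?j \<le> \<epsilon> * real m" using \<epsilon>(1) by simp
      also have "\<dots> \<le> \<epsilon> * real n" using \<epsilon>(1) mn by (intro mult_left_mono) auto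
      finally have "real ?j * - ln x \<le> \<epsilon> * real n * - ln x" using lx by (intro mult_right_mono) auto
      also have "\<dots> = \<epsilon> * - ln x * real n" by simp
      also have "\<dots> \<le> d * real n" using \<epsilon>(2) by (intro mult_right_mono) auto
      finally show ?thesis by simp
    qed
    also have "\<dots> = x ^ ?j" using x by (simp add: exp_of_nat_mult)
    finally have 2: "exp (- (d * real n)) \<le> x ^ ?j" .
    have "exp (d * real n) = exp (2 * d * real n) * exp (- (d * real n))" by (simp add: exp_add[symmetric])
    also have "\<dots> \<le> exp (2 * d * real n) * x ^ ?j" using 2 by (intro mult_left_mono) auto
    also have "exp (2 * d * real n) = exp (- (c * ln 2 / 2) * real n) * 2 powr (c * real n)"
      by (simp add: powr_def exp_add[symmetric] d_def)
    finally show "(1 + x) ^ k \<le> exp (- (c * ln 2 / 2) * real n) * 2 powr (c * real n) * x ^ ?j"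
      using 1 by linarith
  qed
qed

text \<open>Markov's inequality: the mean size of the background graph is at most lam n / 2, and the
  planted edges, at most \<open>n\<close>, account for the extra 1.\<close>

lemma prob_planted_edges:
  assumes m: "m = nat \<lfloor>\<delta> * real n\<rfloor>" "3 \<le> m" "m \<le> n" and lam: "0 < lam" "lam \<le> real n"
  shows "measure_pmf.prob (planted_cycles n lam \<delta>) {(H, G). (4 * lam + 1) * real n < real (card G)} \<le> 1 / 8"
proof -
  let ?E = "complete_graph n" and ?p = "lam / real n"
  have n: "0 < real n" and p: "0 \<le> ?p" "?p \<le> 1" using m lam by auto
  have "measure_pmf.prob (planted_cycles n lam \<delta>) {(H, G). (4 * lam + 1) * real n < real (card G)}
    \<le> measure_pmf.prob (random_two_factor n m) {} + 1 / 8"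
    unfolding planted_cycles_eq[of \<delta> n lam, folded m(1), OF m(3)]
  proof (rule prob_bind_le)
    fix H assume H: "H \<in> set_pmf (random_two_factor n m)"
    have cH: "card H = m" by (rule card_random_two_factor[OF m(2,3) H])
    have "measure_pmf.prob (map_pmf (\<lambda>G0. (H, G0 \<union> H)) (random_subset ?E ?p)) {(H, G). (4 * lam + 1) * real n < real (card G)}
      = measure_pmf.prob (random_subset ?E ?p) {G0. (4 * lam + 1) * real n < real (card (G0 \<union> H))}"
      by (simp add: vimage_def)
    also have "\<dots> \<le> measure_pmf.prob (random_subset ?E ?p) {G0. 4 * lam * real n \<le> real (card G0)}"
    proof (rule measure_pmf.finite_measure_mono)
      show "{G0. (4 * lam + 1) * real n < real (card (G0 \<union> H))} \<subseteq> {G0. 4 * lam * real n \<le> real (card G0)}"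
      proof
        fix G0 assume "G0 \<in> {G0. (4 * lam + 1) * real n < real (card (G0 \<union> H))}"
        moreover have "real (card (G0 \<union> H)) \<le> real (card G0) + real n"
          using card_Un_le[of G0 H] cH m(3) by linarith
        ultimately show "G0 \<in> {G0. 4 * lam * real n \<le> real (card G0)}" by (simp add: algebra_simps)
      qed
    qed simp
    also have "\<dots> \<le> ?p * real (card ?E) / (4 * lam * real n)"
      using lam n by (intro prob_card_random_subset finite_complete_graph p) auto
    also have "\<dots> \<le> ?p * (real n ^ 2 / 2) / (4 * lam * real n)"
      using lam n p card_complete_graph_le[of n] by (intro divide_right_mono mult_left_mono) auto
    also have "\<dots> = 1 / 8" using lam n by (simp add: power2_eq_square)
    finally show "measure_pmf.prob (map_pmf (\<lambda>G0. (H, G0 \<union> H)) (random_subset ?E ?p)) {(H, G). (4 * lam + 1) * real n < real (card G)} \<le> 1 / 8" .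
  qed simp
  thus ?thesis by simp
qed

text \<open>For large \<open>n\<close> an output lies within \<epsilon> m of the truth with
  probability at most 5/8: 1/8 is the posterior mass near an output, 1/8 each is lost to many
  vertices on short cycles and to many edges, and 1/4 to a failure of the construction of many
  2-factors.\<close>

theorem impossibility:
  fixes lam \<delta> :: real
  assumes \<delta>: "0 < \<delta>" "\<delta> \<le> 1" and lam: "1 / (sqrt (2 * \<delta>) + sqrt (1 - \<delta>))\<^sup>2 < lam" and est: "is_estimator est"
  shows "\<not> almost_exact_recovery lam \<delta> est"
proof
  assume rec: "almost_exact_recovery lam \<delta> est"
  have "0 \<le> 1 / (sqrt (2 * \<delta>) + sqrt (1 - \<delta>))\<^sup>2" by simp
  hence lam0: "0 < lam" using lam by linarith
  obtain \<eta> c L N where c: "0 < \<eta>" "0 < c" and many: "\<forall>n\<ge>N. \<forall>V H. V \<subseteq> {..<n} \<longrightarrow> card V = nat \<lfloor>\<delta> * real n\<rfloor> \<longrightarrow>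
     two_regular V H \<longrightarrow> real (card (short_verts H L)) \<le> \<eta> * real n \<longrightarrow>
     measure_pmf.prob (random_subset (complete_graph n) (lam / real n))
       {G0. real (card (factors_in n (card V) (H \<union> G0))) < 2 powr (c * real n)} \<le> 1 / 4"
    using many_factors[OF \<delta> lam] by (elim exE conjE) (rule that; assumption)
  obtain x \<epsilon> where x: "0 < x" "x \<le> 1" and \<epsilon>: "0 < \<epsilon>" and const:
    "\<And>n m k. m \<le> n \<Longrightarrow> real k \<le> (4 * lam + 1) * real n \<Longrightarrow>
       (1 + x) ^ k \<le> exp (- (c * ln 2 / 2) * real n) * 2 powr (c * real n) * x ^ nat \<lfloor>\<epsilon> * real m\<rfloor>"
    using success_constants[OF c(2) lam0] by blast
  have c2: "0 < c * ln 2 / 2" using c by simp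
  have "eventually (\<lambda>n. 2 * real L + 4 \<le> \<delta> * real n \<and> 16 * real L \<le> \<eta> * real n \<and> lam \<le> real n
      \<and> exp (- (c * ln 2 / 2) * real n) \<le> 1 / 8 \<and> N \<le> n) sequentially"
  proof (intro eventually_conj)
    show "eventually (\<lambda>n. 2 * real L + 4 \<le> \<delta> * real n) sequentially" using \<delta> by real_asymp
    show "eventually (\<lambda>n. 16 * real L \<le> \<eta> * real n) sequentially" using c by real_asymp
    show "eventually (\<lambda>n. lam \<le> real n) sequentially" by real_asymp
    have "eventually (\<lambda>n. exp (- d * real n) \<le> 1 / 8) sequentially" if "0 < d" for d
      using that by real_asymp
    from this[OF c2] show "eventually (\<lambda>n. exp (- (c * ln 2 / 2) * real n) \<le> 1 / 8) sequentially" .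
    show "eventually (\<lambda>n. N \<le> n) sequentially" by (rule eventually_ge_at_top)
  qed
  hence "eventually (\<lambda>n. \<epsilon> * (1 - 5 / 8) \<le> expected_error lam \<delta> est n) sequentially"
  proof (rule eventually_mono)
    fix n assume Nn: "2 * real L + 4 \<le> \<delta> * real n \<and> 16 * real L \<le> \<eta> * real n \<and> lam \<le> real n
      \<and> exp (- (c * ln 2 / 2) * real n) \<le> 1 / 8 \<and> N \<le> n"
    define m where "m = nat \<lfloor>\<delta> * real n\<rfloor>"
    have mr: "real m = real_of_int \<lfloor>\<delta> * real n\<rfloor>" using \<delta> by (simp add: m_def)
    have dn: "\<delta> * real n \<le> real n" using \<delta> mult_right_mono[of \<delta> 1 "real n"] by simp
    have m2: "2 * real L + 3 \<le> real m" "real m \<le> real n" using Nn dn unfolding mr by linarith+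
    hence m: "m = nat \<lfloor>\<delta> * real n\<rfloor>" "3 \<le> m" "m \<le> n" by (simp_all add: m_def[symmetric])
    have n0: "0 < real n" using m by simp
    have p: "0 \<le> lam / real n" "lam / real n \<le> 1" using lam0 n0 Nn by auto
    let ?E = "complete_graph n" and ?P = "planted_cycles n lam \<delta>" and ?r = "exp (- (c * ln 2 / 2) * real n)"
    let ?few = "{G. real (card (factors_in n m G)) < 2 powr (c * real n)}"
    let ?big = "{G. (4 * lam + 1) * real n < real (card G)}"
    let ?j = "nat \<lfloor>\<epsilon> * real m\<rfloor>"
    obtain w where w: "\<And>H G. pmf ?P (H, G) = (if G \<in> Pow ?E \<and> H \<in> factors_in n m G then w G else 0)"
      using pmf_planted_cycles[OF m p] by auto
    have "measure_pmf.prob (joint_law lam \<delta> est n) {(H, H'). finite (sym_diff H H') \<and> card (sym_diff H H') \<le> ?j}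
      \<le> ?r + measure_pmf.prob ?P {(H, G). G \<in> ?few \<union> ?big}"
      unfolding joint_law_def
    proof (rule prob_success_le[OF w])
      show "finite (Pow ?E)" by (simp add: finite_complete_graph)
      fix G assume G: "G \<in> Pow ?E"
      hence fG: "finite G" using finite_subset[OF _ finite_complete_graph] by blast
      show "finite (factors_in n m G)"
        by (rule finite_subset[of _ "Pow G"]) (use fG in \<open>auto simp: factors_in_def\<close>)
      fix H' assume nb: "G \<notin> ?few \<union> ?big"
      let ?N = "card {H \<in> factors_in n m G. finite (sym_diff H H') \<and> card (sym_diff H H') \<le> ?j}"
      have "real ?N * x ^ ?j \<le> (1 + x) ^ card G"
        by (rule card_near_subsets[OF fG x]) (auto simp: factors_in_def)
      also have "\<dots> \<le> ?r * 2 powr (c * real n) * x ^ ?j" using nb m by (intro const) auto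
      finally have "real ?N \<le> ?r * 2 powr (c * real n)" using x by simp
      also have "\<dots> \<le> ?r * real (card (factors_in n m G))" using nb by (intro mult_left_mono) auto
      finally show "real ?N \<le> ?r * real (card (factors_in n m G))" .
    qed simp
    also have "measure_pmf.prob ?P {(H, G). G \<in> ?few \<union> ?big}
       \<le> measure_pmf.prob ?P {(H, G). G \<in> ?few} + measure_pmf.prob ?P {(H, G). G \<in> ?big}"
      by (rule order_trans[OF _ measure_Un_le]) (auto intro!: measure_pmf.finite_measure_mono)
    also have "measure_pmf.prob ?P {(H, G). G \<in> ?big} \<le> 1 / 8"
      using prob_planted_edges[OF m lam0] Nn by simp
    also have "measure_pmf.prob ?P {(H, G). G \<in> ?few}
        \<le> measure_pmf.prob (random_two_factor n m) {H. \<eta> * real n < real (card (short_verts H L))} + 1 / 4"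
      unfolding planted_cycles_eq[of \<delta> n lam, folded m(1), OF m(3)]
    proof (rule prob_bind_le)
      fix H assume H: "H \<in> set_pmf (random_two_factor n m)" "H \<notin> {H. \<eta> * real n < real (card (short_verts H L))}"
      obtain V where V: "V \<subseteq> {..<n}" "card V = m" "two_regular V H"
        using H(1) set_random_two_factor[OF m(2,3)] by blast
      have "measure_pmf.prob (map_pmf (\<lambda>G0. (H, G0 \<union> H)) (random_subset ?E (lam / real n))) {(H, G). G \<in> ?few}
        = measure_pmf.prob (random_subset ?E (lam / real n)) {G0. real (card (factors_in n (card V) (H \<union> G0))) < 2 powr (c * real n)}"
        using V by (simp add: vimage_def Un_commute)
      also have "\<dots> \<le> 1 / 4" using V H(2) Nn m by (intro many[rule_format]) auto
      finally show "measure_pmf.prob (map_pmf (\<lambda>G0. (H, G0 \<union> H)) (random_subset ?E (lam / real n))) {(H, G). G \<in> ?few} \<le> 1 / 4" .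
    qed simp
    also have "measure_pmf.prob (random_two_factor n m) {H. \<eta> * real n < real (card (short_verts H L))} \<le> 1 / 8"
    proof -
      have "measure_pmf.prob (random_two_factor n m) {H. \<eta> * real n < real (card (short_verts H L))}
        \<le> real m * real L / (real m - real L) / (\<eta> * real n)"
        using m2 c n0 by (intro prob_random_two_factor_short[OF m(2,3)]) auto
      also have "\<dots> \<le> 2 * real L / (\<eta> * real n)"
      proof (rule divide_right_mono)
        have "real m * real L \<le> (2 * (real m - real L)) * real L" using m2 by (intro mult_right_mono) auto
        thus "real m * real L / (real m - real L) \<le> 2 * real L" using m2 by (simp add: pos_divide_le_eq mult_ac)
      qed (use c in simp)
      also have "\<dots> \<le> 1 / 8" using Nn c n0 by (simp add: pos_divide_le_eq)
      finally show ?thesis .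
    qed
    also have "?r + (1 / 8 + 1 / 4 + 1 / 8) \<le> 5 / 8" using Nn by simp
    finally have "measure_pmf.prob (joint_law lam \<delta> est n) {(H, H'). finite (sym_diff H H') \<and> card (sym_diff H H') \<le> ?j} \<le> 5 / 8"
      by simp
    thus "\<epsilon> * (1 - 5 / 8) \<le> expected_error lam \<delta> est n"
      using \<epsilon> by (intro expected_error_ge[OF m est]) auto
  qed
  moreover have "expected_error lam \<delta> est \<longlonglongrightarrow> 0" using rec by (simp add: almost_exact_recovery_def)
  ultimately have "\<epsilon> * (1 - 5 / 8) \<le> 0" by (metis tendsto_lowerbound sequentially_bot)
  thus False using \<epsilon> by simp
qed

subsection \<open>A program for the message passing estimator\<close>

text \<open>Total-correctness triple with a time bound.\<close>

definition runs :: "(store \<Rightarrow> bool) \<Rightarrow> prog \<Rightarrow> (store \<Rightarrow> bool) \<Rightarrow> nat \<Rightarrow> bool" where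
  "runs P c Q b \<longleftrightarrow> (\<forall>s. P s \<longrightarrow> (\<exists>t s'. exec c s t s' \<and> t \<le> b \<and> Q s'))"

lemma runs_Skip: "(\<And>s. P s \<Longrightarrow> Q s) \<Longrightarrow> runs P Skip Q 1"
  unfolding runs_def using exec.Skip by blast

lemma runs_Assign:
  assumes "\<And>s. P s \<Longrightarrow> Q (s(a := (s a)(eval_expr s e1 := eval_expr s e2)))"
  shows "runs P (Assign a e1 e2) Q 1"
  unfolding runs_def using assms exec.Assign by blast

lemma runs_Seq: "runs P c1 R b1 \<Longrightarrow> runs R c2 Q b2 \<Longrightarrow> runs P (Seq c1 c2) Q (b1 + b2)"
  unfolding runs_def by (meson exec.Seq add_mono)

lemma runs_Seq_Assign:
  assumes "runs R c Q b"
    "\<And>s. P s \<Longrightarrow> R (s(a := (s a)(eval_expr s e1 := eval_expr s e2)))"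
  shows "runs P (Seq (Assign a e1 e2) c) Q (Suc b)"
  using runs_Seq[OF runs_Assign[of P R, OF assms(2)] assms(1)] by simp

lemma runs_weaken:
  "runs P' c Q' b' \<Longrightarrow> (\<And>s. P s \<Longrightarrow> P' s) \<Longrightarrow> (\<And>s. Q' s \<Longrightarrow> Q s) \<Longrightarrow> b' \<le> b \<Longrightarrow> runs P c Q b"
  unfolding runs_def by (meson order_trans)

lemma runs_Cond:
  assumes "runs (\<lambda>s. P s \<and> eval_expr s e \<noteq> 0) c1 Q b" "runs (\<lambda>s. P s \<and> eval_expr s e = 0) c2 Q b"
  shows "runs P (Cond e c1 c2) Q (Suc b)"
  unfolding runs_def
proof (intro allI impI)
  fix s assume P: "P s"
  show "\<exists>t s'. exec (Cond e c1 c2) s t s' \<and> t \<le> Suc b \<and> Q s'"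
  proof (cases "eval_expr s e = 0")
    case True
    then obtain t s' where "exec c2 s t s'" "t \<le> b" "Q s'" using assms(2) P unfolding runs_def by blast
    thus ?thesis using exec.CondFalse[OF True] by (meson Suc_le_mono)
  next
    case False
    then obtain t s' where "exec c1 s t s'" "t \<le> b" "Q s'" using assms(1) P unfolding runs_def by blast
    thus ?thesis using exec.CondTrue[OF False] by (meson Suc_le_mono)
  qed
qed

text \<open>The invariant fixes the number \<open>N\<close> of iterations in advance;
  \<open>m\<close> in place of \<open>N + 1\<close> keeps the time bounds uniform.\<close>

lemma runs_While:
  assumes body: "\<And>i. i < N \<Longrightarrow> runs (I i) c (I (Suc i)) b"
    and e: "\<And>i s. I i s \<Longrightarrow> i \<le> N \<Longrightarrow> eval_expr s e \<noteq> 0 \<longleftrightarrow> i < N"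
    and N: "N < m"
  shows "runs (I 0) (While e c) (I N) ((b + 1) * m)"
proof -
  have "\<exists>t s'. exec (While e c) s t s' \<and> t \<le> 1 + (N - i) * (b + 1) \<and> I N s'" if "I i s" "i \<le> N" for i s
    using that
  proof (induction "N - i" arbitrary: i s)
    case 0
    hence "i = N" by simp
    thus ?case using exec.WhileFalse[of s e c] e[of N s] 0 by auto
  next
    case (Suc k)
    hence i: "i < N" by simp
    obtain t1 s1 where 1: "exec c s t1 s1" "t1 \<le> b" "I (Suc i) s1"
      using body[OF i] Suc.prems unfolding runs_def by blast
    obtain t2 s2 where 2: "exec (While e c) s1 t2 s2" "t2 \<le> 1 + (N - Suc i) * (b + 1)" "I N s2"
    proof -
      have "k = N - Suc i" using Suc.hyps(2) by simp
      from Suc.hyps(1)[OF this 1(3)] i that show ?thesis by auto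
    qed
    have "exec (While e c) s (Suc (t1 + t2)) s2"
      using exec.WhileTrue[OF _ 1(1) 2(1)] e[OF Suc.prems(1)] i by auto
    moreover have "Suc (t1 + t2) \<le> 1 + (N - i) * (b + 1)"
    proof -
      have "N - i = Suc (N - Suc i)" using i by simp
      thus ?thesis using 1 2 by simp
    qed
    ultimately show ?case using 2 by blast
  qed
  from this[of 0] have "\<exists>t s'. exec (While e c) s t s' \<and> t \<le> 1 + N * (b + 1) \<and> I N s'" if "I 0 s" for s
    using that by simp
  moreover have "1 + N * (b + 1) \<le> (b + 1) * m"
  proof -
    have "1 + N * (b + 1) \<le> Suc N * (b + 1)" by simp
    also have "\<dots> \<le> m * (b + 1)" using N by (intro mult_le_mono1) simp
    finally show ?thesis by (simp add: mult.commute)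
  qed
  ultimately show ?thesis unfolding runs_def by (meson order_trans)
qed

abbreviation Var :: "nat \<Rightarrow> expr" where "Var a \<equiv> Read a (Const 0)"
abbreviation Set :: "nat \<Rightarrow> expr \<Rightarrow> prog" where "Set a e \<equiv> Assign a (Const 0) e"

text \<open>Binary logarithm rounded up, with value 0 at 0 and 1.\<close>

definition clog :: "nat \<Rightarrow> nat" where
  "clog m = (LEAST t. m \<le> 2 ^ t)"

lemma clog_less_iff: "i \<le> clog m \<Longrightarrow> (2 ^ i < m) = (i < clog m)"
proof -
  assume i: "i \<le> clog m"
  have "\<exists>t. m \<le> 2 ^ t" by (meson less_exp less_imp_le)
  hence le: "m \<le> 2 ^ clog m" unfolding clog_def by (rule LeastI_ex)
  have "\<not> m \<le> 2 ^ i" if "i < clog m" using that unfolding clog_def by (rule not_less_Least)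
  thus ?thesis using i le by (metis leD le_less not_le)
qed

lemma clog_ge: "m \<le> 2 ^ clog m"
  unfolding clog_def by (rule LeastI_ex) (meson less_exp less_imp_le)

lemma clog_le: "clog m \<le> m"
  unfolding clog_def by (rule Least_le) (simp add: less_imp_le)

definition rounds :: "nat \<Rightarrow> nat" where
  "rounds n = clog (clog (clog n))"

text \<open>Array 3 runs through the powers of 2 by doubling, since the machine cannot
  multiply.\<close>

definition log_prog :: "nat \<Rightarrow> nat \<Rightarrow> prog" where
  "log_prog src dst =
     Seq (Set 3 (Const 1)) (Seq (Set dst (Const 0))
       (While (Sub (Var src) (Var 3)) (Seq (Set 3 (Add (Var 3) (Var 3))) (Set dst (Add (Var dst) (Const 1))))))"

definition same_except :: "nat set \<Rightarrow> store \<Rightarrow> store \<Rightarrow> bool" where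
  "same_except A s s' \<longleftrightarrow> (\<forall>a. a \<notin> A \<longrightarrow> s' a = s a)"

lemma runs_log_prog:
  assumes "src \<noteq> 3" "dst \<noteq> 3" "src \<noteq> dst" "m0 \<le> n"
  shows "runs (\<lambda>s. same_except {3, 4, 5} s0 s \<and> s src 0 = m0) (log_prog src dst)
     (\<lambda>s. same_except {3, 4, 5, dst} s0 s \<and> s dst 0 = clog m0) (5 * Suc n)"
proof -
  let ?I = "\<lambda>i s. same_except {3, 4, 5, dst} s0 s \<and> s src 0 = m0 \<and> s 3 0 = 2 ^ i \<and> s dst 0 = i"
  have "runs (?I 0) (While (Sub (Var src) (Var 3)) (Seq (Set 3 (Add (Var 3) (Var 3))) (Set dst (Add (Var dst) (Const 1)))))
      (?I (clog m0)) ((2 + 1) * Suc n)"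
  proof (rule runs_While)
    fix i assume "i < clog m0"
    have "runs (?I i) (Seq (Set 3 (Add (Var 3) (Var 3))) (Set dst (Add (Var dst) (Const 1)))) (?I (Suc i)) (Suc 1)"
      by (rule runs_Seq_Assign, rule runs_Assign[where P = "\<lambda>s. same_except {3, 4, 5, dst} s0 s \<and> s src 0 = m0 \<and> s 3 0 = 2 ^ Suc i \<and> s dst 0 = i"])
        (use assms in \<open>auto simp: same_except_def\<close>)
    thus "runs (?I i) (Seq (Set 3 (Add (Var 3) (Var 3))) (Set dst (Add (Var dst) (Const 1)))) (?I (Suc i)) 2"
      by (simp add: numeral_2_eq_2)
  next
    fix i s assume "?I i s" "i \<le> clog m0"
    thus "eval_expr s (Sub (Var src) (Var 3)) \<noteq> 0 \<longleftrightarrow> i < clog m0"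
      using clog_less_iff[of i m0] by auto
  next
    show "clog m0 < Suc n" using clog_le[of m0] assms by simp
  qed
  hence "runs (\<lambda>s. same_except {3, 4, 5} s0 s \<and> s src 0 = m0) (log_prog src dst) (?I (clog m0)) (Suc (Suc ((2 + 1) * Suc n)))"
    unfolding log_prog_def
    by (intro runs_Seq_Assign[where R = "\<lambda>s. same_except {3, 4, 5, dst} s0 s \<and> s src 0 = m0 \<and> s 3 0 = 1"]
        runs_Seq_Assign[where R = "?I 0"])
      (use assms in \<open>auto simp: same_except_def\<close>)
  thus ?thesis by (rule runs_weaken) auto
qed

context
  fixes n :: nat and G :: "nat set set" and T K :: nat
begin

definition frame :: "store \<Rightarrow> bool" where
  "frame s \<longleftrightarrow> s 0 0 = n \<and> (\<forall>u<n. \<forall>c<n. s 1 (u * n + c) = (if {u, c} \<in> G then 1 else 0)) \<and>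
     s 5 0 = T \<and> s 6 0 = K \<and> s 7 0 = n * n"

text \<open>The message from \<open>c\<close> to \<open>u\<close> sits in row \<open>u\<close>, so
  the loop over the children \<open>c\<close> of \<open>u\<close> reads adjacent cells and needs
  only additions.\<close>

definition level :: "nat \<Rightarrow> store \<Rightarrow> bool" where
  "level t s \<longleftrightarrow> (\<forall>u<n. \<forall>c<n. s 8 (t * (n * n) + (u * n + c)) = msg n G K t c u)"

text \<open>Progress of the two loops over \<open>u\<close> and \<open>v\<close> in lexicographic
  order.\<close>

definition partial_level :: "nat \<Rightarrow> nat \<Rightarrow> nat \<Rightarrow> store \<Rightarrow> bool" where
  "partial_level t u v s \<longleftrightarrow> (\<forall>u'<n. \<forall>v'<n. u' < u \<or> u' = u \<and> v' < v \<longrightarrow>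
      s 8 (Suc t * (n * n) + (v' * n + u')) = msg n G K (Suc t) u' v')"

definition partial_output :: "nat \<Rightarrow> nat \<Rightarrow> store \<Rightarrow> bool" where
  "partial_output u v s \<longleftrightarrow> (\<forall>u'<n. \<forall>v'<n. s 2 (u' * n + v') \<noteq> 0 \<longleftrightarrow>
     (u' < u \<or> u' = u \<and> v' < v) \<and> {u', v'} \<in> G \<and> 2 * K + 1 < msg n G K T u' v' + msg n G K T v' u')"

lemma frame_upd [simp]: "8 \<le> a \<or> a = 2 \<Longrightarrow> frame (s(a := f)) = frame s"
  by (auto simp: frame_def)
lemma level_upd [simp]: "a \<noteq> 8 \<Longrightarrow> level t (s(a := f)) = level t s"
  by (auto simp: level_def)
lemma partial_level_upd [simp]: "a \<noteq> 8 \<Longrightarrow> partial_level t u v (s(a := f)) = partial_level t u v s"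
  by (auto simp: partial_level_def)
lemma partial_output_upd [simp]: "a \<noteq> 2 \<Longrightarrow> partial_output u v (s(a := f)) = partial_output u v s"
  by (auto simp: partial_output_def)

lemma index_less: "u < n \<Longrightarrow> c < n \<Longrightarrow> u * n + c < n * n"
proof -
  assume "u < n" "c < n"
  hence "u * n + c < Suc u * n" by simp
  also have "\<dots> \<le> n * n" using \<open>u < n\<close> by (intro mult_le_mono1) simp
  finally show ?thesis .
qed

lemma index_inj: "c < n \<Longrightarrow> c' < n \<Longrightarrow> u * n + c = u' * n + c' \<longleftrightarrow> u = u' \<and> c = c'"
  by (metis add.commute div_mult_self3 div_less add_0 mod_less mod_mult_self3 bot_nat_0.not_eq_extremum less_nat_zero_code)

text \<open>The sum of both truncated differences of \<open>c\<close> and \<open>v\<close> is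
  nonzero exactly if they differ.\<close>

definition inner_body :: prog where
  "inner_body = Seq (Cond (Read 1 (Add (Var 13) (Var 16)))
      (Cond (Add (Sub (Var 16) (Var 14)) (Sub (Var 14) (Var 16)))
        (Cond (Sub (Read 8 (Add (Var 9) (Add (Var 13) (Var 16)))) (Var 17))
           (Seq (Set 18 (Var 17)) (Set 17 (Read 8 (Add (Var 9) (Add (Var 13) (Var 16))))))
           (Cond (Sub (Read 8 (Add (Var 9) (Add (Var 13) (Var 16)))) (Var 18))
             (Set 18 (Read 8 (Add (Var 9) (Add (Var 13) (Var 16))))) Skip))
        Skip) Skip)
    (Set 16 (Add (Var 16) (Const 1)))"

definition inner_state :: "nat \<Rightarrow> nat \<Rightarrow> nat \<Rightarrow> store \<Rightarrow> bool" where
  "inner_state t u v s \<longleftrightarrow> frame s \<and> level t s \<and> partial_level t u v s \<and> s 9 0 = t * (n * n) \<and>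
     s 10 0 = Suc t * (n * n) \<and> s 11 0 = t \<and> s 12 0 = u \<and> s 13 0 = u * n \<and> s 14 0 = v \<and> s 15 0 = v * n
     \<and> (\<forall>i. s 2 i = 0)"

lemma inner_state_upd [simp]: "a \<in> {16, 17, 18} \<Longrightarrow> inner_state t u v (s(a := f)) = inner_state t u v s"
  by (auto simp: inner_state_def)

text \<open>What arrays 17 and 18 hold when the loop over children has come to
  \<open>c\<close>.\<close>

definition tops :: "nat \<Rightarrow> nat \<Rightarrow> nat \<Rightarrow> nat \<Rightarrow> nat \<times> nat" where
  "tops t u v c = top2 (map (\<lambda>c. msg n G K t c u) (filter (\<lambda>c. {u, c} \<in> G \<and> c \<noteq> v) [0..<c]))"

lemma tops_Suc: "tops t u v (Suc c) =
    (if {u, c} \<in> G \<and> c \<noteq> v then top2_step (msg n G K t c u) (tops t u v c) else tops t u v c)"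
  by (simp add: tops_def)

lemma runs_inner_body:
  assumes "u < n" "v < n" "c < n"
  shows "runs (\<lambda>s. inner_state t u v s \<and> s 16 0 = c \<and> (s 17 0, s 18 0) = tops t u v c) inner_body
    (\<lambda>s. inner_state t u v s \<and> s 16 0 = Suc c \<and> (s 17 0, s 18 0) = tops t u v (Suc c)) 7"
proof -
  let ?P = "\<lambda>s. inner_state t u v s \<and> s 16 0 = c \<and> (s 17 0, s 18 0) = tops t u v c"
  let ?R = "\<lambda>s. inner_state t u v s \<and> s 16 0 = c \<and> (s 17 0, s 18 0) = tops t u v (Suc c)"
  let ?m = "msg n G K t c u"
  obtain a b where ab: "tops t u v c = (a, b)" by fastforce
  have m: "s 8 (t * (n * n) + (u * n + c)) = ?m" and adj: "s 1 (u * n + c) = (if {u, c} \<in> G then 1 else 0)"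
    and st: "s 9 0 = t * (n * n)" "s 13 0 = u * n" "s 14 0 = v"
    if "inner_state t u v s" for s
    using that assms by (auto simp: inner_state_def level_def frame_def)
  have 1: "runs (\<lambda>s. ?P s \<and> {u, c} \<in> G \<and> c \<noteq> v \<and> a < ?m) (Seq (Set 18 (Var 17)) (Set 17 (Read 8 (Add (Var 9) (Add (Var 13) (Var 16)))))) ?R 2"
  proof -
    have "runs (\<lambda>s. ?P s \<and> {u, c} \<in> G \<and> c \<noteq> v \<and> a < ?m) (Seq (Set 18 (Var 17)) (Set 17 (Read 8 (Add (Var 9) (Add (Var 13) (Var 16)))))) ?R (Suc 1)"
    proof (rule runs_Seq_Assign[OF runs_Assign])
      fix s assume s: "inner_state t u v s \<and> s 16 0 = c \<and> s 18 0 = a \<and> {u, c} \<in> G \<and> c \<noteq> v \<and> a < ?m"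
      thus "?R (s(17 := (s 17)(eval_expr s (Const 0) := eval_expr s (Read 8 (Add (Var 9) (Add (Var 13) (Var 16)))))))"
        using m[of s] st[of s] ab by (simp add: tops_Suc top2_step_def)
    next
      fix s assume "?P s \<and> {u, c} \<in> G \<and> c \<noteq> v \<and> a < ?m"
      thus "inner_state t u v (s(18 := (s 18)(eval_expr s (Const 0) := eval_expr s (Var 17)))) \<and>
        (s(18 := (s 18)(eval_expr s (Const 0) := eval_expr s (Var 17)))) 16 0 = c \<and>
        (s(18 := (s 18)(eval_expr s (Const 0) := eval_expr s (Var 17)))) 18 0 = a \<and> {u, c} \<in> G \<and> c \<noteq> v \<and> a < ?m"
        using ab by simp
    qed
    thus ?thesis by (simp add: numeral_2_eq_2)
  qed
  have 2: "runs (\<lambda>s. ?P s \<and> {u, c} \<in> G \<and> c \<noteq> v \<and> \<not> a < ?m)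
     (Cond (Sub (Read 8 (Add (Var 9) (Add (Var 13) (Var 16)))) (Var 18))
             (Set 18 (Read 8 (Add (Var 9) (Add (Var 13) (Var 16))))) Skip) ?R (Suc 1)"
  proof (rule runs_Cond[OF runs_Assign runs_Skip], goal_cases)
    case (1 s)
    thus ?case using m[of s] st[of s] ab by (auto simp: tops_Suc top2_step_def)
  next
    case (2 s)
    thus ?case using m[of s] st[of s] ab by (auto simp: tops_Suc top2_step_def)
  qed
  have 3: "runs (\<lambda>s. ?P s \<and> {u, c} \<in> G \<and> c \<noteq> v) (Cond (Sub (Read 8 (Add (Var 9) (Add (Var 13) (Var 16)))) (Var 17))
           (Seq (Set 18 (Var 17)) (Set 17 (Read 8 (Add (Var 9) (Add (Var 13) (Var 16))))))
           (Cond (Sub (Read 8 (Add (Var 9) (Add (Var 13) (Var 16)))) (Var 18))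
             (Set 18 (Read 8 (Add (Var 9) (Add (Var 13) (Var 16))))) Skip)) ?R (Suc 2)"
    by (rule runs_Cond; rule runs_weaken[OF 1] runs_weaken[OF 2]) (use m st ab in auto)
  have neq: "c - v + (v - c) = 0 \<longleftrightarrow> c = v" by arith
  have 4: "runs (\<lambda>s. ?P s \<and> {u, c} \<in> G) (Cond (Add (Sub (Var 16) (Var 14)) (Sub (Var 14) (Var 16)))
        (Cond (Sub (Read 8 (Add (Var 9) (Add (Var 13) (Var 16)))) (Var 17))
           (Seq (Set 18 (Var 17)) (Set 17 (Read 8 (Add (Var 9) (Add (Var 13) (Var 16))))))
           (Cond (Sub (Read 8 (Add (Var 9) (Add (Var 13) (Var 16)))) (Var 18))
             (Set 18 (Read 8 (Add (Var 9) (Add (Var 13) (Var 16))))) Skip))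
        Skip) ?R (Suc (Suc 2))"
  proof (rule runs_Cond, goal_cases)
    case 1
    show ?case
    proof (rule runs_weaken[OF 3], goal_cases)
      case (1 s)
      have "s 16 0 = c" "s 14 0 = v" using 1 st(3)[of s] by blast+
      moreover have "eval_expr s (Add (Sub (Var 16) (Var 14)) (Sub (Var 14) (Var 16))) \<noteq> 0" using 1 by blast
      ultimately have "c - v + (v - c) \<noteq> 0" by (simp only: eval_expr.simps simp_thms)
      hence "c \<noteq> v" unfolding neq .
      thus ?case using 1 by blast
    qed auto
  next
    case 2
    show ?case
    proof (rule runs_weaken[OF runs_Skip[of ?R ?R]], goal_cases)
      case (2 s)
      have "s 16 0 = c" "s 14 0 = v" using 2 st(3)[of s] by blast+
      moreover have "eval_expr s (Add (Sub (Var 16) (Var 14)) (Sub (Var 14) (Var 16))) = 0" using 2 by blast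
      ultimately have "c - v + (v - c) = 0" by (simp only: eval_expr.simps)
      hence "c = v" unfolding neq .
      thus ?case using 2 by (simp add: tops_Suc)
    qed auto
  qed
  have 5: "runs ?P (Cond (Read 1 (Add (Var 13) (Var 16)))
      (Cond (Add (Sub (Var 16) (Var 14)) (Sub (Var 14) (Var 16)))
        (Cond (Sub (Read 8 (Add (Var 9) (Add (Var 13) (Var 16)))) (Var 17))
           (Seq (Set 18 (Var 17)) (Set 17 (Read 8 (Add (Var 9) (Add (Var 13) (Var 16))))))
           (Cond (Sub (Read 8 (Add (Var 9) (Add (Var 13) (Var 16)))) (Var 18))
             (Set 18 (Read 8 (Add (Var 9) (Add (Var 13) (Var 16))))) Skip))
        Skip) Skip) ?R (Suc (Suc (Suc 2)))"
  proof (rule runs_Cond, goal_cases)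
    case 1
    show ?case
    proof (rule runs_weaken[OF 4], goal_cases)
      case (1 s)
      have "s 16 0 = c" "s 13 0 = u * n" "s 1 (u * n + c) = (if {u, c} \<in> G then 1 else 0)"
        using 1 st(2)[of s] adj[of s] by blast+
      moreover have "eval_expr s (Read 1 (Add (Var 13) (Var 16))) \<noteq> 0" using 1 by blast
      ultimately have "{u, c} \<in> G" by (simp split: if_splits)
      thus ?case using 1 by blast
    qed auto
  next
    case 2
    show ?case
    proof (rule runs_weaken[OF runs_Skip[of ?R ?R]], goal_cases)
      case (2 s)
      have "s 16 0 = c" "s 13 0 = u * n" "s 1 (u * n + c) = (if {u, c} \<in> G then 1 else 0)"
        using 2 st(2)[of s] adj[of s] by blast+
      moreover have "eval_expr s (Read 1 (Add (Var 13) (Var 16))) = 0" using 2 by blast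
      ultimately have "{u, c} \<notin> G" by (simp split: if_splits)
      thus ?case using 2 by (simp add: tops_Suc)
    qed auto
  qed
  have 6: "runs ?R (Set 16 (Add (Var 16) (Const 1)))
     (\<lambda>s. inner_state t u v s \<and> s 16 0 = Suc c \<and> (s 17 0, s 18 0) = tops t u v (Suc c)) 1"
    by (rule runs_Assign) simp
  show ?thesis unfolding inner_body_def by (rule runs_weaken[OF runs_Seq[OF 5 6]]) auto
qed

text \<open>With truncated subtraction, a - (a - z) is the minimum of a and z.\<close>

definition v_body :: prog where
  "v_body = Seq (Set 17 (Const 0)) (Seq (Set 18 (Const 0)) (Seq (Set 16 (Const 0))
     (Seq (While (Sub (Var 0) (Var 16)) inner_body)
     (Seq (Assign 8 (Add (Var 10) (Add (Var 15) (Var 12)))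
         (Add (Const 1) (Sub (Var 17) (Sub (Var 17) (Sub (Add (Var 6) (Var 6)) (Var 18))))))
     (Seq (Set 14 (Add (Var 14) (Const 1))) (Set 15 (Add (Var 15) (Var 0))))))))"

lemma runs_v_body:
  assumes "u < n" "v < n"
  shows "runs (inner_state t u v) v_body (inner_state t u (Suc v)) (14 * Suc n)"
proof -
  let ?I = "\<lambda>c s. inner_state t u v s \<and> s 16 0 = c \<and> (s 17 0, s 18 0) = tops t u v c"
  have loop: "runs (?I 0) (While (Sub (Var 0) (Var 16)) inner_body) (?I n) ((7 + 1) * Suc n)"
    by (rule runs_While, rule runs_inner_body) (use assms in \<open>auto simp: inner_state_def frame_def\<close>)
  let ?Q1 = "\<lambda>s. frame s \<and> level t s \<and> partial_level t u (Suc v) s \<and> s 9 0 = t * (n * n) \<and>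
     s 10 0 = Suc t * (n * n) \<and> s 11 0 = t \<and> s 12 0 = u \<and> s 13 0 = u * n \<and> s 14 0 = v \<and> s 15 0 = v * n
     \<and> (\<forall>i. s 2 i = 0)"
  let ?Q2 = "\<lambda>s. frame s \<and> level t s \<and> partial_level t u (Suc v) s \<and> s 9 0 = t * (n * n) \<and>
     s 10 0 = Suc t * (n * n) \<and> s 11 0 = t \<and> s 12 0 = u \<and> s 13 0 = u * n \<and> s 14 0 = Suc v \<and> s 15 0 = v * n
     \<and> (\<forall>i. s 2 i = 0)"
  have st: "runs (?I n) (Assign 8 (Add (Var 10) (Add (Var 15) (Var 12)))
         (Add (Const 1) (Sub (Var 17) (Sub (Var 17) (Sub (Add (Var 6) (Var 6)) (Var 18)))))) ?Q1 1"
  proof (rule runs_Assign)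
    fix s assume s: "?I n s"
    obtain a b where ab: "tops t u v n = (a, b)" by fastforce
    have m: "msg n G K (Suc t) u v = 1 + min a (2 * K - b)"
      using ab by (simp add: tops_def children_def)
    define s' where "s' = s(8 := (s 8)(Suc t * (n * n) + (v * n + u) := msg n G K (Suc t) u v))"
    have eq: "s(8 := (s 8)(eval_expr s (Add (Var 10) (Add (Var 15) (Var 12))) :=
       eval_expr s (Add (Const 1) (Sub (Var 17) (Sub (Var 17) (Sub (Add (Var 6) (Var 6)) (Var 18))))))) = s'"
      using s ab m by (simp add: s'_def inner_state_def frame_def mult_2 min_def add.commute)
    have "frame s'" using s by (simp add: s'_def inner_state_def)
    \<comment> \<open>The write goes to level \<open>Suc t\<close>, beyond all cells of level
      \<open>t\<close>.\<close>
    moreover have "level t s'" unfolding level_def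
    proof (intro allI impI)
      fix a c assume "a < n" "c < n"
      hence "a * n + c < n * n" by (rule index_less)
      thus "s' 8 (t * (n * n) + (a * n + c)) = msg n G K t c a"
        using s \<open>a < n\<close> \<open>c < n\<close> by (simp add: s'_def inner_state_def level_def)
    qed
    moreover have "partial_level t u (Suc v) s'" unfolding partial_level_def
    proof (intro allI impI)
      fix u' v' assume h: "u' < n" "v' < n" "u' < u \<or> u' = u \<and> v' < Suc v"
      show "s' 8 (Suc t * (n * n) + (v' * n + u')) = msg n G K (Suc t) u' v'"
      proof (cases "u' = u \<and> v' = v")
        case True thus ?thesis by (simp add: s'_def del: msg.simps)
      next
        case False
        hence ne: "v' * n + u' \<noteq> v * n + u" using index_inj[of u' u v' v] h assms by auto
        have "s 8 (Suc t * (n * n) + (v' * n + u')) = msg n G K (Suc t) u' v'"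
          using s h False unfolding inner_state_def partial_level_def by (metis less_Suc_eq)
        thus ?thesis using ne by (simp add: s'_def del: msg.simps)
      qed
    qed
    ultimately have "?Q1 s'" using s by (simp add: s'_def inner_state_def)
    thus "?Q1 (s(8 := (s 8)(eval_expr s (Add (Var 10) (Add (Var 15) (Var 12))) :=
       eval_expr s (Add (Const 1) (Sub (Var 17) (Sub (Var 17) (Sub (Add (Var 6) (Var 6)) (Var 18))))))))"
      unfolding eq .
  qed
  have inc: "runs ?Q1 (Seq (Set 14 (Add (Var 14) (Const 1))) (Set 15 (Add (Var 15) (Var 0)))) (inner_state t u (Suc v)) (Suc 1)"
    by (rule runs_Seq_Assign[OF runs_Assign[of ?Q2]]) (auto simp: inner_state_def frame_def)
  have "runs (inner_state t u v) v_body (inner_state t u (Suc v))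
     (Suc (Suc (Suc ((7 + 1) * Suc n + (1 + Suc 1)))))"
    unfolding v_body_def
    by (rule runs_Seq_Assign[where R = "\<lambda>s. inner_state t u v s \<and> s 17 0 = 0"],
        rule runs_Seq_Assign[where R = "\<lambda>s. inner_state t u v s \<and> s 17 0 = 0 \<and> s 18 0 = 0"],
        rule runs_Seq_Assign[where R = "?I 0"],
        rule runs_Seq[OF loop runs_Seq[OF st inc]]) (auto simp: tops_def)
  thus ?thesis by (rule runs_weaken) auto
qed

definition u_body :: prog where
  "u_body = Seq (Set 14 (Const 0)) (Seq (Set 15 (Const 0))
     (Seq (While (Sub (Var 0) (Var 14)) v_body)
     (Seq (Set 12 (Add (Var 12) (Const 1))) (Set 13 (Add (Var 13) (Var 0))))))"

definition mid_state :: "nat \<Rightarrow> nat \<Rightarrow> store \<Rightarrow> bool" where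
  "mid_state t u s \<longleftrightarrow> frame s \<and> level t s \<and> partial_level t u 0 s \<and> s 9 0 = t * (n * n) \<and>
     s 10 0 = Suc t * (n * n) \<and> s 11 0 = t \<and> s 12 0 = u \<and> s 13 0 = u * n \<and> (\<forall>i. s 2 i = 0)"

lemma runs_u_body:
  assumes "u < n"
  shows "runs (mid_state t u) u_body (mid_state t (Suc u)) (20 * Suc n ^ 2)"
proof -
  have loop: "runs (inner_state t u 0) (While (Sub (Var 0) (Var 14)) v_body) (inner_state t u n) ((14 * Suc n + 1) * Suc n)"
    by (rule runs_While, rule runs_v_body) (use assms in \<open>auto simp: inner_state_def frame_def\<close>)
  have pl: "partial_level t (Suc u) 0 s" if "partial_level t u n s" for s
    using that by (auto simp: partial_level_def less_Suc_eq)
  let ?Q = "\<lambda>s. frame s \<and> level t s \<and> partial_level t (Suc u) 0 s \<and> s 9 0 = t * (n * n) \<and>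
     s 10 0 = Suc t * (n * n) \<and> s 11 0 = t \<and> s 12 0 = Suc u \<and> s 13 0 = u * n \<and> (\<forall>i. s 2 i = 0)"
  have inc: "runs (inner_state t u n) (Seq (Set 12 (Add (Var 12) (Const 1))) (Set 13 (Add (Var 13) (Var 0)))) (mid_state t (Suc u)) (Suc 1)"
    by (rule runs_Seq_Assign[OF runs_Assign[of ?Q]]) (auto simp: inner_state_def mid_state_def frame_def pl)
  have "runs (mid_state t u) u_body (mid_state t (Suc u)) (Suc (Suc ((14 * Suc n + 1) * Suc n + Suc 1)))"
    unfolding u_body_def
    by (rule runs_Seq_Assign[where R = "\<lambda>s. mid_state t u s \<and> s 14 0 = 0"],
        rule runs_Seq_Assign[where R = "inner_state t u 0"],
        rule runs_Seq[OF loop inc]) (auto simp: inner_state_def mid_state_def)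
  thus ?thesis by (rule runs_weaken) (auto simp: power2_eq_square algebra_simps)
qed

definition t_body :: prog where
  "t_body = Seq (Set 10 (Add (Var 9) (Var 7))) (Seq (Set 12 (Const 0)) (Seq (Set 13 (Const 0))
     (Seq (While (Sub (Var 0) (Var 12)) u_body)
     (Seq (Set 9 (Var 10)) (Set 11 (Add (Var 11) (Const 1)))))))"

definition outer_state :: "nat \<Rightarrow> store \<Rightarrow> bool" where
  "outer_state t s \<longleftrightarrow> frame s \<and> level t s \<and> s 9 0 = t * (n * n) \<and> s 11 0 = t \<and> (\<forall>i. s 2 i = 0)"

lemma runs_t_body:
  "runs (outer_state t) t_body (outer_state (Suc t)) (26 * Suc n ^ 3)"
proof -
  have loop: "runs (mid_state t 0) (While (Sub (Var 0) (Var 12)) u_body) (mid_state t n) ((20 * Suc n ^ 2 + 1) * Suc n)"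
    by (rule runs_While, rule runs_u_body) (auto simp: mid_state_def frame_def)
  have pl: "level (Suc t) s" if "partial_level t n 0 s" for s
    using that by (auto simp: partial_level_def level_def simp del: msg.simps)
  let ?Q = "\<lambda>s. frame s \<and> level (Suc t) s \<and> s 9 0 = Suc t * (n * n) \<and> s 11 0 = t \<and> (\<forall>i. s 2 i = 0)"
  have inc: "runs (mid_state t n) (Seq (Set 9 (Var 10)) (Set 11 (Add (Var 11) (Const 1)))) (outer_state (Suc t)) (Suc 1)"
    by (rule runs_Seq_Assign[OF runs_Assign[of ?Q]]) (auto simp: mid_state_def outer_state_def pl)
  have pl0: "partial_level t 0 0 s" for s by (simp add: partial_level_def)
  have "runs (outer_state t) t_body (outer_state (Suc t)) (Suc (Suc (Suc ((20 * Suc n ^ 2 + 1) * Suc n + Suc 1))))"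
    unfolding t_body_def
    by (rule runs_Seq_Assign[where R = "\<lambda>s. outer_state t s \<and> s 10 0 = Suc t * (n * n)"],
        rule runs_Seq_Assign[where R = "\<lambda>s. outer_state t s \<and> s 10 0 = Suc t * (n * n) \<and> s 12 0 = 0"],
        rule runs_Seq_Assign[where R = "mid_state t 0"],
        rule runs_Seq[OF loop inc]) (auto simp: outer_state_def mid_state_def pl0 frame_def)
  thus ?thesis by (rule runs_weaken) (auto simp: power2_eq_square power3_eq_cube algebra_simps)
qed

text \<open>The truncated difference is nonzero exactly if the sum of the two messages exceeds the
  threshold.\<close>

definition out_body :: prog where
  "out_body = Seq (Cond (Read 1 (Add (Var 13) (Var 14)))
       (Assign 2 (Add (Var 13) (Var 14))
         (Sub (Add (Read 8 (Add (Var 9) (Add (Var 13) (Var 14)))) (Read 8 (Add (Var 9) (Add (Var 15) (Var 12)))))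
              (Add (Add (Var 6) (Var 6)) (Const 1)))) Skip)
     (Seq (Set 14 (Add (Var 14) (Const 1))) (Set 15 (Add (Var 15) (Var 0))))"

definition out_state :: "nat \<Rightarrow> nat \<Rightarrow> store \<Rightarrow> bool" where
  "out_state u v s \<longleftrightarrow> frame s \<and> level T s \<and> s 9 0 = T * (n * n) \<and> partial_output u v s \<and>
     s 12 0 = u \<and> s 13 0 = u * n \<and> s 14 0 = v \<and> s 15 0 = v * n"

lemma runs_out_body:
  assumes "u < n" "v < n"
  shows "runs (out_state u v) out_body (out_state u (Suc v)) 4"
proof -
  let ?P = "\<lambda>s. frame s \<and> level T s \<and> s 9 0 = T * (n * n) \<and> partial_output u (Suc v) s \<and>
     s 12 0 = u \<and> s 13 0 = u * n \<and> s 14 0 = v \<and> s 15 0 = v * n"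
  let ?P2 = "\<lambda>s. frame s \<and> level T s \<and> s 9 0 = T * (n * n) \<and> partial_output u (Suc v) s \<and>
     s 12 0 = u \<and> s 13 0 = u * n \<and> s 14 0 = Suc v \<and> s 15 0 = v * n"
  have po: "partial_output u (Suc v) (s(2 := f))"
    if "partial_output u v s" "\<And>i. i \<noteq> u * n + v \<Longrightarrow> f i = s 2 i"
      "f (u * n + v) \<noteq> 0 \<longleftrightarrow> {u, v} \<in> G \<and> 2 * K + 1 < msg n G K T u v + msg n G K T v u" for s f
    unfolding partial_output_def
  proof (intro allI impI)
    fix u' v' assume h: "u' < n" "v' < n"
    show "(s(2 := f)) 2 (u' * n + v') \<noteq> 0 \<longleftrightarrow> (u' < u \<or> u' = u \<and> v' < Suc v) \<and> {u', v'} \<in> G \<and>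
       2 * K + 1 < msg n G K T u' v' + msg n G K T v' u'"
    proof (cases "u' = u \<and> v' = v")
      case True thus ?thesis using that by simp
    next
      case False
      hence "u' * n + v' \<noteq> u * n + v" using index_inj[of v' v u' u] h assms by auto
      hence "(s(2 := f)) 2 (u' * n + v') = s 2 (u' * n + v')" using that by simp
      thus ?thesis using that(1) h False unfolding partial_output_def by (auto simp: less_Suc_eq)
    qed
  qed
  have m: "s 8 (T * (n * n) + (u * n + v)) = msg n G K T v u" "s 8 (T * (n * n) + (v * n + u)) = msg n G K T u v"
    and adj: "s 1 (u * n + v) = (if {u, v} \<in> G then 1 else 0)"
    and st: "s 9 0 = T * (n * n)" "s 12 0 = u" "s 13 0 = u * n" "s 14 0 = v" "s 15 0 = v * n" "s 6 0 = K"
    if "out_state u v s" for s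
    using that assms by (auto simp: out_state_def level_def frame_def)
  have 1: "runs (out_state u v) (Cond (Read 1 (Add (Var 13) (Var 14)))
       (Assign 2 (Add (Var 13) (Var 14))
         (Sub (Add (Read 8 (Add (Var 9) (Add (Var 13) (Var 14)))) (Read 8 (Add (Var 9) (Add (Var 15) (Var 12)))))
              (Add (Add (Var 6) (Var 6)) (Const 1)))) Skip) ?P (Suc 1)"
  proof (rule runs_Cond[OF runs_Assign runs_Skip], goal_cases)
    case (1 s)
    hence s: "out_state u v s" "{u, v} \<in> G" using adj[of s] st[of s] by (auto split: if_splits)
    have "partial_output u (Suc v) (s(2 := (s 2)(u * n + v := msg n G K T v u + msg n G K T u v - (K + K + 1))))"
      by (rule po) (use s in \<open>auto simp: out_state_def\<close>)
    thus ?case using m[OF s(1)] st[OF s(1)] s by (simp add: out_state_def)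
  next
    case (2 s)
    hence s: "out_state u v s" "{u, v} \<notin> G" using adj[of s] st[of s] by (auto split: if_splits)
    have "s 2 (u * n + v) = 0" using s assms by (auto simp: out_state_def partial_output_def)
    hence "partial_output u (Suc v) (s(2 := s 2))"
      by (intro po) (use s in \<open>auto simp: out_state_def\<close>)
    thus ?case using s by (simp add: out_state_def)
  qed
  have 2: "runs ?P (Seq (Set 14 (Add (Var 14) (Const 1))) (Set 15 (Add (Var 15) (Var 0)))) (out_state u (Suc v)) (Suc 1)"
    by (rule runs_Seq_Assign[OF runs_Assign[of ?P2]]) (auto simp: out_state_def frame_def)
  show ?thesis unfolding out_body_def by (rule runs_weaken[OF runs_Seq[OF 1 2]]) auto
qed

definition out_prog :: prog where
  "out_prog = Seq (Set 12 (Const 0)) (Seq (Set 13 (Const 0)) (While (Sub (Var 0) (Var 12))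
     (Seq (Set 14 (Const 0)) (Seq (Set 15 (Const 0)) (Seq (While (Sub (Var 0) (Var 14)) out_body)
       (Seq (Set 12 (Add (Var 12) (Const 1))) (Set 13 (Add (Var 13) (Var 0)))))))))"

lemma runs_out_prog:
  "runs (outer_state T) out_prog (partial_output n 0) (14 * Suc n ^ 2)"
proof -
  let ?I = "\<lambda>u s. frame s \<and> level T s \<and> s 9 0 = T * (n * n) \<and> partial_output u 0 s \<and>
     s 12 0 = u \<and> s 13 0 = u * n"
  let ?B = "Seq (Set 14 (Const 0)) (Seq (Set 15 (Const 0)) (Seq (While (Sub (Var 0) (Var 14)) out_body)
       (Seq (Set 12 (Add (Var 12) (Const 1))) (Set 13 (Add (Var 13) (Var 0))))))"
  have body: "runs (?I u) ?B (?I (Suc u)) (9 * Suc n)" if u: "u < n" for u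
  proof -
    have loop: "runs (out_state u 0) (While (Sub (Var 0) (Var 14)) out_body) (out_state u n) ((4 + 1) * Suc n)"
      by (rule runs_While, rule runs_out_body) (use u in \<open>auto simp: out_state_def frame_def\<close>)
    have pl: "partial_output (Suc u) 0 s" if "partial_output u n s" for s
      using that by (auto simp: partial_output_def less_Suc_eq)
    let ?Q = "\<lambda>s. frame s \<and> level T s \<and> s 9 0 = T * (n * n) \<and> partial_output (Suc u) 0 s \<and>
     s 12 0 = Suc u \<and> s 13 0 = u * n"
    have inc: "runs (out_state u n) (Seq (Set 12 (Add (Var 12) (Const 1))) (Set 13 (Add (Var 13) (Var 0)))) (?I (Suc u)) (Suc 1)"
      by (rule runs_Seq_Assign[OF runs_Assign[of ?Q]]) (auto simp: out_state_def frame_def pl)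
    have "runs (?I u) ?B (?I (Suc u)) (Suc (Suc ((4 + 1) * Suc n + Suc 1)))"
      by (rule runs_Seq_Assign[where R = "\<lambda>s. ?I u s \<and> s 14 0 = 0"],
          rule runs_Seq_Assign[where R = "out_state u 0"], rule runs_Seq[OF loop inc])
        (auto simp: out_state_def)
    thus ?thesis by (rule runs_weaken) auto
  qed
  have loop: "runs (?I 0) (While (Sub (Var 0) (Var 12)) ?B) (?I n) ((9 * Suc n + 1) * Suc n)"
    by (rule runs_While[where I = ?I], rule body) (auto simp: frame_def)
  have po0: "partial_output 0 0 s" if "\<forall>i. s 2 i = 0" for s using that by (simp add: partial_output_def)
  have "runs (outer_state T) out_prog (?I n) (Suc (Suc ((9 * Suc n + 1) * Suc n)))"
    unfolding out_prog_def
    by (rule runs_Seq_Assign[where R = "\<lambda>s. outer_state T s \<and> s 12 0 = 0"],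
        rule runs_Seq_Assign[where R = "?I 0"], rule loop)
      (auto simp: outer_state_def po0)
  thus ?thesis by (rule runs_weaken) (auto simp: power2_eq_square algebra_simps)
qed

end

text \<open>The shift 2 T + 2 is the smallest one that \<open>msg_bounds\<close> admits.\<close>

definition init_prog :: prog where
  "init_prog = Seq (Set 6 (Add (Add (Var 5) (Var 5)) (Const 2))) (Seq (Set 7 (Const 0)) (Seq (Set 12 (Const 0))
     (Seq (While (Sub (Var 0) (Var 12)) (Seq (Set 7 (Add (Var 7) (Var 0))) (Set 12 (Add (Var 12) (Const 1)))))
     (Seq (Set 13 (Const 0))
     (Seq (While (Sub (Var 7) (Var 13)) (Seq (Assign 8 (Var 13) (Add (Var 6) (Const 1))) (Set 13 (Add (Var 13) (Const 1)))))
     (Seq (Set 9 (Const 0)) (Set 11 (Const 0))))))))"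

lemma runs_init_prog:
  "runs (\<lambda>s. same_except {3, 4, 5} (input_store n G) s \<and> s 5 0 = T) init_prog
     (outer_state n G T (2 * T + 2) 0) (14 * Suc n ^ 2)"
proof -
  let ?K = "2 * T + 2"
  define F where "F s \<longleftrightarrow> s 0 0 = n \<and> (\<forall>u<n. \<forall>c<n. s 1 (u * n + c) = (if {u, c} \<in> G then 1 else 0)) \<and>
     s 5 0 = T \<and> s 6 0 = ?K \<and> (\<forall>i. s 2 i = 0)" for s :: store
  have F_upd: "F (s(a := f)) = F s" if "7 \<le> a" for s a f using that by (auto simp: F_def)
  have F0: "F (s(6 := f))" if "same_except {3, 4, 5} (input_store n G) s \<and> s 5 0 = T" "f 0 = ?K" for s f
  proof -
    have s: "s 0 = input_store n G 0" "s 1 = input_store n G 1" "s 2 = input_store n G 2"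
      using that by (auto simp: same_except_def)
    have "s 1 (u * n + c) = (if {u, c} \<in> G then 1 else 0)" if "u < n" "c < n" for u c
    proof -
      have "(u * n + c) div n = u" "(u * n + c) mod n = c" using that by auto
      moreover have "u * n + c < n * n" using that by (rule index_less)
      ultimately show ?thesis using s by (simp add: input_store_def)
    qed
    thus ?thesis using that s by (auto simp: F_def input_store_def)
  qed
  let ?I1 = "\<lambda>u s. F s \<and> s 7 0 = u * n \<and> s 12 0 = u"
  have l1: "runs (?I1 0) (While (Sub (Var 0) (Var 12)) (Seq (Set 7 (Add (Var 7) (Var 0))) (Set 12 (Add (Var 12) (Const 1)))))
      (?I1 n) ((2 + 1) * Suc n)"
  proof (rule runs_While)
    fix i assume "i < n"
    have "runs (?I1 i) (Seq (Set 7 (Add (Var 7) (Var 0))) (Set 12 (Add (Var 12) (Const 1)))) (?I1 (Suc i)) (Suc 1)"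
      by (rule runs_Seq_Assign[OF runs_Assign[of "\<lambda>s. F s \<and> s 7 0 = Suc i * n \<and> s 12 0 = i"]])
        (auto simp: F_upd, auto simp: F_def)
    thus "runs (?I1 i) (Seq (Set 7 (Add (Var 7) (Var 0))) (Set 12 (Add (Var 12) (Const 1)))) (?I1 (Suc i)) 2"
      by (simp add: numeral_2_eq_2)
  qed (auto simp: F_def)
  let ?I2 = "\<lambda>i s. F s \<and> s 7 0 = n * n \<and> s 13 0 = i \<and> (\<forall>j<i. s 8 j = ?K + 1)"
  have l2: "runs (?I2 0) (While (Sub (Var 7) (Var 13)) (Seq (Assign 8 (Var 13) (Add (Var 6) (Const 1))) (Set 13 (Add (Var 13) (Const 1)))))
      (?I2 (n * n)) ((2 + 1) * (Suc n ^ 2))"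
  proof (rule runs_While)
    fix i
    have "runs (?I2 i) (Seq (Assign 8 (Var 13) (Add (Var 6) (Const 1))) (Set 13 (Add (Var 13) (Const 1)))) (?I2 (Suc i)) (Suc 1)"
      by (rule runs_Seq_Assign[OF runs_Assign[of "\<lambda>s. F s \<and> s 7 0 = n * n \<and> s 13 0 = i \<and> (\<forall>j<Suc i. s 8 j = ?K + 1)"]])
        (auto simp: F_upd less_Suc_eq, auto simp: F_def)
    thus "runs (?I2 i) (Seq (Assign 8 (Var 13) (Add (Var 6) (Const 1))) (Set 13 (Add (Var 13) (Const 1)))) (?I2 (Suc i)) 2"
      by (simp add: numeral_2_eq_2)
  qed (auto simp: power2_eq_square)
  have fin: "runs (?I2 (n * n)) (Seq (Set 9 (Const 0)) (Set 11 (Const 0))) (outer_state n G T ?K 0) (Suc 1)"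
    by (rule runs_Seq_Assign[OF runs_Assign[of "\<lambda>s. ?I2 (n * n) s \<and> s 9 0 = 0"]])
      (auto simp: F_upd, auto simp: F_def outer_state_def frame_def level_def index_less)
  have "runs (\<lambda>s. same_except {3, 4, 5} (input_store n G) s \<and> s 5 0 = T) init_prog
     (outer_state n G T ?K 0)
     (Suc (Suc (Suc ((2 + 1) * Suc n + Suc ((2 + 1) * (Suc n ^ 2) + Suc 1)))))"
    unfolding init_prog_def
    by (rule runs_Seq_Assign[where R = F], rule runs_Seq_Assign[where R = "\<lambda>s. F s \<and> s 7 0 = 0"],
        rule runs_Seq_Assign[where R = "?I1 0"], rule runs_Seq[OF l1],
        rule runs_Seq_Assign[where R = "?I2 0"], rule runs_Seq[OF l2 fin])
      (auto simp: F_upd intro!: F0)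
  thus ?thesis by (rule runs_weaken) (auto simp: power2_eq_square algebra_simps)
qed

text \<open>Memory: 1 is the adjacency matrix, 5, 6, 7 hold \<open>T\<close>, \<open>K\<close>, \<open>n\<^sup>2\<close>, and 8 holds the messages, with the
  levels \<open>t\<close> and \<open>t + 1\<close> starting at 9 and 10. Loop counters are \<open>t\<close> in 11, \<open>u\<close> in 12, \<open>v\<close> in 14, \<open>c\<close>
  in 16, with \<open>u n\<close> in 13 and \<open>v n\<close> in 15 to avoid multiplication; 17 and 18 hold the top two
  messages.\<close>

definition main_prog :: prog where
  "main_prog = Seq (log_prog 0 4) (Seq (log_prog 4 5) (Seq (log_prog 5 4) (Seq (Set 5 (Var 4)) (Seq init_prog
     (Seq (While (Sub (Var 5) (Var 11)) t_body) out_prog)))))"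

lemma polynomial_time_selected:
  "polynomial_time (\<lambda>n G. selected n G (2 * rounds n + 2) (rounds n))"
  unfolding polynomial_time_def
proof (rule exI[of _ main_prog], rule exI[of _ "smult 100 ([:1, 1:] ^ 4)"], intro allI impI)
  fix n :: nat and G assume G: "G \<subseteq> complete_graph n"
  let ?s0 = "input_store n G" and ?T = "rounds n" and ?K = "2 * rounds n + 2"
  have le: "clog n \<le> n" "clog (clog n) \<le> n" "?T \<le> n"
    using clog_le[of n] clog_le[of "clog n"] clog_le[of "clog (clog n)"] by (auto simp: rounds_def)
  have 1: "runs (\<lambda>s. same_except {3, 4, 5} ?s0 s \<and> s 0 0 = n) (log_prog 0 4)
     (\<lambda>s. same_except {3, 4, 5} ?s0 s \<and> s 4 0 = clog n) (5 * Suc n)"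
    using runs_log_prog[of 0 4 n n ?s0] by (simp add: insert_commute insert_absorb)
  have 2: "runs (\<lambda>s. same_except {3, 4, 5} ?s0 s \<and> s 4 0 = clog n) (log_prog 4 5)
     (\<lambda>s. same_except {3, 4, 5} ?s0 s \<and> s 5 0 = clog (clog n)) (5 * Suc n)"
    using runs_log_prog[of 4 5 "clog n" n ?s0] le by (simp add: insert_commute insert_absorb)
  have 3: "runs (\<lambda>s. same_except {3, 4, 5} ?s0 s \<and> s 5 0 = clog (clog n)) (log_prog 5 4)
     (\<lambda>s. same_except {3, 4, 5} ?s0 s \<and> s 4 0 = ?T) (5 * Suc n)"
    using runs_log_prog[of 5 4 "clog (clog n)" n ?s0] le by (simp add: insert_commute insert_absorb rounds_def)
  have 4: "runs (\<lambda>s. same_except {3, 4, 5} ?s0 s \<and> s 4 0 = ?T) (Set 5 (Var 4))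
     (\<lambda>s. same_except {3, 4, 5} ?s0 s \<and> s 5 0 = ?T) 1"
    by (rule runs_Assign) (auto simp: same_except_def)
  have loop: "runs (outer_state n G ?T ?K 0) (While (Sub (Var 5) (Var 11)) t_body) (outer_state n G ?T ?K ?T)
      ((26 * Suc n ^ 3 + 1) * Suc n)"
    by (rule runs_While, rule runs_t_body) (use le in \<open>auto simp: outer_state_def frame_def\<close>)
  note all = runs_Seq[OF 1 runs_Seq[OF 2 runs_Seq[OF 3 runs_Seq[OF 4 runs_Seq[OF runs_init_prog runs_Seq[OF loop runs_out_prog]]]]]]
  have s0: "same_except {3, 4, 5} ?s0 ?s0 \<and> ?s0 0 0 = n" by (simp add: same_except_def input_store_def)
  obtain t s where ts: "exec main_prog ?s0 t s" "partial_output n G ?T ?K n 0 s"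
    "t \<le> 5 * Suc n + (5 * Suc n + (5 * Suc n + (1 + (14 * Suc n ^ 2 + ((26 * Suc n ^ 3 + 1) * Suc n + 14 * Suc n ^ 2)))))"
    using all s0 unfolding runs_def main_prog_def by blast
  have "t \<le> 100 * Suc n ^ 4"
  proof -
    define m where "m = Suc n"
    have p: "1 \<le> m ^ 4" "m \<le> m ^ 4" "m ^ 2 \<le> m ^ 4"
      using power_increasing[of 1 4 m] power_increasing[of 2 4 m] by (auto simp: m_def)
    have e: "(26 * m ^ 3 + 1) * m = 26 * m ^ 4 + m"
      by (simp add: power_numeral_reduce algebra_simps del: power_Suc)
    have "t \<le> 5 * m + (5 * m + (5 * m + (1 + (14 * m ^ 2 + ((26 * m ^ 4 + m) + 14 * m ^ 2)))))"
      using ts(3) unfolding m_def[symmetric] e .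
    hence "t \<le> 100 * m ^ 4" using p by linarith
    thus ?thesis by (simp only: m_def)
  qed
  also have "100 * Suc n ^ 4 = poly (smult 100 ([:1, 1:] ^ 4)) n"
    by (simp add: poly_power)
  finally have t: "t \<le> poly (smult 100 ([:1, 1:] ^ 4)) n" .
  have "output_graph n s = selected n G ?K ?T"
    unfolding output_graph_def selected_def
  proof (intro Collect_cong ex_cong1 conj_cong refl)
    fix u v assume uv: "u < v" "v < n"
    hence "u < n" by simp
    thus "(s 2 (u * n + v) \<noteq> 0) = ({u, v} \<in> G \<and> 2 * ?K + 1 < msg n G ?K ?T u v + msg n G ?K ?T v u)"
      using ts(2) uv unfolding partial_output_def by auto
  qed
  thus "\<exists>t s. exec main_prog ?s0 t s \<and> t \<le> poly (smult 100 ([:1, 1:] ^ 4)) n \<and>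
      output_graph n s = selected n G ?K ?T" using ts(1) t by blast
qed

subsection \<open>Achievability below the threshold\<close>

lemma less_clog_iff: "k < clog m \<longleftrightarrow> 2 ^ k < m"
proof
  assume "k < clog m"
  thus "2 ^ k < m" using clog_less_iff[of k m] by simp
next
  assume "2 ^ k < m"
  hence "(2::nat) ^ k < 2 ^ clog m" using clog_ge[of m] by (rule less_le_trans)
  thus "k < clog m" by simp
qed

lemma less_rounds_iff: "k < rounds n \<longleftrightarrow> 2 ^ (2 ^ (2 ^ k)) < n"
  by (simp add: rounds_def less_clog_iff)

lemma rounds_at_top: "filterlim rounds at_top sequentially"
  unfolding filterlim_at_top
proof
  fix k :: nat
  have "k \<le> rounds n" if "2 ^ (2 ^ (2 ^ k)) < n" for n using that less_rounds_iff[of k n] by simp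
  thus "eventually (\<lambda>n. k \<le> rounds n) sequentially"
    using eventually_gt_at_top[of "2 ^ (2 ^ (2 ^ k)) :: nat"] by (rule eventually_mono[rotated])
qed

text \<open>The number of rounds grows so slowly that the crude bound on the walks with few edges
  outside \<open>H\<close>, which is super-exponential in the length, stays below the square root of \<open>n\<close>.\<close>

lemma crude_term_small:
  fixes \<mu> :: real
  assumes \<mu>: "0 \<le> \<mu>"
  shows "eventually (\<lambda>n. real (2 * rounds n + 1) * (2 + \<mu> + real (2 * rounds n + 1)) ^ (2 * rounds n + 1) *
     (\<mu> * (real (Suc (2 * rounds n + 1)) * 3 ^ (2 * rounds n + 1) + 2 * real (2 * rounds n + 1))) \<le> sqrt (real n)) sequentially"
proof -
  define F where "F T = real (2 * T + 1) * (2 + \<mu> + real (2 * T + 1)) ^ (2 * T + 1) *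
     (\<mu> * (real (Suc (2 * T + 1)) * 3 ^ (2 * T + 1) + 2 * real (2 * T + 1)))" for T
  have "eventually (\<lambda>T::nat. 6 + \<mu> + 6 * real T \<le> 2 ^ T \<and> 4 * real T + 5 \<le> 2 ^ T \<and> 4 * real T + 2 \<le> 2 ^ T) sequentially"
  proof (intro eventually_conj)
    show "eventually (\<lambda>T::nat. 6 + \<mu> + 6 * real T \<le> 2 ^ T) sequentially" by real_asymp
    show "eventually (\<lambda>T::nat. 4 * real T + 5 \<le> 2 ^ T) sequentially" by real_asymp
    show "eventually (\<lambda>T::nat. 4 * real T + 2 \<le> 2 ^ T) sequentially" by real_asymp
  qed
  hence "eventually (\<lambda>n. 6 + \<mu> + 6 * real (rounds n) \<le> 2 ^ rounds n \<and> 4 * real (rounds n) + 5 \<le> 2 ^ rounds n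
      \<and> 4 * real (rounds n) + 2 \<le> 2 ^ rounds n) sequentially"
    by (rule eventually_compose_filterlim[OF _ rounds_at_top])
  hence "eventually (\<lambda>n. F (rounds n) \<le> sqrt (real n)) sequentially"
  proof (rule eventually_mono)
    fix n
    define T where "T = rounds n"
    assume "6 + \<mu> + 6 * real (rounds n) \<le> 2 ^ rounds n \<and> 4 * real (rounds n) + 5 \<le> 2 ^ rounds n
      \<and> 4 * real (rounds n) + 2 \<le> 2 ^ rounds n"
    hence T: "6 + \<mu> + 6 * real T \<le> 2 ^ T" "4 * real T + 5 \<le> 2 ^ T" "4 * real T + 2 \<le> 2 ^ T" by (simp_all add: T_def)
    have "real (4 * T + 5) \<le> real (2 ^ T)" "real (4 * T + 2) \<le> real (2 ^ T)" using T by simp_all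
    hence T': "4 * T + 5 \<le> 2 ^ T" "4 * T + 2 \<le> 2 ^ T" by (simp_all only: of_nat_le_iff)
    define L where "L = 2 * T + 1"
    \<comment> \<open>One number above every base and factor in \<open>F T\<close>, and at most
      \<open>2 ^ T\<close> for large \<open>T\<close>; so F T <= B^(2 L + 3) <= 2^(T 2^T).\<close>
    define B where "B = 6 + \<mu> + 6 * real T"
    have B1: "1 \<le> B" "3 \<le> B" "real L \<le> B" "2 + \<mu> + real L \<le> B" "\<mu> \<le> B" "3 * real L + 1 \<le> B"
      using \<mu> by (simp_all add: B_def L_def)
    have Z: "real (Suc L) * 3 ^ L + 2 * real L \<le> B * B ^ L"
    proof -
      have "2 * real L * 1 \<le> 2 * real L * 3 ^ L" by (intro mult_left_mono) auto
      hence "real (Suc L) * 3 ^ L + 2 * real L \<le> (3 * real L + 1) * 3 ^ L" by (simp add: algebra_simps)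
      also have "\<dots> \<le> B * B ^ L" using B1 by (intro mult_mono power_mono) auto
      finally show ?thesis .
    qed
    have "real L * (2 + \<mu> + real L) ^ L \<le> B * B ^ L" using B1 \<mu> by (intro mult_mono power_mono) auto
    moreover have "\<mu> * (real (Suc L) * 3 ^ L + 2 * real L) \<le> B * (B * B ^ L)"
      using B1 \<mu> Z by (intro mult_mono) auto
    ultimately have "F T \<le> B * B ^ L * (B * (B * B ^ L))"
      unfolding F_def L_def[symmetric] using B1 \<mu> by (intro mult_mono[of "real L * (2 + \<mu> + real L) ^ L"]) auto
    also have "\<dots> = B ^ (2 * L + 3)" unfolding mult_2 power_add power3_eq_cube by (simp only: mult_ac)
    also have "\<dots> \<le> B ^ (2 ^ T)" using B1 T'(1) by (intro power_increasing) (auto simp: L_def)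
    also have "\<dots> \<le> (2 ^ T) ^ (2 ^ T)" using T(1) B1 by (intro power_mono) (auto simp: B_def)
    also have "\<dots> = 2 ^ (T * 2 ^ T)" by (simp add: power_mult)
    also have "\<dots> \<le> 2 ^ (2 ^ T * 2 ^ T)" by (intro power_increasing mult_le_mono1 less_imp_le[OF less_exp]) simp
    finally have FT: "F T \<le> 2 ^ (2 ^ T * 2 ^ T)" .
    have F0: "0 \<le> F T" using \<mu> by (simp add: F_def)
    have "T \<noteq> 0" using T'(1) by (cases T) auto
    \<comment> \<open>\<open>rounds n = Suc k\<close> puts the triple exponential of
      \<open>k\<close> below \<open>n\<close>, and it dominates the square of the bound on
      \<open>F T\<close> because 2 T + 1 <= 2^k.\<close>
    then obtain k where k: "T = Suc k" by (cases T) auto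
    have "2 * T + 1 \<le> 2 ^ k" using T'(2) k by simp
    hence "(2::nat) ^ (2 * T + 1) \<le> 2 ^ (2 ^ k)" by (rule power_increasing) simp
    hence "2 * (2 ^ T * 2 ^ T) \<le> (2::nat) ^ (2 ^ k)" by (simp add: power_add mult_2)
    hence "(2::nat) ^ (2 * (2 ^ T * 2 ^ T)) \<le> 2 ^ (2 ^ (2 ^ k))" by (rule power_increasing) simp
    also have "\<dots> < n" using less_rounds_iff[of k n] k by (simp add: T_def)
    finally have "real (2 ^ (2 * (2 ^ T * 2 ^ T))) \<le> real n" by (simp only: of_nat_le_iff)
    hence "(2 ^ (2 ^ T * 2 ^ T))\<^sup>2 \<le> real n" by (simp only: of_nat_power of_nat_numeral power_even_eq)
    moreover have "(F T)\<^sup>2 \<le> (2 ^ (2 ^ T * 2 ^ T))\<^sup>2" using FT F0 by (intro power_mono)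
    ultimately have "(F T)\<^sup>2 \<le> real n" by linarith
    thus "F (rounds n) \<le> sqrt (real n)" unfolding T_def[symmetric] by (rule real_le_rsqrt)
  qed
  thus ?thesis by (simp only: F_def)
qed

text \<open>The tilt \<open>x\<close> is taken slightly above its optimal value y, and
  \<open>rho\<close> below 1 with rho - x = s + e. Then 2 \<delta> lam = s^2 <= (rho - x)^2, which
  is what the inequalities amount to once \<open>hB\<close> and \<open>hN\<close> are
  chosen.\<close>

lemma subcritical_weights:
  fixes lam \<delta> :: real
  assumes \<delta>: "0 < \<delta>" "\<delta> \<le> 1" and lam: "0 < lam" "lam < 1 / (sqrt (2 * \<delta>) + sqrt (1 - \<delta>))\<^sup>2"
  obtains x hR hB hN rho aN where "0 < x" "x \<le> 1" "1 \<le> hR" "1 \<le> hB" "1 \<le> hN" "0 < rho" "rho < 1"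
    "lam / x * (1 - \<delta>) < aN" "x * hR + (lam / x * \<delta> * hB + aN * hN) \<le> rho * hR" "2 * x * hR \<le> rho * hB"
    "lam / x * \<delta> * hB + aN * hN \<le> rho * hN" "0 \<le> aN"
proof -
  define y where "y = sqrt (lam * (1 - \<delta>))"
  define s where "s = sqrt (2 * \<delta> * lam)"
  have y0: "0 \<le> y" and s0: "0 < s" using lam \<delta> by (auto simp: y_def s_def)
  have sy: "s + y < 1"
  proof -
    let ?t = "sqrt (2 * \<delta>) + sqrt (1 - \<delta>)"
    have t: "0 < ?t" using \<delta> by (auto intro: add_pos_nonneg)
    hence "lam * ?t\<^sup>2 < 1" using lam(2) by (simp add: pos_less_divide_eq)
    hence "sqrt (lam * ?t\<^sup>2) < 1" by simp
    hence "sqrt lam * ?t < 1" using t by (simp add: real_sqrt_mult)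
    thus ?thesis by (simp add: s_def y_def real_sqrt_mult distrib_left mult_ac)
  qed
  define e where "e = (1 - s - y) / 3"
  have e: "0 < e" using sy by (simp add: e_def)
  have sum: "s + y + 3 * e = 1" by (simp add: e_def field_simps)
  define x where "x = y + e"
  define rho where "rho = 1 - e"
  have x: "0 < x" "x \<le> 1" "x < rho" and rho: "0 < rho" "rho < 1" using y0 s0 e sum by (simp_all add: x_def rho_def)
  have d: "rho - x = s + e" using sum by (simp add: x_def rho_def)
  have yy: "lam * (1 - \<delta>) = y * y" using lam \<delta> by (simp add: y_def)
  have ss: "2 * \<delta> * lam = s * s" using lam \<delta> by (simp add: s_def)
  have aN: "lam / x * (1 - \<delta>) < x"
  proof -
    have "lam * (1 - \<delta>) < x * x" unfolding yy x_def using y0 e by (intro mult_strict_mono') auto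
    thus ?thesis using x by (simp add: pos_divide_less_eq)
  qed
  \<comment> \<open>The scale is free; the last two summands make \<open>hB\<close> and
    \<open>hN\<close> at least 1.\<close>
  define hR where "hR = 1 + rho / (2 * x) + rho / (rho - x)"
  \<comment> \<open>\<open>hB\<close> gives equality in its own inequality, and \<open>hN\<close>
    makes the inequalities for red fronts and for fronts outside \<open>V\<close> the same.\<close>
  define hB where "hB = 2 * x * hR / rho"
  define hN where "hN = (rho - x) * hR / rho"
  have hR: "1 \<le> hR" using x rho by (simp add: hR_def)
  have hB: "1 \<le> hB"
  proof -
    have "rho / (2 * x) \<le> hR" using x rho by (simp add: hR_def)
    thus ?thesis using x rho by (simp add: hB_def field_simps)
  qed
  have hN: "1 \<le> hN"
  proof -
    have "rho / (rho - x) \<le> hR" using x rho by (simp add: hR_def)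
    hence "rho \<le> hR * (rho - x)" using x by (simp add: pos_divide_le_eq)
    thus ?thesis using x rho by (simp add: hN_def pos_le_divide_eq mult.commute)
  qed
  have S: "lam / x * \<delta> * hB + x * hN \<le> (rho - x) * hR"
  proof -
    have "lam / x * \<delta> * hB + x * hN = (2 * \<delta> * lam + x * (rho - x)) * hR / rho"
      using x rho by (simp add: hB_def hN_def field_simps)
    also have "2 * \<delta> * lam \<le> (rho - x) * (rho - x)" unfolding ss d using s0 e by (intro mult_mono) auto
    hence "(2 * \<delta> * lam + x * (rho - x)) * hR / rho \<le> ((rho - x) * (rho - x) + x * (rho - x)) * hR / rho"
      using hR rho by (intro divide_right_mono mult_right_mono) auto
    also have "\<dots> = (rho - x) * hR" using rho by (simp add: field_simps)
    finally show ?thesis .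
  qed
  show thesis
  proof (rule that[of x hR hB hN rho x])
    show "x * hR + (lam / x * \<delta> * hB + x * hN) \<le> rho * hR" using S by (simp add: algebra_simps)
    show "2 * x * hR \<le> rho * hB" using rho by (simp add: hB_def)
    have "rho * hN = (rho - x) * hR" using rho by (simp add: hN_def)
    thus "lam / x * \<delta> * hB + x * hN \<le> rho * hN" using S by simp
  qed (use x hR hB hN rho aN in auto)
qed

text \<open>The bound for fixed \<open>H\<close> is affine in the number of vertices on short
  cycles, so averaging over \<open>H\<close> involves only the mean of that number, at most
  \<open>2 * L\<close>.\<close>

lemma expected_error_le:
  fixes A :: "nat \<Rightarrow> nat set set \<Rightarrow> nat set set"
  assumes m: "m = nat \<lfloor>\<delta> * real n\<rfloor>" "3 \<le> m" "m \<le> n"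
    and le: "\<And>H. H \<in> set_pmf (random_two_factor n m) \<Longrightarrow>
      (\<integral>G0. real (card (sym_diff H (A n (G0 \<union> H)))) \<partial>measure_pmf (random_subset (complete_graph n) (lam / real n)))
      \<le> a + b * real (card (short_verts H L))"
    and b: "0 \<le> b" and L: "2 * L < m"
  shows "expected_error lam \<delta> (\<lambda>n G. return_pmf (A n G)) n \<le> (a + b * (2 * real L)) / real m"
proof -
  let ?M = "random_two_factor n m" and ?R = "random_subset (complete_graph n) (lam / real n)"
  have fR: "finite (set_pmf ?R)"
    by (rule finite_subset[of _ "Pow (complete_graph n)"]) (auto simp: finite_complete_graph dest: set_random_subset)
  have fM: "finite (set_pmf ?M)"
    by (rule finite_subset[of _ "Pow (complete_graph n)"]) (use set_random_two_factor_subset[OF m(2,3)] in \<open>auto simp: finite_complete_graph\<close>)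
  have J: "joint_law lam \<delta> (\<lambda>n G. return_pmf (A n G)) n
      = bind_pmf ?M (\<lambda>H. map_pmf (\<lambda>G0. (H, A n (G0 \<union> H))) ?R)"
    using planted_cycles_eq[of \<delta> n lam] m by (simp add: joint_law_def map_pmf_def bind_assoc_pmf bind_return_pmf)
  have "expected_error lam \<delta> (\<lambda>n G. return_pmf (A n G)) n
    = (\<Sum>H\<in>set_pmf ?M. pmf ?M H * (\<integral>G0. reconstruction_error H (A n (G0 \<union> H)) \<partial>measure_pmf ?R))"
    unfolding expected_error_eq J using fM fR by (subst pmf_expectation_bind[of "set_pmf ?M"]) auto
  also have "\<dots> \<le> (\<Sum>H\<in>set_pmf ?M. pmf ?M H * ((a + b * real (card (short_verts H L))) / real m))"
  proof (intro sum_mono mult_left_mono)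
    fix H assume H: "H \<in> set_pmf ?M"
    have "(\<integral>G0. reconstruction_error H (A n (G0 \<union> H)) \<partial>measure_pmf ?R)
      = (\<integral>G0. real (card (sym_diff H (A n (G0 \<union> H)))) \<partial>measure_pmf ?R) / real m"
      using card_random_two_factor[OF m(2,3) H] by (simp add: reconstruction_error_def)
    also have "\<dots> \<le> (a + b * real (card (short_verts H L))) / real m"
      by (intro divide_right_mono le[OF H]) simp
    finally show "(\<integral>G0. reconstruction_error H (A n (G0 \<union> H)) \<partial>measure_pmf ?R)
      \<le> (a + b * real (card (short_verts H L))) / real m" .
  qed simp
  also have "\<dots> = (a * (\<Sum>H\<in>set_pmf ?M. pmf ?M H) + b * (\<Sum>H\<in>set_pmf ?M. pmf ?M H * real (card (short_verts H L)))) / real m"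
    by (simp add: sum_distrib_left sum_divide_distrib sum.distrib[symmetric] add_divide_distrib algebra_simps)
  also have "(\<Sum>H\<in>set_pmf ?M. pmf ?M H) = 1" by (rule sum_pmf_eq_1[OF fM order_refl])
  also have "(\<Sum>H\<in>set_pmf ?M. pmf ?M H * real (card (short_verts H L))) = (\<integral>H. real (card (short_verts H L)) \<partial>measure_pmf ?M)"
    by (subst integral_measure_pmf[OF fM]) auto
  also have "(a * 1 + b * (\<integral>H. real (card (short_verts H L)) \<partial>measure_pmf ?M)) / real m \<le> (a + b * (2 * real L)) / real m"
  proof -
    have "(\<integral>H. real (card (short_verts H L)) \<partial>measure_pmf ?M) \<le> real m * real L / (real m - real L)"
      using L by (intro expected_short_verts[OF m(2,3)]) simp
    also have "\<dots> \<le> 2 * real L"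
    proof -
      have "real m * real L \<le> (2 * (real m - real L)) * real L" using L by (intro mult_right_mono) auto
      thus ?thesis using L by (simp add: pos_divide_le_eq mult_ac)
    qed
    finally show ?thesis using b by (intro divide_right_mono add_mono mult_left_mono) auto
  qed
  finally show ?thesis .
qed

text \<open>Per planted edge the expected error is bounded by two terms: the weighted walks
  contribute a multiple of rho^(2 T), which decays because T tends to infinity, and the repetitions
  contribute a multiple of sqrt n / n.\<close>

theorem achievability:
  fixes lam \<delta> :: real
  assumes \<delta>: "0 < \<delta>" "\<delta> \<le> 1" and lam: "0 < lam" "lam < 1 / (sqrt (2 * \<delta>) + sqrt (1 - \<delta>))\<^sup>2"
  shows "almost_exact_recovery lam \<delta> (\<lambda>n G. return_pmf (selected n G (2 * rounds n + 2) (rounds n)))"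
proof -
  define A where "A n G = selected n G (2 * rounds n + 2) (rounds n)" for n G
  obtain x hR hB hN rho aN where x: "0 < x" "x \<le> 1" and h: "1 \<le> hR" "1 \<le> hB" "1 \<le> hN" and rho: "0 < rho" "rho < 1"
    and aN: "lam / x * (1 - \<delta>) < aN" and R: "x * hR + (lam / x * \<delta> * hB + aN * hN) \<le> rho * hR" and B: "2 * x * hR \<le> rho * hB"
    and N: "lam / x * \<delta> * hB + aN * hN \<le> rho * hN" and aN0: "0 \<le> aN"
    using subcritical_weights[OF \<delta> lam] by blast
  define K where "K = 2 * x * hR + (lam / x * \<delta> * hB + aN * hN)"
  have K: "0 \<le> K" using x h lam \<delta> aN0 by (simp add: K_def)
  define F where "F L = real L * (2 + lam + real L) ^ L * (lam * (real (Suc L) * 3 ^ L + 2 * real L))" for L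
  let ?T = rounds and ?bound = "\<lambda>n. 2 / \<delta> * K * (rho ^ 2) ^ rounds n + 2 / \<delta> * (sqrt (real n) / real n)"
  have "eventually (\<lambda>n. 4 \<le> \<delta> * real n \<and> lam \<le> real n \<and> lam / x * (1 - \<delta> + 1 / real n) \<le> aN) sequentially"
  proof (intro eventually_conj)
    show "eventually (\<lambda>n. 4 \<le> \<delta> * real n) sequentially" using \<delta> by real_asymp
    show "eventually (\<lambda>n. lam \<le> real n) sequentially" by real_asymp
    \<comment> \<open>Rounding the size of \<open>V\<close> down adds up to 1 / n to the density
      outside \<open>V\<close>; \<open>aN\<close> was kept strictly larger to absorb it.\<close>
    have "(\<lambda>n. lam / x * (1 - \<delta> + 1 / real n)) \<longlonglongrightarrow> lam / x * (1 - \<delta> + 0)"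
      by (intro tendsto_intros lim_1_over_n)
    from order_tendstoD(2)[OF this, of aN] aN
    show "eventually (\<lambda>n. lam / x * (1 - \<delta> + 1 / real n) \<le> aN) sequentially"
      by (auto elim!: eventually_mono)
  qed
  moreover have "eventually (\<lambda>n. F (2 * rounds n + 1) \<le> sqrt (real n)) sequentially"
    unfolding F_def by (rule crude_term_small) (use lam in simp)
  \<comment> \<open>Walks are short against the planted set, as the averaging over short cycles
    requires.\<close>
  moreover have "eventually (\<lambda>n. 16 * real (2 * rounds n + 1) \<le> \<delta> * real n) sequentially"
  proof -
    have "eventually (\<lambda>k::nat. 16 * real (2 * k + 1) \<le> \<delta> * 2 ^ (k - 1)) sequentially"
    proof -
      have "eventually (\<lambda>k::nat. 16 * real (2 * Suc k + 1) \<le> \<delta> * 2 ^ k) sequentially" using \<delta> by real_asymp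
      thus ?thesis by (subst eventually_sequentially_Suc[symmetric]) simp
    qed
    hence "eventually (\<lambda>n. 16 * real (2 * rounds n + 1) \<le> \<delta> * 2 ^ (rounds n - 1)) sequentially"
      by (rule eventually_compose_filterlim[OF _ rounds_at_top])
    moreover have "eventually (\<lambda>n. 1 \<le> rounds n) sequentially"
      using rounds_at_top by (simp add: filterlim_at_top)
    ultimately show ?thesis
    proof eventually_elim
      case (elim n)
      have "rounds n - 1 < rounds n" using elim by simp
      hence "2 ^ (2 ^ (2 ^ (rounds n - 1))) < n" by (simp only: less_rounds_iff)
      moreover have "(2::nat) ^ (rounds n - 1) \<le> 2 ^ (2 ^ (2 ^ (rounds n - 1)))"
        by (intro power_increasing order_trans[OF less_imp_le[OF less_exp] less_imp_le[OF less_exp]]) simp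
      ultimately have "real (2 ^ (rounds n - 1)) \<le> real n" by (simp only: of_nat_le_iff)
      hence "\<delta> * 2 ^ (rounds n - 1) \<le> \<delta> * real n" using \<delta> by (intro mult_left_mono) auto
      thus ?case using elim by linarith
    qed
  qed
  ultimately have up: "eventually (\<lambda>n. expected_error lam \<delta> (\<lambda>n G. return_pmf (A n G)) n \<le> ?bound n) sequentially"
  proof eventually_elim
    case (elim n)
    define m where "m = nat \<lfloor>\<delta> * real n\<rfloor>"
    define L where "L = 2 * rounds n + 1"
    have mr: "real m = real_of_int \<lfloor>\<delta> * real n\<rfloor>" using \<delta> by (simp add: m_def)
    have dn: "\<delta> * real n \<le> real n" using \<delta> mult_right_mono[of \<delta> 1 "real n"] by simp
    have m2: "3 \<le> real m" "real m \<le> real n" "real m \<le> \<delta> * real n" "\<delta> * real n - 1 \<le> real m"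
      using elim(1) dn unfolding mr by linarith+
    hence m: "m = nat \<lfloor>\<delta> * real n\<rfloor>" "3 \<le> m" "m \<le> n" by (simp_all add: m_def[symmetric])
    have n0: "0 < real n" using m by simp
    have m4: "\<delta> / 2 * real n \<le> real m" using m2 elim(1) by simp
    have Lm: "2 * L < m"
    proof -
      have "16 * real L \<le> \<delta> * real n" using elim(3) by (simp add: L_def)
      moreover have "1 \<le> real L" by (simp add: L_def)
      ultimately have "real (2 * L) < real m" using m2(4) by simp
      thus ?thesis by (simp only: of_nat_less_iff)
    qed
    let ?p = "lam / real n" and ?E = "complete_graph n"
    have p: "0 \<le> ?p" "?p \<le> 1" using lam n0 elim(1) by auto
    define a where "a = real n * K * rho ^ (L - 1) + real L * (2 + lam + real L) ^ L * (lam * (real (Suc L) * 3 ^ L))"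
    define b where "b = real L * (2 + lam + real L) ^ L * lam"
    have b: "0 \<le> b" using lam by (simp add: b_def)
    have "expected_error lam \<delta> (\<lambda>n G. return_pmf (A n G)) n \<le> (a + b * (2 * real L)) / real m"
    proof (rule expected_error_le[OF m _ b Lm])
      fix H assume "H \<in> set_pmf (random_two_factor n m)"
      then obtain V where V: "V \<subseteq> {..<n}" "card V = m" "two_regular V H" using set_random_two_factor[OF m(2,3)] by blast
      have HE: "H \<subseteq> ?E" using V by (auto simp: complete_graph_def two_regular_def)
      have fR: "finite (set_pmf (random_subset ?E ?p))"
        by (rule finite_subset[of _ "Pow ?E"]) (auto simp: finite_complete_graph dest: set_random_subset)
      have "(\<integral>G0. real (card (sym_diff H (A n (G0 \<union> H)))) \<partial>measure_pmf (random_subset ?E ?p))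
        \<le> (\<integral>G0. real (card (bad_walks n (G0 \<union> H) H V (Suc L))) \<partial>measure_pmf (random_subset ?E ?p))"
      proof (rule integral_mono_AE)
        show "AE G0 in random_subset ?E ?p. real (card (sym_diff H (A n (G0 \<union> H)))) \<le> real (card (bad_walks n (G0 \<union> H) H V (Suc L)))"
        proof (rule AE_pmfI)
          fix G0 assume "G0 \<in> set_pmf (random_subset ?E ?p)"
          hence "G0 \<union> H \<subseteq> ?E" using set_random_subset[of G0 ?E ?p] HE by blast
          from selected_error[OF this _ V(3), of "rounds n" "2 * rounds n + 2"]
          show "real (card (sym_diff H (A n (G0 \<union> H)))) \<le> real (card (bad_walks n (G0 \<union> H) H V (Suc L)))"
            by (simp add: A_def L_def)
        qed
      qed (use fR in \<open>auto intro!: integrable_measure_pmf_finite\<close>)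
      also have "\<dots> \<le> real n * (2 * x * hR + (lam / x * \<delta> * hB + aN * hN)) * rho ^ (L - 1) +
        real L * (2 + lam + real L) ^ L * (lam * (real (Suc L) * 3 ^ L + real (card (short_verts H L))))"
      proof (rule expected_bad_walks[OF V(3,1) p _ x h _ _ _ R B N])
        show "?p * real n \<le> lam" using n0 by simp
        have px: "0 \<le> ?p / x" using p(1) x(1) by (rule divide_nonneg_pos)
        have "?p / x * real (card V) \<le> ?p / x * (\<delta> * real n)" using V m2 px by (intro mult_left_mono) auto
        also have "\<dots> = lam / x * \<delta>" using n0 by simp
        finally show "?p / x * real (card V) \<le> lam / x * \<delta>" .
        have "?p / x * (real n - real (card V)) \<le> ?p / x * (real n - (\<delta> * real n - 1))"
          using V m2 px by (intro mult_left_mono) auto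
        also have "\<dots> = lam / x * (1 - \<delta> + 1 / real n)" using n0 x by (simp add: field_simps)
        also have "\<dots> \<le> aN" using elim(1) by simp
        finally show "?p / x * (real n - real (card V)) \<le> aN" .
      qed (use rho in \<open>auto simp: L_def\<close>)
      also have "\<dots> = a + b * real (card (short_verts H L))" by (simp add: a_def b_def K_def algebra_simps)
      finally show "(\<integral>G0. real (card (sym_diff H (A n (G0 \<union> H)))) \<partial>measure_pmf (random_subset ?E ?p))
        \<le> a + b * real (card (short_verts H L))" .
    qed
    also have "a + b * (2 * real L) = real n * (K * (rho ^ 2) ^ rounds n) + F L"
    proof -
      have "rho ^ (L - 1) = (rho ^ 2) ^ rounds n" by (simp add: L_def power_mult)
      thus ?thesis unfolding a_def b_def F_def by (simp only:) (simp add: algebra_simps)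
    qed
    also have "F L \<le> sqrt (real n)" using elim(2) by (simp add: L_def)
    hence "(real n * (K * (rho ^ 2) ^ rounds n) + F L) / real m \<le> (real n * (K * (rho ^ 2) ^ rounds n) + sqrt (real n)) / real m"
      by (intro divide_right_mono) auto
    also have "\<dots> \<le> (real n * (K * (rho ^ 2) ^ rounds n) + sqrt (real n)) / (\<delta> / 2 * real n)"
      using m4 n0 \<delta> K rho m2 by (intro divide_left_mono) auto
    also have "\<dots> = ?bound n" using n0 \<delta> by (simp add: field_simps)
    finally show ?case .
  qed
  have lo: "eventually (\<lambda>n. 0 \<le> expected_error lam \<delta> (\<lambda>n G. return_pmf (A n G)) n) sequentially"
    by (auto simp: expected_error_def reconstruction_error_def case_prod_unfold intro!: always_eventually Bochner_Integration.integral_nonneg)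
  have lim: "?bound \<longlonglongrightarrow> 0"
  proof -
    have "(\<lambda>k. (rho ^ 2) ^ k) \<longlonglongrightarrow> 0" using rho by (intro LIMSEQ_power_zero) (simp add: power_less_one_iff)
    hence "(\<lambda>n. (rho ^ 2) ^ rounds n) \<longlonglongrightarrow> 0" by (rule filterlim_compose[OF _ rounds_at_top])
    moreover have "(\<lambda>n. sqrt (real n) / real n) \<longlonglongrightarrow> 0" by real_asymp
    ultimately have "?bound \<longlonglongrightarrow> 2 / \<delta> * K * 0 + 2 / \<delta> * 0" by (intro tendsto_intros)
    thus ?thesis by simp
  qed
  have "expected_error lam \<delta> (\<lambda>n G. return_pmf (A n G)) \<longlonglongrightarrow> 0"
    by (rule tendsto_sandwich[OF lo up tendsto_const lim])
  thus ?thesis by (simp add: almost_exact_recovery_def A_def)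
qed

lemma is_estimator_selected:
  "is_estimator (\<lambda>n G. return_pmf (selected n G (2 * rounds n + 2) (rounds n)))"
  by (auto simp: is_estimator_def selected_def)

theorem theorem1:
  fixes lam \<delta> :: real
  assumes "0 < \<delta>" and "\<delta> \<le> 1" and "0 < lam"
  shows "(lam < 1 / (sqrt (2 * \<delta>) + sqrt (1 - \<delta>))\<^sup>2 \<longrightarrow>
            (\<exists>est. is_estimator est \<and> almost_exact_recovery lam \<delta> est) \<and>
            (\<exists>A. polynomial_time A \<and> almost_exact_recovery lam \<delta> (\<lambda>n G. return_pmf (A n G)))) \<and>
         (lam > 1 / (sqrt (2 * \<delta>) + sqrt (1 - \<delta>))\<^sup>2 \<longrightarrow>
            \<not> (\<exists>est. is_estimator est \<and> almost_exact_recovery lam \<delta> est))"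
  using achievability[OF assms] impossibility[OF assms(1,2)] is_estimator_selected polynomial_time_selected
  by blast

end
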